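(* Let $w$ be a majorant satisfying $\log\frac{1}{w(t)} \asymp \log\frac{1}{w(t^2)}$ for $0<t<1$. Let $f \in \mathcal{G}_w \cap \mathcal{N}$, $f\not\equiv 0$, have Herglotz–Nevanlinna factorization $f=\mathcal{O}_f\,(S_\mu/S_\nu)\,B_\Lambda$, where $\mu,\nu$ are mutually singular positive finite singular Borel measures on $\partial\mathbb{D}$, and let $\mu=\mu_P+\mu_C$ be the decomposition of $\mu$ with respect to sets of finite $w$-entropy. Then: (i) The shift invariant subspace generated by $f$ in $\mathcal{G}_w$ is completely determined by the pair $(\Lambda,\mu_P)$. More precisely, $[f]_{\mathcal{G}_w}=[B_\Lambda S_{\mu_P}]_{\mathcal{G}_w}$, and the following permanence property holds: $$[f]_{\mathcal{G}_w}\cap \mathcal{N}_+ \subseteq B_\Lambda S_{\mu_P}\,\mathcal{N}_+ .$$ (ii) The singular inner function $S_\nu$ is cyclic in $\mathcal{G}_w$. In particular, $f$ is cyclic in $\mathcal{G}_w$ if and only if $f=\mathcal{O}_f\, S_{\mu_C}/S_\nu$ up to a unimodular constant factor.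
   Context: $\mathbb{D}$ is the open unit disc, $\partial\mathbb{D}$ the unit circle, $m$ the normalized Lebesgue measure on $\partial\mathbb{D}$. "Singular" for measures means singular with respect to $m$. $A\asymp B$ means $c^{-1}B\le A\le cB$ for some constant $c>0$ (here independent of $t$). A modulus of continuity is a continuous, non-decreasing, sub-additive function on $[0,1]$ vanishing at $0$. A majorant is a continuous non-decreasing $w:[0,1]\to[0,\infty)$ with $w(0)=0$, not identically zero, such that $w^\lambda$ is a modulus of continuity for some $\lambda>0$. $\mathcal{G}_w$ is the Banach space of analytic functions $g$ in $\mathbb{D}$ with $\lim_{|z|\to1-}w(1-|z|)g(z)=0$, with norm $\|g\|_{\mathcal{G}_w}=\sup_{z\in\mathbb{D}}w(1-|z|)|g(z)|$; polynomials are dense in it. $[g]_{\mathcal{G}_w}$ is the smallest closed subspace of $\mathcal{G}_w$ containing $g$ and invariant under multiplication by $z$; $g$ is cyclic in $\mathcal{G}_w$ if $[g]_{\mathcal{G}_w}=\mathcal{G}_w$. $\mathcal{N}$ is the Nevanlinna class: analytic $f$ in $\mathbb{D}$ with $\sup_{0<r<1}\int_{\partial\mathbb{D}}\log^+|f(r\zeta)|\,dm(\zeta)<\infty$. Each nonzero $f\in\mathcal{N}$ factors uniquely as $f=\mathcal{O}_f(S_\mu/S_\nu)B_\Lambda$, where $\mathcal{O}_f(z)=\exp\big(\int_{\partial\mathbb{D}}\frac{\zeta+z}{\zeta-z}\log|f(\zeta)|\,dm(\zeta)\big)$ is the outer factor; $S_\sigma(z)=\exp\big(-\int_{\partial\mathbb{D}}\frac{\zeta+z}{\zeta-z}\,d\sigma(\zeta)\big)$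 is the singular inner function of a positive finite singular Borel measure $\sigma$; $\mu,\nu$ are mutually singular; $B_\Lambda$ is the Blaschke product, including a unimodular constant factor $e^{i\gamma}$, with zero sequence $\Lambda$ (the zeros of $f$ in $\mathbb{D}$). The Smirnov class $\mathcal{N}_+$ consists of the functions in $\mathcal{N}$ with $\nu=0$ in this factorization (together with the zero function). A closed set $E\subset\partial\mathbb{D}$ of Lebesgue measure zero has finite $w$-entropy if $\int_{\partial\mathbb{D}}\log w(\mathrm{dist}(\zeta,E))\,dm(\zeta)>-\infty$, where $\mathrm{dist}$ is the unit-normalized arc-length distance on $\partial\mathbb{D}$. Each positive finite singular Borel measure $\mu$ on $\partial\mathbb{D}$ decomposes uniquely as $\mu=\mu_P+\mu_C$ with $\mu_P,\mu_C\geq 0$ where $\mu_P$ is concentrated on a countable union of sets of finite $w$-entropy and $\mu_C$ assigns measure zero to every set of finite $w$-entropy. *)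

theory Defs
  imports "HOL-Complex_Analysis.Complex_Analysis"
begin

text \<open>
  Functions on the open unit disc are total functions \<^typ>\<open>complex \<Rightarrow> complex\<close> of which only
  the restriction to \<^term>\<open>ball (0::complex) 1\<close> matters: all function classes below are
  invariant under changing values outside the disc, so equality of these classes as sets is the same
  as equality of the corresponding classes of functions on the disc.
\<close>

section \<open>Measures on the unit circle\<close>

abbreviation circle_borel :: "complex measure" where
  "circle_borel \<equiv> restrict_space borel (sphere 0 1)"

text \<open>Normalized Lebesgue measure on the circle.\<close>

definition circle_lebesgue :: "complex measure" where
  "circle_lebesgue =
     distr (restrict_space lborel {0..<1}) circle_borel (\<lambda>t::real. cis (2 * pi * t))"

definition mutually_singular :: "'a measure \<Rightarrow> 'a measure \<Rightarrow> bool" where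
  "mutually_singular M N \<longleftrightarrow>
     sets M = sets N \<and> (\<exists>A\<in>sets M. emeasure M A = 0 \<and> emeasure N (space N - A) = 0)"

definition finite_singular_measure :: "complex measure \<Rightarrow> bool" where
  "finite_singular_measure \<sigma> \<longleftrightarrow>
     sets \<sigma> = sets circle_borel \<and> finite_measure \<sigma> \<and> mutually_singular \<sigma> circle_lebesgue"

section \<open>Majorants and the spaces they define\<close>

definition modulus_of_continuity :: "(real \<Rightarrow> real) \<Rightarrow> bool" where
  "modulus_of_continuity w \<longleftrightarrow>
     continuous_on {0..1} w \<and> mono_on {0..1} w \<and> w 0 = 0 \<and>
     (\<forall>s\<in>{0..1}. \<forall>t\<in>{0..1}. s + t \<le> 1 \<longrightarrow> w (s + t) \<le> w s + w t)"

definition majorant :: "(real \<Rightarrow> real) \<Rightarrow> bool" where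
  "majorant w \<longleftrightarrow>
     continuous_on {0..1} w \<and> mono_on {0..1} w \<and> (\<forall>t\<in>{0..1}. 0 \<le> w t) \<and> w 0 = 0 \<and>
     (\<exists>t\<in>{0..1}. w t \<noteq> 0) \<and>
     (\<exists>l>0. modulus_of_continuity (\<lambda>t. w t powr l))"

definition G_space :: "(real \<Rightarrow> real) \<Rightarrow> (complex \<Rightarrow> complex) set" where
  "G_space w = {g. g holomorphic_on ball 0 1 \<and>
     ((\<lambda>z. of_real (w (1 - norm z)) * g z) \<longlongrightarrow> 0) (filtercomap norm (at_left 1))}"

definition G_norm :: "(real \<Rightarrow> real) \<Rightarrow> (complex \<Rightarrow> complex) \<Rightarrow> real" where
  "G_norm w g = (SUP z\<in>ball 0 1. w (1 - norm z) * norm (g z))"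

definition G_closed_subspace :: "(real \<Rightarrow> real) \<Rightarrow> (complex \<Rightarrow> complex) set \<Rightarrow> bool" where
  "G_closed_subspace w V \<longleftrightarrow>
     V \<subseteq> G_space w \<and> (\<lambda>z. 0) \<in> V \<and>
     (\<forall>g\<in>V. \<forall>h\<in>V. (\<lambda>z. g z + h z) \<in> V) \<and>
     (\<forall>c. \<forall>g\<in>V. (\<lambda>z. c * g z) \<in> V) \<and>
     (\<forall>u. \<forall>g\<in>G_space w. (\<forall>n. u n \<in> V) \<and>
        (\<lambda>n::nat. G_norm w (\<lambda>z. u n z - g z)) \<longlonglongrightarrow> 0 \<longrightarrow> g \<in> V)"

definition shift_invariant :: "(complex \<Rightarrow> complex) set \<Rightarrow> bool" where
  "shift_invariant V \<longleftrightarrow> (\<forall>g\<in>V. (\<lambda>z. z * g z) \<in> V)"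

definition G_generated :: "(real \<Rightarrow> real) \<Rightarrow> (complex \<Rightarrow> complex) \<Rightarrow> (complex \<Rightarrow> complex) set" where
  "G_generated w g = \<Inter>{V. G_closed_subspace w V \<and> shift_invariant V \<and> g \<in> V}"

definition G_cyclic :: "(real \<Rightarrow> real) \<Rightarrow> (complex \<Rightarrow> complex) \<Rightarrow> bool" where
  "G_cyclic w g \<longleftrightarrow> G_generated w g = G_space w"

section \<open>The Nevanlinna and Smirnov classes\<close>

text \<open>Here \<^term>\<open>ln (max 1 x)\<close> is $\log^+ x$ also for $x = 0$.\<close>

definition nevanlinna :: "(complex \<Rightarrow> complex) set" where
  "nevanlinna = {f. f holomorphic_on ball 0 1 \<and>
     bdd_above ((\<lambda>r. \<integral>\<zeta>. ln (max 1 (norm (f (of_real r * \<zeta>)))) \<partial>circle_lebesgue) ` {0<..<1})}"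

text \<open>The boundary values of \<^term>\<open>f\<close> are its radial limits, which exist almost everywhere
  for functions of the Nevanlinna class.\<close>

definition boundary_value :: "(complex \<Rightarrow> complex) \<Rightarrow> complex \<Rightarrow> complex" where
  "boundary_value f \<zeta> = Lim (at_left 1) (\<lambda>r::real. f (of_real r * \<zeta>))"

definition outer_factor :: "(complex \<Rightarrow> complex) \<Rightarrow> complex \<Rightarrow> complex" where
  "outer_factor f z =
     exp (\<integral>\<zeta>. (\<zeta> + z) / (\<zeta> - z) * of_real (ln (norm (boundary_value f \<zeta>))) \<partial>circle_lebesgue)"

definition singular_inner :: "complex measure \<Rightarrow> complex \<Rightarrow> complex" where
  "singular_inner \<sigma> z = exp (- (\<integral>\<zeta>. (\<zeta> + z) / (\<zeta> - z) \<partial>\<sigma>))"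

text \<open>
  A finite or infinite sequence in the disc, repeated according to multiplicity, is given by
  an index set $J$ and the points $\Lambda_n$ for $n \in J$.
\<close>

definition zero_sequence :: "(complex \<Rightarrow> complex) \<Rightarrow> nat set \<Rightarrow> (nat \<Rightarrow> complex) \<Rightarrow> bool" where
  "zero_sequence f J \<Lambda> \<longleftrightarrow>
     (\<forall>n\<in>J. \<Lambda> n \<in> ball 0 1) \<and>
     (\<forall>z\<in>ball 0 1. finite {n\<in>J. \<Lambda> n = z} \<and> int (card {n\<in>J. \<Lambda> n = z}) = zorder f z)"

definition blaschke_condition :: "nat set \<Rightarrow> (nat \<Rightarrow> complex) \<Rightarrow> bool" where
  "blaschke_condition J \<Lambda> \<longleftrightarrow> summable (\<lambda>n. if n \<in> J then 1 - norm (\<Lambda> n) else 0)"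

definition blaschke_factor :: "complex \<Rightarrow> complex \<Rightarrow> complex" where
  "blaschke_factor a z =
     (if a = 0 then z else of_real (norm a) / a * ((a - z) / (1 - cnj a * z)))"

definition blaschke_product :: "real \<Rightarrow> nat set \<Rightarrow> (nat \<Rightarrow> complex) \<Rightarrow> complex \<Rightarrow> complex" where
  "blaschke_product \<gamma> J \<Lambda> z =
     cis \<gamma> * prodinf (\<lambda>n. if n \<in> J then blaschke_factor (\<Lambda> n) z else 1)"

definition nevanlinna_factorization ::
  "(complex \<Rightarrow> complex) \<Rightarrow> complex measure \<Rightarrow> complex measure \<Rightarrow>
     real \<Rightarrow> nat set \<Rightarrow> (nat \<Rightarrow> complex) \<Rightarrow> bool" where
  "nevanlinna_factorization f \<mu> \<nu> \<gamma> J \<Lambda> \<longleftrightarrow>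
     finite_singular_measure \<mu> \<and> finite_singular_measure \<nu> \<and> mutually_singular \<mu> \<nu> \<and>
     zero_sequence f J \<Lambda> \<and> blaschke_condition J \<Lambda> \<and>
     (\<forall>z\<in>ball 0 1. f z =
        outer_factor f z * (singular_inner \<mu> z / singular_inner \<nu> z) * blaschke_product \<gamma> J \<Lambda> z)"

definition smirnov :: "(complex \<Rightarrow> complex) set" where
  "smirnov = {f\<in>nevanlinna. (\<forall>z\<in>ball 0 1. f z = 0) \<or>
     (\<exists>\<mu> \<gamma> J \<Lambda>. nevanlinna_factorization f \<mu> (null_measure circle_borel) \<gamma> J \<Lambda>)}"

section \<open>Sets of finite entropy\<close>

text \<open>Arc length is normalized such that the whole circle has length 1.\<close>

definition arc_dist :: "complex \<Rightarrow> complex \<Rightarrow> real" where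
  "arc_dist \<zeta> \<xi> = \<bar>Arg (\<zeta> / \<xi>)\<bar> / (2 * pi)"

definition arc_setdist :: "complex \<Rightarrow> complex set \<Rightarrow> real" where
  "arc_setdist \<zeta> E = (INF \<xi>\<in>E. arc_dist \<zeta> \<xi>)"

text \<open>
  The integrand is bounded above, so integrability means that the integral is not $-\infty$.
  The values on the null set \<^term>\<open>E\<close>, where \<^term>\<open>w\<close> vanishes, are irrelevant.
  The empty set, to which there is no distance, is left out; every measure vanishes on it, so
  the decomposition below does not depend on this.
\<close>

definition finite_entropy :: "(real \<Rightarrow> real) \<Rightarrow> complex set \<Rightarrow> bool" where
  "finite_entropy w E \<longleftrightarrow>
     E \<noteq> {} \<and> E \<subseteq> sphere 0 1 \<and> closed E \<and> emeasure circle_lebesgue E = 0 \<and>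
     integrable circle_lebesgue (\<lambda>\<zeta>. ln (w (arc_setdist \<zeta> E)))"

definition entropy_decomposition ::
  "(real \<Rightarrow> real) \<Rightarrow> complex measure \<Rightarrow> complex measure \<Rightarrow> complex measure \<Rightarrow> bool" where
  "entropy_decomposition w \<mu> \<mu>P \<mu>C \<longleftrightarrow>
     sets \<mu>P = sets \<mu> \<and> sets \<mu>C = sets \<mu> \<and>
     (\<forall>A\<in>sets \<mu>. emeasure \<mu> A = emeasure \<mu>P A + emeasure \<mu>C A) \<and>
     (\<exists>\<E>. countable \<E> \<and> (\<forall>E\<in>\<E>. finite_entropy w E) \<and> emeasure \<mu>P (space \<mu>P - \<Union>\<E>) = 0) \<and>
     (\<forall>E. finite_entropy w E \<longrightarrow> emeasure \<mu>C E = 0)"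

end

theory Submission
 imports Defs
begin

text \<open>
 Write S for the exponential of minus the Herglotz integral of an arbitrary finite measure on the
 circle. The outer factor is a quotient of two such functions with absolutely continuous
 measures, so $f = B S_\<alpha> / S_\<beta>$ up to a unimodular constant, with the singular parts $\<mu>$ of
 $\<alpha>$ and $\<nu>$ of $\<beta>$. Two facts carry the proof.

 (a) If a finite measure $\<kappa>$ does not charge sets of finite entropy, then $q S_\<kappa>$ comes
 arbitrarily close to 1 in the growth space for bounded $q$. Following Roberts, $\<kappa>$ is
 decomposed greedily along a rapidly refining sequence of dyadic partitions into pieces whose mass
 on every arc of length $t$ is at most a small multiple of $t \log (1/w(t))$. What resists the
 decomposition is carried by a set of finite entropy.

 (b) If $E$ has finite entropy, then $\log (1/w(1-|z|))$ is at most the Poisson integral of an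
 absolutely continuous measure on a tangential neighbourhood of $E$. Hence a bound by $1/w$ (or
 by the exponential of that Poisson integral) for $B S_\<alpha> / S_\<beta>$ there forces $\<beta> \le \<alpha>$ on
 $E$; this is seen by testing Poisson integrals against continuous functions on circles that
 tend to the boundary.

 By (b), $\<nu>$ and $\<beta>$ vanish on sets of finite entropy, so $S_\<nu>$ is cyclic by (a), and
 $B S_{\<mu>_P}$ is obtained from $S_\<beta> f$ by dividing out a factor covered by (a). Conversely,
 $f$ is the limit of $S_\<beta>^s f$ as $s \to 0$, and $S_\<beta>^{1-s}$ can be divided out of
 $S_\<beta> f$ because $S_\<beta>^s f$ grows at most like $w^{s-1}$ and (a) holds for the weight $w^s$.
 For the permanence, (b) is applied to $h / S_{\<mu>_P|E}$, which the maximum principle controls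
 near $E$. The quotient $h / (B S_{\<mu>_P})$ has the outer factor of $h$ because $B$ and $S_{\<mu>_P}$
 have unimodular radial limits almost everywhere.
\<close>

text \<open>The hypothesis on w(t^2) makes a power change of scale harmless: log(1/w) changes by at
  most a bounded factor between t and t^4. In (a) the inverse of a piece living at scale e is
  replaced by its dilation, which is accurate up to a power of e only where 1 - |z| >= e^(1/4).
  Closer to the circle the weight itself has to beat the growth of the quotients, and it can, as
  w(e^(1/4)) is at most a positive power of w(e). In (b) the hypothesis allows a neighbourhood of E
  as wide as (1 - |z|)^(1/4); outside of it a measure on E has a negligible Poisson integral. Since
  the outer factor is carried by measures too, every obstruction is an inequality between finite
  measures on closed sets, and the equality of the invariant subspaces requires no knowledge of the
  boundary behaviour of f. Boundary values enter with the permanence, because the Smirnov class is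
  defined through the outer factor of the boundary values of the quotient. Fatou's theorem, the
  unimodular radial limits and the measurability of the boundary values serve that purpose.\<close>

abbreviation "leb \<equiv> circle_lebesgue"

lemmas LINT_cong = Bochner_Integration.integral_cong
and LINT_add = Bochner_Integration.integral_add
and LINT_diff = Bochner_Integration.integral_diff
and LINT_sum = Bochner_Integration.integral_sum
and LINT_integrable_bound = Bochner_Integration.integrable_bound
and LINT_integrable_sum = Bochner_Integration.integrable_sum

abbreviation circle_integral :: "(complex => 'a) => 'a::{banach, second_countable_topology}" (binder "\<oint>" 10)
 where "circle_integral g \<equiv> integral\<^sup>L leb g"

section \<open>Lebesgue measure on the circle, and Cauchy's formula for it\<close>

lemma space_circle_borel [simp]: "space circle_borel = sphere 0 1"
 by (simp add: space_restrict_space)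

lemma cis_measurable: "(%t::real. cis (2 * pi * t)) \<in> borel \<rightarrow>\<^sub>M circle_borel"
 by (intro measurable_restrict_space2 borel_measurable_continuous_onI continuous_intros) auto

lemma cis_measurable_unit:
 "(%t::real. cis (2 * pi * t)) \<in> restrict_space lborel {0..<1} \<rightarrow>\<^sub>M circle_borel"
 by (rule measurable_restrict_space1) (simp add: cis_measurable)

lemma sets_circle_lebesgue [simp, measurable_cong]: "sets leb = sets circle_borel"
 by (simp add: circle_lebesgue_def)

lemma space_circle_lebesgue [simp]: "space leb = sphere 0 1"
 by (simp add: circle_lebesgue_def)

lemma emeasure_circle_lebesgue:
 assumes "A \<in> sets circle_borel"
 shows "emeasure leb A = emeasure lborel {t\<in>{0..<1}. cis (2 * pi * t) \<in> A}"
proof -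
 have "emeasure leb A =
  emeasure (restrict_space lborel {0..<1}) ((%t. cis (2 * pi * t)) -` A \<inter> {0..<1})"
  unfolding circle_lebesgue_def
  by (subst emeasure_distr[OF cis_measurable_unit assms]) (simp add: space_restrict_space)
 also have "... = emeasure lborel ((%t. cis (2 * pi * t)) -` A \<inter> {0..<1})"
  by (subst emeasure_restrict_space) auto
 also have "(%t. cis (2 * pi * t)) -` A \<inter> {0..<1} = {t\<in>{0..<1}. cis (2 * pi * t) \<in> A}"
  by auto
 finally show ?thesis .
qed

lemma emeasure_circle_lebesgue_space: "emeasure leb (sphere 0 1) = 1"
proof -
 have "sphere (0::complex) 1 \<in> sets circle_borel"
  using sets.top[of circle_borel] by simp
 moreover have "{t\<in>{0..<1}. cis (2 * pi * t) \<in> sphere 0 1} = {0..<1}"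
  by auto
 ultimately show ?thesis
  by (simp add: emeasure_circle_lebesgue)
qed

locale circle_measure = finite_measure \<kappa> for \<kappa> :: "complex measure" +
 assumes sets_circle: "sets \<kappa> = sets circle_borel"
begin

lemma space_circle [simp]: "space \<kappa> = sphere 0 1"
 using sets_eq_imp_space_eq[OF sets_circle] by simp

lemma measurable_circle_iff: "f \<in> \<kappa> \<rightarrow>\<^sub>M N \<longleftrightarrow> f \<in> circle_borel \<rightarrow>\<^sub>M N"
 using measurable_cong_sets[OF sets_circle, of N N] by auto

lemma borel_measurable_continuous [intro]:
 fixes g :: "complex => 'a::{second_countable_topology, t2_space}"
 assumes "continuous_on (sphere 0 1) g"
 shows "g \<in> borel_measurable \<kappa>"
 unfolding measurable_circle_iff using assms by (rule borel_measurable_continuous_on_restrict)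

lemma integrable_continuous:
 fixes g :: "complex => 'a::{second_countable_topology, banach}"
 assumes "continuous_on (sphere 0 1) g"
 shows "integrable \<kappa> g"
proof -
 have "bounded (g ` sphere 0 1)"
  by (intro compact_imp_bounded compact_continuous_image assms) simp
 then obtain B where "\<forall>x\<in>sphere 0 1. norm (g x) \<le> B"
  unfolding bounded_iff by blast
 then show ?thesis
  by (intro integrable_const_bound[where B=B]) (auto intro: borel_measurable_continuous assms)
qed

end

interpretation leb: circle_measure leb
proof (rule circle_measure.intro)
 show "finite_measure leb"
  by (rule finite_measureI) (simp add: emeasure_circle_lebesgue_space)
qed (simp add: circle_measure_axioms_def)

lemma measure_circle_lebesgue_space [simp]: "measure leb (sphere 0 1) = 1"
 by (simp add: measure_def emeasure_circle_lebesgue_space)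

lemma circle_measure_if:
 "finite_measure \<kappa> ==> sets \<kappa> = sets circle_borel ==> circle_measure \<kappa>"
 by (simp add: circle_measure_def circle_measure_axioms_def)

text \<open>Contour integrals are gauge integrals over the closed interval, while \<open>leb\<close>
  is a push-forward from the half-open one; the additional endpoint is a null set. This makes
  Cauchy's theory available for \<open>leb\<close>.\<close>

lemma integral_circle_lebesgue:
 fixes g :: "complex => complex"
 assumes "continuous_on (sphere 0 1) g"
 shows "((%t. g (cis (2 * pi * t))) has_integral (\<oint>x. g x)) {0..1}"
proof -
 have c: "continuous_on {0..1} (%t. g (cis (2 * pi * t)))"
  by (intro continuous_on_compose2[OF assms] continuous_intros) auto
 have gm: "g \<in> borel_measurable circle_borel"
  using assms by (rule borel_measurable_continuous_on_restrict)
 have "(\<oint>x. g x) =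
   (\<integral>t. g (cis (2 * pi * t)) \<partial>restrict_space lborel {0..<1})"
  unfolding circle_lebesgue_def by (rule integral_distr[OF cis_measurable_unit gm])
 also have "... = (LBINT t:{0..<1}. g (cis (2 * pi * t)))"
  by (subst integral_restrict_space) (auto simp: set_lebesgue_integral_def)
 also have "... = (LBINT t:{0..1}. g (cis (2 * pi * t)))"
  unfolding set_lebesgue_integral_def
 proof (rule integral_cong_AE)
  have "(%t. g (cis (2 * pi * t))) \<in> borel_measurable borel"
   by (rule measurable_compose[OF cis_measurable gm])
  then show "(%t. indicator {0..<1} t *\<^sub>R g (cis (2 * pi * t))) \<in> borel_measurable lborel"
   "(%t. indicator {0..1} t *\<^sub>R g (cis (2 * pi * t))) \<in> borel_measurable lborel"
   by (auto intro!: borel_measurable_scaleR)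
  have "AE t in lborel. t \<noteq> (1::real)"
   by (rule AE_lborel_singleton)
  then show "AE t in lborel. indicator {0..<1} t *\<^sub>R g (cis (2 * pi * t)) =
    indicator {0..1} t *\<^sub>R g (cis (2 * pi * t))"
   by eventually_elim (auto simp: indicator_def)
 qed
 finally have e: "(\<oint>x. g x) = (LBINT t:{0..1}. g (cis (2 * pi * t)))" .
 have "set_integrable lborel {0..1} (%t. g (cis (2 * pi * t)))"
  using borel_integrable_compact[OF _ c] by (simp add: set_integrable_def)
 from set_borel_integral_eq_integral[OF this] show ?thesis
  unfolding e by (simp add: has_integral_integrable_integral)
qed

text \<open>With u = cis(2 pi t) one has du = 2 pi i u dt, which accounts for the additional factor
  x and for the absence of a constant.\<close>

lemma Cauchy_integral_circle_lebesgue: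
 assumes c: "continuous_on (cball 0 1) g" and h: "g holomorphic_on ball 0 1" and w: "norm w < 1"
 shows "(\<oint>x. g x * x / (x - w)) = g w"
proof -
 have "((%u. g u / (u - w)) has_contour_integral (2 * of_real pi * \<i> * g w)) (circlepath 0 1)"
  using Cauchy_integral_circlepath[OF c h] w by simp
 then have "((%t. g (circlepath 0 1 t) / (circlepath 0 1 t - w) *
   vector_derivative (circlepath 0 1) (at t within {0..1})) has_integral
   (2 * of_real pi * \<i> * g w)) {0..1}"
  by (simp add: has_contour_integral_def)
 moreover have "g (circlepath 0 1 t) / (circlepath 0 1 t - w) *
   vector_derivative (circlepath 0 1) (at t within {0..1}) =
   2 * pi * \<i> * (g (cis (2 * pi * t)) * cis (2 * pi * t) / (cis (2 * pi * t) - w))"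
  if "t \<in> {0..1}" for t
 proof -
  have "circlepath 0 1 t = cis (2 * pi * t)"
   by (simp add: circlepath cis_conv_exp mult_ac)
  moreover have "vector_derivative (circlepath 0 1) (at t within {0..1}) =
    2 * pi * \<i> * cis (2 * pi * t)"
   using that by (subst vector_derivative_circlepath01) (auto simp: cis_conv_exp mult_ac)
  ultimately show ?thesis by (simp add: mult_ac)
 qed
 ultimately have "((%t. 2 * pi * \<i> *
   (g (cis (2 * pi * t)) * cis (2 * pi * t) / (cis (2 * pi * t) - w)))
   has_integral (2 * of_real pi * \<i> * g w)) {0..1}"
  by (rule has_integral_eq[rotated])
 from has_integral_mult_right[OF this, of "1 / (2 * pi * \<i>)"]
 have 1: "((%t. g (cis (2 * pi * t)) * cis (2 * pi * t) / (cis (2 * pi * t) - w))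
   has_integral g w) {0..1}"
  by simp
 have "continuous_on (sphere 0 1) (%x. g x * x / (x - w))"
  using w by (intro continuous_intros continuous_on_subset[OF c]) auto
 from integral_circle_lebesgue[OF this] 1 show ?thesis
  by (rule has_integral_unique)
qed

lemma mean_value_circle_lebesgue:
 assumes c: "continuous_on (cball 0 1) g" and h: "g holomorphic_on ball 0 1"
 shows "(\<oint>x. g x) = g 0"
proof -
 have "(\<oint>x. g x) = (\<oint>x. g x * x / (x - 0))"
  by (rule LINT_cong) auto
 then show ?thesis
  using Cauchy_integral_circle_lebesgue[OF c h, of 0] by simp
qed

lemma norm_dilation_less: "norm x \<le> 1 ==> 0 \<le> r ==> r < 1 ==> norm (of_real r * x :: complex) < 1"
 using mult_left_mono[of "norm x" 1 r] by (simp add: norm_mult)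

lemma dilation_disc:
 assumes g: "g holomorphic_on ball 0 1" and r: "0 \<le> r" "r < 1"
 shows "continuous_on (cball 0 1) (%x. g (of_real r * x))" "continuous_on (sphere 0 1) (%x. g (of_real r * x))"
  "(%x. g (of_real r * x)) holomorphic_on ball 0 1"
proof -
 show c: "continuous_on (cball 0 1) (%x. g (of_real r * x))"
  by (rule continuous_on_compose2[OF holomorphic_on_imp_continuous_on[OF g]])
   (use norm_dilation_less r in "auto intro!: continuous_intros")
 show "continuous_on (sphere 0 1) (%x. g (of_real r * x))" by (rule continuous_on_subset[OF c]) auto
 show "(%x. g (of_real r * x)) holomorphic_on ball 0 1"
  by (rule holomorphic_on_compose_gen[OF _ g, unfolded o_def])
   (use norm_dilation_less r in "auto intro!: holomorphic_intros")
qed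

section \<open>The Herglotz and Poisson kernels\<close>

definition herglotz :: "complex => complex => complex" where
 "herglotz z \<zeta> = (\<zeta> + z) / (\<zeta> - z)"

definition poisson :: "complex => complex => real" where
 "poisson z \<zeta> = (1 - (norm z)\<^sup>2) / (norm (\<zeta> - z))\<^sup>2"

lemma circle_minus_disc_ge: "norm x = 1 ==> 1 - norm z \<le> norm (x - z)"
 by (metis norm_triangle_ineq2)

lemma circle_minus_disc_nz [simp]: "norm x = 1 ==> norm z < 1 ==> x - z \<noteq> 0"
 by auto

lemma Re_herglotz:
 assumes "norm x = 1"
 shows "Re (herglotz z x) = poisson z x"
proof -
 have "Re ((x + z) * cnj (x - z)) = (norm x)\<^sup>2 - (norm z)\<^sup>2"
  unfolding cmod_power2 by (simp add: algebra_simps power2_eq_square)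
 then show ?thesis
  by (simp add: herglotz_def poisson_def complex_div_cnj[of "x + z"] assms)
qed

lemma poisson_nonneg [simp]: "norm z \<le> 1 ==> 0 \<le> poisson z x"
 by (auto simp: poisson_def power_le_one_iff intro!: divide_nonneg_nonneg)

lemma poisson_le:
 assumes "norm z < 1" "0 < d" "d \<le> norm (x - z)"
 shows "poisson z x \<le> 2 * (1 - norm z) / d\<^sup>2"
proof -
 have "1 - (norm z)\<^sup>2 = (1 + norm z) * (1 - norm z)"
  by (simp add: power2_eq_square algebra_simps)
 also have "... \<le> 2 * (1 - norm z)"
  using assms by (intro mult_right_mono) auto
 finally have "1 - (norm z)\<^sup>2 \<le> 2 * (1 - norm z)" .
 moreover have "d\<^sup>2 \<le> (norm (x - z))\<^sup>2"
  using assms by (intro power_mono) auto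
 ultimately show ?thesis
  unfolding poisson_def using assms by (intro frac_le) (auto simp: power_le_one_iff)
qed

lemma continuous_on_herglotz [continuous_intros]:
 "norm z < 1 ==> continuous_on (sphere 0 1) (herglotz z)"
 unfolding herglotz_def by (intro continuous_intros) auto

lemma continuous_on_poisson [continuous_intros]:
 "norm z < 1 ==> continuous_on (sphere 0 1) (poisson z)"
 unfolding poisson_def by (intro continuous_intros) auto

text \<open>Multiplying y - r x by \<open>cnj x * cnj y\<close> gives the conjugate of x - r y. The
  symmetry lets Fubini move the dilation from the Lebesgue variable to the variable of the
  measure.\<close>

lemma poisson_sym:
 assumes "norm x = 1" "norm y = 1"
 shows "poisson (of_real r * x) y = poisson (of_real r * y) x"
proof -
 have "norm (y - of_real r * x) = norm (cnj y * x) * norm (y - of_real r * x)"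
  using assms by (simp add: norm_mult)
 also have "... = norm (cnj (x - of_real r * y))"
 proof -
  have 1: "y * cnj y = 1" "x * cnj x = 1"
   using assms by (simp_all add: complex_norm_square[symmetric])
  have "norm (cnj y * x) * norm (y - of_real r * x) =
    norm (cnj y * cnj x) * norm (y - of_real r * x)"
   by (simp add: norm_mult)
  also have "... = norm (cnj x * (y * cnj y) - of_real r * cnj y * (x * cnj x))"
   by (simp add: norm_mult[symmetric] algebra_simps)
  finally show ?thesis by (simp add: 1)
 qed
 also have "... = norm (x - of_real r * y)"
  by (rule complex_mod_cnj)
 finally show ?thesis
  using assms by (simp add: poisson_def norm_mult)
qed

lemma norm_herglotz_le:
 assumes "norm z < 1" "norm x = 1"
 shows "norm (herglotz z x) \<le> 2 / (1 - norm z)"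
proof -
 have "norm (x + z) \<le> 2"
  using norm_triangle_ineq[of x z] assms by simp
 then show ?thesis
  unfolding herglotz_def norm_divide
  using assms circle_minus_disc_ge[of x z] by (intro frac_le) auto
qed

text \<open>On the circle \<open>herglotz z\<close> is the conjugate of a function that is
  holomorphic in x with value 1 at 0, so the mean value property applies.\<close>

lemma integral_herglotz_lebesgue:
 assumes z: "norm z < 1"
 shows "(\<oint>x. herglotz z x) = 1"
proof -
 define G where "G x = (1 + cnj z * x) / (1 - cnj z * x)" for x
 have nz: "1 - cnj z * x \<noteq> 0" if "norm x \<le> 1" for x
 proof -
  have "norm (cnj z * x) < 1"
   using z that by (simp add: norm_mult) (metis mult_left_le norm_ge_zero order_le_less_trans)
  then show ?thesis by auto
 qed
 have "(\<oint>x. herglotz z x) = (\<oint>x. cnj (G x))"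
 proof (rule LINT_cong)
  fix x assume "x \<in> space leb"
  then have n: "norm x = 1" by simp
  have 1: "x * cnj x = 1"
   using n by (simp add: complex_norm_square[symmetric])
  then have "x + z = x * (1 + z * cnj x)" "x - z = x * (1 - z * cnj x)"
   by (simp_all add: algebra_simps)
  then show "herglotz z x = cnj (G x)"
   using n by (auto simp: herglotz_def G_def)
 qed simp
 also have "... = cnj (\<oint>x. G x)"
  by simp
 also have "(\<oint>x. G x) = G 0"
  unfolding G_def
  by (rule mean_value_circle_lebesgue)
   (auto intro!: continuous_intros holomorphic_intros simp: nz[simplified])
 finally show ?thesis by (simp add: G_def)
qed

lemma integral_poisson_lebesgue:
 assumes z: "norm z < 1"
 shows "(\<oint>x. poisson z x) = 1"
proof -
 have "(\<oint>x. poisson z x) = (\<oint>x. Re (herglotz z x))"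
  by (rule LINT_cong) (auto simp: Re_herglotz)
 also have "... = Re (\<oint>x. herglotz z x)"
  by (intro integral_Re leb.integrable_continuous continuous_intros z)
 finally show ?thesis by (simp add: integral_herglotz_lebesgue z)
qed

text \<open>On the circle the Poisson kernel is the Cauchy kernel x/(x - z) plus
  \<open>cnj z * x / (1 - cnj z * x)\<close>. The second summand times g is holomorphic in x and
  vanishes at 0, so it has mean zero.\<close>

lemma Poisson_formula:
 fixes g :: "complex => complex"
 assumes c: "continuous_on (cball 0 1) g" and h: "g holomorphic_on ball 0 1" and z: "norm z < 1"
 shows "(\<oint>x. poisson z x * g x) = g z"
proof -
 define G where "G x = g x * cnj z * x / (1 - cnj z * x)" for x
 have nz: "1 - cnj z * x \<noteq> 0" if "norm x \<le> 1" for x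
 proof -
  have "norm (cnj z * x) < 1"
   using z that by (simp add: norm_mult) (metis mult_left_le norm_ge_zero order_le_less_trans)
  then show ?thesis by auto
 qed
 have Gc: "continuous_on (cball 0 1) G" and Gh: "G holomorphic_on ball 0 1"
  unfolding G_def
  by (auto intro!: continuous_intros holomorphic_intros c h simp: nz[simplified])
 have cs: "continuous_on (sphere 0 1) g" "continuous_on (sphere 0 1) G"
  using c Gc by (auto elim: continuous_on_subset)
 have "(\<oint>x. poisson z x * g x) =
   (\<oint>x. g x * x / (x - z) + G x)"
 proof (rule LINT_cong)
  fix x assume "x \<in> space leb"
  then have n: "norm x = 1" by simp
  have 1: "x * cnj x = 1"
   using n by (simp add: complex_norm_square[symmetric])
  have a: "x - z \<noteq> 0" using n z by auto
  have b: "cnj x - cnj z \<noteq> 0" using n z by auto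
  have "1 - cnj z * x = x * (cnj x - cnj z)"
   using 1 by (simp add: algebra_simps)
  then have "G x = g x * (cnj z / (cnj x - cnj z))"
   using n by (auto simp: G_def)
  then have "g x * x / (x - z) + G x = g x * (x / (x - z) + cnj z / (cnj x - cnj z))"
   by (simp add: algebra_simps)
  also have "x / (x - z) + cnj z / (cnj x - cnj z) =
    (x * cnj x - z * cnj z) / ((x - z) * cnj (x - z))"
   using a b by (simp add: divide_simps) (simp add: algebra_simps)
  also have "... = of_real (poisson z x)"
   unfolding poisson_def using n
   by (simp add: complex_norm_square[symmetric] del: complex_cnj_diff)
  finally show "complex_of_real (poisson z x) * g x = g x * x / (x - z) + G x"
   by (simp add: mult_ac)
 qed simp
 also have "... = (\<oint>x. g x * x / (x - z)) + (\<oint>x. G x)"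
  using z by (intro LINT_add leb.integrable_continuous
    continuous_intros cs) auto
 also have "... = g z"
  using Cauchy_integral_circle_lebesgue[OF c h z] mean_value_circle_lebesgue[OF Gc Gh]
  by (simp add: G_def)
 finally show ?thesis .
qed

section \<open>Herglotz exponentials of measures\<close>

definition poisson_integral :: "complex measure => complex => real" where
 "poisson_integral \<kappa> z = (\<integral>\<zeta>. poisson z \<zeta> \<partial>\<kappa>)"

definition herglotz_integral :: "complex measure => complex => complex" where
 "herglotz_integral \<kappa> z = (\<integral>\<zeta>. herglotz z \<zeta> \<partial>\<kappa>)"

lemma singular_inner_eq: "singular_inner \<kappa> z = exp (- herglotz_integral \<kappa> z)"
 by (simp add: singular_inner_def herglotz_integral_def herglotz_def)

lemma singular_inner_nz [simp]: "singular_inner \<kappa> z \<noteq> 0"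
 by (simp add: singular_inner_eq)

lemma herglotz_diff:
 assumes "norm z < 1" "norm y < 1" "norm x = 1"
 shows "herglotz y x - herglotz z x = (y - z) * (2 * x / ((x - y) * (x - z)))"
proof -
 have "x - y \<noteq> 0" "x - z \<noteq> 0" using assms by auto
 then show ?thesis
  unfolding herglotz_def by (simp add: divide_simps) (simp add: algebra_simps)
qed

lemma herglotz_0: "norm x = 1 ==> herglotz 0 x = 1" "norm x = 1 ==> poisson 0 x = 1"
 by (auto simp: herglotz_def poisson_def)

context circle_measure
begin

lemma integrable_herglotz [simp]: "norm z < 1 ==> integrable \<kappa> (herglotz z)"
 by (intro integrable_continuous continuous_intros)

lemma integrable_poisson [simp]: "norm z < 1 ==> integrable \<kappa> (poisson z)"
 by (intro integrable_continuous continuous_intros)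

lemma Re_herglotz_integral:
 assumes "norm z < 1"
 shows "Re (herglotz_integral \<kappa> z) = poisson_integral \<kappa> z"
proof -
 have "Re (herglotz_integral \<kappa> z) = (\<integral>x. Re (herglotz z x) \<partial>\<kappa>)"
  unfolding herglotz_integral_def using assms by (simp add: integral_Re)
 also have "... = poisson_integral \<kappa> z"
  unfolding poisson_integral_def
  by (rule LINT_cong) (auto simp: Re_herglotz)
 finally show ?thesis .
qed

lemma norm_singular_inner:
 "norm z < 1 ==> norm (singular_inner \<kappa> z) = exp (- poisson_integral \<kappa> z)"
 by (simp add: singular_inner_eq Re_herglotz_integral)

lemma poisson_integral_nonneg [simp]: "norm z < 1 ==> 0 \<le> poisson_integral \<kappa> z"
 unfolding poisson_integral_def by (intro integral_nonneg_AE AE_I2) simp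

lemma norm_singular_inner_le: "norm z < 1 ==> norm (singular_inner \<kappa> z) \<le> 1"
 by (simp add: norm_singular_inner)

lemma norm_herglotz_integral_le:
 assumes "norm z < 1"
 shows "norm (herglotz_integral \<kappa> z) \<le> 2 / (1 - norm z) * measure \<kappa> (sphere 0 1)"
proof -
 have "norm (herglotz_integral \<kappa> z) \<le> (\<integral>x. norm (herglotz z x) \<partial>\<kappa>)"
  unfolding herglotz_integral_def by (rule integral_norm_bound)
 also have "... \<le> (\<integral>x. 2 / (1 - norm z) \<partial>\<kappa>)"
  using assms by (intro integral_mono) (auto intro: norm_herglotz_le)
 finally show ?thesis by (simp add: mult.commute)
qed

lemma norm_singular_inner_minus_1_le:
 assumes "norm z < 1"
 shows "norm (singular_inner \<kappa> z - 1) \<le>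
  2 / (1 - norm z) * measure \<kappa> (sphere 0 1) * exp (2 / (1 - norm z) * measure \<kappa> (sphere 0 1))"
proof -
 let ?x = "- herglotz_integral \<kappa> z" and ?a = "2 / (1 - norm z) * measure \<kappa> (sphere 0 1)"
 have x: "norm ?x \<le> ?a" using norm_herglotz_integral_le[OF assms] by simp
 have r: "\<bar>Re ?x\<bar> \<le> ?a"
  using x abs_Re_le_cmod[of ?x] by (rule order_trans[rotated])
 have "norm (exp ?x - (\<Sum>k\<le>0. ?x ^ k / fact k)) \<le> exp \<bar>Re ?x\<bar> * norm ?x ^ Suc 0 / fact 0"
  by (rule Taylor_exp)
 also have "... = exp \<bar>Re ?x\<bar> * norm ?x"
  by simp
 also have "... \<le> exp ?a * ?a"
  using x r by (intro mult_mono exp_le_cancel_iff[THEN iffD2]) auto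
 finally show ?thesis by (simp add: singular_inner_eq mult_ac)
qed

text \<open>The kernel varies at a rate of at most 2/(1 - |z|)^2, and the dilation moves z by at
  most 1 - q. It will be applied where 1 - q is far smaller than (1 - |z|)^2.\<close>

lemma norm_herglotz_integral_diff_le:
 assumes "norm z < 1" "0 \<le> q" "q \<le> 1"
 shows "norm (herglotz_integral \<kappa> (of_real q * z) - herglotz_integral \<kappa> z) \<le>
  2 * (1 - q) / (1 - norm z)\<^sup>2 * measure \<kappa> (sphere 0 1)"
proof -
 have r: "norm (of_real q * z) \<le> norm z"
  using assms by (simp add: norm_mult mult_left_le_one_le)
 then have r1: "norm (of_real q * z) < 1" using assms by simp
 have "norm (herglotz_integral \<kappa> (of_real q * z) - herglotz_integral \<kappa> z) =
   norm (\<integral>x. herglotz (of_real q * z) x - herglotz z x \<partial>\<kappa>)"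
  unfolding herglotz_integral_def using assms r1 by simp
 also have "... \<le> (\<integral>x. norm (herglotz (of_real q * z) x - herglotz z x) \<partial>\<kappa>)"
  by (rule integral_norm_bound)
 also have "... \<le> (\<integral>x. 2 * (1 - q) / (1 - norm z)\<^sup>2 \<partial>\<kappa>)"
 proof (intro integral_mono)
  fix x assume "x \<in> space \<kappa>"
  then have n: "norm x = 1" by simp
  have "of_real q * z - z = - of_real (1 - q) * z" by (simp add: algebra_simps)
  then have "norm (of_real q * z - z) = \<bar>1 - q\<bar> * norm z"
   by (simp only: norm_mult norm_minus_cancel norm_of_real)
  then have a: "norm (of_real q * z - z) \<le> 1 - q"
   using assms by (simp add: mult_left_le)
  have b: "1 - norm z \<le> norm (x - of_real q * z)" "1 - norm z \<le> norm (x - z)"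
   using circle_minus_disc_ge[OF n, of "of_real q * z"] circle_minus_disc_ge[OF n, of z] r by simp_all
  have "norm (herglotz (of_real q * z) x - herglotz z x) =
    norm (of_real q * z - z) * (2 / (norm (x - of_real q * z) * norm (x - z)))"
   unfolding herglotz_diff[OF assms(1) r1 n] by (simp add: norm_mult norm_divide n)
  also have "... \<le> (1 - q) * (2 / ((1 - norm z) * (1 - norm z)))"
   using assms a b n by (intro mult_mono frac_le) auto
  finally show "norm (herglotz (of_real q * z) x - herglotz z x) \<le> 2 * (1 - q) / (1 - norm z)\<^sup>2"
   by (simp add: power2_eq_square mult_ac)
 qed (use assms r1 in auto)
 finally show ?thesis by (simp add: mult_ac)
qed

text \<open>By \<open>herglotz_diff\<close> the difference quotient at z is again an integral
  against the measure, with a kernel that is continuous in y; dominated convergence gives its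
  limit.\<close>

lemma herglotz_integral_holomorphic: "herglotz_integral \<kappa> holomorphic_on ball 0 1"
proof -
 have "\<exists>D. (herglotz_integral \<kappa> has_field_derivative D) (at z)" if z: "z \<in> ball 0 1" for z
 proof -
  define g where "g y = (\<integral>x. 2 * x / ((x - y) * (x - z)) \<partial>\<kappa>)" for y
  have z1: "norm z < 1" using z by simp
  have int: "integrable \<kappa> (%x. 2 * x / ((x - y) * (x - z)))" if "norm y < 1" for y
   using that z1 by (intro integrable_continuous continuous_intros) auto
  have eq: "herglotz_integral \<kappa> y - herglotz_integral \<kappa> z = g y * (y - z)" if y: "norm y < 1" for y
  proof -
   have "herglotz_integral \<kappa> y - herglotz_integral \<kappa> z = (\<integral>x. herglotz y x - herglotz z x \<partial>\<kappa>)"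
    unfolding herglotz_integral_def using z1 y by simp
   also have "... = (\<integral>x. (y - z) * (2 * x / ((x - y) * (x - z))) \<partial>\<kappa>)"
    using z1 y by (intro LINT_cong) (auto simp: herglotz_diff)
   also have "... = g y * (y - z)"
    unfolding g_def by (subst integral_mult_right_zero) (rule mult.commute)
   finally show ?thesis .
  qed
  have "continuous (at z within ball 0 1) g"
   unfolding continuous_within tendsto_at_iff_sequentially
  proof (intro allI impI)
   fix X assume X: "\<forall>i. X i \<in> ball 0 1 - {z}" "X \<longlonglongrightarrow> z"
   define d where "d = (1 - norm z) / 2"
   have d: "0 < d" using z1 by (simp add: d_def)
   have "\<forall>\<^sub>F i in sequentially. norm (X i) < norm z + d"
    using order_tendstoD(2)[OF tendsto_norm[OF X(2)], of "norm z + d"] d by simp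
   then obtain N where N: "\<And>i. i \<ge> N ==> norm (X i) < norm z + d"
    by (auto simp: eventually_sequentially)
   have "(%i. g (X (i + N))) \<longlonglongrightarrow> g z"
    unfolding g_def
   proof (rule integral_dominated_convergence[where w="%_. 2 / (d * d)"])
    show "AE x in \<kappa>. (%i. 2 * x / ((x - X (i + N)) * (x - z))) \<longlonglongrightarrow> 2 * x / ((x - z) * (x - z))"
     using z1 by (intro AE_I2 tendsto_intros LIMSEQ_ignore_initial_segment X) auto
    show "AE x in \<kappa>. norm (2 * x / ((x - X (i + N)) * (x - z))) \<le> 2 / (d * d)" for i
    proof (rule AE_I2)
     fix x assume "x \<in> space \<kappa>"
     then have n: "norm x = 1" by simp
     have "1 - norm z = 2 * d" by (simp add: d_def)
     then have "d \<le> norm (x - X (i + N))" "d \<le> norm (x - z)"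
      using circle_minus_disc_ge[OF n, of "X (i + N)"] circle_minus_disc_ge[OF n, of z] N[of "i + N"] d
      by auto
     then show "norm (2 * x / ((x - X (i + N)) * (x - z))) \<le> 2 / (d * d)"
      using d n by (simp add: norm_mult norm_divide) (intro frac_le mult_mono, auto)
    qed
   qed (use int X z1 in "auto intro!: borel_measurable_integrable")
   then show "(g \<circ> X) \<longlonglongrightarrow> g z"
    unfolding comp_def by (rule LIMSEQ_offset)
  qed
  then have "isCont g z"
   using at_within_open[OF z open_ball] by (simp add: continuous_at)
  have "(herglotz_integral \<kappa> has_field_derivative g z) (at z within ball 0 1)"
   unfolding has_field_derivative_iff
  proof (rule Lim_transform_within_open[where f=g and s="ball 0 1"])
   show "(g \<longlongrightarrow> g z) (at z within ball 0 1)"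
    using \<open>isCont g z\<close> at_within_open[OF z open_ball] by (simp add: continuous_at)
  qed (use eq z in auto)
  then show ?thesis
   using at_within_open[OF z open_ball] by auto
 qed
 then show ?thesis
  by (subst holomorphic_on_open) auto
qed

lemma singular_inner_holomorphic: "singular_inner \<kappa> holomorphic_on ball 0 1"
proof -
 have "(%z. exp (- herglotz_integral \<kappa> z)) holomorphic_on ball 0 1"
  by (intro holomorphic_intros herglotz_integral_holomorphic)
 then show ?thesis by (simp add: singular_inner_eq[abs_def])
qed

lemma herglotz_integral_0: "herglotz_integral \<kappa> 0 = of_real (measure \<kappa> (sphere 0 1))"
proof -
 have "herglotz_integral \<kappa> 0 = (\<integral>x. 1 \<partial>\<kappa>)"
  unfolding herglotz_integral_def
  by (rule LINT_cong) (auto simp: herglotz_0)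
 then show ?thesis by (simp add: scaleR_conv_of_real)
qed

lemma continuous_on_poisson_integral_dilation:
 assumes r: "0 \<le> r" "r < 1"
 shows "continuous_on (sphere 0 1) (%x. poisson_integral \<kappa> (of_real r * x))"
proof (rule continuous_on_eq)
 show "continuous_on (sphere 0 1) (%x. - ln (norm (singular_inner \<kappa> (of_real r * x))))"
  by (intro continuous_intros dilation_disc(2)[OF singular_inner_holomorphic r]) (simp add: singular_inner_nz)
qed (use norm_dilation_less r in "simp add: norm_singular_inner")

lemma norm_singular_inner_0: "norm (singular_inner \<kappa> 0) = exp (- measure \<kappa> (sphere 0 1))"
 by (simp add: singular_inner_eq herglotz_integral_0)

end

section \<open>Operations on measures on the circle\<close>

lemma (in circle_measure) circle_measure_density:
 assumes "integrable \<kappa> t"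
 shows "circle_measure (density \<kappa> (%x. ennreal (t x)))"
proof (rule circle_measure_if)
 have "(\<integral>\<^sup>+x. ennreal (t x) \<partial>\<kappa>) \<noteq> \<infinity>"
 proof -
  have "(\<integral>\<^sup>+x. ennreal (t x) \<partial>\<kappa>) \<le> (\<integral>\<^sup>+x. ennreal (norm (t x)) \<partial>\<kappa>)"
   by (intro nn_integral_mono ennreal_leI) auto
  then show ?thesis
   using assms by (auto simp: integrable_iff_bounded top_unique)
 qed
 moreover have "emeasure (density \<kappa> (%x. ennreal (t x))) (space \<kappa>) = (\<integral>\<^sup>+x. ennreal (t x) \<partial>\<kappa>)"
  using assms by (subst emeasure_density)
   (auto intro!: nn_integral_cong simp: indicator_def borel_measurable_integrable
      simp del: space_circle)
 ultimately show "finite_measure (density \<kappa> (%x. ennreal (t x)))"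
  by (intro finite_measureI) auto
qed (simp add: sets_circle)

lemma (in circle_measure) herglotz_integral_density:
 assumes "t \<in> borel_measurable \<kappa>" "\<And>y. 0 \<le> t y" "norm z < 1"
 shows "herglotz_integral (density \<kappa> (%x. ennreal (t x))) z = (\<integral>y. t y *\<^sub>R herglotz z y \<partial>\<kappa>)"
 unfolding herglotz_integral_def
 using assms by (intro integral_density) (auto intro: continuous_intros)

lemma (in circle_measure) poisson_integral_density:
 assumes "t \<in> borel_measurable \<kappa>" "\<And>y. 0 \<le> t y" "norm z < 1"
 shows "poisson_integral (density \<kappa> (%x. ennreal (t x))) z = (\<integral>y. t y * poisson z y \<partial>\<kappa>)"
 unfolding poisson_integral_def
 using assms by (subst integral_density) (auto intro: continuous_intros)

definition sum_circle_measure :: "complex measure => complex measure => complex measure" where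
 "sum_circle_measure \<alpha> \<beta> = measure_of (sphere 0 1) (sets circle_borel) (%A. emeasure \<alpha> A + emeasure \<beta> A)"

lemma sets_sum_circle_measure [simp]: "sets (sum_circle_measure \<alpha> \<beta>) = sets circle_borel"
 unfolding sum_circle_measure_def using sets.sigma_sets_eq[of circle_borel] sets.space_closed[of circle_borel]
 by (subst sets_measure_of) auto

lemma emeasure_sum_circle_measure:
 assumes "circle_measure \<alpha>" "circle_measure \<beta>" "A \<in> sets circle_borel"
 shows "emeasure (sum_circle_measure \<alpha> \<beta>) A = emeasure \<alpha> A + emeasure \<beta> A"
proof -
 interpret a: circle_measure \<alpha> by fact
 interpret b: circle_measure \<beta> by fact
 have "countably_additive (sets circle_borel) (%A. emeasure \<alpha> A + emeasure \<beta> A)"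
  unfolding countably_additive_def
 proof (intro allI impI)
  fix A :: "nat => complex set"
  assume A: "range A \<subseteq> sets circle_borel" "disjoint_family A" "\<Union>(range A) \<in> sets circle_borel"
  have "(\<Sum>i. emeasure \<alpha> (A i) + emeasure \<beta> (A i)) = (\<Sum>i. emeasure \<alpha> (A i)) + (\<Sum>i. emeasure \<beta> (A i))"
   by (intro suminf_add[symmetric] summableI)
  also have "... = emeasure \<alpha> (\<Union>(range A)) + emeasure \<beta> (\<Union>(range A))"
   using A by (subst (1 2) suminf_emeasure) (auto simp: a.sets_circle b.sets_circle)
  finally show "(\<Sum>i. emeasure \<alpha> (A i) + emeasure \<beta> (A i)) =
    emeasure \<alpha> (\<Union>(range A)) + emeasure \<beta> (\<Union>(range A))" .
 qed
 then show ?thesis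
  using assms(3) sets.sigma_sets_eq[of circle_borel] sets.space_closed[of circle_borel]
   sets.sigma_algebra_axioms[of circle_borel]
  by (intro emeasure_measure_of[OF sum_circle_measure_def])
   (auto simp: positive_def sum_circle_measure_def)
qed

lemma circle_measure_sum:
 assumes "circle_measure \<alpha>" "circle_measure \<beta>"
 shows "circle_measure (sum_circle_measure \<alpha> \<beta>)"
proof (rule circle_measure_if)
 interpret a: circle_measure \<alpha> by fact
 interpret b: circle_measure \<beta> by fact
 have sp: "space (sum_circle_measure \<alpha> \<beta>) = sphere 0 1"
  using sets_eq_imp_space_eq[OF sets_sum_circle_measure] by simp
 have "sphere (0::complex) 1 \<in> sets circle_borel"
  using sets.top[of circle_borel] by simp
 then have "emeasure (sum_circle_measure \<alpha> \<beta>) (sphere 0 1) \<noteq> \<infinity>"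
  using emeasure_sum_circle_measure[OF assms] a.emeasure_finite b.emeasure_finite by simp
 then show "finite_measure (sum_circle_measure \<alpha> \<beta>)"
  by (intro finite_measureI) (simp add: sp)
qed simp

text \<open>Sums of measures are known only through their values on sets, as in
  \<open>entropy_decomposition\<close>. Both summands are dominated by \<kappa>, so integrability
  and the bound for dominated convergence pass from \<kappa> to them, and induction over integrable
  functions gives additivity.\<close>

lemma integral_measure_add:
 fixes g :: "complex => 'b::{banach, second_countable_topology}"
 assumes sets: "sets \<alpha> = sets \<kappa>" "sets \<beta> = sets \<kappa>"
  and add: "\<And>A. A \<in> sets \<kappa> ==> emeasure \<kappa> A = emeasure \<alpha> A + emeasure \<beta> A"
  and g: "integrable \<kappa> g"
 shows "integrable \<alpha> g \<and> integrable \<beta> g \<and> integral\<^sup>L \<kappa> g = integral\<^sup>L \<alpha> g + integral\<^sup>L \<beta> g"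
proof -
 have le: "\<alpha> \<le> \<kappa>" "\<beta> \<le> \<kappa>"
  using sets add by (subst le_measure; simp)+
 have sp: "space \<alpha> = space \<kappa>" "space \<beta> = space \<kappa>"
  using sets[THEN sets_eq_imp_space_eq] by auto
 have int: "integrable \<alpha> f \<and> integrable \<beta> f" if "integrable \<kappa> f" for f :: "complex => 'b"
 proof -
  have "(\<integral>\<^sup>+x. norm (f x) \<partial>\<alpha>) \<le> (\<integral>\<^sup>+x. norm (f x) \<partial>\<kappa>)" "(\<integral>\<^sup>+x. norm (f x) \<partial>\<beta>) \<le> (\<integral>\<^sup>+x. norm (f x) \<partial>\<kappa>)"
   using le sets by (auto intro!: nn_integral_mono_measure)
  with that show ?thesis
   using measurable_cong_sets[OF sets(1) refl, of "borel :: 'b measure"]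
    measurable_cong_sets[OF sets(2) refl, of "borel :: 'b measure"]
   unfolding integrable_iff_bounded by auto
 qed
 show ?thesis
  using g
 proof (induction rule: integrable_induct)
  case (base A c)
  then have "emeasure \<alpha> A \<noteq> \<infinity>" "emeasure \<beta> A \<noteq> \<infinity>"
   using add[of A] by (auto simp: less_top)
  moreover have "integrable \<kappa> (%x. indicator A x *\<^sub>R c)" using base by simp
  moreover have "measure \<kappa> A = measure \<alpha> A + measure \<beta> A"
   using add[of A] base calculation unfolding measure_def by (simp add: enn2real_plus less_top)
  ultimately show ?case
   using int[of "%x. indicator A x *\<^sub>R c"] base sets by (simp add: scaleR_left_distrib less_top)
 next
  case (add f g)
  then show ?case by simp
 next
  case (lim f s)
  have "(%i. integral\<^sup>L M (s i)) \<longlonglongrightarrow> integral\<^sup>L M f" if M: "M = \<kappa> \<or> M = \<alpha> \<or> M = \<beta>" for M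
  proof (rule integral_dominated_convergence[where w="%x. 2 * norm (f x)"])
   show "f \<in> borel_measurable M" "\<And>i. s i \<in> borel_measurable M" "integrable M (%x. 2 * norm (f x))"
    using lim int M by (auto intro!: borel_measurable_integrable)
   show "AE x in M. (%i. s i x) \<longlonglongrightarrow> f x" "\<And>i. AE x in M. norm (s i x) \<le> 2 * norm (f x)"
    using lim M sp by auto
  qed
  from this[of \<kappa>] this[of \<alpha>] this[of \<beta>] lim
  have "(%i. integral\<^sup>L \<alpha> (s i) + integral\<^sup>L \<beta> (s i)) \<longlonglongrightarrow> integral\<^sup>L \<kappa> f"
   "(%i. integral\<^sup>L \<alpha> (s i) + integral\<^sup>L \<beta> (s i)) \<longlonglongrightarrow> integral\<^sup>L \<alpha> f + integral\<^sup>L \<beta> f"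
   by (auto intro: tendsto_add)
  then show ?case
   using int lim LIMSEQ_unique by blast
 qed
qed

text \<open>The relation \<kappa> = \<alpha> + \<beta> is kept as a predicate because it arises in
  several ways: from \<open>sum_circle_measure\<close>, from differences, from restrictions to a set
  and from the entropy decomposition.\<close>

definition splits :: "complex measure => complex measure => complex measure => bool" where
 "splits \<kappa> \<alpha> \<beta> \<longleftrightarrow> circle_measure \<kappa> \<and> circle_measure \<alpha> \<and> circle_measure \<beta> \<and>
  (\<forall>A\<in>sets circle_borel. emeasure \<kappa> A = emeasure \<alpha> A + emeasure \<beta> A)"

lemma splits_sum: "circle_measure \<alpha> ==> circle_measure \<beta> ==> splits (sum_circle_measure \<alpha> \<beta>) \<alpha> \<beta>"
 by (simp add: splits_def circle_measure_sum emeasure_sum_circle_measure)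

lemma splits_integral:
 assumes "splits \<kappa> \<alpha> \<beta>" "norm z < 1"
 shows "herglotz_integral \<kappa> z = herglotz_integral \<alpha> z + herglotz_integral \<beta> z"
  and "poisson_integral \<kappa> z = poisson_integral \<alpha> z + poisson_integral \<beta> z"
  and "singular_inner \<kappa> z = singular_inner \<alpha> z * singular_inner \<beta> z"
proof -
 interpret k: circle_measure \<kappa> using assms by (simp add: splits_def)
 have s: "sets \<alpha> = sets \<kappa>" "sets \<beta> = sets \<kappa>"
  and a: "A \<in> sets \<kappa> ==> emeasure \<kappa> A = emeasure \<alpha> A + emeasure \<beta> A" for A
  using assms by (auto simp: splits_def circle_measure_def circle_measure_axioms_def)
 show h: "herglotz_integral \<kappa> z = herglotz_integral \<alpha> z + herglotz_integral \<beta> z"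
  unfolding herglotz_integral_def using assms
  by (intro integral_measure_add[THEN conjunct2, THEN conjunct2] s a k.integrable_herglotz)
 show "poisson_integral \<kappa> z = poisson_integral \<alpha> z + poisson_integral \<beta> z"
  unfolding poisson_integral_def using assms
  by (intro integral_measure_add[THEN conjunct2, THEN conjunct2] s a k.integrable_poisson)
 show "singular_inner \<kappa> z = singular_inner \<alpha> z * singular_inner \<beta> z"
  unfolding singular_inner_eq h by (simp add: exp_add exp_diff exp_minus field_simps)
qed

lemma splits_diff:
 assumes \<kappa>: "circle_measure \<kappa>" and \<alpha>: "circle_measure \<alpha>"
  and le: "\<And>A. A \<in> sets circle_borel ==> emeasure \<alpha> A \<le> emeasure \<kappa> A"
 shows "splits \<kappa> \<alpha> (diff_measure \<kappa> \<alpha>)"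
proof -
 interpret k: circle_measure \<kappa> by fact
 interpret a: circle_measure \<alpha> by fact
 have e: "emeasure (diff_measure \<kappa> \<alpha>) A = emeasure \<kappa> A - emeasure \<alpha> A" if "A \<in> sets circle_borel" for A
  using that le by (intro emeasure_diff_measure)
   (auto simp: k.sets_circle a.sets_circle k.finite_measure_axioms a.finite_measure_axioms)
 have top: "sphere (0::complex) 1 \<in> sets circle_borel"
  using sets.top[of circle_borel] by simp
 have sp: "space (diff_measure \<kappa> \<alpha>) = sphere 0 1"
  using sets_eq_imp_space_eq[of "diff_measure \<kappa> \<alpha>" \<kappa>] by simp
 have "circle_measure (diff_measure \<kappa> \<alpha>)"
 proof (rule circle_measure_if)
  show "finite_measure (diff_measure \<kappa> \<alpha>)"
   by (intro finite_measureI) (simp add: sp e[OF top])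
 qed (simp add: k.sets_circle)
 then show ?thesis
  using \<kappa> \<alpha> e le by (auto simp: splits_def add_diff_inverse_ennreal)
qed

lemma circle_measure_restrict:
 assumes "circle_measure \<kappa>" "E \<in> sets circle_borel"
 shows "circle_measure (density \<kappa> (indicator E))"
  and "A \<in> sets circle_borel ==> emeasure (density \<kappa> (indicator E)) A = emeasure \<kappa> (A \<inter> E)"
  and "splits \<kappa> (density \<kappa> (indicator E)) (density \<kappa> (indicator (sphere 0 1 - E)))"
proof -
 interpret circle_measure \<kappa> by fact
 have e: "emeasure (density \<kappa> (indicator E)) A = emeasure \<kappa> (A \<inter> E)"
  if "A \<in> sets circle_borel" "E \<in> sets circle_borel" for A E
  using that sets_circle
  by (subst emeasure_density) (auto simp flip: indicator_inter_arith simp: Int_commute)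
 have c: "circle_measure (density \<kappa> (indicator E))" if "E \<in> sets circle_borel" for E
 proof (rule circle_measure_if)
  show "finite_measure (density \<kappa> (indicator E))"
   using e[OF sets.top that] emeasure_finite
   by (intro finite_measureI) (auto simp: space_circle)
 qed (simp add: sets_circle)
 show "circle_measure (density \<kappa> (indicator E))"
  "A \<in> sets circle_borel ==> emeasure (density \<kappa> (indicator E)) A = emeasure \<kappa> (A \<inter> E)"
  using e c assms by auto
 have E': "sphere 0 1 - E \<in> sets circle_borel"
  using sets.compl_sets[OF assms(2)] by simp
 show "splits \<kappa> (density \<kappa> (indicator E)) (density \<kappa> (indicator (sphere 0 1 - E)))"
  unfolding splits_def
 proof (intro conjI ballI c assms E')
  fix A assume A: "A \<in> sets circle_borel"
  have "A = A \<inter> E \<union> A \<inter> (sphere 0 1 - E)"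
   using sets.sets_into_space[OF A] by auto
  moreover have "emeasure \<kappa> (A \<inter> E \<union> A \<inter> (sphere 0 1 - E)) =
    emeasure \<kappa> (A \<inter> E) + emeasure \<kappa> (A \<inter> (sphere 0 1 - E))"
   using A assms E' by (intro plus_emeasure[symmetric]) (auto simp: sets_circle)
  ultimately show "emeasure \<kappa> A =
    emeasure (density \<kappa> (indicator E)) A + emeasure (density \<kappa> (indicator (sphere 0 1 - E))) A"
   using A E' assms by (simp add: e)
 qed
qed

lemma closed_sets_circle: "closed K ==> K \<subseteq> sphere 0 1 ==> K \<in> sets circle_borel"
 by (auto simp: sets_restrict_space image_iff intro!: bexI[of _ K])

text \<open>Reduces a comparison of measures to closed sets, where continuous test functions decide.
  Inner regularity concerns Borel measures on the whole plane, hence the push-forward under the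
  inclusion of the circle.\<close>

lemma inner_regular_circle_le:
 assumes \<alpha>: "circle_measure \<alpha>" and \<beta>: "circle_measure \<beta>" and A: "A \<in> sets circle_borel"
  and le: "\<And>K. closed K ==> K \<subseteq> A ==> emeasure \<beta> K \<le> emeasure \<alpha> K"
 shows "emeasure \<beta> A \<le> emeasure \<alpha> A"
proof -
 interpret a: circle_measure \<alpha> by fact
 interpret b: circle_measure \<beta> by fact
 define \<beta>' where "\<beta>' = distr \<beta> borel (%x. x)"
 have id: "(%x. x) \<in> \<beta> \<rightarrow>\<^sub>M borel"
  by (auto intro: continuous_intros)
 have AS: "A \<subseteq> sphere 0 1"
  using sets.sets_into_space[OF A] by simp
 have e: "emeasure \<beta>' B = emeasure \<beta> (B \<inter> sphere 0 1)" if "B \<in> sets borel" for B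
  unfolding \<beta>'_def using that by (subst emeasure_distr[OF id]) auto
 have "A \<in> sets borel"
  using A by (auto simp: sets_restrict_space)
 then have "emeasure \<beta>' A = (SUP K \<in> {K. K \<subseteq> A \<and> compact K}. emeasure \<beta>' K)"
  by (intro inner_regular) (auto simp: e \<beta>'_def emeasure_distr[OF id])
 moreover have "emeasure \<beta>' A = emeasure \<beta> A"
  using AS \<open>A \<in> sets borel\<close> by (simp add: e Int_absorb2)
 moreover have "(SUP K \<in> {K. K \<subseteq> A \<and> compact K}. emeasure \<beta>' K) \<le> emeasure \<alpha> A"
 proof (rule SUP_least)
  fix K assume "K \<in> {K. K \<subseteq> A \<and> compact K}"
  then have K: "K \<subseteq> A" "compact K" by auto
  then have "emeasure \<beta>' K = emeasure \<beta> K"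
   using AS by (subst e) (auto simp: Int_absorb2 compact_imp_closed)
  also have "... \<le> emeasure \<alpha> K"
   using K by (intro le compact_imp_closed)
  also have "... \<le> emeasure \<alpha> A"
   using K A by (intro emeasure_mono) (auto simp: a.sets_circle)
  finally show "emeasure \<beta>' K \<le> emeasure \<alpha> A" .
 qed
 ultimately show ?thesis by simp
qed

text \<open>The functions max(0, 1 - n dist(x, K)) decrease to the indicator of K because K is
  closed.\<close>

lemma closed_le_if_test_functions:
 assumes \<alpha>: "circle_measure \<alpha>" and \<beta>: "circle_measure \<beta>"
  and K: "closed K" "K \<subseteq> sphere 0 1"
  and le: "\<And>p :: complex => real. continuous_on (sphere 0 1) p ==> (\<And>x. 0 \<le> p x) ==> (\<And>x. p x \<le> 1) ==>
   (\<integral>x. p x \<partial>\<beta>) \<le> (\<integral>x. p x \<partial>\<alpha>)"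
 shows "emeasure \<beta> K \<le> emeasure \<alpha> K"
proof (cases "K = {}")
 case False
 define p :: "nat => complex => real" where "p n x = max 0 (1 - real n * infdist x K)" for n x
 have c: "continuous_on (sphere 0 1) (p n)" for n
  unfolding p_def by (intro continuous_intros)
 have b: "0 \<le> p n x" "p n x \<le> 1" for n x
  by (auto simp: p_def infdist_nonneg)
 have l: "(%n. p n x) \<longlonglongrightarrow> indicator K x" for x
 proof (cases "x \<in> K")
  case False
  then have d: "infdist x K > 0"
   using K \<open>K \<noteq> {}\<close> by (intro infdist_pos_not_in_closed)
  obtain N :: nat where N: "1 / infdist x K < real N"
   using reals_Archimedean2 by blast
  have "p n x = 0" if "n \<ge> N" for n
  proof -
   have "1 < real N * infdist x K" using N d by (simp add: field_simps)
   also have "... \<le> real n * infdist x K" using that d by simp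
   finally show ?thesis by (simp add: p_def)
  qed
  then show ?thesis
   using False by (intro tendsto_eventually) (auto simp: eventually_sequentially)
 qed (simp add: p_def)
 have "(%n. \<integral>x. p n x \<partial>\<kappa>) \<longlonglongrightarrow> measure \<kappa> K" if "circle_measure \<kappa>" for \<kappa>
 proof -
  interpret circle_measure \<kappa> by fact
  have KS: "K \<in> sets \<kappa>" using K by (simp add: sets_circle closed_sets_circle)
  have "(%n. \<integral>x. p n x \<partial>\<kappa>) \<longlonglongrightarrow> (\<integral>x. indicator K x \<partial>\<kappa>)"
   by (rule integral_dominated_convergence[where w="%_. 1"]) (use b l KS c in "auto simp del: space_circle")
  then show ?thesis using KS K by (simp add: Int_absorb2)
 qed
 moreover have "(\<integral>x. p n x \<partial>\<beta>) \<le> (\<integral>x. p n x \<partial>\<alpha>)" for n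
  by (intro le c b)
 ultimately have "measure \<beta> K \<le> measure \<alpha> K"
  using \<alpha> \<beta> by (intro LIMSEQ_le[of "%n. \<integral>x. p n x \<partial>\<beta>" _ "%n. \<integral>x. p n x \<partial>\<alpha>"]) auto
 then show ?thesis
  using \<alpha> \<beta> by (simp add: circle_measure_def finite_measure.emeasure_eq_measure ennreal_leI)
qed auto

section \<open>Boundary behaviour of Poisson integrals\<close>

lemma tendsto_poisson_integral_continuous:
 fixes \<phi> :: "complex => real"
 assumes c: "continuous_on (sphere 0 1) \<phi>" and u: "norm u = 1"
  and r: "\<And>n. 0 \<le> r n" "\<And>n. r n < 1" "r \<longlonglongrightarrow> (1::real)"
 shows "(%n. \<integral>y. \<phi> y * poisson (of_real (r n) * u) y \<partial>leb) \<longlonglongrightarrow> \<phi> u"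
proof (rule LIMSEQ_I)
 fix e :: real assume e: "0 < e"
 have "bounded (\<phi> ` sphere 0 1)"
  by (intro compact_imp_bounded compact_continuous_image c) simp
 then obtain B where B: "\<forall>x\<in>sphere 0 1. norm (\<phi> x) \<le> B"
  unfolding bounded_iff by blast
 have B0: "0 \<le> B" using B u norm_ge_zero[of "\<phi> u"] by (metis dist_0_norm mem_sphere order_trans)
 obtain d where d: "d > 0" "\<And>y. norm y = 1 ==> norm (y - u) < d ==> \<bar>\<phi> y - \<phi> u\<bar> < e / 2"
  using c u e unfolding continuous_on_iff dist_norm
  by (metis dist_0_norm half_gt_zero mem_sphere real_norm_def)
 \<comment> \<open>The constant is 2B times 8: at distance at least d from u the oscillation of
   \<phi> is at most 2B, and once 1 - r < d/2 the kernel there is at most 2(1 - r)/(d/2)^2.\<close>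
 have "(%n. 16 * B * (1 - r n) / d\<^sup>2) \<longlonglongrightarrow> 16 * B * (1 - 1) / d\<^sup>2"
  using d by (intro tendsto_intros r) auto
 then have "\<forall>\<^sub>F n in sequentially. 16 * B * (1 - r n) / d\<^sup>2 < e / 2"
  by (rule order_tendstoD(2)) (use e in simp)
 moreover have "\<forall>\<^sub>F n in sequentially. 1 - d / 2 < r n"
  using d by (intro order_tendstoD(1)[OF r(3)]) auto
 ultimately have "\<forall>\<^sub>F n in sequentially.
  norm ((\<oint>y. \<phi> y * poisson (of_real (r n) * u) y) - \<phi> u) < e"
 proof eventually_elim
  case (elim n)
  let ?z = "of_real (r n) * u"
  have z: "norm ?z = r n" "norm ?z < 1" using r(1,2)[of n] u by (auto simp: norm_mult)
  have int: "integrable leb (%y. \<phi> y * poisson ?z y)"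
   using z c by (intro leb.integrable_continuous continuous_intros)
  have "(\<oint>y. \<phi> y * poisson ?z y) - \<phi> u =
    (\<oint>y. \<phi> y * poisson ?z y) - (\<oint>y. \<phi> u * poisson ?z y)"
   using z by (simp add: integral_poisson_lebesgue)
  also have "... = (\<oint>y. (\<phi> y - \<phi> u) * poisson ?z y)"
   using int z by (simp add: LINT_diff[symmetric] algebra_simps)
  also have "norm ... \<le> (\<oint>y. norm ((\<phi> y - \<phi> u) * poisson ?z y))"
   by (rule integral_norm_bound)
  also have "... \<le> (\<oint>y. e / 2 * poisson ?z y + 16 * B * (1 - r n) / d\<^sup>2)"
  proof (intro integral_mono)
   show "integrable leb (%y. norm ((\<phi> y - \<phi> u) * poisson ?z y))"
    using z c by (intro leb.integrable_continuous continuous_intros)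
   fix y assume "y \<in> space leb"
   then have n: "norm y = 1" by simp
   have p: "0 \<le> poisson ?z y" using z by simp
   have nn: "0 \<le> 16 * B * (1 - r n) / d\<^sup>2" using B0 r(2)[of n] by simp
   show "norm ((\<phi> y - \<phi> u) * poisson ?z y) \<le> e / 2 * poisson ?z y + 16 * B * (1 - r n) / d\<^sup>2"
   proof (cases "norm (y - u) < d")
    case True
    then have "norm ((\<phi> y - \<phi> u) * poisson ?z y) \<le> e / 2 * poisson ?z y"
     using mult_right_mono[OF less_imp_le[OF d(2)[OF n True]] p] p by (simp add: abs_mult)
    then show ?thesis using nn by linarith
   next
    case False
    have "u - ?z = of_real (1 - r n) * u" by (simp add: algebra_simps)
    then have "norm (u - ?z) = 1 - r n"
     using r(2)[of n] u by (simp only: norm_mult norm_of_real) simp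
    moreover have "norm (y - u) \<le> norm (y - ?z) + norm (u - ?z)"
     using norm_triangle_ineq4[of "y - ?z" "u - ?z"] by simp
    ultimately have "d / 2 \<le> norm (y - ?z)"
     using False elim by linarith
    then have "poisson ?z y \<le> 2 * (1 - norm ?z) / (d / 2)\<^sup>2"
     using d z by (intro poisson_le) auto
    also have "... = 8 * (1 - r n) / d\<^sup>2"
     by (simp only: z) (simp add: power2_eq_square)
    finally have "poisson ?z y \<le> 8 * (1 - r n) / d\<^sup>2" .
    moreover have "\<bar>\<phi> y - \<phi> u\<bar> \<le> 2 * B"
     using B n u by (smt (verit) dist_0_norm mem_sphere real_norm_def)
    ultimately have "\<bar>\<phi> y - \<phi> u\<bar> * poisson ?z y \<le> 2 * B * (8 * (1 - r n) / d\<^sup>2)"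
     using p B0 by (intro mult_mono) auto
    moreover have "2 * B * (8 * (1 - r n) / d\<^sup>2) = 16 * B * (1 - r n) / d\<^sup>2" by simp
    moreover have "0 \<le> e / 2 * poisson ?z y" using e p by simp
    moreover have "norm ((\<phi> y - \<phi> u) * poisson ?z y) = \<bar>\<phi> y - \<phi> u\<bar> * poisson ?z y"
     using p by (simp add: abs_mult)
    ultimately show ?thesis by linarith
   qed
  qed (use z in auto)
  also have "... = e / 2 + 16 * B * (1 - r n) / d\<^sup>2"
   using z by (simp add: integral_poisson_lebesgue)
  finally show ?case using elim by linarith
 qed
 then show "\<exists>no. \<forall>n\<ge>no. norm ((\<oint>y. \<phi> y * poisson (of_real (r n) * u) y) - \<phi> u) < e"
  by (simp add: eventually_sequentially)
qed

text \<open>The Poisson integral of the measure, tested against \<phi>, becomes the Poisson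
  extension of \<phi> integrated against the measure. The kernel is bounded for fixed r, so Fubini
  applies, and \<open>poisson_sym\<close> exchanges the variables.\<close>

lemma (in circle_measure) Fubini_poisson:
 fixes \<phi> :: "complex => real"
 assumes c: "continuous_on (sphere 0 1) \<phi>" and r: "0 \<le> r" "r < 1"
 shows "integrable leb (%y. \<phi> y * poisson_integral \<kappa> (of_real r * y))"
  and "(\<oint>y. \<phi> y * poisson_integral \<kappa> (of_real r * y)) =
  (\<integral>u. \<integral>y. \<phi> y * poisson (of_real r * u) y \<partial>leb \<partial>\<kappa>)"
proof -
 interpret pair_sigma_finite leb \<kappa> ..
 interpret p: finite_measure "leb \<Otimes>\<^sub>M \<kappa>"
  by (intro finite_measure_pair_measure leb.finite_measure_axioms finite_measure_axioms)
 obtain B where B: "\<forall>x\<in>sphere 0 1. norm (\<phi> x) \<le> B"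
 proof -
  have "bounded (\<phi> ` sphere 0 1)"
   by (intro compact_imp_bounded compact_continuous_image c) simp
  then show ?thesis using that unfolding bounded_iff by blast
 qed
 have idm[measurable]: "(%x. x) \<in> \<kappa> \<rightarrow>\<^sub>M borel" "(%x. x) \<in> leb \<rightarrow>\<^sub>M borel"
  by (auto intro: continuous_intros leb.borel_measurable_continuous)
 have [measurable]: "\<phi> \<in> borel_measurable leb"
  using c by (rule leb.borel_measurable_continuous)
 have m1: "(%x. fst x) \<in> leb \<Otimes>\<^sub>M \<kappa> \<rightarrow>\<^sub>M (borel :: complex measure)"
  by (rule measurable_compose[OF measurable_fst idm(2)])
 have m2: "(%x. snd x) \<in> leb \<Otimes>\<^sub>M \<kappa> \<rightarrow>\<^sub>M (borel :: complex measure)"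
  by (rule measurable_compose[OF measurable_snd idm(1)])
 have meas: "(%x. \<phi> (fst x) * poisson (of_real r * fst x) (snd x)) \<in> borel_measurable (leb \<Otimes>\<^sub>M \<kappa>)"
  unfolding poisson_def using m1 m2 by measurable
 have int: "integrable (leb \<Otimes>\<^sub>M \<kappa>) (%(y, u). \<phi> y * poisson (of_real r * y) u)"
 proof (rule p.integrable_const_bound[where B="B * (2 * (1 - r) / (1 - r)\<^sup>2)"])
  show "AE x in leb \<Otimes>\<^sub>M \<kappa>. norm (case x of (y, u) => \<phi> y * poisson (of_real r * y) u)
    \<le> B * (2 * (1 - r) / (1 - r)\<^sup>2)"
  proof (rule AE_I2)
   fix x assume "x \<in> space (leb \<Otimes>\<^sub>M \<kappa>)"
   then obtain y u where x: "x = (y, u)" and n: "norm y = 1" "norm u = 1"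
    by (auto simp: space_pair_measure)
   have z: "norm (of_real r * y) = r" using n r by (simp add: norm_mult)
   have "poisson (of_real r * y) u \<le> 2 * (1 - norm (of_real r * y)) / (1 - r)\<^sup>2"
    using r z circle_minus_disc_ge[OF n(2), of "of_real r * y"] by (intro poisson_le) auto
   then have "poisson (of_real r * y) u \<le> 2 * (1 - r) / (1 - r)\<^sup>2"
    by (simp only: z)
   moreover have "0 \<le> poisson (of_real r * y) u" using z r by simp
   moreover have "\<bar>\<phi> y\<bar> \<le> B" using B n by auto
   ultimately show "norm (case x of (y, u) => \<phi> y * poisson (of_real r * y) u)
    \<le> B * (2 * (1 - r) / (1 - r)\<^sup>2)"
    using mult_mono[of "\<bar>\<phi> y\<bar>" B "poisson (of_real r * y) u" "2 * (1 - r) / (1 - r)\<^sup>2"]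
    unfolding x by (simp only: prod.case norm_mult real_norm_def abs_of_nonneg) (auto simp: abs_mult)
  qed
 qed (use meas in "simp add: split_beta")
 have pe: "\<phi> y * poisson_integral \<kappa> (of_real r * y) = (\<integral>u. \<phi> y * poisson (of_real r * y) u \<partial>\<kappa>)" for y
  by (simp add: poisson_integral_def)
 show "integrable leb (%y. \<phi> y * poisson_integral \<kappa> (of_real r * y))"
  unfolding pe using integrable_fst[OF int] by simp
 have "(\<oint>y. \<phi> y * poisson_integral \<kappa> (of_real r * y)) =
  (\<integral>u. \<integral>y. \<phi> y * poisson (of_real r * y) u \<partial>leb \<partial>\<kappa>)"
  unfolding pe by (rule Fubini_integral[OF int, symmetric])
 also have "... = (\<integral>u. \<integral>y. \<phi> y * poisson (of_real r * u) y \<partial>leb \<partial>\<kappa>)"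
  by (intro LINT_cong refl) (auto simp: poisson_sym)
 finally show "(\<oint>y. \<phi> y * poisson_integral \<kappa> (of_real r * y)) =
  (\<integral>u. \<integral>y. \<phi> y * poisson (of_real r * u) y \<partial>leb \<partial>\<kappa>)" .
qed

lemma integral_continuous_poisson_bounds:
 fixes p :: "complex => real"
 assumes c: "continuous_on (sphere 0 1) p" and b: "\<And>x. norm x = 1 ==> \<bar>p x\<bar> \<le> B" and z: "norm z < 1"
 shows "\<bar>\<integral>y. p y * poisson z y \<partial>leb\<bar> \<le> B"
proof -
 have "norm (\<oint>y. p y * poisson z y) \<le> (\<oint>y. norm (p y * poisson z y))"
  by (rule integral_norm_bound)
 also have "... \<le> (\<oint>y. B * poisson z y)"
  using z c b by (intro integral_mono leb.integrable_continuous continuous_intros)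
   (auto simp: abs_mult intro!: mult_right_mono)
 also have "... = B" using z by (simp add: integral_poisson_lebesgue)
 finally show ?thesis by simp
qed

text \<open>Weak convergence of the Poisson integrals on growing circles to the measure: after
  Fubini the inner integrals tend to p pointwise and are bounded by sup |p|.\<close>

lemma (in circle_measure) tendsto_integral_poisson_integral:
 fixes p :: "complex => real"
 assumes c: "continuous_on (sphere 0 1) p"
  and r: "\<And>n. 0 \<le> r n" "\<And>n. r n < 1" "r \<longlonglongrightarrow> (1::real)"
 shows "(%n. \<integral>y. p y * poisson_integral \<kappa> (of_real (r n) * y) \<partial>leb) \<longlonglongrightarrow> (\<integral>u. p u \<partial>\<kappa>)"
proof -
 obtain B where B: "\<forall>x\<in>sphere 0 1. norm (p x) \<le> B"
 proof -
  have "bounded (p ` sphere 0 1)"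
   by (intro compact_imp_bounded compact_continuous_image c) simp
  then show ?thesis using that unfolding bounded_iff by blast
 qed
 have [measurable_cong]: "sets \<kappa> = sets circle_borel" by (rule sets_circle)
 interpret pair_sigma_finite \<kappa> leb ..
 have idm: "(%x. x) \<in> \<kappa> \<rightarrow>\<^sub>M borel" "(%x. x) \<in> leb \<rightarrow>\<^sub>M borel"
  by (auto intro: continuous_intros leb.borel_measurable_continuous)
 have [measurable]: "p \<in> borel_measurable leb"
  using c by (rule leb.borel_measurable_continuous)
 have m1: "(%x. fst x) \<in> \<kappa> \<Otimes>\<^sub>M leb \<rightarrow>\<^sub>M (borel :: complex measure)"
  by (rule measurable_compose[OF measurable_fst idm(1)])
 have m2: "(%x. snd x) \<in> \<kappa> \<Otimes>\<^sub>M leb \<rightarrow>\<^sub>M (borel :: complex measure)"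
  by (rule measurable_compose[OF measurable_snd idm(2)])
 have meas: "(%x. p (snd x) * poisson (of_real r * fst x) (snd x)) \<in> borel_measurable (\<kappa> \<Otimes>\<^sub>M leb)" for r
  unfolding poisson_def using m1 m2 by measurable
 have "(%n. \<integral>u. \<integral>y. p y * poisson (of_real (r n) * u) y \<partial>leb \<partial>\<kappa>) \<longlonglongrightarrow> (\<integral>u. p u \<partial>\<kappa>)"
 proof (rule integral_dominated_convergence[where w="%_. B"])
  show "p \<in> borel_measurable \<kappa>" using c by auto
  show "(%u. \<integral>y. p y * poisson (of_real (r i) * u) y \<partial>leb) \<in> borel_measurable \<kappa>" for i
   using leb.borel_measurable_lebesgue_integral[of "%u y. p y * poisson (of_real (r i) * u) y" \<kappa>]
    meas[of "r i"] by (simp add: split_beta)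
  show "AE x in \<kappa>. (%i. \<integral>y. p y * poisson (of_real (r i) * x) y \<partial>leb) \<longlonglongrightarrow> p x"
   using r by (intro AE_I2 tendsto_poisson_integral_continuous c) auto
  show "AE x in \<kappa>. norm (\<oint>y. p y * poisson (of_real (r i) * x) y) \<le> B" for i
  proof (rule AE_I2)
   fix x assume "x \<in> space \<kappa>"
   then have "norm (of_real (r i) * x) < 1" using r by (simp add: norm_mult)
   then show "norm (\<oint>y. p y * poisson (of_real (r i) * x) y) \<le> B"
    using B unfolding real_norm_def by (intro integral_continuous_poisson_bounds c) auto
  qed
 qed auto
 then show ?thesis
  using Fubini_poisson(2)[OF c] r by simp
qed

section \<open>Majorants\<close>

locale weight =
 fixes w :: "real => real" and c :: real
 assumes majorant: "majorant w" and c_pos: "0 < c"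
  and log_square: "\<And>t. 0 < t ==> t < 1 ==>
   inverse c * ln (1 / w (t\<^sup>2)) \<le> ln (1 / w t) \<and> ln (1 / w t) \<le> c * ln (1 / w (t\<^sup>2))"
begin

definition lam :: "real => real" where "lam t = ln (1 / w t)"

lemma w_cont: "continuous_on {0..1} w" and w_nonneg: "0 \<le> t ==> t \<le> 1 ==> 0 \<le> w t"
 and w_0 [simp]: "w 0 = 0"
 using majorant by (auto simp: majorant_def)

lemma w_mono: "0 \<le> s ==> s \<le> t ==> t \<le> 1 ==> w s \<le> w t"
 using majorant by (auto simp: majorant_def mono_on_def)

text \<open>Subadditivity is iterated over steps of length t. With n the integer part of l/t, the
  value at l is at most n + 1 times the value at t, and n + 1 <= 2l/t since l/t >= 1.\<close>

lemma w_powr_subadditive: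
 obtains L where "0 < L"
  "\<And>t l. 0 < t ==> t \<le> l ==> l \<le> 1 ==> w l powr L \<le> 2 * l / t * w t powr L"
proof -
 obtain L where L: "0 < L" "modulus_of_continuity (%t. w t powr L)"
  using majorant by (auto simp: majorant_def)
 have sub: "w (s + t) powr L \<le> w s powr L + w t powr L" if "0 \<le> s" "0 \<le> t" "s + t \<le> 1" for s t
  using L that by (auto simp: modulus_of_continuity_def)
 have *: "w (real n * t + s) powr L \<le> (real n + 1) * w t powr L"
  if "0 < t" "t \<le> 1" "0 \<le> s" "s \<le> t" "real n * t + s \<le> 1" for n t s
  using that
 proof (induction n)
  case 0
  then show ?case using L by (auto intro!: powr_mono2 w_mono w_nonneg)
 next
  case (Suc n)
  have "w (real (Suc n) * t + s) powr L = w ((real n * t + s) + t) powr L"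
   by (simp add: algebra_simps)
  also have "... \<le> w (real n * t + s) powr L + w t powr L"
   using Suc.prems by (intro sub) (auto simp: algebra_simps)
  also have "... \<le> (real n + 1) * w t powr L + w t powr L"
   using Suc.prems by (intro add_right_mono Suc.IH) (auto simp: algebra_simps)
  finally show ?case by (simp add: algebra_simps)
 qed
 have "w l powr L \<le> 2 * l / t * w t powr L" if "0 < t" "t \<le> l" "l \<le> 1" for t l
 proof -
  define n where "n = nat \<lfloor>l / t\<rfloor>"
  have "1 \<le> l / t" using that by simp
  then have n: "real n \<le> l / t" "l / t < real n + 1"
   unfolding n_def by linarith+
  then have "real n * t \<le> l" "l < real n * t + t"
   using that by (auto simp: field_simps)
  then have "w (real n * t + (l - real n * t)) powr L \<le> (real n + 1) * w t powr L"
   using that by (intro *) auto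
  also have "... \<le> 2 * l / t * w t powr L"
   using n \<open>1 \<le> l / t\<close> by (intro mult_right_mono) auto
  finally show ?thesis by simp
 qed
 with L that show thesis by blast
qed

text \<open>A zero at t > 0 would force w(1) = 0 by the preceding comparison, hence w = 0 by
  monotonicity, which the definition of a majorant excludes.\<close>

lemma w_pos: "0 < w t" if t: "0 < t" "t \<le> 1" for t
proof (rule ccontr)
 assume "\<not> 0 < w t"
 then have t0: "w t = 0" using w_nonneg[of t] t by simp
 obtain L where L: "0 < L"
  "\<And>t l. 0 < t ==> t \<le> l ==> l \<le> 1 ==> w l powr L \<le> 2 * l / t * w t powr L"
  by (rule w_powr_subadditive) blast
 have "w 1 powr L \<le> 0"
  using L(2)[of t 1] t t0 by simp
 then have "w 1 = 0"
  using powr_ge_zero[of "w 1" L] by (metis antisym powr_eq_0_iff)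
 then have "w s = 0" if "0 \<le> s" "s \<le> 1" for s
  using w_mono[of s 1] w_nonneg[of s] that by simp
 then show False using majorant by (auto simp: majorant_def)
qed

lemma lam_square: "0 < t ==> t < 1 ==> lam (t\<^sup>2) \<le> c * lam t"
 using log_square[of t] c_pos by (simp add: lam_def field_simps)

lemma w_tendsto_0: "(w \<longlongrightarrow> 0) (at_right 0)"
proof -
 have "(w \<longlongrightarrow> w 0) (at 0 within {0..1})"
  using w_cont unfolding continuous_on_def by (rule bspec) simp
 then show ?thesis by (simp add: at_within_Icc_at_right)
qed

lemma w_small:
 assumes "0 < e"
 obtains d where "0 < d" "d < 1" "\<And>t. 0 \<le> t ==> t \<le> d ==> w t < e"
proof -
 have "\<forall>\<^sub>F t in at_right 0. w t < e"
  using order_tendstoD(2)[OF w_tendsto_0 assms] .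
 then obtain b where b: "0 < b" "\<And>t. 0 < t ==> t < b ==> w t < e"
  unfolding eventually_at_right[OF zero_less_one] by blast
 define d where "d = min (b/2) (1/2)"
 have d: "0 < d" "d < 1" "d < b" using b by (auto simp: d_def)
 have "w t < e" if "0 \<le> t" "t \<le> d" for t
  using that b(2)[of t] d assms by (cases "t = 0") auto
 with d that show thesis by blast
qed

text \<open>If \<open>lam t\<close> were at most 0, the hypothesis on squares would keep
  \<open>lam\<close> at most 0 along t^(2^n), so that w >= 1 at points tending to 0. Hence
  \<open>lam\<close> is non-negative although w is not normalized.\<close>

lemma w_less_1: assumes t: "0 < t" "t < 1" shows "w t < 1"
proof (rule ccontr)
 assume *: "\<not> w t < 1"
 have "lam (t ^ (2 ^ n)) \<le> 0" for n
 proof (induction n)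
  case 0
  then show ?case using * by (simp add: lam_def ln_div)
 next
  case (Suc n)
  have "t ^ 2 ^ n < 1" using t by (simp add: power_less_one_iff)
  then have "lam ((t ^ 2 ^ n)\<^sup>2) \<le> c * lam (t ^ 2 ^ n)"
   using t by (intro lam_square) auto
  also have "... \<le> 0" using Suc c_pos by (simp add: mult_nonneg_nonpos)
  finally show ?case by (simp add: power_mult[symmetric] mult.commute)
 qed
 then have ge: "1 \<le> w (t ^ (2 ^ n))" for n
 proof -
  have p: "0 < t ^ (2 ^ n)" "t ^ (2 ^ n) \<le> 1" using t by (auto simp: power_le_one)
  from \<open>lam (t ^ (2 ^ n)) \<le> 0\<close> have "ln (w (t ^ (2 ^ n))) \<ge> 0"
   using w_pos[OF p] by (simp add: lam_def ln_div)
  then show ?thesis using w_pos[OF p] by simp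
 qed
 obtain d where d: "0 < d" "d < 1" "\<And>t. 0 \<le> t ==> t \<le> d ==> w t < 1"
  by (rule w_small[of 1]) auto
 have "(%n. t ^ n) \<longlonglongrightarrow> 0" using t by (intro LIMSEQ_power_zero) auto
 then have "\<forall>\<^sub>F n in sequentially. t ^ n < d"
  by (rule order_tendstoD(2)) (rule d)
 then obtain N where "\<And>n. n \<ge> N ==> t ^ n < d"
  by (auto simp: eventually_sequentially)
 moreover have "N \<le> 2 ^ N" by (simp add: less_imp_le)
 ultimately have "t ^ 2 ^ N < d" by blast
 then have "w (t ^ 2 ^ N) < 1" using t by (intro d) auto
 with ge[of N] show False by simp
qed

lemma w_le_1: assumes t: "0 \<le> t" "t \<le> 1" shows "w t \<le> 1"
proof -
 have "w 1 \<le> 1"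
 proof (rule tendsto_upperbound)
  have "(w \<longlongrightarrow> w 1) (at 1 within {0..1})"
   using w_cont by (auto simp: continuous_on_def)
  then show "(w \<longlongrightarrow> w 1) (at_left 1)" by (simp add: at_within_Icc_at_left)
  show "\<forall>\<^sub>F t in at_left 1. w t \<le> 1"
   using w_less_1 by (intro eventually_at_leftI[of 0]) (auto intro: less_imp_le)
 qed simp
 then show ?thesis using w_mono[of t 1] t by simp
qed

lemma lam_nonneg: "0 \<le> t ==> t \<le> 1 ==> 0 \<le> lam t"
 using w_le_1[of t] w_pos[of t] by (cases "t = 0") (auto simp: lam_def ln_div)

lemma w_eq_exp: "0 < t ==> t \<le> 1 ==> w t = exp (- lam t)"
 using w_pos[of t] by (simp add: lam_def ln_div)

lemma lam_antimono: "0 < s ==> s \<le> t ==> t \<le> 1 ==> lam t \<le> lam s"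
 using w_mono[of s t] w_pos[of s] w_pos[of t] by (simp add: lam_def ln_div)

lemma lam_power4: assumes t: "0 < t" "t < 1" shows "lam (t ^ 4) \<le> c\<^sup>2 * lam t"
proof -
 have "lam (t ^ 4) = lam ((t\<^sup>2)\<^sup>2)" by simp
 also have "... \<le> c * lam (t\<^sup>2)" using t by (intro lam_square) (auto simp: power_less_one_iff)
 also have "... \<le> c * (c * lam t)" using t c_pos by (intro mult_left_mono lam_square) auto
 finally show ?thesis by (simp add: power2_eq_square)
qed

text \<open>The logarithm of the subadditivity estimate, with D = 1/L: \<open>lam\<close> grows at
  most logarithmically as t decreases. This bounds its change over a dyadic step, its singularity at
  the ends of an arc and its size against powers of t.\<close>

lemma lam_compare:
 obtains D where "0 < D" "\<And>t l. 0 < t ==> t \<le> l ==> l \<le> 1 ==> lam t \<le> lam l + D * ln (2 * l / t)"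
proof -
 obtain L where L: "0 < L"
  "\<And>t l. 0 < t ==> t \<le> l ==> l \<le> 1 ==> w l powr L \<le> 2 * l / t * w t powr L"
  by (rule w_powr_subadditive) blast
 have "lam t \<le> lam l + 1 / L * ln (2 * l / t)" if t: "0 < t" "t \<le> l" "l \<le> 1" for t l
 proof -
  have p: "0 < w t" "0 < w l" using t by (auto intro!: w_pos)
  have "ln (w l powr L) \<le> ln (2 * l / t * w t powr L)"
   using L(2)[OF t] p t by (subst ln_le_cancel_iff) auto
  then have "L * ln (w l) \<le> ln (2 * l / t) + L * ln (w t)"
   using p t by (subst (asm) ln_mult) (auto simp: ln_powr)
  then have "ln (w l) \<le> 1 / L * ln (2 * l / t) + ln (w t)"
   using L by (simp add: field_simps)
  then show ?thesis using p by (simp add: lam_def ln_div)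
 qed
 with L show thesis using that[of "1 / L"] by simp
qed

lemma lam_at_top:
 obtains d where "0 < d" "d < 1" "\<And>t. 0 < t ==> t \<le> d ==> M \<le> lam t"
proof -
 obtain d where d: "0 < d" "d < 1" "\<And>t. 0 \<le> t ==> t \<le> d ==> w t < exp (- M)"
  by (rule w_small[of "exp (- M)"]) auto
 have "M \<le> lam t" if "0 < t" "t \<le> d" for t
 proof -
  have "exp (- lam t) < exp (- M)" using d(2) d(3)[of t] that w_eq_exp[of t] by (simp del: exp_less_cancel_iff)
  then show ?thesis by simp
 qed
 with d that show thesis by blast
qed

lemma w_disc: "norm z < 1 ==> 0 < w (1 - norm z)" "norm z < 1 ==> w (1 - norm z) \<le> 1"
 by (auto intro!: w_pos w_le_1)

section \<open>Growth spaces\<close>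

lemma G_space_iff:
 "g \<in> G_space w \<longleftrightarrow> g holomorphic_on ball 0 1 \<and>
  (\<forall>e>0. \<exists>R<1. \<forall>z. R < norm z --> norm z < 1 --> w (1 - norm z) * norm (g z) < e)"
proof -
 have *: "norm (of_real (w (1 - norm z)) * g z) = w (1 - norm z) * norm (g z)" if "norm z < 1" for z
  using w_disc[OF that] by (simp add: norm_mult)
 have "((%z. of_real (w (1 - norm z)) * g z) \<longlongrightarrow> 0) (filtercomap norm (at_left 1)) \<longleftrightarrow>
  (\<forall>e>0. \<exists>R<1. \<forall>z. R < norm z --> norm z < 1 --> norm (of_real (w (1 - norm z)) * g z) < e)"
  unfolding tendsto_iff dist_norm eventually_filtercomap
 proof (intro all_cong1 imp_cong refl)
  fix e :: real
  show "(\<exists>Q. eventually Q (at_left 1) \<and> (\<forall>z. Q (norm z) --> norm (of_real (w (1 - norm z)) * g z - 0) < e)) \<longleftrightarrow>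
   (\<exists>R<1. \<forall>z. R < norm z --> norm z < 1 --> norm (of_real (w (1 - norm z)) * g z) < e)" (is "?l \<longleftrightarrow> ?r")
  proof
   assume ?l
   then obtain Q where Q: "eventually Q (at_left 1)" "\<And>z. Q (norm z) ==> norm (of_real (w (1 - norm z)) * g z) < e"
    by auto
   obtain b where "b < 1" "\<And>y. b < y ==> y < 1 ==> Q y"
    using Q(1) unfolding eventually_at_left[OF zero_less_one] by blast
   then show ?r using Q(2) by blast
  next
   assume ?r
   then obtain R where "R < 1" "\<And>z. R < norm z ==> norm z < 1 ==> norm (of_real (w (1 - norm z)) * g z) < e"
    by blast
   then show ?l
    by (intro exI[of _ "%y. R < y \<and> y < 1"]) (auto intro!: eventually_at_leftI[of R])
  qed
 qed
 then show ?thesis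
  unfolding G_space_def using * by simp
qed

lemma G_space_holomorphic: "g \<in> G_space w ==> g holomorphic_on ball 0 1"
 by (simp add: G_space_def)

lemma G_spaceD:
 "g \<in> G_space w ==> 0 < e ==> \<exists>R<1. \<forall>z. R < norm z --> norm z < 1 --> w (1 - norm z) * norm (g z) < e"
 by (simp add: G_space_iff)

lemma G_space_bounded:
 assumes "g \<in> G_space w"
 obtains C where "0 < C" "\<And>z. norm z < 1 ==> w (1 - norm z) * norm (g z) \<le> C"
proof -
 obtain R where R: "R < 1" "\<And>z. R < norm z ==> norm z < 1 ==> w (1 - norm z) * norm (g z) < 1"
  using G_spaceD[OF assms zero_less_one] by auto
 have "continuous_on (cball 0 R) g"
  using R G_space_holomorphic[OF assms]
  by (auto intro!: holomorphic_on_imp_continuous_on elim: holomorphic_on_subset)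
 then have "bounded (g ` cball 0 R)"
  by (intro compact_imp_bounded compact_continuous_image) auto
 then obtain B where B: "0 < B" "\<And>z. z \<in> cball 0 R ==> norm (g z) \<le> B"
  unfolding bounded_pos by blast
 have "w (1 - norm z) * norm (g z) \<le> max 1 B" if "norm z < 1" for z
 proof (cases "R < norm z")
  case False
  then have "w (1 - norm z) * norm (g z) \<le> 1 * B"
   using w_disc[OF that] B by (intro mult_mono) auto
  then show ?thesis by simp
 qed (use R(2)[of z] that in auto)
 then show thesis using that[of "max 1 B"] by simp
qed

lemma G_norm_bdd_above:
 assumes "g \<in> G_space w"
 shows "bdd_above ((%z. w (1 - norm z) * norm (g z)) ` ball 0 1)"
proof -
 obtain C where "\<And>z. norm z < 1 ==> w (1 - norm z) * norm (g z) \<le> C"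
  by (rule G_space_bounded[OF assms]) blast
 then show ?thesis by (intro bdd_aboveI2[where M=C]) auto
qed

lemma G_norm_ge:
 assumes "g \<in> G_space w" "norm z < 1"
 shows "w (1 - norm z) * norm (g z) \<le> G_norm w g"
 unfolding G_norm_def using assms
 by (intro cSUP_upper[of z "ball 0 1" "%z. w (1 - norm z) * norm (g z)"] G_norm_bdd_above) auto

lemma G_norm_le:
 assumes "\<And>z. norm z < 1 ==> w (1 - norm z) * norm (g z) \<le> e"
 shows "G_norm w g \<le> e"
 unfolding G_norm_def using assms
 by (intro cSUP_least[of "ball 0 1" "%z. w (1 - norm z) * norm (g z)"]) auto

lemma G_norm_nonneg:
 assumes "g \<in> G_space w"
 shows "0 \<le> G_norm w g"
proof -
 have "0 \<le> w (1 - norm (0::complex)) * norm (g 0)"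
  using w_disc[of 0] by simp
 also have "... \<le> G_norm w g"
  by (rule G_norm_ge[OF assms]) simp
 finally show ?thesis .
qed

lemma G_space_bounded_mult:
 assumes g: "g \<in> G_space w" and b: "b holomorphic_on ball 0 1" "\<And>z. norm z < 1 ==> norm (b z) \<le> B"
 shows "(%z. b z * g z) \<in> G_space w"
 unfolding G_space_iff
proof (intro conjI allI impI)
 fix e :: real assume e: "0 < e"
 have B0: "0 \<le> B" using order_trans[OF norm_ge_zero b(2)[of 0]] by simp
 define d where "d = e / (B + 1)"
 have "0 < d" using e B0 by (simp add: d_def)
 from G_spaceD[OF g this]
 obtain R where R: "R < 1" "\<And>z. R < norm z ==> norm z < 1 ==> w (1 - norm z) * norm (g z) < d"
  by auto
 have *: "w (1 - norm z) * norm (b z * g z) < e" if "R < norm z" "norm z < 1" for z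
 proof -
  have "w (1 - norm z) * norm (b z * g z) = norm (b z) * (w (1 - norm z) * norm (g z))"
   by (simp add: norm_mult)
  also have "... \<le> B * (w (1 - norm z) * norm (g z))"
   using b(2)[of z] that w_disc[of z] by (intro mult_right_mono) auto
  also have "... \<le> B * d"
   using R(2)[OF that] B0 by (intro mult_left_mono) auto
  also have "... < e"
   using B0 e by (simp add: d_def field_simps)
  finally show ?thesis .
 qed
 show "\<exists>R<1. \<forall>z. R < norm z --> norm z < 1 --> w (1 - norm z) * norm (b z * g z) < e"
  by (intro exI[of _ R] conjI allI impI R(1) *)
qed (rule holomorphic_on_mult[OF b(1) G_space_holomorphic[OF g]])

lemma G_space_1: "(%z. 1) \<in> G_space w"
 unfolding G_space_iff
proof (intro conjI allI impI)
 fix e :: real assume e: "0 < e"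
 obtain d where d: "0 < d" "d < 1" "\<And>t. 0 \<le> t ==> t \<le> d ==> w t < e"
  by (rule w_small[OF e]) blast
 show "\<exists>R<1. \<forall>z::complex. R < norm z --> norm z < 1 --> w (1 - norm z) * norm (1::complex) < e"
  by (intro exI[of _ "1 - d"]) (use d in auto)
qed simp

lemma G_space_if_bounded:
 "b holomorphic_on ball 0 1 ==> (\<And>z. norm z < 1 ==> norm (b z) \<le> B) ==> b \<in> G_space w"
 using G_space_bounded_mult[OF G_space_1, of b B] by simp

lemma G_space_add: "f \<in> G_space w ==> g \<in> G_space w ==> (%z. f z + g z) \<in> G_space w"
 unfolding G_space_def by (auto intro!: holomorphic_intros simp: distrib_left intro: tendsto_add_zero)

lemma G_space_cmult: "g \<in> G_space w ==> (%z. k * g z) \<in> G_space w"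
 by (rule G_space_bounded_mult[of g "%_. k" "norm k"]) simp_all

lemma G_space_diff: "f \<in> G_space w ==> g \<in> G_space w ==> (%z. f z - g z) \<in> G_space w"
 using G_space_add[of f "%z. -1 * g z"] G_space_cmult[of g "-1"] by simp

lemma G_space_closed_subspace: "G_closed_subspace w (G_space w)"
 unfolding G_closed_subspace_def
 using G_space_add G_space_cmult G_space_cmult[OF G_space_1, of 0] by auto

lemma G_space_shift: "shift_invariant (G_space w)"
 unfolding shift_invariant_def
 by (intro ballI G_space_bounded_mult[where B=1]) (auto intro: less_imp_le)

lemma G_closed_subspaceD:
 assumes "G_closed_subspace w V"
 shows "V \<subseteq> G_space w" and "(%z. 0) \<in> V"
  and "\<And>g h. g \<in> V ==> h \<in> V ==> (%z. g z + h z) \<in> V"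
  and "\<And>k g. g \<in> V ==> (%z. k * g z) \<in> V"
  and "\<And>u g. (\<And>n. u n \<in> V) ==> g \<in> G_space w ==>
   (%n::nat. G_norm w (%z. u n z - g z)) \<longlonglongrightarrow> 0 ==> g \<in> V"
proof -
 note V = assms[unfolded G_closed_subspace_def]
 show "V \<subseteq> G_space w" using V by (rule conjunct1)
 show "(%z. 0) \<in> V" using V by (elim conjE)
 show "\<And>g h. g \<in> V ==> h \<in> V ==> (%z. g z + h z) \<in> V" using V by simp
 show "\<And>k g. g \<in> V ==> (%z. k * g z) \<in> V" using V by simp
 have V5: "\<forall>u. \<forall>g\<in>G_space w. (\<forall>n. u n \<in> V) \<and>
   (%n::nat. G_norm w (%z. u n z - g z)) \<longlonglongrightarrow> 0 --> g \<in> V"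
  using V by (elim conjE)
 show "g \<in> V" if "\<And>n. u n \<in> V" "g \<in> G_space w"
   "(%n::nat. G_norm w (%z. u n z - g z)) \<longlonglongrightarrow> 0" for u g
  by (rule V5[rule_format, OF that(2), of u]) (use that in simp)
qed

lemma G_generated_closed: 
 assumes "g \<in> G_space w"
 shows "G_closed_subspace w (G_generated w g)" "shift_invariant (G_generated w g)" "g \<in> G_generated w g"
proof -
 have ne: "G_space w \<in> {V. G_closed_subspace w V \<and> shift_invariant V \<and> g \<in> V}"
  using assms G_space_closed_subspace G_space_shift by simp
 show "shift_invariant (G_generated w g)" "g \<in> G_generated w g"
  by (auto simp: G_generated_def shift_invariant_def)
 show "G_closed_subspace w (G_generated w g)"
  unfolding G_closed_subspace_def
 proof (intro conjI ballI allI impI)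
  show "G_generated w g \<subseteq> G_space w"
   unfolding G_generated_def using ne by (rule Inter_lower)
  show "(%z. 0) \<in> G_generated w g"
   unfolding G_generated_def using G_closed_subspaceD(2) by simp
  show "(%z. f z + h z) \<in> G_generated w g" if "f \<in> G_generated w g" "h \<in> G_generated w g" for f h
   using that G_closed_subspaceD(3) unfolding G_generated_def by simp
  show "(%z. k * h z) \<in> G_generated w g" if "h \<in> G_generated w g" for h k
   using that G_closed_subspaceD(4) unfolding G_generated_def by simp
  show "h \<in> G_generated w g"
   if h: "h \<in> G_space w" and u: "(\<forall>n. u n \<in> G_generated w g) \<and> (%n::nat. G_norm w (%z. u n z - h z)) \<longlonglongrightarrow> 0"
   for u h
   unfolding G_generated_def
  proof (rule InterI)
   fix V assume V: "V \<in> {V. G_closed_subspace w V \<and> shift_invariant V \<and> g \<in> V}"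
   then have "u n \<in> V" for n
    using u unfolding G_generated_def by blast
   then show "h \<in> V"
    using G_closed_subspaceD(5)[of V u h] V h u by simp
  qed
 qed
qed

lemma G_generated_subset:
 "G_closed_subspace w V ==> shift_invariant V ==> g \<in> V ==> G_generated w g \<subseteq> V"
 by (auto simp: G_generated_def)

abbreviation w_close :: "(complex => complex) => (complex => complex) => real => bool" where
 "w_close g h e \<equiv> \<forall>z. norm z < 1 --> w (1 - norm z) * norm (g z - h z) \<le> e"

lemma G_closedI:
 assumes V: "G_closed_subspace w V" and g: "g \<in> G_space w"
  and approx: "\<And>e. 0 < e ==> \<exists>v\<in>V. w_close v g e"
 shows "g \<in> V"
proof -
 have "\<forall>n. \<exists>v\<in>V. w_close v g (inverse (real (Suc n)))"
  using approx by simp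
 then obtain v where v: "\<And>n. v n \<in> V"
  "\<And>n z. norm z < 1 ==> w (1 - norm z) * norm (v n z - g z) \<le> inverse (real (Suc n))"
  by metis
 have "(%n. G_norm w (%z. v n z - g z)) \<longlonglongrightarrow> 0"
 proof (rule tendsto_sandwich[of "%_. 0"])
  show "\<forall>\<^sub>F n in sequentially. 0 \<le> G_norm w (%z. v n z - g z)"
   using v(1) G_closed_subspaceD(1)[OF V] g by (intro always_eventually allI G_norm_nonneg G_space_diff) auto
  show "\<forall>\<^sub>F n in sequentially. G_norm w (%z. v n z - g z) \<le> inverse (real (Suc n))"
   by (intro always_eventually allI G_norm_le v)
  show "(%n. inverse (real (Suc n))) \<longlonglongrightarrow> 0"
   by (rule LIMSEQ_inverse_real_of_nat)
 qed simp
 then show ?thesis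
  by (rule G_closed_subspaceD(5)[OF V v(1) g])
qed

lemma G_closed_subspaceI:
 assumes "V \<subseteq> G_space w" "(%z. 0) \<in> V" "\<And>g h. g \<in> V ==> h \<in> V ==> (%z. g z + h z) \<in> V"
  "\<And>k g. g \<in> V ==> (%z. k * g z) \<in> V"
  and approx: "\<And>g. g \<in> G_space w ==>
   (\<And>e. 0 < e ==> \<exists>v\<in>V. w_close v g e) ==> g \<in> V"
 shows "G_closed_subspace w V"
 unfolding G_closed_subspace_def
proof (intro conjI ballI allI impI)
 show "V \<subseteq> G_space w" "(%z. 0) \<in> V" by fact+
 show "\<And>g h. g \<in> V ==> h \<in> V ==> (%z. g z + h z) \<in> V" "\<And>k g. g \<in> V ==> (%z. k * g z) \<in> V" by fact+
next
 fix u g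
 assume g: "g \<in> G_space w" and u: "(\<forall>n. u n \<in> V) \<and> (%n::nat. G_norm w (%z. u n z - g z)) \<longlonglongrightarrow> 0"
 show "g \<in> V"
 proof (rule approx[OF g])
 fix e :: real assume e: "0 < e"
 then have "\<forall>\<^sub>F n in sequentially. G_norm w (%z. u n z - g z) < e"
  using u by (auto intro: order_tendstoD(2))
 then obtain n where "G_norm w (%z. u n z - g z) < e"
  by (auto simp: eventually_sequentially)
 moreover have "(%z. u n z - g z) \<in> G_space w"
  using u g assms(1) by (intro G_space_diff) auto
 ultimately have "w_close (u n) g e"
  by (auto intro: order_trans[OF G_norm_ge less_imp_le])
 then show "\<exists>v\<in>V. w_close v g e"
  using u by blast
 qed
qed

end

section \<open>Bounded multipliers and invariant subspaces\<close>

definition bounded_on_disc :: "(complex => complex) => bool" where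
 "bounded_on_disc b \<longleftrightarrow> b holomorphic_on ball 0 1 \<and> (\<exists>B. \<forall>z. norm z < 1 --> norm (b z) \<le> B)"

lemma bounded_on_disc_mult:
 assumes "bounded_on_disc a" "bounded_on_disc b"
 shows "bounded_on_disc (%z. a z * b z)"
proof -
 obtain A B where "\<And>z. norm z < 1 ==> norm (a z) \<le> A" "\<And>z. norm z < 1 ==> norm (b z) \<le> B"
  using assms unfolding bounded_on_disc_def by blast
 then have "norm (a z * b z) \<le> A * B" if "norm z < 1" for z
  using that order_trans[OF norm_ge_zero, of "a z" A] unfolding norm_mult by (intro mult_mono) auto
 with assms show ?thesis
  unfolding bounded_on_disc_def by (blast intro: holomorphic_intros)
qed

lemma bounded_on_discD: "bounded_on_disc b ==> b holomorphic_on ball 0 1"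
 "bounded_on_disc b ==> \<exists>B>0. \<forall>z. norm z < 1 --> norm (b z) \<le> B"
proof -
 assume "bounded_on_disc b"
 then obtain B where "\<forall>z. norm z < 1 --> norm (b z) \<le> B" "b holomorphic_on ball 0 1"
  by (auto simp: bounded_on_disc_def)
 then show "b holomorphic_on ball 0 1" "\<exists>B>0. \<forall>z. norm z < 1 --> norm (b z) \<le> B"
  by (auto intro!: exI[of _ "max B 1"] simp: le_max_iff_disj)
qed

lemma bounded_on_disc_const: "bounded_on_disc (%z. k)"
 by (auto simp: bounded_on_disc_def)

lemma bounded_on_disc_cball:
 assumes "b holomorphic_on ball 0 R" "1 < R"
 shows "bounded_on_disc b"
proof -
 have "continuous_on (cball 0 1) b"
  using assms by (auto intro!: holomorphic_on_imp_continuous_on elim: holomorphic_on_subset)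
 then have "bounded (b ` cball 0 1)"
  by (intro compact_imp_bounded compact_continuous_image) auto
 then obtain B where "\<forall>x\<in>cball 0 1. norm (b x) \<le> B"
  unfolding bounded_iff by blast
 with assms show ?thesis
  by (auto simp: bounded_on_disc_def intro!: exI[of _ B] elim: holomorphic_on_subset)
qed

lemma radii_to_1:
 obtains r where "\<And>n. 0 < r n" "\<And>n. r n < 1" "r \<longlonglongrightarrow> (1::real)"
proof
 have "(%n. 1 - inverse (real (Suc (Suc n)))) \<longlonglongrightarrow> 1 - 0"
  by (intro tendsto_intros LIMSEQ_Suc[OF LIMSEQ_inverse_real_of_nat])
 then show "(%n. 1 - inverse (real (Suc (Suc n)))) \<longlonglongrightarrow> 1" by simp
qed (auto simp: field_simps)

lemma dilation_holomorphic:
 assumes "b holomorphic_on ball 0 1" "0 < r" "r < 1"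
 shows "(%z. b (of_real r * z)) holomorphic_on ball 0 (1 / r)"
proof -
 have "(b \<circ> (%z. of_real r * z)) holomorphic_on ball 0 (1 / r)"
  by (rule holomorphic_on_compose_gen[OF _ assms(1)])
   (use assms in "auto intro!: holomorphic_intros simp: norm_mult field_simps")
 then show ?thesis by (simp add: comp_def)
qed

lemma dilation_bounded:
 assumes "b holomorphic_on ball 0 1" "0 < r" "r < 1"
 shows "bounded_on_disc (%z. b (of_real r * z))"
 by (rule bounded_on_disc_cball[OF dilation_holomorphic[OF assms]]) (use assms in auto)

lemma dilation_uniform_limit:
 fixes b :: "complex => complex"
 assumes b: "continuous_on (ball 0 1) b" and R: "R < 1" and e: "0 < e"
 shows "\<exists>d<1. \<forall>r. d < r --> r < 1 --> (\<forall>z. norm z \<le> R --> norm (b (of_real r * z) - b z) < e)"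
proof -
 have "uniformly_continuous_on (cball 0 R) b"
  using R by (intro compact_uniformly_continuous continuous_on_subset[OF b]) auto
 then obtain d where d: "0 < d" "\<And>x y. x \<in> cball 0 R ==> y \<in> cball 0 R ==> dist y x < d ==> dist (b y) (b x) < e"
  unfolding uniformly_continuous_on_def using e by meson
 have "norm (b (of_real r * z) - b z) < e" if r: "max 0 (1 - d) < r" "r < 1" and z: "norm z \<le> R" for r z
 proof -
  have "norm (of_real r * z) \<le> norm z"
   using r by (simp add: norm_mult mult_left_le_one_le)
  moreover have "norm (of_real r * z - z) = (1 - r) * norm z"
  proof -
   have "of_real r * z - z = - of_real (1 - r) * z" by (simp add: algebra_simps)
   then have "norm (of_real r * z - z) = \<bar>1 - r\<bar> * norm z"
    by (simp only: norm_mult norm_minus_cancel norm_of_real)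
   then show ?thesis using r by simp
  qed
  moreover have "(1 - r) * norm z < d"
  proof -
   have "(1 - r) * norm z \<le> 1 - r"
    using r z R by (intro mult_left_le) auto
   then show ?thesis using r by linarith
  qed
  ultimately show ?thesis
   using d(2)[of z "of_real r * z"] z r by (simp add: dist_norm)
 qed
 then show ?thesis using d(1) by (intro exI[of _ "max 0 (1 - d)"]) auto
qed

context weight
begin

lemma G_space_if_bounded_on_disc: "bounded_on_disc b ==> b \<in> G_space w"
 unfolding bounded_on_disc_def by (auto intro: G_space_if_bounded)

lemma G_space_mult: "bounded_on_disc b ==> g \<in> G_space w ==> (%z. b z * g z) \<in> G_space w"
 unfolding bounded_on_disc_def using G_space_bounded_mult[of g b] by blast

text \<open>The decay of w(1 - |z|) g(z) at the boundary turns bounded, locally uniform convergence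
  of multipliers into norm convergence of the products: outside a compact disc the bound C times a
  small number suffices, inside it uniform convergence does.\<close>

lemma G_mult_approx:
 assumes g: "g \<in> G_space w" and e: "0 < e"
  and C: "\<And>n z. norm z < 1 ==> norm (b n z - a z) \<le> C"
  and lim: "\<And>R e. R < 1 ==> 0 < e ==> \<forall>\<^sub>F n in F. \<forall>z. norm z \<le> R --> norm (b n z - a z) < e"
 shows "\<forall>\<^sub>F n in F. w_close (%z. b n z * g z) (%z. a z * g z) e"
proof -
 have C0: "0 \<le> C" using order_trans[OF norm_ge_zero C[of 0]] by simp
 define d where "d = e / (C + 1)"
 have d: "0 < d" using C0 e by (simp add: d_def)
 obtain R where R: "R < 1" "\<And>z. R < norm z ==> norm z < 1 ==> w (1 - norm z) * norm (g z) < d"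
  using G_spaceD[OF g d] by auto
 obtain K where K: "0 < K" "\<And>z. norm z < 1 ==> w (1 - norm z) * norm (g z) \<le> K"
  by (rule G_space_bounded[OF g]) blast
 have "0 < e / K" using e K by simp
 from lim[OF R(1) this] show ?thesis
 proof eventually_elim
  case (elim n)
  show ?case
  proof (intro allI impI)
   fix z :: complex assume z: "norm z < 1"
   have eq: "w (1 - norm z) * norm (b n z * g z - a z * g z) = norm (b n z - a z) * (w (1 - norm z) * norm (g z))"
    by (simp add: norm_mult flip: left_diff_distrib)
   have nn: "0 \<le> w (1 - norm z) * norm (g z)" using w_disc[OF z] by simp
   show "w (1 - norm z) * norm (b n z * g z - a z * g z) \<le> e"
   proof (cases "norm z \<le> R")
    case True
    have "norm (b n z - a z) * (w (1 - norm z) * norm (g z)) \<le> e / K * K"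
     using True elim K z nn e by (intro mult_mono) (auto intro: less_imp_le)
    also have "... = e" using K by simp
    finally show ?thesis unfolding eq .
   next
    case False
    then have "norm (b n z - a z) * (w (1 - norm z) * norm (g z)) \<le> C * d"
     using R(2)[of z] C z nn C0 by (intro mult_mono) auto
    also have "... \<le> e" using C0 e by (simp add: d_def field_simps)
    finally show ?thesis unfolding eq .
   qed
  qed
 qed
qed

lemma G_generated_sub: "g \<in> G_space w ==> G_generated w g \<subseteq> G_space w"
 using G_closed_subspaceD(1)[OF G_generated_closed(1)] .

lemma invariant_power:
 assumes "shift_invariant V" "g \<in> V"
 shows "(%z. z ^ n * g z) \<in> V"
proof (induction n)
 case (Suc n)
 then have "(%z. z * (z ^ n * g z)) \<in> V"
  using assms(1) unfolding shift_invariant_def by (rule bspec[rotated])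
 then show ?case by (simp add: mult.assoc)
qed (simp add: assms)

lemma invariant_polynomial:
 assumes V: "G_closed_subspace w V" "shift_invariant V" "g \<in> V"
 shows "(%z. (\<Sum>i<n. a i * z ^ i) * g z) \<in> V"
proof (induction n)
 case 0
 then show ?case using G_closed_subspaceD(2)[OF V(1)] by simp
next
 case (Suc n)
 have "(%z. (\<Sum>i<n. a i * z ^ i) * g z + a n * (z ^ n * g z)) \<in> V"
  by (intro G_closed_subspaceD(3,4)[OF V(1)] Suc invariant_power V)
 then show ?case by (simp add: distrib_right mult.assoc)
qed

text \<open>As R > 1, the Taylor polynomials converge uniformly on the closed disc, and a uniformly
  small multiplier has a small effect in the norm.\<close>

lemma invariant_holomorphic:
 assumes V: "G_closed_subspace w V" "shift_invariant V" "g \<in> V"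
  and b: "b holomorphic_on ball 0 R" and R: "1 < R"
 shows "(%z. b z * g z) \<in> V"
proof -
 have g: "g \<in> G_space w" using V G_closed_subspaceD(1) by blast
 define a where "a n = (deriv ^^ n) b 0 / fact n" for n
 have sums: "(%n. a n * z ^ n) sums b z" if "z \<in> ball 0 R" for z
  using holomorphic_power_series[OF b that] by (simp add: a_def)
 obtain q where q: "1 < q" "q < R" using R dense by blast
 have "summable (%n. a n * of_real q ^ n)"
  using sums[of "of_real q"] q by (auto simp: sums_iff)
 from powser_insidea[OF this, of 1] have sa: "summable (%n. norm (a n))"
  using q by simp
 have "uniform_limit (cball 0 1) (%n z. \<Sum>i<n. a i * z ^ i) (%z. suminf (%i. a i * z ^ i)) sequentially"
 proof (rule Weierstrass_m_test[OF _ sa])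
  fix n and z :: complex assume "z \<in> cball 0 1"
  then show "norm (a n * z ^ n) \<le> norm (a n)"
   by (simp add: norm_mult norm_power mult_left_le power_le_one)
 qed
 then have ul: "uniform_limit (cball 0 1) (%n z. \<Sum>i<n. a i * z ^ i) b sequentially"
  by (rule uniform_limit_cong'[THEN iffD1, rotated 2]) (use sums R in "auto simp: sums_iff")
 show ?thesis
 proof (rule G_closedI[OF V(1)])
  show "(%z. b z * g z) \<in> G_space w"
   by (intro G_space_mult bounded_on_disc_cball[OF b R] g)
  fix e :: real assume e: "0 < e"
  obtain K where K: "0 < K" "\<And>z. norm z < 1 ==> w (1 - norm z) * norm (g z) \<le> K"
   by (rule G_space_bounded[OF g]) blast
  have "\<forall>\<^sub>F n in sequentially. \<forall>z\<in>cball 0 1. dist (\<Sum>i<n. a i * z ^ i) (b z) < e / K"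
   by (rule uniform_limitD[OF ul]) (use e K in simp)
  then obtain n where n: "\<And>z. z \<in> cball 0 1 ==> dist (\<Sum>i<n. a i * z ^ i) (b z) < e / K"
   unfolding eventually_sequentially by blast
  have "w (1 - norm z) * norm ((\<Sum>i<n. a i * z ^ i) * g z - b z * g z) \<le> e" if z: "norm z < 1" for z
  proof -
   have "w (1 - norm z) * norm ((\<Sum>i<n. a i * z ^ i) * g z - b z * g z) =
     dist (\<Sum>i<n. a i * z ^ i) (b z) * (w (1 - norm z) * norm (g z))"
    by (simp add: norm_mult dist_norm flip: left_diff_distrib)
   also have "... \<le> e / K * K"
    using n[of z] K e z w_disc[OF z] by (intro mult_mono) auto
   finally show ?thesis using K by simp
  qed
  then show "\<exists>v\<in>V. w_close v (%z. b z * g z) e"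
   by (intro bexI[OF _ invariant_polynomial[OF V, of a n]]) simp
 qed
qed

text \<open>The dilations of b are holomorphic beyond the circle and obey the bound of b. They
  converge to b only locally uniformly, which is enough by \<open>G_mult_approx\<close>.\<close>

lemma invariant_bounded:
 assumes V: "G_closed_subspace w V" "shift_invariant V" "g \<in> V" and b: "bounded_on_disc b"
 shows "(%z. b z * g z) \<in> V"
proof (rule G_closedI[OF V(1)])
 have g: "g \<in> G_space w" using V G_closed_subspaceD(1) by blast
 show "(%z. b z * g z) \<in> G_space w"
  by (intro G_space_mult b g)
 fix e :: real assume e: "0 < e"
 obtain B where B: "0 < B" "\<And>z. norm z < 1 ==> norm (b z) \<le> B"
  using bounded_on_discD(2)[OF b] by blast
 have bh: "b holomorphic_on ball 0 1" using b by (rule bounded_on_discD)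
 obtain r where r: "\<And>n. 0 < r n" "\<And>n. r n < 1" and r1: "r \<longlonglongrightarrow> (1::real)"
  by (rule radii_to_1) blast
 have "\<forall>\<^sub>F n in sequentially. \<forall>z. norm z < 1 -->
   w (1 - norm z) * norm (b (of_real (r n) * z) * g z - b z * g z) \<le> e"
 proof (rule G_mult_approx[OF g e, where C="B + B"])
  fix n and z :: complex assume z: "norm z < 1"
  have "norm (of_real (r n) * z) < 1"
   using z r[of n] by (simp add: norm_mult) (metis less_imp_le mult_left_le_one_le norm_ge_zero order_le_less_trans)
  then show "norm (b (of_real (r n) * z) - b z) \<le> B + B"
   using z B(2) by (intro order_trans[OF norm_triangle_ineq4 add_mono]) auto
 next
  fix R e' :: real assume "R < 1" "0 < e'"
  from dilation_uniform_limit[OF holomorphic_on_imp_continuous_on[OF bh] this]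
  obtain d where d: "d < 1" "\<And>r. d < r ==> r < 1 ==> (\<forall>z. norm z \<le> R --> norm (b (of_real r * z) - b z) < e')"
   by auto
  have "\<forall>\<^sub>F n in sequentially. d < r n"
   by (rule order_tendstoD(1)[OF r1 d(1)])
  then show "\<forall>\<^sub>F n in sequentially. \<forall>z. norm z \<le> R --> norm (b (of_real (r n) * z) - b z) < e'"
   by eventually_elim (use d(2) r in blast)
 qed
 then obtain n where n: "\<forall>z. norm z < 1 -->
   w (1 - norm z) * norm (b (of_real (r n) * z) * g z - b z * g z) \<le> e"
  unfolding eventually_sequentially by blast
 have "(%z. b (of_real (r n) * z) * g z) \<in> V"
  by (rule invariant_holomorphic[OF V dilation_holomorphic[OF bh r]]) (use r[of n] in simp)
 with n show "\<exists>v\<in>V. w_close v (%z. b z * g z) e"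
  by (intro bexI) auto
qed

text \<open>Every g is the norm limit of its dilations, and these are multiples of 1 by functions
  holomorphic beyond the circle. Near the boundary w(1 - |z|) <= w(1 - r|z|), so the smallness of w
  |g| at rz controls the dilation at z.\<close>

lemma G_space_if_1_in:
 assumes V: "G_closed_subspace w V" "shift_invariant V" "(%z. 1) \<in> V"
 shows "V = G_space w"
proof (intro equalityI subsetI)
 fix g assume g: "g \<in> G_space w"
 show "g \<in> V"
 proof (rule G_closedI[OF V(1) g])
  fix e :: real assume e: "0 < e"
  obtain R where R: "R < 1" "\<And>z. R < norm z ==> norm z < 1 ==> w (1 - norm z) * norm (g z) < e / 2"
   using G_spaceD[OF g, of "e / 2"] e by auto
  define R' where "R' = max ((1 + R) / 2) (1/2)"
  have R': "R' < 1" "R < R'" "0 < R'" proof -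
   have "R < (1 + R) / 2" "(1 + R) / 2 < 1" using R(1) by simp_all
   then show "R' < 1" "R < R'" "0 < R'" by (auto simp: R'_def less_max_iff_disj)
  qed
  have gh: "g holomorphic_on ball 0 1" using g by (rule G_space_holomorphic)
  from dilation_uniform_limit[OF holomorphic_on_imp_continuous_on[OF gh] R'(1) e]
  obtain d where d: "d < 1" "\<And>r. d < r ==> r < 1 ==> (\<forall>z. norm z \<le> R' --> norm (g (of_real r * z) - g z) < e)"
   by auto
  \<comment> \<open>The bound \<open>r > R / R'\<close> ensures that |rz| > R as soon as |z| >
    R'.\<close>
  define m where "m = Max {d, R / R', 0}"
  have "R / R' < 1" using R' by simp
  then have "m < 1" using d by (simp add: m_def)
  then obtain r where r: "m < r" "r < 1" using dense by blast
  then have r': "d < r" "R / R' < r" "0 < r" by (auto simp: m_def)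
  have "w (1 - norm z) * norm (g (of_real r * z) - g z) \<le> e" if z: "norm z < 1" for z
  proof (cases "norm z \<le> R'")
   case True
   then have "w (1 - norm z) * norm (g (of_real r * z) - g z) \<le> 1 * e"
    using d(2)[OF r'(1) r(2)] w_disc[OF z] e by (intro mult_mono) (auto intro: less_imp_le)
   then show ?thesis by simp
  next
   case False
   have rz: "norm (of_real r * z) = r * norm z" using r' by (simp add: norm_mult)
   have "r * R' < r * norm z" using False r' by simp
   moreover have "R < r * R'" using r'(2) R' by (simp add: field_simps)
   ultimately have 1: "R < r * norm z" by linarith
   have 2: "r * norm z \<le> norm z" using r r' by (simp add: mult_left_le_one_le)
   have "w (1 - norm z) * norm (g (of_real r * z)) \<le> w (1 - r * norm z) * norm (g (of_real r * z))"
    using 2 z r' by (intro mult_right_mono w_mono) auto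
   also have "... < e / 2" using R(2)[of "of_real r * z"] 1 2 z rz by simp
   finally have a: "w (1 - norm z) * norm (g (of_real r * z)) < e / 2" .
   have b: "w (1 - norm z) * norm (g z) < e / 2" using R(2)[of z] z False R' by simp
   have "w (1 - norm z) * norm (g (of_real r * z) - g z) \<le> w (1 - norm z) * (norm (g (of_real r * z)) + norm (g z))"
    using w_disc[OF z] by (intro mult_left_mono norm_triangle_ineq4) auto
   then show ?thesis using a b by (simp add: distrib_left)
  qed
  moreover have "(%z. g (of_real r * z) * 1) \<in> V"
   by (rule invariant_holomorphic[OF V dilation_holomorphic[OF gh r'(3) r(2)]]) (use r r' in simp)
  ultimately show "\<exists>v\<in>V. w_close v g e"
   by (intro bexI[of _ "%z. g (of_real r * z)"]) auto
 qed
qed (use G_closed_subspaceD(1)[OF V(1)] in blast)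

text \<open>Formulated relative to the weight of the locale, so that it can be instantiated for the
  powers of w as well.\<close>

definition approx_cyclic :: "(complex => complex) => bool" where
 "approx_cyclic S \<longleftrightarrow> (\<forall>e>0. \<exists>q. bounded_on_disc q \<and>
  (w_close (%z. q z * S z) (%_. 1) e))"

lemma approx_cyclic_imp_G_cyclic:
 assumes S: "bounded_on_disc S" and c: "approx_cyclic S"
 shows "G_cyclic w S"
 unfolding G_cyclic_def
proof (rule G_space_if_1_in)
 have SG: "S \<in> G_space w" using S by (rule G_space_if_bounded_on_disc)
 show V: "G_closed_subspace w (G_generated w S)" "shift_invariant (G_generated w S)"
  by (intro G_generated_closed SG)+
 show "(%z. 1) \<in> G_generated w S"
 proof (rule G_closedI[OF V(1) G_space_1])
  fix e :: real assume "0 < e"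
  then obtain q where "bounded_on_disc q" "w_close (%z. q z * S z) (%_. 1) e"
   using c unfolding approx_cyclic_def by blast
  then show "\<exists>v\<in>G_generated w S. w_close v (%_. 1) e"
   by (intro bexI[OF _ invariant_bounded[OF V G_generated_closed(3)[OF SG]]]) auto
 qed
qed

text \<open>The weight is split as w^a w^(1-a): the second power absorbs the growth of g, the first
  is left for the approximate inversion of S. Bounded g corresponds to a = 1. For a function that is
  merely O(1/w) no positive exponent is left, which is why \<open>f_in\<close> approaches f through
  products.\<close>

lemma remove_factor:
 assumes V: "G_closed_subspace w V" "shift_invariant V" "(%z. S z * g z) \<in> V"
  and g: "g \<in> G_space w" and K: "\<And>z. norm z < 1 ==> norm (g z) \<le> K * w (1 - norm z) powr (a - 1)"
  and approx: "\<And>e. 0 < e ==> \<exists>q. bounded_on_disc q \<and>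
  (\<forall>z. norm z < 1 --> w (1 - norm z) powr a * norm (q z * S z - 1) \<le> e)"
 shows "g \<in> V"
proof (rule G_closedI[OF V(1) g])
 fix e :: real assume e: "0 < e"
 have K0: "0 \<le> K * w (1 - norm (0::complex)) powr (a - 1)"
  by (rule order_trans[OF norm_ge_zero K]) simp
 have "0 < w (1 - norm (0::complex)) powr (a - 1)"
  using w_disc(1)[of 0] by simp
 then have K0: "0 \<le> K" using K0 by (simp add: zero_le_mult_iff)
 define d where "d = e / (K + 1)"
 have d: "0 < d" using K0 e by (simp add: d_def)
 obtain q where q: "bounded_on_disc q" "\<forall>z. norm z < 1 --> w (1 - norm z) powr a * norm (q z * S z - 1) \<le> d"
  using approx[OF d] by blast
 have "w (1 - norm z) * norm (q z * (S z * g z) - g z) \<le> e" if z: "norm z < 1" for z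
 proof -
  have w0: "0 < w (1 - norm z)" using w_disc[OF z] by simp
  have "q z * (S z * g z) - g z = (q z * S z - 1) * g z" by (simp add: algebra_simps)
  then have "w (1 - norm z) * norm (q z * (S z * g z) - g z) =
    w (1 - norm z) * norm (q z * S z - 1) * norm (g z)"
   by (simp add: norm_mult)
  also have "... \<le> w (1 - norm z) * norm (q z * S z - 1) * (K * w (1 - norm z) powr (a - 1))"
   using w0 K[OF z] by (intro mult_left_mono) auto
  also have "... = K * (w (1 - norm z) powr a * norm (q z * S z - 1))"
   using w0 by (simp add: powr_diff)
  also have "... \<le> K * d" using q(2) z K0 by (intro mult_left_mono) auto
  also have "... \<le> e" using K0 e by (simp add: d_def field_simps)
  finally show ?thesis .
 qed
 then show "\<exists>v\<in>V. w_close v g e"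
  by (intro bexI[OF _ invariant_bounded[OF V q(1)]]) simp
qed

text \<open>The functions that are limits of bounded multiples of b form a closed invariant subspace
  containing b. This gives access to individual elements of a subspace defined as an
  intersection.\<close>

lemma G_generated_approx:
 assumes b: "b \<in> G_space w" and h: "h \<in> G_generated w b" and e: "0 < e"
 shows "\<exists>q. bounded_on_disc q \<and> w_close (%z. q z * b z) h e"
proof -
 let ?P = "%h e. \<exists>q. bounded_on_disc q \<and> w_close (%z. q z * b z) h e"
 define V where "V = {h\<in>G_space w. \<forall>e>0. ?P h e}"
 have add: "?P (%z. h z + k z) (s + t)" if P: "?P h s" "?P k t" for h k s t
 proof -
  obtain q1 q2 where q: "bounded_on_disc q1" "bounded_on_disc q2"
   "w_close (%z. q1 z * b z) h s"
   "w_close (%z. q2 z * b z) k t"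
   using P by blast
  have "bounded_on_disc (%z. q1 z + q2 z)"
  proof -
   obtain A B where "\<And>z. norm z < 1 ==> norm (q1 z) \<le> A" "\<And>z. norm z < 1 ==> norm (q2 z) \<le> B"
    using q(1,2) unfolding bounded_on_disc_def by blast
   then have "norm (q1 z + q2 z) \<le> A + B" if "norm z < 1" for z
    using that by (intro order_trans[OF norm_triangle_ineq add_mono]) auto
   with q(1,2) show ?thesis
    unfolding bounded_on_disc_def by (blast intro: holomorphic_intros)
  qed
  moreover have "w (1 - norm z) * norm ((q1 z + q2 z) * b z - (h z + k z)) \<le> s + t" if z: "norm z < 1" for z
  proof -
   have "(q1 z + q2 z) * b z - (h z + k z) = (q1 z * b z - h z) + (q2 z * b z - k z)"
    by (simp add: algebra_simps)
   then have "w (1 - norm z) * norm ((q1 z + q2 z) * b z - (h z + k z)) \<le>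
     w (1 - norm z) * (norm (q1 z * b z - h z) + norm (q2 z * b z - k z))"
    using w_disc[OF z] by (simp only:) (intro mult_left_mono norm_triangle_ineq, simp)
   also have "... \<le> s + t"
    unfolding distrib_left using q(3,4) z by (intro add_mono) auto
   finally show ?thesis .
  qed
  ultimately show ?thesis by (intro exI[of _ "%z. q1 z + q2 z"]) auto
 qed
 have mult: "?P (%z. m z * h z) e" if m: "bounded_on_disc m" and P: "\<forall>e>0. ?P h e" and e: "0 < e" for m h e
 proof -
  obtain B where B: "0 < B" "\<forall>z. norm z < 1 --> norm (m z) \<le> B"
   using bounded_on_discD(2)[OF m] by blast
  obtain q where q: "bounded_on_disc q" "w_close (%z. q z * b z) h (e / B)"
   using P[rule_format, of "e / B"] e B by auto
  have "w (1 - norm z) * norm (m z * q z * b z - m z * h z) \<le> e" if z: "norm z < 1" for z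
  proof -
   have "w (1 - norm z) * norm (m z * q z * b z - m z * h z) = norm (m z) * (w (1 - norm z) * norm (q z * b z - h z))"
    by (simp add: norm_mult[symmetric] right_diff_distrib mult_ac)
   also have "... \<le> B * (e / B)"
    using B q(2) z w_disc[OF z] by (intro mult_mono) auto
   finally show ?thesis using B by simp
  qed
  then show ?thesis
   using bounded_on_disc_mult[OF m q(1)] by (intro exI[of _ "%z. m z * q z"]) auto
 qed
 have "bounded_on_disc (%z. z)"
  unfolding bounded_on_disc_def by (auto intro!: exI[of _ 1])
 then have "shift_invariant V"
  unfolding shift_invariant_def V_def using mult G_space_mult by blast
 moreover have "b \<in> V"
 proof -
  have "?P b e" if "0 < e" for e
   using that bounded_on_disc_const[of 1] by (intro exI[of _ "%z. 1"]) auto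
  then show ?thesis using b by (simp add: V_def)
 qed
 moreover have "G_closed_subspace w V"
 proof (rule G_closed_subspaceI)
  show "V \<subseteq> G_space w" by (auto simp: V_def)
  have "?P (%z. 0) e" if "0 < e" for e
   using that bounded_on_disc_const[of 0] by (intro exI[of _ "%z. 0"]) auto
  then show "(%z. 0) \<in> V"
   using G_closed_subspaceD(2)[OF G_space_closed_subspace] by (simp add: V_def)
  show "(%z. g z + h z) \<in> V" if "g \<in> V" "h \<in> V" for g h
  proof -
   have "?P (%z. g z + h z) e" if "0 < e" for e
   proof -
    have "0 < e / 2" using that by simp
    then have "?P g (e / 2)" "?P h (e / 2)"
     using \<open>g \<in> V\<close> \<open>h \<in> V\<close> unfolding V_def by blast+
    then have "?P (%z. g z + h z) (e / 2 + e / 2)" by (rule add)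
    then show ?thesis by (simp only: field_sum_of_halves)
   qed
   then show ?thesis using that G_space_add by (simp add: V_def)
  qed
  show "(%z. k * g z) \<in> V" if "g \<in> V" for k g
   using that mult[OF bounded_on_disc_const[of k], of g] G_space_cmult by (simp add: V_def)
  fix g assume g: "g \<in> G_space w"
   and ap: "\<And>e. 0 < e ==> \<exists>v\<in>V. w_close v g e"
  have "?P g e" if e: "0 < e" for e
  proof -
   obtain v where v: "v \<in> V" "w_close v g (e / 2)"
    using ap[of "e / 2"] e by auto
   have "0 < e / 2" using e by simp
   then have 1: "?P v (e / 2)" using v(1) unfolding V_def by blast
   \<comment> \<open>The remainder g - v is itself small, so the multiplier 0 approximates
     it.\<close>
   have 2: "?P (%z. g z - v z) (e / 2)"
    using v(2) bounded_on_disc_const[of 0] by (intro exI[of _ "%z. 0"]) (simp add: norm_minus_commute)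
   have "?P (%z. v z + (g z - v z)) (e / 2 + e / 2)"
    by (rule add[OF 1 2])
   then show ?thesis by (simp only: field_sum_of_halves add_diff_cancel_left' add_diff_eq)
  qed
  then show "g \<in> V" using g by (simp add: V_def)
 qed
 ultimately have "G_generated w b \<subseteq> V" by (intro G_generated_subset)
 then show ?thesis using h e by (auto simp: V_def)
qed

end

section \<open>Arcs\<close>

definition circle_param :: "complex => real" where
 "circle_param \<zeta> = Arg2pi \<zeta> / (2 * pi)"

lemma circle_param_bounds: "0 \<le> circle_param x" "circle_param x < 1"
 using Arg2pi[of x] by (auto simp: circle_param_def)

lemma cis_circle_param: "norm x = 1 ==> cis (2 * pi * circle_param x) = x"
 using complex_norm_eq_1_exp[of x] by (simp add: circle_param_def cis_conv_exp)

lemma circle_param_cis: "0 \<le> t ==> t < 1 ==> circle_param (cis (2 * pi * t)) = t"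
 using Arg2pi_unique[of 1 "2 * pi * t" "cis (2 * pi * t)"] by (simp add: circle_param_def cis_conv_exp)

lemma circle_param_measurable: "circle_param \<in> borel_measurable borel"
proof -
 have "Arg2pi \<in> borel_measurable borel"
  unfolding borel_measurable_iff_greater using open_Arg2pi2pi_gt by auto
 then show ?thesis unfolding circle_param_def[abs_def] by measurable
qed

lemma circle_param_measurable' [measurable]: "circle_param \<in> borel_measurable circle_borel"
 by (intro measurable_restrict_space1 circle_param_measurable)

lemma nn_integral_circle_lebesgue:
 assumes f: "f \<in> borel_measurable circle_borel"
 shows "(\<integral>\<^sup>+x. f x \<partial>leb) = (\<integral>\<^sup>+t. f (cis (2 * pi * t)) * indicator {0..<1} t \<partial>lborel)"
proof -
 have "(\<integral>\<^sup>+x. f x \<partial>leb) = (\<integral>\<^sup>+t. f (cis (2 * pi * t)) \<partial>restrict_space lborel {0..<1})"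
  unfolding circle_lebesgue_def by (rule nn_integral_distr[OF cis_measurable_unit]) (use f in simp)
 also have "... = (\<integral>\<^sup>+t. f (cis (2 * pi * t)) * indicator {0..<1} t \<partial>lborel)"
  by (rule nn_integral_restrict_space) simp
 finally show ?thesis .
qed

lemma nn_integral_circle_param:
 assumes g: "g \<in> borel_measurable borel"
 shows "(\<integral>\<^sup>+x. g (circle_param x) \<partial>leb) = (\<integral>\<^sup>+t. g t * indicator {0..<1} t \<partial>lborel)"
proof -
 have "(%x. g (circle_param x)) \<in> borel_measurable circle_borel"
  using g by measurable
 from nn_integral_circle_lebesgue[OF this] show ?thesis
  by (simp add: circle_param_cis indicator_def cong: nn_integral_cong_simp if_cong)
   (auto intro!: nn_integral_cong simp: circle_param_cis)
qed

lemma norm_cis_diff: "norm (cis a - cis b) = 2 * \<bar>sin ((a - b) / 2)\<bar>"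
proof -
 have "(norm (cis a - cis b))\<^sup>2 = (cos a - cos b)\<^sup>2 + (sin a - sin b)\<^sup>2"
  by (simp add: cmod_power2)
 also have "... = 2 - 2 * cos (a - b)"
  using sin_cos_squared_add[of a] sin_cos_squared_add[of b]
  by (simp add: cos_diff power2_eq_square algebra_simps)
 also have "... = (2 * \<bar>sin ((a - b) / 2)\<bar>)\<^sup>2"
 proof -
  have "a - b = 2 * ((a - b) / 2)" by (simp add: field_simps)
  then have "cos (a - b) = cos (2 * ((a - b) / 2))" by (rule arg_cong)
  also have "... = 1 - 2 * (sin ((a - b) / 2))\<^sup>2" by (rule cos_double_sin)
  finally show ?thesis by (simp only: power_mult_distrib power2_abs) simp
 qed
 finally show ?thesis
  by (rule power2_eq_imp_eq) auto
qed

text \<open>The chord between points at angle a has length 2 |sin(a/2)|. In terms of the chord the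
  distance is continuous and monotone, whereas the principal argument jumps.\<close>

lemma arc_dist_eq:
 assumes "norm x = 1" "norm y = 1"
 shows "arc_dist x y = arcsin (norm (x - y) / 2) / pi"
proof -
 define a where "a = Arg (x / y)"
 have n: "norm (x / y) = 1" using assms by (simp add: norm_divide)
 have "cis a = x / y"
  unfolding a_def using n by (subst cis_Arg) (auto simp: sgn_div_norm)
 then have "x = cis a * y" using assms by (auto simp: field_simps)
 then have "norm (x - y) = norm ((cis a - cis 0) * y)" by (simp add: algebra_simps)
 also have "... = 2 * \<bar>sin (a / 2)\<bar>" using assms norm_cis_diff[of a 0] by (simp add: norm_mult)
 finally have 1: "norm (x - y) / 2 = \<bar>sin (a / 2)\<bar>" by simp
 have a: "\<bar>a\<bar> \<le> pi" using Arg_bounded[of "x / y"] by (auto simp: a_def)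
 have "\<bar>sin (a / 2)\<bar> = sin (\<bar>a\<bar> / 2)"
 proof (cases "0 \<le> a")
  case True
  then show ?thesis using a sin_ge_zero[of "a / 2"] by simp
 next
  case False
  then show ?thesis using a sin_ge_zero[of "- a / 2"] by simp
 qed
 then have "arcsin \<bar>sin (a / 2)\<bar> = \<bar>a\<bar> / 2"
  using a by (simp add: arcsin_sin)
 then show ?thesis unfolding 1 arc_dist_def a_def[symmetric] by (simp only:)
qed

lemma infdist_sphere_le_2:
 assumes "norm x = 1" "E \<subseteq> sphere 0 1" "E \<noteq> {}"
 shows "infdist x E \<le> 2"
proof -
 obtain y where y: "y \<in> E" using assms by blast
 then have "norm y = 1" using assms by auto
 then have "dist x y \<le> 2"
  using norm_triangle_ineq4[of x y] assms by (simp add: dist_norm)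
 then show ?thesis using infdist_le[OF y] by (rule order_trans[rotated])
qed

lemma arc_setdist_eq:
 assumes u: "norm u = 1" and E: "closed E" "E \<subseteq> sphere 0 1" "E \<noteq> {}"
 shows "arc_setdist u E = arcsin (infdist u E / 2) / pi"
proof -
 obtain v where v: "v \<in> E" "infdist u E = dist u v"
  using infdist_attains_inf[OF E(1,3)] by blast
 have e: "arc_dist u x = arcsin (dist u x / 2) / pi" if "x \<in> E" for x
  using that E u by (subst arc_dist_eq) (auto simp: dist_norm)
 have "arc_setdist u E = arc_dist u v"
  unfolding arc_setdist_def
 proof (rule cInf_eq_minimum)
  show "arc_dist u v \<in> arc_dist u ` E" using v by simp
  fix x assume "x \<in> arc_dist u ` E"
  then obtain y where y: "y \<in> E" "x = arc_dist u y" by auto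
  have "dist u v \<le> dist u y" using v infdist_le[OF y(1), of u] by simp
  moreover have "dist u y \<le> 2"
   using norm_triangle_ineq4[of u y] y E u by (auto simp: dist_norm)
  moreover have "- 1 \<le> dist u v / 2" by (rule order_trans[of _ 0]) auto
  ultimately show "arc_dist u v \<le> x"
   unfolding y(2) e[OF y(1)] e[OF v(1)] by (intro divide_right_mono arcsin_le_arcsin) auto
 qed
 then show ?thesis using e[OF v(1)] v by simp
qed

text \<open>Taylor's remainder x^3/6 and x^2 <= 4. The factor 1/3 is crude but suffices for
  \<open>arc_setdist\<close> <= \<open>infdist\<close>, because 3/2 <= pi.\<close>

lemma sin_ge_third:
 assumes "0 \<le> x" "x \<le> (2::real)"
 shows "x / 3 \<le> sin x"
proof -
 have "\<bar>sin x - (\<Sum>m<3. sin_coeff m * x ^ m)\<bar> \<le> inverse (fact 3) * \<bar>x\<bar> ^ 3"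
  by (rule Maclaurin_sin_bound)
 moreover have "(\<Sum>m<3. sin_coeff m * x ^ m) = x"
  by (simp add: eval_nat_numeral sin_coeff_def)
 moreover have "inverse (fact 3) * \<bar>x\<bar> ^ 3 = x * (x * x) / 6"
  using assms by (simp add: eval_nat_numeral)
 moreover have "x * (x * x) \<le> x * (2 * 2)"
  using assms by (intro mult_left_mono mult_mono) auto
 ultimately show ?thesis by linarith
qed

lemma arc_setdist_bounds:
 assumes y: "norm y = 1" and E: "closed E" "E \<subseteq> sphere 0 1" "E \<noteq> {}"
 shows "0 \<le> arc_setdist y E" "arc_setdist y E \<le> 1 / 2" "arc_setdist y E = 0 \<longleftrightarrow> y \<in> E"
  "arc_setdist y E \<le> infdist y E"
proof -
 let ?x = "infdist y E / 2"
 have x: "0 \<le> ?x" "?x \<le> 1" using infdist_nonneg[of y E] infdist_sphere_le_2[OF y E(2,3)] by auto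
 have e: "arc_setdist y E = arcsin ?x / pi" by (rule arc_setdist_eq[OF y E])
 have b: "0 \<le> arcsin ?x" "arcsin ?x \<le> pi / 2"
  using arcsin_le_arcsin[of 0 ?x] arcsin_ubound[of ?x] x by auto
 show "0 \<le> arc_setdist y E" using b unfolding e by simp
 show "arc_setdist y E \<le> 1 / 2" using b unfolding e by (simp add: field_simps)
 have "arcsin ?x = 0 \<longleftrightarrow> ?x = 0"
  using x by (metis arcsin_0 sin_arcsin sin_zero order_trans zero_le_one neg_le_0_iff_le)
 then show "arc_setdist y E = 0 \<longleftrightarrow> y \<in> E"
  unfolding e using in_closed_iff_infdist_zero[OF E(1,3), of y] by simp
 have "arcsin ?x / 3 \<le> sin (arcsin ?x)"
  using b pi_less_4 by (intro sin_ge_third) auto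
 then have "arcsin ?x \<le> 3 / 2 * infdist y E" using x by simp
 also have "... \<le> pi * infdist y E"
  using pi_ge_two by (intro mult_right_mono infdist_nonneg) auto
 finally show "arc_setdist y E \<le> infdist y E" unfolding e by (simp add: field_simps)
qed

lemma continuous_on_arc_setdist:
 assumes E: "closed E" "E \<subseteq> sphere 0 1" "E \<noteq> {}"
 shows "continuous_on (sphere 0 1) (%x. arc_setdist x E)"
proof -
 have "continuous_on (sphere 0 1) (%x. arcsin (infdist x E / 2) / pi)"
 proof (intro continuous_on_divide continuous_on_const continuous_on_arcsin ballI)
  show "continuous_on (sphere 0 1) (%x. infdist x E)"
   by (intro continuous_intros)
  fix x :: complex assume "x \<in> sphere 0 1"
  then have "infdist x E \<le> 2" using E by (intro infdist_sphere_le_2) auto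
  then show "- 1 \<le> infdist x E / 2 \<and> infdist x E / 2 \<le> 1"
   using infdist_nonneg[of x E] by auto
 qed auto
 then show ?thesis
  by (rule continuous_on_eq) (use E in "auto simp: arc_setdist_eq")
qed

text \<open>Points on both sides of the cut at 1 are close although their parameters are not, hence
  the minimum. It comes from sin(pi d) = sin(pi (1 - d)), which brings the angle into the range
  where arcsin inverts the sine.\<close>

lemma arc_dist_ge_param:
 assumes "norm x = 1" "norm y = 1"
 defines "d \<equiv> \<bar>circle_param x - circle_param y\<bar>"
 shows "min d (1 - d) \<le> arc_dist x y"
proof -
 let ?s = "circle_param x" and ?t = "circle_param y"
 have d: "0 \<le> d" "d < 1"
  using circle_param_bounds[of x] circle_param_bounds[of y] by (auto simp: d_def)
 have "norm (x - y) = norm (cis (2 * pi * ?s) - cis (2 * pi * ?t))"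
  using assms by (simp add: cis_circle_param)
 also have "... = 2 * \<bar>sin (pi * (?s - ?t))\<bar>"
  unfolding norm_cis_diff by (simp add: right_diff_distrib diff_divide_distrib)
 also have "\<bar>sin (pi * (?s - ?t))\<bar> = \<bar>sin (pi * d)\<bar>"
 proof (cases "?t \<le> ?s")
  case False
  then have "pi * d = - (pi * (?s - ?t))" by (simp add: d_def algebra_simps)
  then have "sin (pi * d) = - sin (pi * (?s - ?t))" by (simp only: sin_minus)
  then show ?thesis by simp
 qed (simp add: d_def)
 also have "... = sin (pi * d)"
  using d by (intro abs_of_nonneg sin_ge_zero) (auto simp: mult_left_le)
 finally have n: "norm (x - y) / 2 = sin (pi * d)" by simp
 have "sin (pi * d) = sin (pi * min d (1 - d))"
 proof (cases "d \<le> 1 - d")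
  case False
  have "sin (pi * (1 - d)) = sin (pi - pi * d)" by (simp add: right_diff_distrib)
  also have "... = sin (pi * d)" by (rule sin_pi_minus)
  finally show ?thesis using False by (simp add: min_def)
 qed (simp add: min_def)
 moreover have "arcsin (sin (pi * min d (1 - d))) = pi * min d (1 - d)"
 proof (rule arcsin_sin)
  have "min d (1 - d) \<le> 1 / 2" by (auto simp: min_def)
  then have "pi * min d (1 - d) \<le> pi * (1 / 2)" by (intro mult_left_mono) auto
  then show "pi * min d (1 - d) \<le> pi / 2" by simp
  have "0 \<le> pi * min d (1 - d)" using d by simp
  then show "- (pi / 2) \<le> pi * min d (1 - d)" using pi_ge_zero by linarith
 qed
 ultimately show ?thesis
  unfolding arc_dist_eq[OF assms(1,2)] n by simp
qed

lemma norm_diff_le_param: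
 assumes "norm x = 1" "norm y = 1"
 shows "norm (x - y) \<le> 2 * pi * \<bar>circle_param x - circle_param y\<bar>"
proof -
 let ?s = "circle_param x" and ?t = "circle_param y"
 have "norm (x - y) = norm (cis (2 * pi * ?s) - cis (2 * pi * ?t))"
  using assms by (simp add: cis_circle_param)
 also have "... = 2 * \<bar>sin (pi * (?s - ?t))\<bar>"
  unfolding norm_cis_diff by (simp add: right_diff_distrib diff_divide_distrib)
 also have "... \<le> 2 * \<bar>pi * (?s - ?t)\<bar>"
  by (intro mult_left_mono abs_sin_x_le_abs_x) auto
 finally show ?thesis by (simp add: abs_mult)
qed

lemma emeasure_circle_param: 
 assumes "A \<in> sets borel"
 shows "emeasure leb {x\<in>sphere 0 1. circle_param x \<in> A} = emeasure lborel (A \<inter> {0..<1})"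
proof -
 have S: "{x\<in>sphere 0 1. circle_param x \<in> A} \<in> sets circle_borel"
  using measurable_sets[OF circle_param_measurable' assms] by (simp add: vimage_def Int_def conj_commute)
 have "{t \<in> {0..<1}. cis (2 * pi * t) \<in> {x \<in> sphere 0 1. circle_param x \<in> A}} = A \<inter> {0..<1}"
  by (auto simp: circle_param_cis)
 then show ?thesis
  using emeasure_circle_lebesgue[OF S] by simp
qed

definition arc_index :: "nat => complex => nat" where
 "arc_index n \<zeta> = nat \<lfloor>2 ^ n * circle_param \<zeta>\<rfloor>"

lemma arc_index_bounds:
 "real (arc_index n x) \<le> 2 ^ n * circle_param x" "2 ^ n * circle_param x < real (arc_index n x) + 1"
 "arc_index n x < 2 ^ n"
proof -
 have nn: "0 \<le> 2 ^ n * circle_param x" using circle_param_bounds by simp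
 then show 1: "real (arc_index n x) \<le> 2 ^ n * circle_param x" "2 ^ n * circle_param x < real (arc_index n x) + 1"
  unfolding arc_index_def by (auto simp: of_nat_nat)
 have "2 ^ n * circle_param x < (2 ^ n :: real)"
  using circle_param_bounds by simp
 with 1(1) have "real (arc_index n x) < (2 ^ n :: real)" by (rule order.strict_trans1)
 then have "real (arc_index n x) < real (2 ^ n)" by simp
 then show "arc_index n x < 2 ^ n" by (simp only: of_nat_less_iff)
qed

lemma arc_index_eq_iff:
 "arc_index n x = j \<longleftrightarrow> real j \<le> 2 ^ n * circle_param x \<and> 2 ^ n * circle_param x < real j + 1"
 using arc_index_bounds[of n x] by auto

lemma arc_index_div: 
 assumes "m \<le> n"
 shows "arc_index m x = arc_index n x div 2 ^ (n - m)"
proof -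
 have "real_of_int \<lfloor>2 ^ n * circle_param x\<rfloor> = real (arc_index n x)" for n
  using circle_param_bounds[of x] by (simp add: arc_index_def of_nat_nat)
 have "(2::real) ^ n = 2 ^ m * 2 ^ (n - m)" using assms by (simp flip: power_add)
 then have "2 ^ m * circle_param x = 2 ^ n * circle_param x / of_nat (2 ^ (n - m))" by simp
 then have "\<lfloor>2 ^ m * circle_param x\<rfloor> = \<lfloor>2 ^ n * circle_param x\<rfloor> div int (2 ^ (n - m))"
  using floor_divide_real_eq_div[of "int (2 ^ (n - m))" "2 ^ n * circle_param x"] by simp
 then show ?thesis
  unfolding arc_index_def using circle_param_bounds[of x] by (simp add: nat_div_distrib nat_power_eq)
qed

lemma arc_index_measurable [measurable]: "arc_index n \<in> circle_borel \<rightarrow>\<^sub>M count_space UNIV"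
 unfolding arc_index_def[abs_def] by measurable

lemma arc_sets [measurable]: "{x\<in>sphere 0 1. arc_index n x = j} \<in> sets circle_borel"
 using measurable_sets[OF arc_index_measurable[of n], of "{j}"] by (simp add: vimage_def Int_def conj_commute)

lemma norm_diff_le_arc_index:
 assumes "norm x = 1" "norm y = 1" "arc_index n x = arc_index n y"
 shows "norm (x - y) \<le> 2 * pi / 2 ^ n"
proof -
 have "2 ^ n * \<bar>circle_param x - circle_param y\<bar> = \<bar>2 ^ n * circle_param x - 2 ^ n * circle_param y\<bar>"
  by (simp add: abs_mult flip: right_diff_distrib)
 also have "... \<le> 1"
  using arc_index_bounds[of n x] arc_index_bounds[of n y] assms(3) by linarith
 finally have "\<bar>circle_param x - circle_param y\<bar> \<le> 1 / 2 ^ n" by (simp add: field_simps)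
 then have "2 * pi * \<bar>circle_param x - circle_param y\<bar> \<le> 2 * pi * (1 / 2 ^ n)"
  by (intro mult_left_mono) auto
 then show ?thesis using norm_diff_le_param[OF assms(1,2)] by simp
qed

text \<open>An affine substitution carries the arc to the unit interval, so that a single integral
  of g serves the arcs of all stages.\<close>

lemma nn_integral_arc:
 assumes g: "g \<in> borel_measurable borel" and j: "j < 2 ^ n"
 shows "(\<integral>\<^sup>+x. g (2 ^ n * circle_param x - real j) * indicator {x. arc_index n x = j} x \<partial>leb) =
  ennreal (1 / 2 ^ n) * (\<integral>\<^sup>+t. g t * indicator {0..<1} t \<partial>lborel)"
proof -
 let ?f = "%t. g (2 ^ n * t - real j) * indicator {0..<1} (2 ^ n * t - real j)"
 have m: "?f \<in> borel_measurable borel" using g by measurable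
 have sub: "t \<in> {0..<1}" if t: "2 ^ n * t - real j \<in> {0..<1}" for t :: real
 proof -
  have 1: "0 \<le> 2 ^ n * t" using t by auto
  have "2 ^ n * t < real j + 1" using t by auto
  also have "... \<le> 2 ^ n" using j by (metis of_nat_Suc of_nat_le_iff Suc_leI of_nat_numeral of_nat_power add.commute)
  finally have "t < 1" by simp
  moreover have "0 \<le> t" using 1 by (simp add: zero_le_mult_iff) (metis not_le zero_less_numeral zero_less_power)
  ultimately show ?thesis by simp
 qed
 have "(\<integral>\<^sup>+x. g (2 ^ n * circle_param x - real j) * indicator {x. arc_index n x = j} x \<partial>leb) =
   (\<integral>\<^sup>+x. ?f (circle_param x) \<partial>leb)"
  by (intro nn_integral_cong) (auto simp: indicator_def arc_index_eq_iff)
 also have "... = (\<integral>\<^sup>+t. ?f t * indicator {0..<1} t \<partial>lborel)"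
  by (rule nn_integral_circle_param[OF m])
 also have "... = (\<integral>\<^sup>+t. ?f t \<partial>lborel)"
  using sub by (intro nn_integral_cong) (auto simp: indicator_def)
 also have "... = ennreal \<bar>1 / 2 ^ n\<bar> * (\<integral>\<^sup>+t. ?f (real j / 2 ^ n + 1 / 2 ^ n * t) \<partial>lborel)"
  by (rule nn_integral_real_affine[OF m]) simp
 also have "(%t. ?f (real j / 2 ^ n + 1 / 2 ^ n * t)) = (%t. g t * indicator {0..<1} t)"
  by (auto simp: distrib_left fun_eq_iff)
 finally show ?thesis by simp
qed

lemma emeasure_arc:
 assumes "j < 2 ^ n"
 shows "emeasure leb {x\<in>sphere 0 1. arc_index n x = j} = ennreal (1 / 2 ^ n)"
proof -
 have "emeasure leb {x\<in>sphere 0 1. arc_index n x = j} =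
   (\<integral>\<^sup>+x. indicator {x\<in>sphere 0 1. arc_index n x = j} x \<partial>leb)"
  by (rule nn_integral_indicator[symmetric]) (simp only: sets_circle_lebesgue arc_sets)
 also have "... = (\<integral>\<^sup>+x. (%_. 1) (2 ^ n * circle_param x - real j) * indicator {x. arc_index n x = j} x \<partial>leb)"
  by (intro nn_integral_cong) (auto simp: indicator_def)
 also have "... = ennreal (1 / 2 ^ n) * (\<integral>\<^sup>+t. (%_. 1) t * indicator {0..<1::real} t \<partial>lborel)"
  by (rule nn_integral_arc[OF _ assms]) simp
 also have "... = ennreal (1 / 2 ^ n)" by simp
 finally show ?thesis .
qed

section \<open>Greedy decomposition along a sequence of partitions\<close>

text \<open>
 From a cell whose remaining mass $m$ exceeds the threshold exactly the mass \<open>T k\<close> is removed, so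
 that no piece has more than \<open>T k\<close> on a cell, and every heavy cell uses up \<open>T k\<close> of the total mass.
\<close>

primrec grid_rest :: "'a measure => (nat => 'a => nat) => (nat => real) => nat => 'a => real" where
 "grid_rest M cell T 0 = (%x. 1)"
| "grid_rest M cell T (Suc k) = (%x.
  let m = (\<integral>y. indicator {y. cell k y = cell k x} y * grid_rest M cell T k y \<partial>M)
  in if m \<le> T k then 0 else grid_rest M cell T k x * (1 - T k / m))"

declare grid_rest.simps(2) [simp del]

text \<open>Only a finite measurable partition and a positive threshold at every stage enter. With a
  constant partition the locale also provides the plain splitting of an integral over arcs, see
  \<open>integral_arcs\<close>.\<close>

locale grid = finite_measure M for M :: "'a measure" +
 fixes cell :: "nat => 'a => nat" and T :: "nat => real" and N :: "nat => nat"
 assumes cell_measurable [measurable]: "\<And>k. cell k \<in> M \<rightarrow>\<^sub>M count_space UNIV"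
  and cell_less: "\<And>k x. x \<in> space M ==> cell k x < N k"
  and T_pos: "\<And>k. 0 < T k"
begin

abbreviation R where "R \<equiv> grid_rest M cell T"

definition mass :: "nat => nat => real" where
 "mass k j = (\<integral>y. indicator {y. cell k y = j} y * R k y \<partial>M)"

definition heavy :: "nat => nat set" where
 "heavy k = {j. T k < mass k j}"

definition piece :: "nat => 'a => real" where
 "piece k x = R k x - R (Suc k) x"

lemma R_Suc: "R (Suc k) x = (if cell k x \<in> heavy k then R k x * (1 - T k / mass k (cell k x)) else 0)"
 by (auto simp: grid_rest.simps(2) heavy_def mass_def Let_def)

lemma R_bounds: "0 \<le> R k x" "R k x \<le> 1"
proof (induction k)
 case (Suc k)
 { case 1 show ?case using Suc T_pos[of k] by (auto simp: R_Suc heavy_def intro!: mult_nonneg_nonneg)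
 next
  case 2 show ?case
   using Suc T_pos[of k] by (auto simp: R_Suc heavy_def intro!: mult_le_one) }
qed auto

lemma R_measurable [measurable]: "R k \<in> borel_measurable M"
proof (induction k)
 case (Suc k)
 have "(%x. if cell k x \<in> heavy k then R k x * (1 - T k / mass k (cell k x)) else 0) \<in> borel_measurable M"
 proof (rule measurable_If)
  show "(%x. R k x * (1 - T k / mass k (cell k x))) \<in> borel_measurable M"
   using Suc by measurable
 qed measurable
 then show ?case by (simp only: R_Suc[abs_def, symmetric])
qed simp

lemma R_integrable: "integrable M (R k)"
 using R_bounds by (intro integrable_const_bound[where B=1]) auto

lemma piece_bounds: "0 \<le> piece k x" "piece k x \<le> 1"
proof -
 have "R (Suc k) x \<le> R k x"
  using R_bounds[of k x] T_pos[of k] by (auto simp: R_Suc heavy_def intro!: mult_left_le)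
 then show "0 \<le> piece k x" "piece k x \<le> 1"
  using R_bounds[of k x] R_bounds[of "Suc k" x] by (auto simp: piece_def)
qed

lemma piece_measurable [measurable]: "piece k \<in> borel_measurable M"
 unfolding piece_def by measurable

lemma piece_integrable: "integrable M (piece k)"
 using piece_bounds by (intro integrable_const_bound[where B=1]) auto

lemma sum_pieces: "(\<Sum>k<n. piece k x) = 1 - R n x"
 by (induction n) (auto simp: piece_def)

lemma cell_indicator_integrable:
 "integrable M f ==> integrable M (%y. indicator {y. cell k y = j} y * (f y :: real))"
proof -
 assume f: "integrable M f"
 have "{y\<in>space M. cell k y = j} \<in> sets M" by measurable
 from integrable_mult_indicator[OF this f]
 show ?thesis
  by (rule Bochner_Integration.integrable_cong[THEN iffD1, OF refl, rotated]) (auto simp: indicator_def)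
qed

lemma piece_mass:
 "(\<integral>y. indicator {y. cell k y = j} y * piece k y \<partial>M) = (if j \<in> heavy k then T k else mass k j)"
proof (cases "j \<in> heavy k")
 case True
 then have "mass k j \<noteq> 0" using T_pos[of k] by (auto simp: heavy_def)
 have "(\<integral>y. indicator {y. cell k y = j} y * piece k y \<partial>M) =
   (\<integral>y. T k / mass k j * (indicator {y. cell k y = j} y * R k y) \<partial>M)"
  using True by (intro LINT_cong refl)
   (auto simp: piece_def R_Suc indicator_def algebra_simps)
 also have "... = T k / mass k j * mass k j"
  unfolding mass_def by (rule integral_mult_right_zero)
 finally show ?thesis using True \<open>mass k j \<noteq> 0\<close> by simp
next
 case False
 have "(\<integral>y. indicator {y. cell k y = j} y * piece k y \<partial>M) = (\<integral>y. indicator {y. cell k y = j} y * R k y \<partial>M)"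
  using False by (intro LINT_cong refl) (auto simp: piece_def R_Suc indicator_def)
 then show ?thesis using False by (simp add: mass_def)
qed

lemma piece_mass_le: "(\<integral>y. indicator {y. cell k y = j} y * piece k y \<partial>M) \<le> T k"
 unfolding piece_mass by (auto simp: heavy_def)

lemma heavy_less: "j \<in> heavy k ==> j < N k"
proof (rule ccontr)
 assume j: "j \<in> heavy k" "\<not> j < N k"
 have "mass k j = (\<integral>y. 0 \<partial>M)"
  unfolding mass_def using j cell_less
  by (intro LINT_cong refl) (auto simp: indicator_def)
 then show False using j T_pos[of k] by (simp add: heavy_def)
qed

lemma finite_heavy: "finite (heavy k)"
 using heavy_less by (intro finite_subset[of "heavy k" "{..<N k}"]) auto

lemma integral_cells:
 assumes f: "integrable M f"
 shows "(\<integral>y. f y \<partial>M) = (\<Sum>j<N k. \<integral>y. indicator {y. cell k y = j} y * (f y :: real) \<partial>M)"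
proof -
 have "(\<integral>y. f y \<partial>M) = (\<integral>y. (\<Sum>j<N k. indicator {y. cell k y = j} y * f y) \<partial>M)"
 proof (intro LINT_cong refl)
  fix y assume "y \<in> space M"
  then have "cell k y \<in> {..<N k}" using cell_less by simp
  moreover have "indicator {y. cell k y = j} y * f y = (if j = cell k y then f y else 0)" for j
   by (auto simp: indicator_def)
  ultimately show "f y = (\<Sum>j<N k. indicator {y. cell k y = j} y * f y)"
   by simp
 qed
 also have "... = (\<Sum>j<N k. \<integral>y. indicator {y. cell k y = j} y * f y \<partial>M)"
  by (intro LINT_sum cell_indicator_integrable f)
 finally show ?thesis .
qed

lemma card_heavy_le: "card (heavy k) * T k \<le> (\<integral>y. piece k y \<partial>M)"
proof -
 have "card (heavy k) * T k = (\<Sum>j\<in>heavy k. \<integral>y. indicator {y. cell k y = j} y * piece k y \<partial>M)"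
  by (simp add: piece_mass)
 also have "... \<le> (\<Sum>j<N k. \<integral>y. indicator {y. cell k y = j} y * piece k y \<partial>M)"
  using heavy_less piece_bounds by (intro sum_mono2 integral_nonneg_AE) auto
 also have "... = (\<integral>y. piece k y \<partial>M)"
  by (rule integral_cells[OF piece_integrable, symmetric])
 finally show ?thesis .
qed

lemma sum_card_heavy_le: "(\<Sum>k<n. card (heavy k) * T k) \<le> measure M (space M)"
proof -
 have "(\<Sum>k<n. card (heavy k) * T k) \<le> (\<Sum>k<n. \<integral>y. piece k y \<partial>M)"
  by (intro sum_mono card_heavy_le)
 also have "... = (\<integral>y. (\<Sum>k<n. piece k y) \<partial>M)"
  by (intro LINT_sum[symmetric] piece_integrable)
 also have "... \<le> (\<integral>y. 1 \<partial>M)"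
  using R_bounds R_integrable unfolding sum_pieces by (intro integral_mono) auto
 finally show ?thesis by simp
qed

lemma R_decreasing: "m \<le> n ==> R n x \<le> R m x"
proof (rule lift_Suc_antimono_le[of "%n. R n x"])
 show "R (Suc n) x \<le> R n x" for n using piece_bounds[of n x] by (simp add: piece_def)
qed

text \<open>A point whose cell is light at some stage loses all its remaining weight there, so the
  remainders tend to 0 almost everywhere, dominated by 1.\<close>

lemma integral_R_tendsto_0:
 assumes "AE x in M. \<exists>k. cell k x \<notin> heavy k"
 shows "(%n. \<integral>x. R n x \<partial>M) \<longlonglongrightarrow> 0"
proof -
 have "(%n. \<integral>x. R n x \<partial>M) \<longlonglongrightarrow> (\<integral>x. 0 \<partial>M)"
 proof (rule integral_dominated_convergence[where w="%_. 1"])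
  show "AE x in M. (%n. R n x) \<longlonglongrightarrow> 0"
   using assms
  proof eventually_elim
   case (elim x)
   then obtain k where k: "cell k x \<notin> heavy k" by blast
   have "R n x = 0" if "n \<ge> Suc k" for n
    using R_decreasing[OF that, of x] R_bounds[of n x] k by (simp add: R_Suc)
   then show ?case
    by (intro tendsto_eventually) (auto simp: eventually_sequentially)
  qed
 qed (use R_bounds in auto)
 then show ?thesis by simp
qed

end

section \<open>Sets left over by light arcs\<close>

text \<open>Open arcs, because their removal has to leave a closed set. The dyadic endpoints then
  stay in the residual set, which adds only a countable set.\<close>

definition open_arc :: "nat => nat => complex set" where
 "open_arc n j = {z. real j < 2 ^ n * circle_param z \<and> 2 ^ n * circle_param z < real j + 1}"

lemma open_open_arc: "j < 2 ^ n ==> open (open_arc n j)"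
proof -
 assume j: "j < 2 ^ n"
 have "real j + 1 \<le> 2 ^ n"
  using j by (metis of_nat_Suc of_nat_le_iff Suc_leI of_nat_numeral of_nat_power add.commute)
 then have "(real j + 1) / 2 ^ n * (2 * pi) \<le> 1 * (2 * pi)"
  by (intro mult_right_mono) auto
 then have "open ({y. real j / 2 ^ n * (2 * pi) < Arg2pi y} \<inter> {y. Arg2pi y < (real j + 1) / 2 ^ n * (2 * pi)})"
  by (intro open_Arg2pi2pi_less_Int) auto
 also have "... = open_arc n j"
  by (auto simp: open_arc_def circle_param_def field_simps)
 finally show ?thesis .
qed

text \<open>The light arcs of stage \<^term>\<open>k\<close> are those whose index is outside \<^term>\<open>H k\<close>.\<close>

definition residual_set :: "(nat => nat) => (nat => nat set) => complex set" where
 "residual_set n H = sphere 0 1 - (\<Union>k. \<Union>j\<in>{..<2 ^ n k} - H k. open_arc (n k) j)"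

lemma residual_set_closed: "closed (residual_set n H)"
 and residual_set_subset: "residual_set n H \<subseteq> sphere 0 1"
 and residual_set_nonempty: "residual_set n H \<noteq> {}"
proof -
 show "closed (residual_set n H)"
  unfolding residual_set_def by (intro closed_Diff open_UN ballI open_open_arc) auto
 \<comment> \<open>The point 1 is an endpoint of arcs at every stage, so it is never
   removed.\<close>
 have "circle_param 1 = 0" by (simp add: circle_param_def Arg2pi_eq_0)
 then have "1 \<in> residual_set n H"
  by (auto simp: residual_set_def open_arc_def)
 then show "residual_set n H \<noteq> {}" by blast
qed (auto simp: residual_set_def)

lemma heavy_in_residual_set:
 assumes "norm x = 1" "\<And>k. arc_index (n k) x \<in> H k"
 shows "x \<in> residual_set n H"
proof (rule ccontr)
 assume "x \<notin> residual_set n H"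
 then obtain k j where j: "j < 2 ^ n k" "j \<notin> H k" "x \<in> open_arc (n k) j"
  using assms by (auto simp: residual_set_def)
 then have "arc_index (n k) x = j" by (auto simp: arc_index_eq_iff open_arc_def)
 then show False using j assms by auto
qed

text \<open>Residual points lie outside the open light arc of y, hence in the parameter at least as
  far from y as the nearer endpoint; x is the position of y in that arc, rescaled to the unit
  interval.\<close>

lemma arc_setdist_residual_ge:
 assumes y: "norm y = 1" and j: "arc_index (n k) y \<notin> H k"
 defines "x \<equiv> 2 ^ n k * circle_param y - real (arc_index (n k) y)"
 shows "min x (1 - x) / 2 ^ n k \<le> arc_setdist y (residual_set n H)"
proof -
 let ?F = "residual_set n H" and ?j = "arc_index (n k) y" and ?s = "circle_param y" and ?M = "2 ^ n k :: real"
 have M: "0 < ?M" by simp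
 have x: "0 \<le> x" "x < 1" using arc_index_bounds[of "n k" y] by (auto simp: x_def)
 have "min x (1 - x) / ?M \<le> arc_dist y u" if u: "u \<in> ?F" for u
 proof -
  let ?t = "circle_param u"
  have n: "norm u = 1" using u by (auto simp: residual_set_def)
  have "u \<notin> open_arc (n k) ?j"
   using u j arc_index_bounds(3)[of "n k" y] by (auto simp: residual_set_def)
  then have t: "?M * ?t \<le> real ?j \<or> real ?j + 1 \<le> ?M * ?t"
   by (auto simp: open_arc_def not_less)
  have t01: "0 \<le> ?M * ?t" "?M * ?t \<le> ?M"
   using circle_param_bounds[of u] by (auto simp: mult_left_le intro: less_imp_le)
  have jM: "real ?j + 1 \<le> ?M"
   using arc_index_bounds(3)[of "n k" y]
   by (metis of_nat_Suc of_nat_le_iff Suc_leI of_nat_numeral of_nat_power add.commute)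
  have d: "?M * \<bar>?s - ?t\<bar> = \<bar>?M * ?s - ?M * ?t\<bar>"
   by (simp add: abs_mult flip: right_diff_distrib)
  \<comment> \<open>The second inequality covers the way around through the parameter 0: in units of
    one arc the full circle has length K.\<close>
  have gen: "min (a - J) (1 - (a - J)) \<le> \<bar>a - b\<bar>" "min (a - J) (1 - (a - J)) \<le> K - \<bar>a - b\<bar>"
   if "J \<le> a" "a < J + 1" "b \<le> J \<or> J + 1 \<le> b" "0 \<le> J" "0 \<le> b" "b \<le> K" "J + 1 \<le> K" for J a b K :: real
   using that by (auto simp: min_def abs_if)
  have J: "real ?j \<le> ?M * ?s" "?M * ?s < real ?j + 1" "0 \<le> real ?j"
   using arc_index_bounds[of "n k" y] by auto
  have "min x (1 - x) \<le> ?M * \<bar>?s - ?t\<bar>"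
   unfolding d x_def by (rule gen(1)[OF J(1,2) t J(3) t01 jM])
  moreover have "min x (1 - x) \<le> ?M * (1 - \<bar>?s - ?t\<bar>)"
   unfolding right_diff_distrib[of _ 1] mult_1_right d x_def by (rule gen(2)[OF J(1,2) t J(3) t01 jM])
  ultimately have "min x (1 - x) \<le> ?M * min \<bar>?s - ?t\<bar> (1 - \<bar>?s - ?t\<bar>)"
   by (auto simp: min_def)
  then have "min x (1 - x) / ?M \<le> min \<bar>?s - ?t\<bar> (1 - \<bar>?s - ?t\<bar>)"
   by (subst pos_divide_le_eq[OF M]) (metis mult.commute)
  also have "... \<le> arc_dist y u"
   by (rule arc_dist_ge_param[OF y n])
  finally show ?thesis .
 qed
 then show ?thesis
  unfolding arc_setdist_def by (intro cINF_greatest residual_set_nonempty)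
qed

context circle_measure
begin

lemma arc_grid: "(\<And>k. 0 < T k) ==> grid \<kappa> (%k. arc_index (n k)) T (%k. 2 ^ n k)"
 using arc_index_bounds(3)
 by (intro grid.intro grid_axioms.intro finite_measure_axioms) (auto simp: measurable_circle_iff)

lemma integral_arcs:
 fixes f :: "complex => real"
 assumes "integrable \<kappa> f"
 shows "(\<integral>x. f x \<partial>\<kappa>) = (\<Sum>j<2 ^ n. \<integral>x. indicator {x. arc_index n x = j} x * f x \<partial>\<kappa>)"
  and "integrable \<kappa> (%x. indicator {x. arc_index n x = j} x * f x)"
proof -
 interpret g: grid \<kappa> "%k. arc_index n" "%_. 1" "%k. 2 ^ n"
  by (rule arc_grid) simp
 show "(\<integral>x. f x \<partial>\<kappa>) = (\<Sum>j<2 ^ n. \<integral>x. indicator {x. arc_index n x = j} x * f x \<partial>\<kappa>)"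
  by (rule g.integral_cells[OF assms])
 show "integrable \<kappa> (%x. indicator {x. arc_index n x = j} x * f x)"
  by (rule g.cell_indicator_integrable[OF assms])
qed

end

text \<open>Moving the boundary point by a times the distance of z to the circle changes |x - z| by
  a factor of at most 1 + a.\<close>

lemma poisson_Harnack:
 assumes "norm x = 1" "norm y = 1" "norm z < 1" "norm (x - y) \<le> a * (1 - norm z)" "0 \<le> a"
 shows "poisson z x \<le> (1 + a)\<^sup>2 * poisson z y"
proof -
 have n: "0 < norm (x - z)" "0 < norm (y - z)" using assms by auto
 have "norm (y - z) \<le> norm (x - z) + norm (x - y)"
  using norm_triangle_ineq4[of "x - z" "x - y"] by simp
 also have "norm (x - y) \<le> a * norm (x - z)"
  using assms(4) mult_left_mono[OF circle_minus_disc_ge[OF assms(1), of z] assms(5)] by linarith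
 finally have "norm (y - z) \<le> (1 + a) * norm (x - z)" by (simp add: algebra_simps)
 then have "(norm (y - z))\<^sup>2 \<le> ((1 + a) * norm (x - z))\<^sup>2"
  by (intro power_mono) auto
 then have "1 / (norm (x - z))\<^sup>2 \<le> (1 + a)\<^sup>2 / (norm (y - z))\<^sup>2"
  using n unfolding power_mult_distrib by (simp add: field_simps)
 moreover have "0 \<le> 1 - (norm z)\<^sup>2" using assms(3) by (simp add: power_le_one_iff)
 ultimately have "(1 - (norm z)\<^sup>2) * (1 / (norm (x - z))\<^sup>2) \<le> (1 - (norm z)\<^sup>2) * ((1 + a)\<^sup>2 / (norm (y - z))\<^sup>2)"
  by (rule mult_left_mono)
 then show ?thesis by (simp add: poisson_def mult.commute)
qed

text \<open>On an arc of length 2^(-n) <= 1 - |z| the kernel is comparable with its mean over the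
  arc, so mass at most T on each arc acts like a density of at most 2^n T. Points of one arc are
  within 2 pi 2^(-n), which gives the Harnack factor (1 + 2 pi)^2.\<close>

lemma (in circle_measure) poisson_integral_arcs_le:
 assumes \<theta>: "\<theta> \<in> borel_measurable \<kappa>" "\<And>x. 0 \<le> \<theta> x" "\<And>x. \<theta> x \<le> 1"
  and T: "\<And>j. (\<integral>x. indicator {x. arc_index n x = j} x * \<theta> x \<partial>\<kappa>) \<le> T"
  and z: "norm z < 1" "1 / 2 ^ n \<le> 1 - norm z"
 shows "(\<integral>x. \<theta> x * poisson z x \<partial>\<kappa>) \<le> (1 + 2 * pi)\<^sup>2 * 2 ^ n * T"
proof -
 let ?I = "%j x. indicator {x. arc_index n x = j} x :: real"
 define C where "C = (1 + 2 * pi)\<^sup>2"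
 define p where "p j = (\<oint>y. ?I j y * poisson z y)" for j
 have C0: "0 \<le> C" by (simp add: C_def)
 have p0: "0 \<le> p j" for j
  unfolding p_def using z by (intro integral_nonneg_AE) auto
 have int\<theta>: "integrable \<kappa> \<theta>"
  using \<theta> by (intro integrable_const_bound[where B=1]) auto
 have int: "integrable \<kappa> (%x. \<theta> x * poisson z x)"
  using \<theta> z
  by (intro LINT_integrable_bound[OF integrable_poisson[OF z(1)]])
   (auto intro!: mult_left_le_one_le borel_measurable_times continuous_intros simp: abs_mult)
 have le: "poisson z x \<le> C * 2 ^ n * p j" if "norm x = 1" "arc_index n x = j" for x j
 proof -
  have j: "j < 2 ^ n" using that arc_index_bounds(3) by auto
  have intI: "integrable leb (?I j)"
   using leb.integral_arcs(2)[of "%_. 1"] by simp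
  have "(\<oint>y. ?I j y) = measure leb {x\<in>sphere 0 1. arc_index n x = j}"
   using arc_sets[of n j] by (simp add: Int_def conj_commute)
  then have 1: "(\<oint>y. ?I j y) = 1 / 2 ^ n"
   using emeasure_arc[OF j] by (simp add: measure_def)
  have "poisson z x / 2 ^ n = (\<oint>y. ?I j y * poisson z x)"
   using 1 by simp
  also have "... \<le> (\<oint>y. C * (?I j y * poisson z y))"
  proof (intro integral_mono)
   show "integrable leb (%y. ?I j y * poisson z x)"
    using intI by simp
   show "integrable leb (%y. C * (?I j y * poisson z y))"
    using z by (intro integrable_mult_right leb.integral_arcs(2)) simp
   fix y assume "y \<in> space leb"
   then have y: "norm y = 1" by simp
   show "?I j y * poisson z x \<le> C * (?I j y * poisson z y)"
   proof (cases "arc_index n y = j")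
    case True
    have "norm (x - y) \<le> 2 * pi * (1 / 2 ^ n)"
     using norm_diff_le_arc_index[OF that(1) y, of n] that True by simp
    also have "... \<le> 2 * pi * (1 - norm z)" using z by (intro mult_left_mono) auto
    finally have "poisson z x \<le> C * poisson z y"
     unfolding C_def using z by (intro poisson_Harnack that y) auto
    then show ?thesis using True by simp
   qed simp
  qed
  also have "... = C * p j" by (simp add: p_def)
  finally show ?thesis by (simp add: field_simps)
 qed
 have "(\<integral>x. \<theta> x * poisson z x \<partial>\<kappa>) = (\<Sum>j<2 ^ n. \<integral>x. ?I j x * (\<theta> x * poisson z x) \<partial>\<kappa>)"
  by (rule integral_arcs[OF int])
 also have "... \<le> (\<Sum>j<2 ^ n. C * 2 ^ n * p j * T)"
 proof (intro sum_mono)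
  fix j
  have "(\<integral>x. ?I j x * (\<theta> x * poisson z x) \<partial>\<kappa>) \<le> (\<integral>x. C * 2 ^ n * p j * (?I j x * \<theta> x) \<partial>\<kappa>)"
  proof (intro integral_mono integrable_mult_right integral_arcs int int\<theta>)
   fix x assume "x \<in> space \<kappa>"
   then show "?I j x * (\<theta> x * poisson z x) \<le> C * 2 ^ n * p j * (?I j x * \<theta> x)"
    using le[of x j] \<theta>(2)[of x] by (auto simp: indicator_def mult.commute intro: mult_left_mono)
  qed
  also have "... = C * 2 ^ n * p j * (\<integral>x. ?I j x * \<theta> x \<partial>\<kappa>)"
   by (rule integral_mult_right_zero)
  also have "... \<le> C * 2 ^ n * p j * T"
   using C0 p0 by (intro mult_left_mono T) auto
  finally show "(\<integral>x. ?I j x * (\<theta> x * poisson z x) \<partial>\<kappa>) \<le> C * 2 ^ n * p j * T" .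
 qed
 also have "... = C * 2 ^ n * T * (\<Sum>j<2 ^ n. p j)"
  by (simp add: sum_distrib_left mult_ac)
 also have "(\<Sum>j<2 ^ n. p j) = 1"
  unfolding p_def using z
  by (subst leb.integral_arcs(1)[symmetric]) (auto simp: integral_poisson_lebesgue)
 finally show ?thesis by (simp add: C_def)
qed

text \<open>An integrable majorant of the logarithmic singularities at both ends of an arc, from ln
  u <= u with u the square root of 2/y.\<close>

lemma ln_two_over_min_le:
 assumes "0 < x" "x < (1::real)"
 shows "ln (2 / min x (1 - x)) \<le> 4 * (x powr (-1/2) + (1 - x) powr (-1/2))"
proof -
 define y where "y = min x (1 - x)"
 have y: "0 < y" "y = x \<or> y = 1 - x" using assms by (auto simp: y_def min_def)
 have "ln (2 / y) = 2 * ln ((2 / y) powr (1/2))"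
  using y by (simp add: ln_powr)
 also have "... \<le> 2 * (2 / y) powr (1/2)"
  using y by (intro mult_left_mono ln_bound) auto
 also have "... \<le> 2 * (4 / y) powr (1/2)"
  using y by (intro mult_left_mono powr_mono2 divide_right_mono) auto
 also have "(4 / y) powr (1/2) = 2 * y powr (-1/2)"
 proof -
  have "(4 / y) powr (1/2) = sqrt (4 / y)" using y by (intro powr_half_sqrt) simp
  also have "... = 2 / sqrt y" by (simp add: real_sqrt_divide)
  also have "sqrt y = y powr (1/2)" using y by (simp add: powr_half_sqrt)
  also have "2 / y powr (1/2) = 2 * y powr - (1/2)" by (simp add: powr_minus_divide)
  finally show ?thesis by simp
 qed
 finally have "ln (2 / y) \<le> 4 * y powr (-1/2)" by simp
 also have "... \<le> 4 * (x powr (-1/2) + (1 - x) powr (-1/2))"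
  using y by auto
 finally show ?thesis by (simp add: y_def)
qed

lemma nn_integral_inverse_sqrt_finite:
 "(\<integral>\<^sup>+x. ennreal (4 * (x powr (-1/2) + (1 - x) powr (-1/2))) * indicator {0..<1} x \<partial>lborel) < \<infinity>"
proof -
 let ?f = "%x::real. indicator {0..1} x * x powr (-1/2)"
 have "((%x. x powr (-1/2)) has_integral (1 powr (-1/2 + 1) / (-1/2 + 1))) {0..1::real}"
  by (rule has_integral_powr_from_0) auto
 then have "(?f has_integral 2) UNIV"
  by (subst (asm) has_integral_restrict_UNIV[symmetric])
   (simp add: indicator_def of_bool_def if_distrib[of "%a. a * _"] cong: if_cong)
 then have 1: "(\<integral>\<^sup>+x. ennreal (?f x) \<partial>lborel) = 2"
  by (subst nn_integral_has_integral_lborel[where I=2]) auto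
 have "(\<integral>\<^sup>+x. ennreal (?f x) \<partial>lborel) = ennreal \<bar>-1\<bar> * (\<integral>\<^sup>+x. ennreal (?f (1 + (-1) * x)) \<partial>lborel)"
  by (rule nn_integral_real_affine) auto
 then have 2: "(\<integral>\<^sup>+x. ennreal (?f (1 - x)) \<partial>lborel) = 2"
  using 1 by simp
 have "(\<integral>\<^sup>+x. ennreal (4 * (x powr (-1/2) + (1 - x) powr (-1/2))) * indicator {0..<1} x \<partial>lborel)
   \<le> (\<integral>\<^sup>+x. 4 * (ennreal (?f x) + ennreal (?f (1 - x))) \<partial>lborel)"
  by (intro nn_integral_mono) (auto simp: indicator_def ennreal_mult ennreal_plus)
 also have "... = 4 * ((\<integral>\<^sup>+x. ennreal (?f x) \<partial>lborel) + (\<integral>\<^sup>+x. ennreal (?f (1 - x)) \<partial>lborel))"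
  by (subst nn_integral_cmult, simp, subst nn_integral_add) auto
 also have "... = 16"
  unfolding 1 2 by simp
 finally show ?thesis by (simp add: le_less_trans)
qed

context weight
begin

text \<open>At t = 0 both sides are 0, because 1/0 = 0 and ln 0 = 0. Points of the set itself thus
  contribute 0 instead of infinity to the entropy integrand, which is harmless on a null
  set.\<close>

lemma lam_eq: "0 \<le> t ==> t \<le> 1 ==> lam t = - ln (w t)"
 using w_pos[of t] by (cases "t = 0") (auto simp: lam_def ln_div)

lemma lam_arc_setdist_measurable:
 assumes E: "closed E" "E \<subseteq> sphere 0 1" "E \<noteq> {}"
 shows "(%x. lam (arc_setdist x E)) \<in> borel_measurable leb"
proof -
 have "continuous_on (sphere 0 1) (%x. w (arc_setdist x E))"
 proof (rule continuous_on_compose2[OF w_cont continuous_on_arc_setdist[OF E]])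
  show "(%x. arc_setdist x E) ` sphere 0 1 \<subseteq> {0..1}"
   using arc_setdist_bounds(1,2)[OF _ E] by fastforce
 qed
 then have "(%x. w (arc_setdist x E)) \<in> borel_measurable leb"
  by (rule leb.borel_measurable_continuous)
 then show ?thesis unfolding lam_def by measurable
qed

lemma lam_arc_setdist:
 assumes E: "closed E" "E \<subseteq> sphere 0 1" "E \<noteq> {}" and x: "norm x = 1"
 shows "0 \<le> lam (arc_setdist x E)" "ln (w (arc_setdist x E)) = - lam (arc_setdist x E)"
proof -
 have b: "0 \<le> arc_setdist x E" "arc_setdist x E \<le> 1"
  using arc_setdist_bounds(1,2)[OF x E] by auto
 show "0 \<le> lam (arc_setdist x E)" "ln (w (arc_setdist x E)) = - lam (arc_setdist x E)"
  using lam_nonneg[OF b] lam_eq[OF b] by auto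
qed

lemma finite_entropyI:
 assumes E: "closed E" "E \<subseteq> sphere 0 1" "E \<noteq> {}" and null: "emeasure leb E = 0"
  and fin: "(\<integral>\<^sup>+x. ennreal (lam (arc_setdist x E)) \<partial>leb) < \<infinity>"
 shows "finite_entropy w E"
proof -
 have "integrable leb (%x. lam (arc_setdist x E))"
 proof (rule integrableI_bounded[OF lam_arc_setdist_measurable[OF E]])
  have "(\<integral>\<^sup>+x. ennreal (norm (lam (arc_setdist x E))) \<partial>leb) = (\<integral>\<^sup>+x. ennreal (lam (arc_setdist x E)) \<partial>leb)"
   using lam_arc_setdist(1)[OF E] by (intro nn_integral_cong) simp
  then show "(\<integral>\<^sup>+x. ennreal (norm (lam (arc_setdist x E))) \<partial>leb) < \<infinity>"
   using fin by simp
 qed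
 then have "integrable leb (%x. - lam (arc_setdist x E))" by simp
 moreover have "integrable leb (%x. - lam (arc_setdist x E)) \<longleftrightarrow>
   integrable leb (%x. ln (w (arc_setdist x E)))"
  using lam_arc_setdist(2)[OF E] by (intro Bochner_Integration.integrable_cong) auto
 ultimately show ?thesis using E null by (simp add: finite_entropy_def)
qed

lemma finite_entropyD:
 assumes "finite_entropy w E"
 shows "closed E" "E \<subseteq> sphere 0 1" "E \<noteq> {}" "emeasure leb E = 0"
  "integrable leb (%x. lam (arc_setdist x E))"
proof -
 show E: "closed E" "E \<subseteq> sphere 0 1" "E \<noteq> {}" "emeasure leb E = 0"
  using assms by (auto simp: finite_entropy_def)
 have "integrable leb (%x. - ln (w (arc_setdist x E)))"
  using assms by (simp add: finite_entropy_def)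
 moreover have "integrable leb (%x. - ln (w (arc_setdist x E))) \<longleftrightarrow>
   integrable leb (%x. lam (arc_setdist x E))"
  using lam_arc_setdist(2)[OF E(1-3)] by (intro Bochner_Integration.integrable_cong) auto
 ultimately show "integrable leb (%x. lam (arc_setdist x E))" by simp
qed

text \<open>
 On stage $k$ the function \<open>lam\<close> is $2^{k+K}$ up to a bounded error. The total length of the heavy
 arcs is then $O(2^{-k})$, which makes the entropy of what they leave over finite.
\<close>

definition scale :: "nat => nat => nat" where
 "scale K k = (LEAST n. 2 ^ (k + K) \<le> lam ((1/2) ^ n))"

definition eps :: "nat => nat => real" where
 "eps K k = (1/2) ^ scale K k"

lemma scale_ex: "\<exists>n. 2 ^ (k + K) \<le> lam ((1/2) ^ n)"
proof -
 obtain d where d: "0 < d" "\<And>t. 0 < t ==> t \<le> d ==> 2 ^ (k + K) \<le> lam t"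
  by (rule lam_at_top[of "2 ^ (k + K)"]) blast
 obtain n where "(1/2::real) ^ n < d"
  using real_arch_pow_inv[OF d(1), of "1/2"] by auto
 then have "2 ^ (k + K) \<le> lam ((1/2) ^ n)" by (intro d) auto
 then show ?thesis ..
qed

lemma eps_pos: "0 < eps K k" "eps K k \<le> 1" "eps K k = 1 / 2 ^ scale K k"
 by (auto simp: eps_def power_le_one power_one_over)

lemma lam_eps_ge: "2 ^ (k + K) \<le> lam (eps K k)"
 unfolding eps_def scale_def using scale_ex[of k K] by (rule LeastI_ex)

lemma lam_eps_ge_1: "1 \<le> lam (eps K k)"
 by (rule order_trans[OF _ lam_eps_ge]) simp

lemma scale_mono: "scale K k \<le> scale K (Suc k)"
 unfolding scale_def[of K k]
proof (rule Least_le)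
 have "(2::real) ^ (k + K) \<le> 2 ^ (Suc k + K)" by simp
 also have "... \<le> lam ((1/2) ^ scale K (Suc k))"
  using lam_eps_ge[of "Suc k" K] by (simp only: eps_def)
 finally show "2 ^ (k + K) \<le> lam ((1/2) ^ scale K (Suc k))" .
qed

text \<open>By minimality the dyadic number before \<open>eps K k\<close> stays below the level, and
  one halving raises \<open>lam\<close> by at most D ln 4. At scale 0 there is no predecessor, which
  is why \<open>lam 1\<close> enters the constant.\<close>

lemma lam_eps_le:
 obtains D where "0 < D" "\<And>K k. lam (eps K k) \<le> 2 ^ (k + K) + D"
proof -
 obtain D where D: "0 < D" "\<And>t l. 0 < t ==> t \<le> l ==> l \<le> 1 ==> lam t \<le> lam l + D * ln (2 * l / t)"
  by (rule lam_compare) blast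
 have "lam (eps K k) \<le> 2 ^ (k + K) + (D * ln 4 + lam 1)" for K k
 proof (cases "scale K k")
  case 0
  have "0 \<le> (2::real) ^ (k + K) + D * ln 4" using D by (intro add_nonneg_nonneg) auto
  then show ?thesis by (simp add: eps_def 0)
 next
  case (Suc n)
  have "\<not> 2 ^ (k + K) \<le> lam ((1/2) ^ n)"
   using Suc not_less_Least[of n "%n. 2 ^ (k + K) \<le> lam ((1/2) ^ n)"] by (simp add: scale_def)
  moreover have "lam ((1/2) ^ Suc n) \<le> lam ((1/2) ^ n) + D * ln (2 * (1/2) ^ n / (1/2) ^ Suc n)"
   by (rule D(2)) (auto simp: power_le_one)
  moreover have "D * ln (2 * (1/2) ^ n / (1/2) ^ Suc n) = D * ln 4" by simp
  moreover have "0 \<le> lam 1" by (rule lam_nonneg) auto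
  ultimately have "lam ((1/2) ^ Suc n) \<le> 2 ^ (k + K) + (D * ln 4 + lam 1)" by linarith
  then show ?thesis unfolding eps_def Suc .
 qed
 moreover have "0 < D * ln 4 + lam 1"
  using D lam_nonneg[of 1] by (intro add_pos_nonneg) auto
 ultimately show thesis using that by blast
qed

end

section \<open>Singular inner functions of measures vanishing on sets of finite entropy\<close>

text \<open>The parameter a bounds the growth of each quotient and will be small against the
  constants of the weight; K starts the stages so close to the circle that the sum of all errors is
  small. The residual set has finite entropy for every choice of the two.\<close>

locale roberts = weight w c + circle_measure \<kappa> for w c \<kappa> +
 fixes a :: real and K :: nat
 assumes a_pos: "0 < a"
begin

sublocale grid \<kappa> "%k. arc_index (scale K k)" "%k. a * eps K k * lam (eps K k)" "%k. 2 ^ scale K k"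
 by (rule arc_grid, intro mult_pos_pos a_pos eps_pos(1) less_le_trans[OF zero_less_one lam_eps_ge_1])

text \<open>The threshold is at least \<open>a * eps K k\<close> times 2^k because
  \<open>lam (eps K k)\<close> >= 2^k, and the heavy arcs together cannot use up more than the total
  mass.\<close>

lemma card_heavy_eps_le: "card (heavy k) * eps K k \<le> measure \<kappa> (sphere 0 1) / a / 2 ^ k"
proof -
 have "card (heavy k) * (a * eps K k * lam (eps K k)) \<le> (\<integral>y. piece k y \<partial>\<kappa>)"
  by (rule card_heavy_le)
 also have "... \<le> (\<integral>y. 1 \<partial>\<kappa>)"
  using piece_bounds piece_integrable by (intro integral_mono) auto
 also have "... = measure \<kappa> (sphere 0 1)" by simp
 finally have 1: "card (heavy k) * (a * eps K k * lam (eps K k)) \<le> measure \<kappa> (sphere 0 1)" .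
 have "(2::real) ^ k \<le> 2 ^ (k + K)" by (rule power_increasing) auto
 then have "2 ^ k \<le> lam (eps K k)" using lam_eps_ge[of k K] by linarith
 then have "card (heavy k) * (a * eps K k) * 2 ^ k \<le> card (heavy k) * (a * eps K k) * lam (eps K k)"
  using a_pos eps_pos(1)[of K k] by (intro mult_left_mono) auto
 with 1 have "card (heavy k) * (a * eps K k) * 2 ^ k \<le> measure \<kappa> (sphere 0 1)"
  by (simp add: mult_ac)
 then show ?thesis using a_pos by (simp add: field_simps)
qed

text \<open>Points that are heavy at every stage lie, for each k, in a set of measure
  O(2^(-k)).\<close>

lemma AE_light: "AE x in leb. \<exists>k. arc_index (scale K k) x \<notin> heavy k"
proof -
 define A where "A k = {x\<in>space leb. arc_index (scale K k) x \<in> heavy k}" for k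
 have A: "A k \<in> sets leb" for k unfolding A_def by measurable
 have mA: "measure leb (A k) \<le> measure \<kappa> (sphere 0 1) / a / 2 ^ k" for k
 proof -
  have "A k = (\<Union>j\<in>heavy k. {x\<in>sphere 0 1. arc_index (scale K k) x = j})" by (auto simp: A_def)
  then have "measure leb (A k) \<le>
    (\<Sum>j\<in>heavy k. measure leb {x\<in>sphere 0 1. arc_index (scale K k) x = j})"
   by (simp only:) (intro leb.finite_measure_subadditive_finite finite_heavy, auto simp: arc_sets simp del: mem_sphere mem_sphere_0)
  also have "... = (\<Sum>j\<in>heavy k. eps K k)"
   using heavy_less by (intro sum.cong refl) (simp add: measure_def emeasure_arc eps_pos(3) del: mem_sphere mem_sphere_0)
  also have "... = card (heavy k) * eps K k" by simp
  also have "... \<le> measure \<kappa> (sphere 0 1) / a / 2 ^ k" by (rule card_heavy_eps_le)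
  finally show ?thesis .
 qed
 have I: "(\<Inter>k. A k) \<in> sets leb" using A by blast
 have bound: "measure leb (\<Inter>k. A k) \<le> measure \<kappa> (sphere 0 1) / a * (1/2) ^ k" for k
 proof -
  have "measure leb (\<Inter>k. A k) \<le> measure leb (A k)"
   by (intro leb.finite_measure_mono A) auto
  also have "... \<le> measure \<kappa> (sphere 0 1) / a / 2 ^ k" by (rule mA)
  also have "... = measure \<kappa> (sphere 0 1) / a * (1/2) ^ k" by (simp add: power_one_over)
  finally show ?thesis .
 qed
 have "(%k. measure \<kappa> (sphere 0 1) / a * (1/2) ^ k) \<longlonglongrightarrow> measure \<kappa> (sphere 0 1) / a * 0"
  by (rule tendsto_mult_left[OF LIMSEQ_power_zero]) simp
 then have "measure leb (\<Inter>k. A k) \<le> measure \<kappa> (sphere 0 1) / a * 0"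
  by (rule LIMSEQ_le_const) (intro exI allI impI bound)
 then have "measure leb (\<Inter>k. A k) \<le> 0" by simp
 then have "emeasure leb (\<Inter>k. A k) = 0"
  using leb.emeasure_eq_measure[of "\<Inter>k. A k"] by (simp add: ennreal_neg)
 then have "AE x in leb. x \<notin> (\<Inter>k. A k)"
  using I by (intro AE_not_in) (simp add: null_sets_def)
 then show ?thesis
  using AE_space by eventually_elim (auto simp: A_def)
qed

lemma AE_not_grid_point: "AE x in leb. \<forall>n j. 2 ^ n * circle_param x \<noteq> real j"
proof -
 define A where "A = (\<Union>n. \<Union>j. {real j / 2 ^ n})"
 have "countable A" unfolding A_def by auto
 then have "A \<in> null_sets lborel" by (rule countable_imp_null_set_lborel)
 then have "A \<in> sets borel" "emeasure lborel A = 0" by (auto simp: null_sets_def)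
 moreover have "emeasure lborel (A \<inter> {0..<1}) \<le> emeasure lborel A"
  using \<open>A \<in> sets borel\<close> by (intro emeasure_mono) auto
 ultimately have "emeasure leb {x\<in>sphere 0 1. circle_param x \<in> A} = 0"
  using emeasure_circle_param[OF \<open>A \<in> sets borel\<close>] by simp
 moreover have "{x\<in>sphere 0 1. circle_param x \<in> A} \<in> sets leb"
  using measurable_sets[OF circle_param_measurable' \<open>A \<in> sets borel\<close>]
  by (simp add: vimage_def Int_def conj_commute)
 ultimately have "AE x in leb. x \<notin> {x\<in>sphere 0 1. circle_param x \<in> A}"
  by (intro AE_not_in) (simp add: null_sets_def)
 then show ?thesis
  using AE_space
 proof eventually_elim
  case (elim x)
  then have "circle_param x \<notin> A" by simp
  then have "circle_param x \<noteq> real j / 2 ^ n" for n j by (auto simp: A_def)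
  then show ?case by (auto simp: field_simps)
 qed
qed

abbreviation F where "F \<equiv> residual_set (scale K) heavy"

lemma F_sets: "F \<in> sets leb"
 using closed_sets_circle[OF residual_set_closed residual_set_subset] by simp

lemma F_null: "emeasure leb F = 0"
proof -
 have "AE x in leb. x \<notin> F"
  using AE_light AE_not_grid_point
 proof eventually_elim
  case (elim x)
  then obtain k where k: "arc_index (scale K k) x \<notin> heavy k" by blast
  have "x \<in> open_arc (scale K k) (arc_index (scale K k) x)"
   using arc_index_bounds[of "scale K k" x] elim(2)[rule_format, of "scale K k" "arc_index (scale K k) x"]
   by (simp add: open_arc_def)
  then show ?case using k arc_index_bounds(3)[of "scale K k" x] by (auto simp: residual_set_def)
 qed
 then show ?thesis
  by (rule AE_iff_null_sets[OF F_sets, THEN iffD2, THEN null_setsD1])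
qed

text \<open>Almost every y has a first light stage k. If x is its position in the light arc, its
  distance to F is at least min(x, 1 - x) times \<open>eps K k\<close>, so \<open>lam\<close> of the
  distance is \<open>lam (eps K k)\<close> plus a logarithm in x. For k > 0 that arc lies in a heavy
  arc of stage k - 1, and the total contribution of such arcs is comparable with the sum of the
  thresholds over the heavy arcs of stage k - 1, which is summable.\<close>

lemma F_entropy: "finite_entropy w F"
proof (rule finite_entropyI[OF residual_set_closed residual_set_subset residual_set_nonempty F_null])
 let ?s = "scale K" and ?e = "eps K"
 obtain D where D: "0 < D" "\<And>t l. 0 < t ==> t \<le> l ==> l \<le> 1 ==> lam t \<le> lam l + D * ln (2 * l / t)"
  by (rule lam_compare) blast
 obtain D' where D': "0 < D'" "\<And>K k. lam (eps K k) \<le> 2 ^ (k + K) + D'"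
  by (rule lam_eps_le) blast
 define \<psi> :: "real => real" where "\<psi> x = 4 * (x powr (-1/2) + (1 - x) powr (-1/2))" for x
 have \<psi>0: "0 \<le> \<psi> x" for x by (simp add: \<psi>_def)
 have \<psi>m[measurable]: "\<psi> \<in> borel_measurable borel" unfolding \<psi>_def by measurable
 define Q where "Q = enn2real (\<integral>\<^sup>+x. ennreal (\<psi> x) * indicator {0..<1} x \<partial>lborel)"
 have Q: "(\<integral>\<^sup>+x. ennreal (\<psi> x) * indicator {0..<1} x \<partial>lborel) = ennreal Q" "0 \<le> Q"
  using nn_integral_inverse_sqrt_finite by (auto simp: Q_def \<psi>_def)
 define G where "G k x = ennreal (lam (?e k) + D * \<psi> x)" for k x
 have Gm[measurable]: "G k \<in> borel_measurable borel" for k unfolding G_def by measurable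
 have lam0: "0 \<le> lam (?e k)" for k using lam_eps_ge_1[where K=K and k=k] by linarith
 have GI: "(\<integral>\<^sup>+x. G k x * indicator {0..<1} x \<partial>lborel) = ennreal (lam (?e k) + D * Q)" for k
 proof -
  have "(\<integral>\<^sup>+x. G k x * indicator {0..<1} x \<partial>lborel) =
    (\<integral>\<^sup>+x. ennreal (lam (?e k)) * indicator {0..<1} x + ennreal D * (ennreal (\<psi> x) * indicator {0..<1} x) \<partial>lborel)"
   using D \<psi>0 lam0 by (intro nn_integral_cong) (auto simp: G_def ennreal_plus ennreal_mult indicator_def)
  also have "... = ennreal (lam (?e k)) + ennreal D * ennreal Q"
   by (subst nn_integral_add) (auto simp: nn_integral_cmult Q)
  finally show ?thesis using D Q lam0 by (simp add: ennreal_plus ennreal_mult)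
 qed
 \<comment> \<open>Arcs of stage k that lie in a heavy arc of the preceding stage; at stage 0 there
   is no condition.\<close>
 define L where "L k = {j. j < 2 ^ ?s k \<and> (\<forall>i. k = Suc i --> j div 2 ^ (?s k - ?s i) \<in> heavy i)}" for k
 have finL: "finite (L k)" for k unfolding L_def by simp
 define f where "f k y = (\<Sum>j\<in>L k. G k (2 ^ ?s k * circle_param y - real j) * indicator {y. arc_index (?s k) y = j} y)" for k y
 have fm[measurable]: "f k \<in> borel_measurable leb" for k
  unfolding f_def by measurable
 define v where "v k = (case k of 0 => real (card (L 0)) * ?e 0 * (lam (?e 0) + D * Q)
  | Suc i => (2 + D' + D * Q) / a * (card (heavy i) * (a * ?e i * lam (?e i))))" for k
 have fI: "(\<integral>\<^sup>+y. f k y \<partial>leb) \<le> ennreal (v k)" for k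
 proof -
  have "(\<integral>\<^sup>+y. f k y \<partial>leb) =
    (\<Sum>j\<in>L k. \<integral>\<^sup>+y. G k (2 ^ ?s k * circle_param y - real j) * indicator {y. arc_index (?s k) y = j} y \<partial>leb)"
   unfolding f_def by (rule nn_integral_sum) measurable
  also have "... = (\<Sum>j\<in>L k. ennreal (1 / 2 ^ ?s k) * ennreal (lam (?e k) + D * Q))"
   by (intro sum.cong refl) (simp add: nn_integral_arc GI L_def)
  also have "... = ennreal (real (card (L k)) * ?e k * (lam (?e k) + D * Q))"
  proof -
   define B where "B = lam (?e k) + D * Q"
   have "0 \<le> B" using lam0[of k] D Q by (simp add: B_def)
   then show ?thesis
    unfolding B_def[symmetric]
    by (simp add: eps_pos(3) ennreal_mult[symmetric] ennreal_of_nat_eq_real_of_nat)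
  qed
  also have "... \<le> ennreal (v k)"
  proof (cases k)
   case (Suc i)
   let ?q = "2 ^ (?s k - ?s i) :: nat"
   have "L k \<subseteq> (\<Union>h\<in>heavy i. {h * ?q..<h * ?q + ?q})"
   proof
    fix j assume "j \<in> L k"
    then have h: "j div ?q \<in> heavy i" using Suc by (simp add: L_def)
    have "j = (j div ?q) * ?q + j mod ?q" by (rule div_mult_mod_eq[symmetric])
    moreover have "j mod ?q < ?q" by simp
    ultimately have "j \<in> {(j div ?q) * ?q..<(j div ?q) * ?q + ?q}"
     by (metis atLeastLessThan_iff le_add1 nat_add_left_cancel_less)
    then show "j \<in> (\<Union>h\<in>heavy i. {h * ?q..<h * ?q + ?q})" using h by blast
   qed
   then have "card (L k) \<le> card (\<Union>h\<in>heavy i. {h * ?q..<h * ?q + ?q})"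
    by (intro card_mono) (auto simp: finite_heavy)
   also have "... \<le> (\<Sum>h\<in>heavy i. card {h * ?q..<h * ?q + ?q})"
    by (rule card_UN_le[OF finite_heavy])
   also have "... = card (heavy i) * ?q" by simp
   finally have "real (card (L k)) \<le> real (card (heavy i) * ?q)" by (simp only: of_nat_le_iff)
   then have "real (card (L k)) * ?e k \<le> real (card (heavy i)) * (2 ^ (?s k - ?s i) * ?e k)"
    using eps_pos(1)[of K k] mult_right_mono[of "real (card (L k))" "real (card (heavy i) * ?q)" "?e k"]
    by (simp add: mult.assoc)
   also have "2 ^ (?s k - ?s i) * ?e k = ?e i"
    unfolding eps_pos(3) using scale_mono[of K i] Suc by (simp add: power_diff)
   finally have 1: "real (card (L k)) * ?e k \<le> real (card (heavy i)) * ?e i" .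
   \<comment> \<open>From stage i to the next the level only doubles, and the bounded error is
     absorbed because \<open>lam (eps K i)\<close> >= 1.\<close>
   have "lam (?e k) + D * Q \<le> 2 * 2 ^ (i + K) + (D' + D * Q) * 1"
    using D'(2)[of K k] Suc by simp
   also have "... \<le> 2 * lam (?e i) + (D' + D * Q) * lam (?e i)"
    using lam_eps_ge[of i K] lam_eps_ge_1[where K=K and k=i] D' D Q by (intro add_mono mult_left_mono) auto
   also have "... = (2 + D' + D * Q) * lam (?e i)" by (simp add: algebra_simps)
   finally have 2: "lam (?e k) + D * Q \<le> (2 + D' + D * Q) * lam (?e i)" .
   have "real (card (L k)) * ?e k * (lam (?e k) + D * Q) \<le>
     real (card (heavy i)) * ?e i * ((2 + D' + D * Q) * lam (?e i))"
    using eps_pos(1)[of K i] lam0[of k] D Q by (intro mult_mono 1 2) auto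
   also have "... = v k"
    using a_pos by (simp add: v_def Suc mult_ac)
   finally show ?thesis by (rule ennreal_leI)
  qed (simp add: v_def)
  finally show ?thesis .
 qed
 have sv: "summable v"
 proof -
  have T0: "0 \<le> a * ?e i * lam (?e i)" for i
   using a_pos eps_pos(1)[of K i] lam0[of i] by simp
  have "summable (%i. card (heavy i) * (a * ?e i * lam (?e i)))"
   using sum_card_heavy_le T0 by (intro summableI_nonneg_bounded) auto
  then have "summable (%i. v (Suc i))"
   unfolding v_def nat.case by (rule summable_mult)
  then show ?thesis by (subst (asm) summable_Suc_iff)
 qed
 have v0: "0 \<le> v k" for k
 proof (cases k)
  case 0
  then show ?thesis
   using eps_pos(1)[of K 0] lam0[of 0] D(1) Q(2) by (simp add: v_def)
 next
  case (Suc i)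
  then show ?thesis
   using a_pos eps_pos(1)[of K i] lam0[of i] D(1) D'(1) Q(2) by (simp add: v_def)
 qed
 have "AE y in leb. ennreal (lam (arc_setdist y F)) \<le> (\<Sum>k. f k y)"
  using AE_light AE_not_grid_point AE_space
 proof eventually_elim
  case (elim y)
  then have n: "norm y = 1" by simp
  define k where "k = (LEAST k. arc_index (?s k) y \<notin> heavy k)"
  have k: "arc_index (?s k) y \<notin> heavy k"
   unfolding k_def using elim(1) by (rule LeastI_ex)
  have kl: "arc_index (?s i) y \<in> heavy i" if "i < k" for i
   using not_less_Least[of i "%k. arc_index (?s k) y \<notin> heavy k"] that by (simp add: k_def)
  define j where "j = arc_index (?s k) y"
  define x where "x = 2 ^ ?s k * circle_param y - real j"
  have x: "0 < x" "x < 1"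
   using arc_index_bounds[of "?s k" y] elim(2)[rule_format, of "?s k" j] by (auto simp: x_def j_def)
  have "j \<in> L k"
  proof -
   have "j div 2 ^ (?s k - ?s i) \<in> heavy i" if "k = Suc i" for i
    using kl[of i] arc_index_div[of "?s i" "?s k" y] that scale_mono[of K i] by (simp add: j_def)
   then show ?thesis using arc_index_bounds(3)[of "?s k" y] by (simp add: L_def j_def)
  qed
  have d: "min x (1 - x) * ?e k \<le> arc_setdist y F"
   using arc_setdist_residual_ge[OF n, of "?s" k heavy] k by (simp add: x_def j_def eps_pos(3))
  have p: "0 < min x (1 - x) * ?e k" using x eps_pos(1)[of K k] by simp
  have "min x (1 - x) * ?e k \<le> 1 * ?e k" using x eps_pos(1)[of K k] by (intro mult_right_mono) auto
  then have le: "min x (1 - x) * ?e k \<le> ?e k" by simp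
  have d1: "arc_setdist y F \<le> 1"
   using arc_setdist_bounds(2)[OF n residual_set_closed residual_set_subset residual_set_nonempty, of "?s" heavy] by simp
  have "lam (arc_setdist y F) \<le> lam (min x (1 - x) * ?e k)"
   by (rule lam_antimono[OF p d d1])
  also have "... \<le> lam (?e k) + D * ln (2 * ?e k / (min x (1 - x) * ?e k))"
   by (rule D(2)[OF p le eps_pos(2)])
  also have "2 * ?e k / (min x (1 - x) * ?e k) = 2 / min x (1 - x)"
   using eps_pos(1)[of K k] by simp
  also have "lam (?e k) + D * ln (2 / min x (1 - x)) \<le> lam (?e k) + D * \<psi> x"
   using D ln_two_over_min_le[OF x] by (auto simp: \<psi>_def intro!: mult_left_mono)
  finally have "ennreal (lam (arc_setdist y F)) \<le> G k x"
   unfolding G_def by (rule ennreal_leI)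
  also have "G k x = G k (2 ^ ?s k * circle_param y - real j) * indicator {y. arc_index (?s k) y = j} y"
   by (simp add: x_def j_def)
  also have "... \<le> f k y"
   unfolding f_def by (rule member_le_sum[OF \<open>j \<in> L k\<close>]) (auto simp: finL)
  also have "... = (\<Sum>i\<in>{k}. f i y)" by simp
  also have "... \<le> (\<Sum>k. f k y)"
   by (rule sum_le_suminf) auto
  finally show ?case .
 qed
 then have "(\<integral>\<^sup>+y. ennreal (lam (arc_setdist y F)) \<partial>leb) \<le> (\<integral>\<^sup>+y. (\<Sum>k. f k y) \<partial>leb)"
  by (rule nn_integral_mono_AE)
 also have "... = (\<Sum>k. \<integral>\<^sup>+y. f k y \<partial>leb)"
  by (rule nn_integral_suminf) measurable
 also have "... \<le> (\<Sum>k. ennreal (v k))"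
  by (intro suminf_le fI) auto
 also have "... = ennreal (\<Sum>k. v k)"
  by (rule suminf_ennreal2[OF v0 sv])
 also have "... < \<infinity>" by simp
 finally show "(\<integral>\<^sup>+y. ennreal (lam (arc_setdist y F)) \<partial>leb) < \<infinity>" .
qed

lemma rest_tendsto_0:
 assumes "emeasure \<kappa> F = 0"
 shows "(%n. \<integral>x. R n x \<partial>\<kappa>) \<longlonglongrightarrow> 0"
proof (rule integral_R_tendsto_0)
 have "F \<in> sets \<kappa>" using F_sets by (simp add: sets_circle)
 then have "AE y in \<kappa>. y \<notin> F"
  using assms by (intro AE_not_in) (simp add: null_sets_def)
 then show "AE y in \<kappa>. \<exists>k. arc_index (scale K k) y \<notin> heavy k"
  using AE_space
 proof eventually_elim
  case (elim y)
  then show ?case using heavy_in_residual_set[of y "scale K" heavy] by auto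
 qed
qed

end

text \<open>\<open>lam t\<close> is at most a constant plus a multiple of log(1/t), so a power of t
  is dominated by a power of w(t). This makes the error of the dilations comparable with the
  weight.\<close>

lemma (in weight) sqrt_eps_le:
 obtains A B where "0 < A" "0 < B" "\<And>t. 0 < t ==> t \<le> 1 ==> sqrt t \<le> A * exp (- B * lam t)"
proof -
 obtain D where D: "0 < D" "\<And>t l. 0 < t ==> t \<le> l ==> l \<le> 1 ==> lam t \<le> lam l + D * ln (2 * l / t)"
  by (rule lam_compare) blast
 have "sqrt t \<le> exp ((lam 1 / D + ln 2) / 2) * exp (- (1 / (2 * D)) * lam t)" if t: "0 < t" "t \<le> 1" for t
 proof -
  have "lam t \<le> lam 1 + D * (ln 2 - ln t)"
   using D(2)[of t 1] t by (simp add: ln_div)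
  then have "lam t / D \<le> (lam 1 + D * (ln 2 - ln t)) / D"
   using D(1) by (intro divide_right_mono) auto
  also have "... = lam 1 / D + ln 2 - ln t"
   using D(1) by (simp add: add_divide_distrib)
  finally have "ln t \<le> lam 1 / D + ln 2 - lam t / D" by simp
  then have "ln t / 2 \<le> (lam 1 / D + ln 2 - lam t / D) / 2"
   by (rule divide_right_mono) simp
  also have "... = (lam 1 / D + ln 2) / 2 + - (1 / (2 * D)) * lam t"
   by (simp add: diff_divide_distrib)
  finally have "ln t / 2 \<le> (lam 1 / D + ln 2) / 2 + - (1 / (2 * D)) * lam t" .
  then have "exp (ln t / 2) \<le> exp ((lam 1 / D + ln 2) / 2 + - (1 / (2 * D)) * lam t)" by simp
  moreover have "exp (ln t / 2) = sqrt t"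
   using t by (simp add: ln_sqrt[symmetric])
  ultimately show ?thesis by (simp only: exp_add)
 qed
 then show thesis using that[of "exp ((lam 1 / D + ln 2) / 2)" "1 / (2 * D)"] D(1) by simp
qed

lemma norm_exp_minus_1_le: "norm (exp z - 1) \<le> norm z * exp (norm (z::complex))"
proof -
 have "norm (exp z - (\<Sum>k\<le>0. z ^ k / fact k)) \<le> exp \<bar>Re z\<bar> * norm z ^ Suc 0 / fact 0"
  by (rule Taylor_exp)
 also have "... \<le> exp (norm z) * norm z"
  using abs_Re_le_cmod[of z] by (simp add: mult_right_mono)
 finally show ?thesis by (simp add: mult.commute)
qed

text \<open>Telescoping that keeps the products of the earlier factors: these are not bounded by 1,
  each may be as large as the exponential of a multiple of \<open>lam\<close> at its scale.\<close>

lemma norm_prod_minus_1_le: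
 fixes E :: "nat => complex"
 shows "norm ((\<Prod>k<n. E k) - 1) \<le> (\<Sum>k<n. norm (E k - 1) * (\<Prod>j<k. norm (E j)))"
proof (induction n)
 case (Suc n)
 have "(\<Prod>k<Suc n. E k) - 1 = ((\<Prod>k<n. E k) - 1) + (E n - 1) * (\<Prod>k<n. E k)"
  by (simp add: algebra_simps)
 then have "norm ((\<Prod>k<Suc n. E k) - 1) \<le> norm ((\<Prod>k<n. E k) - 1) + norm ((E n - 1) * (\<Prod>k<n. E k))"
  by (simp only: norm_triangle_ineq)
 also have "norm ((E n - 1) * (\<Prod>k<n. E k)) = norm (E n - 1) * (\<Prod>j<n. norm (E j))"
  by (simp add: norm_mult prod_norm)
 finally show ?case using Suc by simp
qed simp

context roberts
begin

abbreviation piece_measure where "piece_measure k \<equiv> density \<kappa> (%x. ennreal (piece k x))"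
abbreviation rest_measure where "rest_measure n \<equiv> density \<kappa> (%x. ennreal (R n x))"

lemma circle_measure_pieces: "circle_measure (piece_measure k)" "circle_measure (rest_measure n)"
 by (intro circle_measure_density piece_integrable R_integrable)+

lemma herglotz_integral_split:
 assumes z: "norm z < 1"
 shows "herglotz_integral \<kappa> z = (\<Sum>k<n. herglotz_integral (piece_measure k) z) + herglotz_integral (rest_measure n) z"
proof -
 have int: "integrable \<kappa> (%x. f x *\<^sub>R herglotz z x)"
  if "f \<in> borel_measurable \<kappa>" "\<And>x. 0 \<le> f x" "\<And>x. f x \<le> 1" for f :: "complex => real"
  using that z
  by (intro LINT_integrable_bound[OF integrable_herglotz[OF z]])
   (auto intro!: mult_left_le_one_le borel_measurable_scaleR continuous_intros)
 have "herglotz_integral \<kappa> z = (\<integral>x. (\<Sum>k<n. piece k x *\<^sub>R herglotz z x) + R n x *\<^sub>R herglotz z x \<partial>\<kappa>)"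
  unfolding herglotz_integral_def
  by (intro LINT_cong refl)
   (simp add: scaleR_left.sum[symmetric] sum_pieces flip: scaleR_left_distrib)
 also have "... = (\<Sum>k<n. \<integral>x. piece k x *\<^sub>R herglotz z x \<partial>\<kappa>) + (\<integral>x. R n x *\<^sub>R herglotz z x \<partial>\<kappa>)"
  using piece_bounds R_bounds
  by (subst LINT_add, intro LINT_integrable_sum int, simp_all add: int)
 finally show ?thesis
  using z piece_bounds R_bounds by (simp add: herglotz_integral_density)
qed

text \<open>The exact inverse of the function S of a piece may be unbounded in the disc. Its
  dilation by 1 - \<open>eps K k\<close> is bounded if \<open>eps K k\<close> < 1, and close to the
  inverse away from the circle.\<close>

definition quot :: "nat => complex => complex" where
 "quot k z = exp (herglotz_integral (piece_measure k) (of_real (1 - eps K k) * z))"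

definition err :: "nat => complex => complex" where
 "err k z = quot k z * singular_inner (piece_measure k) z"

lemma one_minus_eps: "0 \<le> 1 - eps K k" "1 - eps K k < 1"
 using eps_pos[of K k] by auto

lemma norm_dilated: "norm (z::complex) < 1 ==> norm (of_real (1 - eps K k) * z) \<le> 1 - eps K k"
 using one_minus_eps[of k] by (simp only: norm_mult norm_of_real) (simp add: mult_left_le)

text \<open>The dilated point has distance at least \<open>eps K k\<close> from the circle, and the
  piece has mass at most \<open>a * eps K k * lam (eps K k)\<close> on each arc of that length, so
  its Poisson integral there is controlled by a times \<open>lam\<close>.\<close>

lemma norm_err_le:
 assumes z: "norm z < 1"
 shows "norm (err k z) \<le> exp ((1 + 2 * pi)\<^sup>2 * a * lam (eps K k))"
proof -
 interpret p: circle_measure "piece_measure k" by (rule circle_measure_pieces)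
 let ?z = "of_real (1 - eps K k) * z"
 have z': "norm ?z < 1" using norm_dilated[OF z, of k] one_minus_eps[of k] by linarith
 have "poisson_integral (piece_measure k) ?z \<le> (1 + 2 * pi)\<^sup>2 * 2 ^ scale K k * (a * eps K k * lam (eps K k))"
  unfolding poisson_integral_density[OF piece_measurable piece_bounds(1) z']
  using norm_dilated[OF z, of k] eps_pos(3)[of K k]
  by (intro poisson_integral_arcs_le[where n="scale K k"] piece_measurable piece_bounds piece_mass_le z') auto
 also have "... = (1 + 2 * pi)\<^sup>2 * a * lam (eps K k)"
  by (simp add: eps_pos(3))
 finally have 1: "poisson_integral (piece_measure k) ?z \<le> (1 + 2 * pi)\<^sup>2 * a * lam (eps K k)" .
 have "norm (err k z) = exp (poisson_integral (piece_measure k) ?z) * norm (singular_inner (piece_measure k) z)"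
  unfolding err_def quot_def by (simp only: norm_mult norm_exp_eq_Re p.Re_herglotz_integral[OF z'])
 also have "... \<le> exp ((1 + 2 * pi)\<^sup>2 * a * lam (eps K k)) * 1"
  using 1 p.norm_singular_inner_le[OF z] by (intro mult_mono) auto
 finally show ?thesis by simp
qed

lemma measure_piece_le: "measure (piece_measure k) (sphere 0 1) \<le> measure \<kappa> (sphere 0 1)"
proof -
 have "emeasure (piece_measure k) (sphere 0 1) = (\<integral>\<^sup>+x. ennreal (piece k x) * indicator (sphere 0 1) x \<partial>\<kappa>)"
  using sets.top[of \<kappa>] by (subst emeasure_density) auto
 also have "... \<le> (\<integral>\<^sup>+x. indicator (sphere 0 1) x \<partial>\<kappa>)"
  using piece_bounds by (intro nn_integral_mono) (auto simp: indicator_def)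
 also have "... = emeasure \<kappa> (sphere 0 1)"
  using sets.top[of \<kappa>] by (intro nn_integral_indicator) (simp only: space_circle)
 finally show ?thesis
  unfolding measure_def using emeasure_finite[of "sphere 0 1"]
  by (intro enn2real_mono) (auto simp: less_top[symmetric])
qed

text \<open>The dilation moves z by at most \<open>eps K k\<close>, while (1 - |z|)^2 is at least
  the square root of \<open>eps K k\<close>; the quotient of the two is the error.\<close>

lemma norm_err_minus_1_le:
 assumes z: "norm z < 1" and e: "0 < e" "e \<le> 1 - norm z" "e ^ 4 = eps K k"
 defines "M \<equiv> measure \<kappa> (sphere 0 1)"
 shows "norm (err k z - 1) \<le> 2 * M * exp (2 * M) * sqrt (eps K k)"
proof -
 interpret p: circle_measure "piece_measure k" by (rule circle_measure_pieces)
 let ?q = "1 - eps K k"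
 let ?x = "herglotz_integral (piece_measure k) (of_real ?q * z) - herglotz_integral (piece_measure k) z"
 have sq: "e\<^sup>2 = sqrt (eps K k)"
  using e(3) by (intro real_sqrt_unique[symmetric]) (auto simp: power_mult[symmetric])
 have s1: "0 \<le> sqrt (eps K k)" "sqrt (eps K k) \<le> 1" using eps_pos[of K k] by auto
 have M0: "0 \<le> M" by (simp add: M_def)
 have "norm ?x \<le> 2 * (1 - ?q) / (1 - norm z)\<^sup>2 * measure (piece_measure k) (sphere 0 1)"
  by (rule p.norm_herglotz_integral_diff_le[OF z]) (use one_minus_eps[of k] in auto)
 also have "... \<le> 2 * eps K k / e\<^sup>2 * M"
 proof (intro mult_mono)
  have "e\<^sup>2 \<le> (1 - norm z)\<^sup>2" using e by (intro power_mono) auto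
  then show "2 * (1 - ?q) / (1 - norm z)\<^sup>2 \<le> 2 * eps K k / e\<^sup>2"
   using eps_pos(1)[of K k] e(1) by (intro frac_le) auto
  show "measure (piece_measure k) (sphere 0 1) \<le> M"
   using measure_piece_le[of k] by (simp add: M_def)
 qed (use eps_pos(1)[of K k] in auto)
 also have "... = 2 * M * (eps K k / sqrt (eps K k))"
  unfolding sq by simp
 also have "eps K k / sqrt (eps K k) = sqrt (eps K k)"
  using eps_pos(1)[of K k] by (intro real_div_sqrt) simp
 finally have x: "norm ?x \<le> 2 * M * sqrt (eps K k)" .
 also have "... \<le> 2 * M * 1" using s1 M0 by (intro mult_left_mono) auto
 finally have x2: "norm ?x \<le> 2 * M" by simp
 have "err k z = exp ?x"
  by (simp add: err_def quot_def singular_inner_eq exp_diff exp_minus divide_inverse)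
 then have "norm (err k z - 1) \<le> norm ?x * exp (norm ?x)" using norm_exp_minus_1_le[of ?x] by simp
 also have "... \<le> (2 * M * sqrt (eps K k)) * exp (2 * M)"
  using x x2 s1 M0 by (intro mult_mono) auto
 finally show ?thesis by (simp add: mult_ac)
qed

lemma quot_bounded:
 assumes "eps K k < 1"
 shows "bounded_on_disc (quot k)"
proof -
 interpret p: circle_measure "piece_measure k" by (rule circle_measure_pieces)
 have "(%z. exp (herglotz_integral (piece_measure k) z)) holomorphic_on ball 0 1"
  by (intro holomorphic_intros p.herglotz_integral_holomorphic)
 from dilation_bounded[OF this, of "1 - eps K k"] show ?thesis
  using assms eps_pos[of K k] by (simp add: quot_def[abs_def])
qed

text \<open>The levels 2^(j+K) grow geometrically, so all earlier stages together are of the size of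
  the current one. The product of the earlier errors is thus no worse than one more factor of the
  current kind.\<close>

lemma sum_lam_eps_le:
 assumes "\<And>K k. lam (eps K k) \<le> 2 ^ (k + K) + D" "0 < D"
 shows "(\<Sum>j<k. lam (eps K j)) \<le> (1 + D) * lam (eps K k)"
proof -
 have "(\<Sum>j<k. lam (eps K j)) \<le> (\<Sum>j<k. 2 ^ (j + K) + D)" by (intro sum_mono assms)
 also have "... = (\<Sum>j<k. 2 ^ j) * 2 ^ K + real k * D"
  by (simp add: sum.distrib power_add sum_distrib_right)
 also have "(\<Sum>j<k. 2 ^ j) = (2 ^ k - 1 :: real)"
  using geometric_sum[of "2::real" k] by simp
 also have "(2 ^ k - 1) * 2 ^ K + real k * D \<le> 2 ^ (k + K) + 2 ^ (k + K) * D"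
 proof (intro add_mono mult_right_mono)
  have "real k < 2 ^ k" by simp
  also have "(2::real) ^ k \<le> 2 ^ (k + K)" by (rule power_increasing) auto
  finally show "real k \<le> 2 ^ (k + K)" by simp
 qed (use assms in "auto simp: power_add algebra_simps")
 also have "... = (1 + D) * 2 ^ (k + K)" by (simp add: algebra_simps)
 also have "... \<le> (1 + D) * lam (eps K k)"
  using lam_eps_ge[of k K] assms by (intro mult_left_mono) auto
 finally show ?thesis .
qed

text \<open>Two regimes, divided at the fourth root \<eta> of \<open>eps K k\<close>. For 1 - |z| >=
  \<eta> the dilation error, at most a multiple of exp(-B l), beats the growth exp(b (1 + D) l) of
  the earlier factors. Closer to the circle only the weight helps: w(\<eta>) <= exp(-l/c^2), because
  l = \<open>lam (\<eta> ^ 4)\<close> is at most c^2 \<open>lam \<eta>\<close>.\<close>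

lemma weighted_err_le:
 assumes D: "\<And>K k. lam (eps K k) \<le> 2 ^ (k + K) + D" "0 < D"
  and AB: "0 < A" "0 < B" "\<And>t. 0 < t ==> t \<le> 1 ==> sqrt t \<le> A * exp (- B * lam t)"
  and eps1: "eps K k < 1"
  and \<beta>: "(1 + 2 * pi)\<^sup>2 * a * (2 + D) \<le> \<beta>" "2 * \<beta> \<le> 1 / c\<^sup>2" "2 * \<beta> \<le> B"
  and z: "norm z < 1"
 defines "M \<equiv> measure \<kappa> (sphere 0 1)"
 shows "w (1 - norm z) * (norm (err k z - 1) * (\<Prod>j<k. norm (err j z))) \<le>
  (2 + 2 * M * exp (2 * M) * A) * exp (- \<beta> * lam (eps K k))"
proof -
 define b where "b = (1 + 2 * pi)\<^sup>2 * a"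
 define l where "l = lam (eps K k)"
 have b0: "0 \<le> b" using a_pos by (simp add: b_def)
 have l1: "1 \<le> l" using lam_eps_ge_1[of K k] by (simp add: l_def)
 have M0: "0 \<le> M" by (simp add: M_def)
 have \<beta>0: "b * (2 + D) \<le> \<beta>" using \<beta>(1) by (simp add: b_def)
 have "(\<Prod>j<k. norm (err j z)) \<le> (\<Prod>j<k. exp (b * lam (eps K j)))"
  using norm_err_le[OF z] by (intro prod_mono) (auto simp: b_def)
 also have "... = exp (b * (\<Sum>j<k. lam (eps K j)))"
  by (simp add: exp_sum sum_distrib_left)
 also have "... \<le> exp (b * ((1 + D) * l))"
  using sum_lam_eps_le[OF D, of k] b0 unfolding l_def by (simp add: mult_left_mono)
 finally have P: "(\<Prod>j<k. norm (err j z)) \<le> exp (b * ((1 + D) * l))" .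
 have P0: "0 \<le> (\<Prod>j<k. norm (err j z))" by (intro prod_nonneg) auto
 define \<eta> where "\<eta> = root 4 (eps K k)"
 have \<eta>: "0 < \<eta>" "\<eta> ^ 4 = eps K k" "\<eta> < 1"
  using eps_pos(1)[of K k] eps1 by (auto simp: \<eta>_def)
 have wz: "0 < w (1 - norm z)" "w (1 - norm z) \<le> 1" using w_disc[OF z] by auto
 show ?thesis
 proof (cases "\<eta> \<le> 1 - norm z")
  case True
  have "norm (err k z - 1) \<le> 2 * M * exp (2 * M) * sqrt (eps K k)"
   unfolding M_def by (rule norm_err_minus_1_le[OF z \<eta>(1) True \<eta>(2)])
  also have "... \<le> 2 * M * exp (2 * M) * (A * exp (- B * l))"
   unfolding l_def using M0 eps_pos[of K k] by (intro mult_left_mono AB(3)) auto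
  finally have "norm (err k z - 1) \<le> 2 * M * exp (2 * M) * A * exp (- B * l)" by simp
  then have "norm (err k z - 1) * (\<Prod>j<k. norm (err j z)) \<le>
    (2 * M * exp (2 * M) * A * exp (- B * l)) * exp (b * ((1 + D) * l))"
   using P P0 M0 AB by (intro mult_mono) auto
  also have "... = 2 * M * exp (2 * M) * A * exp ((b * (1 + D) - B) * l)"
   by (simp add: exp_add[symmetric] algebra_simps)
  also have "... \<le> 2 * M * exp (2 * M) * A * exp (- \<beta> * l)"
  proof -
   have "b * (1 + D) \<le> b * (2 + D)" using b0 by (intro mult_left_mono) auto
   then have "b * (1 + D) - B \<le> - \<beta>" using \<beta>0 \<beta>(3) by linarith
   then have "(b * (1 + D) - B) * l \<le> - \<beta> * l" using l1 by (intro mult_right_mono) auto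
   then show ?thesis using M0 AB by (intro mult_left_mono) auto
  qed
  also have "... \<le> (2 + 2 * M * exp (2 * M) * A) * exp (- \<beta> * l)"
   by (intro mult_right_mono) auto
  finally have "norm (err k z - 1) * (\<Prod>j<k. norm (err j z)) \<le> (2 + 2 * M * exp (2 * M) * A) * exp (- \<beta> * l)" .
  moreover have "w (1 - norm z) * (norm (err k z - 1) * (\<Prod>j<k. norm (err j z))) \<le> norm (err k z - 1) * (\<Prod>j<k. norm (err j z))"
   using wz P0 by (intro mult_left_le_one_le) auto
  ultimately show ?thesis unfolding l_def by linarith
 next
  case False
  have "norm (err k z - 1) \<le> norm (err k z) + 1"
   using norm_triangle_ineq4[of "err k z" 1] by simp
  also have "... \<le> exp (b * l) + exp (b * l)"
   using norm_err_le[OF z, of k] b0 l1 by (intro add_mono) (auto simp: b_def l_def)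
  finally have e: "norm (err k z - 1) \<le> 2 * exp (b * l)" by simp
  have "lam (\<eta> ^ 4) \<le> c\<^sup>2 * lam \<eta>" by (rule lam_power4[OF \<eta>(1,3)])
  then have "l / c\<^sup>2 \<le> lam \<eta>" using c_pos by (simp add: \<eta>(2) l_def field_simps)
  then have "exp (- lam \<eta>) \<le> exp (- (l / c\<^sup>2))" by simp
  moreover have "w (1 - norm z) \<le> w \<eta>" using False \<eta> z by (intro w_mono) auto
  moreover have "w \<eta> = exp (- lam \<eta>)" using \<eta> by (intro w_eq_exp) auto
  ultimately have wl: "w (1 - norm z) \<le> exp (- (l / c\<^sup>2))" by linarith
  have "w (1 - norm z) * (norm (err k z - 1) * (\<Prod>j<k. norm (err j z))) \<le>
    exp (- (l / c\<^sup>2)) * (2 * exp (b * l) * exp (b * ((1 + D) * l)))"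
   using wl e P P0 wz by (intro mult_mono mult_nonneg_nonneg) auto
  also have "... = 2 * exp ((b * (2 + D) - 1 / c\<^sup>2) * l)"
   by (simp add: exp_add[symmetric] algebra_simps)
  also have "... \<le> 2 * exp (- \<beta> * l)"
  proof -
   have "b * (2 + D) - 1 / c\<^sup>2 \<le> - \<beta>" using \<beta>0 \<beta>(2) by linarith
   then have "(b * (2 + D) - 1 / c\<^sup>2) * l \<le> - \<beta> * l" using l1 by (intro mult_right_mono) auto
   then show ?thesis by simp
  qed
  also have "... \<le> (2 + 2 * M * exp (2 * M) * A) * exp (- \<beta> * l)"
   using M0 AB by (intro mult_right_mono) auto
  finally show ?thesis unfolding l_def .
 qed
qed

end

context weight
begin

text \<open>The quotients of finitely many stages approximately cancel the pieces. What remains is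
  the function S of the rest, whose mass tends to 0 because \<kappa> does not charge the residual
  set. The errors of the stages sum to at most e/2 independently of the number of stages, so this
  number can be chosen last.\<close>

theorem approx_cyclic_singular_inner:
 assumes \<kappa>: "circle_measure \<kappa>" and null: "\<And>E. finite_entropy w E ==> emeasure \<kappa> E = 0"
 shows "approx_cyclic (singular_inner \<kappa>)"
 unfolding approx_cyclic_def
proof (intro allI impI)
 fix e :: real assume e: "0 < e"
 interpret k: circle_measure \<kappa> by fact
 obtain D where D: "0 < D" "\<And>K k. lam (eps K k) \<le> 2 ^ (k + K) + D"
  by (rule lam_eps_le) blast
 obtain A B where AB: "0 < A" "0 < B" "\<And>t. 0 < t ==> t \<le> 1 ==> sqrt t \<le> A * exp (- B * lam t)"
  by (rule sqrt_eps_le) blast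
 \<comment> \<open>\<beta> is the decay rate that is left in both regimes: half of the available
   exponent is spent on the growth of the factors, and this determines a.\<close>
 define \<beta> where "\<beta> = min (1 / c\<^sup>2) B / 2"
 have \<beta>: "0 < \<beta>" "2 * \<beta> \<le> 1 / c\<^sup>2" "2 * \<beta> \<le> B"
  using c_pos AB by (auto simp: \<beta>_def)
 define a where "a = \<beta> / ((1 + 2 * pi)\<^sup>2 * (2 + D))"
 have pp: "0 < (1 + 2 * pi)\<^sup>2" using pi_gt_zero by (intro zero_less_power) linarith
 have a: "0 < a" "(1 + 2 * pi)\<^sup>2 * a * (2 + D) \<le> \<beta>"
  using \<beta> D(1) pp by (auto simp: a_def)
 define M where "M = measure \<kappa> (sphere 0 1)"
 define C where "C = 2 + 2 * M * exp (2 * M) * A"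
 have C: "0 < C" using AB by (auto simp: C_def M_def intro!: add_pos_nonneg)
 \<comment> \<open>Three thresholds for 2^K: the first makes every \<open>eps K k\<close> less than
   1, the second gives q <= 1/2, the third makes the geometric series of the errors at most
   e/2.\<close>
 have "\<exists>K. max (lam 1) (max (ln 2 / \<beta>) (ln (4 * C / e) / \<beta>)) < 2 ^ K"
  by (rule real_arch_pow) simp
 then obtain K where K: "max (lam 1) (max (ln 2 / \<beta>) (ln (4 * C / e) / \<beta>)) < 2 ^ K"
  by blast
 have K1: "lam 1 < 2 ^ K" and "ln 2 / \<beta> < 2 ^ K" "ln (4 * C / e) / \<beta> < 2 ^ K"
  using K unfolding max_less_iff_conj by blast+
 then have K2: "ln 2 < \<beta> * 2 ^ K" "ln (4 * C / e) < \<beta> * 2 ^ K"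
  by (simp_all only: pos_divide_less_eq[OF \<beta>(1)] mult.commute)
 define q where "q = exp (- \<beta> * 2 ^ K)"
 have q: "0 < q" "q \<le> 1 / 2" "C * (2 * q) \<le> e / 2"
 proof -
  show "0 < q" by (simp add: q_def)
  have "exp (- (\<beta> * 2 ^ K)) \<le> exp (- ln 2)" using K2(1) by simp
  also have "exp (- ln 2) = (1 / 2 :: real)" by (simp add: exp_minus)
  finally show "q \<le> 1 / 2" by (simp add: q_def)
  have "exp (- (\<beta> * 2 ^ K)) \<le> exp (- ln (4 * C / e))" using K2(2) by simp
  also have "exp (- ln (4 * C / e)) = e / (4 * C)" using C e by (simp add: exp_minus)
  finally have "q \<le> e / (4 * C)" by (simp add: q_def)
  then show "C * (2 * q) \<le> e / 2" using C by (simp add: field_simps)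
 qed
 interpret r: roberts w c \<kappa> a K
  by (intro roberts.intro roberts_axioms.intro weight_axioms \<kappa> a)
 have eps1: "eps K k < 1" for k
 proof (rule ccontr)
  assume "\<not> eps K k < 1"
  then have "eps K k = 1" using eps_pos(2)[of K k] by simp
  then have "2 ^ (k + K) \<le> lam 1" using lam_eps_ge[of k K] by simp
  moreover have "(2::real) ^ K \<le> 2 ^ (k + K)" by (rule power_increasing) auto
  ultimately show False using K1 by simp
 qed
 have sum_le: "w (1 - norm z) * norm ((\<Prod>k<n. r.err k z) - 1) \<le> e / 2" if z: "norm z < 1" for z n
 proof -
  have "w (1 - norm z) * norm ((\<Prod>k<n. r.err k z) - 1) \<le>
    w (1 - norm z) * (\<Sum>k<n. norm (r.err k z - 1) * (\<Prod>j<k. norm (r.err j z)))"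
   using w_disc[OF z] by (intro mult_left_mono norm_prod_minus_1_le) auto
  also have "... = (\<Sum>k<n. w (1 - norm z) * (norm (r.err k z - 1) * (\<Prod>j<k. norm (r.err j z))))"
   by (rule sum_distrib_left)
  also have "... \<le> (\<Sum>k<n. C * (q * q ^ k))"
  proof (rule sum_mono)
   fix k
   have "w (1 - norm z) * (norm (r.err k z - 1) * (\<Prod>j<k. norm (r.err j z))) \<le> C * exp (- \<beta> * lam (eps K k))"
    unfolding C_def M_def by (rule r.weighted_err_le[OF D(2,1) AB eps1 a(2) \<beta>(2,3) z])
   also have "exp (- \<beta> * lam (eps K k)) \<le> q * q ^ k"
   proof -
    \<comment> \<open>By this \<open>lam (eps K k)\<close> is at least (k + 1) 2^K, so the doubly
      exponential decay is replaced by a geometric one with ratio q.\<close>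
    have "real k + 1 \<le> 2 ^ k" by (induction k) auto
    then have "(real k + 1) * 2 ^ K \<le> 2 ^ k * 2 ^ K" by (intro mult_right_mono) auto
    also have "... \<le> lam (eps K k)" using lam_eps_ge[of k K] by (simp add: power_add)
    finally have "\<beta> * ((real k + 1) * 2 ^ K) \<le> \<beta> * lam (eps K k)" using \<beta> by (intro mult_left_mono) auto
    then have "exp (- (\<beta> * lam (eps K k))) \<le> exp (- (\<beta> * ((real k + 1) * 2 ^ K)))" by simp
    also have "... = q * q ^ k"
     by (simp add: q_def exp_of_nat_mult[symmetric] exp_add[symmetric] algebra_simps)
    finally show ?thesis by simp
   qed
   finally show "w (1 - norm z) * (norm (r.err k z - 1) * (\<Prod>j<k. norm (r.err j z))) \<le> C * (q * q ^ k)"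
    using C by simp
  qed
  also have "... = C * q * (\<Sum>k<n. q ^ k)" by (simp add: sum_distrib_left mult_ac)
  also have "(\<Sum>k<n. q ^ k) \<le> 2"
  proof -
   have "(\<Sum>k<n. q ^ k) \<le> (\<Sum>k<n. (1/2) ^ k)" using q by (intro sum_mono power_mono) auto
   also have "... \<le> 2" by (subst sum_gp_strict) (simp add: power_one_over)
   finally show ?thesis .
  qed
  then have "C * q * (\<Sum>k<n. q ^ k) \<le> C * q * 2" using C q by (intro mult_left_mono) auto
  finally show ?thesis using q by (simp add: mult_ac)
 qed
 have "(%n. measure (r.rest_measure n) (sphere 0 1)) \<longlonglongrightarrow> 0"
 proof -
  have "measure (r.rest_measure n) (sphere 0 1) = (\<integral>x. r.R n x \<partial>\<kappa>)" for n
  proof -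
   have "emeasure (r.rest_measure n) (sphere 0 1) = (\<integral>\<^sup>+x. ennreal (r.R n x) * indicator (sphere 0 1) x \<partial>\<kappa>)"
    using sets.top[of \<kappa>] by (subst emeasure_density) auto
   also have "... = (\<integral>\<^sup>+x. ennreal (r.R n x) \<partial>\<kappa>)"
    by (intro nn_integral_cong) auto
   also have "... = ennreal (\<integral>x. r.R n x \<partial>\<kappa>)"
    using r.R_bounds by (intro nn_integral_eq_integral r.R_integrable) auto
   finally show ?thesis
    using r.R_bounds by (simp add: measure_def integral_nonneg_AE)
  qed
  then show ?thesis using r.rest_tendsto_0 null[OF r.F_entropy] by simp
 qed
 then have small: "\<forall>\<^sub>F n in sequentially. measure (r.rest_measure n) (sphere 0 1) < d" if "0 < d" for d
  by (rule order_tendstoD(2)) fact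
 have "\<forall>\<^sub>F n in sequentially. \<forall>z. norm z < 1 -->
   w (1 - norm z) * norm (singular_inner (r.rest_measure n) z * 1 - 1 * 1) \<le> e / 2"
 proof (rule G_mult_approx[OF G_space_1, where C=2 and a="%z. 1"])
  show "norm (singular_inner (r.rest_measure n) z - 1) \<le> 2" if "norm z < 1" for n z
   using norm_triangle_ineq4[of "singular_inner (r.rest_measure n) z" 1]
    circle_measure.norm_singular_inner_le[OF r.circle_measure_pieces(2) that, of n] by simp
  fix R d :: real assume R: "R < 1" and d: "0 < d"
  \<comment> \<open>A bound for |S - 1| on |z| <= R in terms of the mass m, vanishing with m. The
    maximum guards against negative R.\<close>
  define f where "f m = 2 / (1 - max 0 R) * m * exp (2 / (1 - max 0 R) * m)" for m :: real
  have "f \<midarrow>0\<rightarrow> f 0" unfolding f_def by (intro tendsto_intros)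
  then have "\<forall>\<^sub>F m in at 0. f m < d" by (rule order_tendstoD(2)) (simp add: f_def d)
  then obtain t where t: "0 < t" "\<And>m. m \<noteq> 0 ==> \<bar>m\<bar> < t ==> f m < d"
   unfolding eventually_at by (auto simp: dist_norm)
  from small[OF t(1)]
  show "\<forall>\<^sub>F n in sequentially. \<forall>z. norm z \<le> R --> norm (singular_inner (r.rest_measure n) z - 1) < d"
  proof eventually_elim
   case (elim n)
   interpret p: circle_measure "r.rest_measure n" by (rule r.circle_measure_pieces)
   let ?m = "measure (r.rest_measure n) (sphere 0 1)"
   show ?case
   proof (intro allI impI)
    fix z :: complex assume zR: "norm z \<le> R"
    have z: "norm z < 1" using zR R by simp
    have fr: "2 / (1 - norm z) \<le> 2 / (1 - max 0 R)" using zR R by (intro divide_left_mono) auto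
    have m0: "0 \<le> ?m" by simp
    have 1: "2 / (1 - norm z) * ?m \<le> 2 / (1 - max 0 R) * ?m"
     by (rule mult_right_mono[OF fr m0])
    have "norm (singular_inner (r.rest_measure n) z - 1) \<le> 2 / (1 - norm z) * ?m * exp (2 / (1 - norm z) * ?m)"
     by (rule p.norm_singular_inner_minus_1_le[OF z])
    also have "... \<le> f ?m"
    proof -
     have "x * exp x \<le> y * exp y" if "x \<le> y" "0 \<le> x" for x y :: real
      using that by (intro mult_mono) auto
     from this[OF 1] show ?thesis unfolding f_def using m0 z by simp
    qed
    also have "f ?m < d"
     using t(2)[of ?m] elim m0 d by (cases "?m = 0") (auto simp: f_def)
    finally show "norm (singular_inner (r.rest_measure n) z - 1) < d" .
   qed
  qed
 qed (use e in auto)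
 then obtain n where n: "w_close (singular_inner (r.rest_measure n)) (%_. 1) (e / 2)"
  unfolding eventually_sequentially by auto
 define Q where "Q z = (\<Prod>k<n. r.quot k z)" for z
 have "bounded_on_disc (%z. \<Prod>k<m. r.quot k z)" for m
 proof (induction m)
  case (Suc m)
  then have "bounded_on_disc (%z. (\<Prod>k<m. r.quot k z) * r.quot m z)"
   by (rule bounded_on_disc_mult) (rule r.quot_bounded[OF eps1])
  then show ?case by simp
 qed (simp add: bounded_on_disc_const)
 then have Q: "bounded_on_disc Q" by (simp add: Q_def[abs_def])
 have "w (1 - norm z) * norm (Q z * singular_inner \<kappa> z - 1) \<le> e" if z: "norm z < 1" for z
 proof -
  let ?S = "singular_inner (r.rest_measure n) z" and ?E = "\<Prod>k<n. r.err k z"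
  have "singular_inner \<kappa> z = (\<Prod>k<n. singular_inner (r.piece_measure k) z) * ?S"
   unfolding singular_inner_eq r.herglotz_integral_split[OF z, of n]
   by (simp add: exp_sum[symmetric] sum_negf flip: exp_add)
  then have "Q z * singular_inner \<kappa> z = ?E * ?S"
   by (simp add: Q_def r.err_def prod.distrib mult_ac)
  then have "Q z * singular_inner \<kappa> z - 1 = ?S * (?E - 1) + (?S - 1)"
   by (simp add: algebra_simps)
  then have "norm (Q z * singular_inner \<kappa> z - 1) \<le> norm (?S * (?E - 1)) + norm (?S - 1)"
   by (simp only: norm_triangle_ineq)
  also have "norm (?S * (?E - 1)) \<le> norm (?E - 1)"
   using circle_measure.norm_singular_inner_le[OF r.circle_measure_pieces(2) z, of n]
   by (simp add: norm_mult mult_left_le_one_le)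
  finally have "norm (Q z * singular_inner \<kappa> z - 1) \<le> norm (?E - 1) + norm (?S - 1)" by simp
  then have "w (1 - norm z) * norm (Q z * singular_inner \<kappa> z - 1) \<le> w (1 - norm z) * (norm (?E - 1) + norm (?S - 1))"
   using w_disc[OF z] by (intro mult_left_mono) auto
  also have "... \<le> e / 2 + e / 2"
   unfolding distrib_left using sum_le[OF z, of n] n z by (intro add_mono) auto
  finally show ?thesis by simp
 qed
 with Q show "\<exists>q. bounded_on_disc q \<and> (w_close (%z. q z * singular_inner \<kappa> z) (%_. 1) e)"
  by blast
qed

end

section \<open>Comparison of singular parts near sets of finite entropy\<close>

text \<open>
 Off this region the Poisson integral of a measure on $E$ is $O(\sqrt{1-|z|})$; on it, two
 applications of the hypothesis on $w(t^2)$ compare $w(1-|z|)$ with $w$ at the distance to $E$.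
\<close>

definition tangential_region :: "complex set => complex set" where
 "tangential_region E = {z. norm z < 1 \<and> infdist z E \<le> sqrt (sqrt (1 - norm z)) / 4}"

lemma one_minus_norm_le_infdist:
 assumes "E \<subseteq> sphere 0 1" "E \<noteq> {}"
 shows "1 - norm z \<le> infdist z E"
 unfolding infdist_notempty[OF assms(2)]
proof (rule cINF_greatest[OF assms(2)])
 fix y assume "y \<in> E"
 then have "norm y = 1" using assms by auto
 then show "1 - norm z \<le> dist z y"
  using circle_minus_disc_ge[of y z] by (simp add: dist_norm norm_minus_commute)
qed

text \<open>With s = (1 - |z|)^(1/4) the points of E have distance at least s/4 from z, so the
  kernel on E is at most 2 s^4/(s/4)^2 = 32 s^2.\<close>

lemma poisson_integral_off_region_le:
 assumes \<beta>: "circle_measure \<beta>" and E: "E \<in> sets circle_borel"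
  and z: "norm z < 1" "sqrt (sqrt (1 - norm z)) / 4 \<le> infdist z E"
 shows "poisson_integral (density \<beta> (indicator E)) z \<le> 32 * sqrt (1 - norm z) * measure \<beta> (sphere 0 1)"
proof -
 interpret b: circle_measure \<beta> by fact
 interpret e: circle_measure "density \<beta> (indicator E)" by (rule circle_measure_restrict[OF \<beta> E])
 define s where "s = sqrt (sqrt (1 - norm z))"
 have s: "0 < s" "s\<^sup>2 = sqrt (1 - norm z)" "s ^ 4 = 1 - norm z"
 proof -
  show "0 < s" "s\<^sup>2 = sqrt (1 - norm z)" using z by (auto simp: s_def)
  then have "(s\<^sup>2)\<^sup>2 = 1 - norm z" using z by simp
  then show "s ^ 4 = 1 - norm z" by simp
 qed
 have d: "s / 4 \<le> infdist z E" using z by (simp add: s_def)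
 have "poisson_integral (density \<beta> (indicator E)) z = (\<integral>x. indicator E x * poisson z x \<partial>\<beta>)"
  using b.poisson_integral_density[of "indicator E" z] E z
  by (simp add: b.sets_circle ennreal_indicator b.measurable_circle_iff)
 also have "... \<le> (\<integral>x. 32 * s\<^sup>2 \<partial>\<beta>)"
 proof (intro integral_mono)
  show "integrable \<beta> (%x. indicator E x * poisson z x)"
   using integrable_mult_indicator[OF _ b.integrable_poisson[OF z(1)], of E] E by (simp add: b.sets_circle)
  fix x assume "x \<in> space \<beta>"
  then have n: "norm x = 1" by simp
  show "indicator E x * poisson z x \<le> 32 * s\<^sup>2"
  proof (cases "x \<in> E")
   case True
   have "s / 4 \<le> norm (x - z)"
    using d infdist_le[OF True, of z] by (simp add: dist_norm norm_minus_commute)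
   then have "poisson z x \<le> 2 * (1 - norm z) / (s / 4)\<^sup>2"
    using s z by (intro poisson_le) auto
   also have "... = 32 * (s ^ 4 / s\<^sup>2)"
    by (simp add: s(3) power_divide)
   also have "s ^ 4 / s\<^sup>2 = s\<^sup>2" using s(1) by (simp add: eval_nat_numeral)
   finally show ?thesis using True by simp
  qed simp
 qed simp
 finally show ?thesis using s by (simp add: ac_simps)
qed

text \<open>Circles free of zeros of b along which the mean of -log|b| tends to 0, as is possible
  for Blaschke products. Such a factor leaves no trace in the limit of inequalities tested on these
  circles.\<close>

definition good_radii :: "(complex => complex) => (nat => real) => bool" where
 "good_radii b r \<longleftrightarrow> (\<forall>n. 0 < r n \<and> r n < 1) \<and> r \<longlonglongrightarrow> 1 \<and>
  (\<forall>n \<zeta>. norm \<zeta> = 1 --> b (of_real (r n) * \<zeta>) \<noteq> 0) \<and>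
  (%n. \<integral>\<zeta>. - ln (norm (b (of_real (r n) * \<zeta>))) \<partial>leb) \<longlonglongrightarrow> 0"

text \<open>In the region the hypothesis bounds the Poisson integral of the part of \<beta> on E by
  that of \<alpha> + \<gamma> plus -log|b|; elsewhere it is O(sqrt(1 - |z|)) anyway. Tested on good
  circles, the pointwise inequality becomes one of measures in the limit, and \<gamma> vanishes on
  E.\<close>

lemma singular_part_le:
 assumes \<alpha>: "circle_measure \<alpha>" and \<beta>: "circle_measure \<beta>" and \<gamma>: "circle_measure \<gamma>"
  and E: "closed E" "E \<subseteq> sphere 0 1" and null: "emeasure \<gamma> E = 0"
  and b: "b holomorphic_on ball 0 1" "\<And>z. norm z < 1 ==> norm (b z) \<le> 1" and r: "good_radii b r"
  and bound: "\<And>z. z \<in> tangential_region E ==>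
   norm (b z * singular_inner \<alpha> z / singular_inner \<beta> z) \<le> exp (poisson_integral \<gamma> z)"
  and K: "closed K" "K \<subseteq> E"
 shows "emeasure \<beta> K \<le> emeasure \<alpha> K"
proof -
 interpret a: circle_measure \<alpha> by fact
 interpret b: circle_measure \<beta> by fact
 interpret g: circle_measure \<gamma> by fact
 have Es: "E \<in> sets circle_borel" by (rule closed_sets_circle[OF E])
 define \<beta>E where "\<beta>E = density \<beta> (indicator E)"
 define \<beta>' where "\<beta>' = density \<beta> (indicator (sphere 0 1 - E))"
 have sp: "splits \<beta> \<beta>E \<beta>'" and \<beta>E: "circle_measure \<beta>E"
  unfolding \<beta>E_def \<beta>'_def by (rule circle_measure_restrict[OF \<beta> Es])+
 interpret e: circle_measure \<beta>E by fact
 interpret b': circle_measure \<beta>' using sp by (simp add: splits_def)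
 define q where "q = sum_circle_measure \<alpha> \<gamma>"
 have sps: "splits q \<alpha> \<gamma>" and q: "circle_measure q"
  unfolding q_def by (rule splits_sum[OF \<alpha> \<gamma>], rule circle_measure_sum[OF \<alpha> \<gamma>])
 interpret s: circle_measure q by fact
 define M where "M = measure \<beta> (sphere 0 1)"
 have M0: "0 \<le> M" by (simp add: M_def)
 have r01: "0 < r n" "r n < 1" "0 \<le> r n" and r1: "r \<longlonglongrightarrow> 1"
  and bnz: "norm y = 1 ==> b (of_real (r n) * y) \<noteq> 0"
  and L: "(%n. \<integral>y. - ln (norm (b (of_real (r n) * y))) \<partial>leb) \<longlonglongrightarrow> 0" for n y
  using r by (auto simp: good_radii_def less_imp_le)
 have pt: "poisson_integral \<beta>E z \<le> - ln (norm (b z)) + poisson_integral q z + 32 * sqrt (1 - norm z) * M"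
  if z: "norm z < 1" "b z \<noteq> 0" for z
 proof -
  have lb: "0 \<le> - ln (norm (b z))" using b(2)[OF z(1)] z(2) by simp
  have s0: "poisson_integral q z = poisson_integral \<alpha> z + poisson_integral \<gamma> z"
   by (rule splits_integral[OF sps z(1)])
  show ?thesis
  proof (cases "z \<in> tangential_region E")
   case True
   have "norm (b z * singular_inner \<alpha> z / singular_inner \<beta> z) =
     exp (ln (norm (b z)) + - poisson_integral \<alpha> z + poisson_integral \<beta> z)"
    using z by (simp only: norm_mult norm_divide a.norm_singular_inner b.norm_singular_inner exp_add exp_ln_iff)
     (simp add: exp_minus field_simps)
   then have "ln (norm (b z)) + - poisson_integral \<alpha> z + poisson_integral \<beta> z \<le> poisson_integral \<gamma> z"
    using bound[OF True] by simp
   moreover have "poisson_integral \<beta>E z \<le> poisson_integral \<beta> z"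
    using splits_integral(2)[OF sp z(1)] b'.poisson_integral_nonneg[OF z(1)] by simp
   moreover have "0 \<le> 32 * sqrt (1 - norm z) * M" using M0 z by simp
   ultimately show ?thesis unfolding s0 by linarith
  next
   case False
   then have "sqrt (sqrt (1 - norm z)) / 4 \<le> infdist z E"
    using z by (simp add: tangential_region_def)
   then have "poisson_integral \<beta>E z \<le> 32 * sqrt (1 - norm z) * M"
    unfolding \<beta>E_def M_def by (rule poisson_integral_off_region_le[OF \<beta> Es z(1)])
   then show ?thesis using lb s.poisson_integral_nonneg[OF z(1)] by linarith
  qed
 qed
 have test: "(\<integral>x. p x \<partial>\<beta>E) \<le> (\<integral>x. p x \<partial>q)"
  if p: "continuous_on (sphere 0 1) p" "\<And>x. 0 \<le> p x" "\<And>x. p x \<le> 1" for p :: "complex => real"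
 proof -
  have "(\<oint>y. p y * poisson_integral \<beta>E (of_real (r n) * y)) \<le>
    (\<oint>y. - ln (norm (b (of_real (r n) * y)))) +
    (\<oint>y. p y * poisson_integral q (of_real (r n) * y)) + 32 * sqrt (1 - r n) * M" for n
  proof -
   have nz: "norm (of_real (r n) * y) = r n" if "norm y = 1" for y :: complex
    using r01[of n] that by (simp add: norm_mult)
   have c: "continuous_on (sphere 0 1) (%y. - ln (norm (b (of_real (r n) * y))))"
    using bnz[of _ n] nz r01[of n]
    by (intro continuous_intros continuous_on_compose2[OF holomorphic_on_imp_continuous_on[OF b(1)]]) auto
   have i1: "integrable leb (%y. - ln (norm (b (of_real (r n) * y))))"
    by (rule leb.integrable_continuous[OF c])
   have i2: "integrable leb (%y. p y * poisson_integral q (of_real (r n) * y))"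
    by (rule s.Fubini_poisson(1)[OF p(1) r01(3,2)])
   have "(\<oint>y. p y * poisson_integral \<beta>E (of_real (r n) * y)) \<le>
    (\<oint>y. - ln (norm (b (of_real (r n) * y))) + p y * poisson_integral q (of_real (r n) * y) + 32 * sqrt (1 - r n) * M)"
   proof (intro integral_mono Bochner_Integration.integrable_add i1 i2)
    show "integrable leb (%y. p y * poisson_integral \<beta>E (of_real (r n) * y))"
     by (rule e.Fubini_poisson(1)[OF p(1) r01(3,2)])
    fix y assume "y \<in> space leb"
    then have n1: "norm y = 1" by simp
    let ?z = "of_real (r n) * y"
    have z: "norm ?z < 1" "b ?z \<noteq> 0" using nz[OF n1] r01[of n] bnz[OF n1, of n] by auto
    have lb: "0 \<le> - ln (norm (b ?z))" using b(2)[OF z(1)] z(2) by simp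
    have "p y * poisson_integral \<beta>E ?z \<le> p y * (- ln (norm (b ?z)) + poisson_integral q ?z + 32 * sqrt (1 - norm ?z) * M)"
     by (intro mult_left_mono pt z p)
    also have "... = p y * (- ln (norm (b ?z))) + p y * poisson_integral q ?z + p y * (32 * sqrt (1 - r n) * M)"
     unfolding nz[OF n1] by (simp only: distrib_left)
    also have "... \<le> - ln (norm (b ?z)) + p y * poisson_integral q ?z + 32 * sqrt (1 - r n) * M"
     using p(2,3)[of y] lb M0 r01[of n] by (intro add_mono mult_left_le_one_le order_refl) auto
    finally show "p y * poisson_integral \<beta>E ?z \<le> - ln (norm (b ?z)) + p y * poisson_integral q ?z + 32 * sqrt (1 - r n) * M" .
   qed simp
   also have "... = (\<oint>y. - ln (norm (b (of_real (r n) * y)))) +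
    (\<oint>y. p y * poisson_integral q (of_real (r n) * y)) + 32 * sqrt (1 - r n) * M"
    using i1 i2 by (subst LINT_add) auto
   finally show ?thesis .
  qed
  moreover have "(%n. \<integral>y. p y * poisson_integral \<beta>E (of_real (r n) * y) \<partial>leb) \<longlonglongrightarrow> (\<integral>x. p x \<partial>\<beta>E)"
   by (rule e.tendsto_integral_poisson_integral[OF p(1) r01(3,2) r1])
  moreover have "(%n. (\<oint>y. - ln (norm (b (of_real (r n) * y)))) +
    (\<oint>y. p y * poisson_integral q (of_real (r n) * y)) + 32 * sqrt (1 - r n) * M)
    \<longlonglongrightarrow> 0 + (\<integral>x. p x \<partial>q) + 32 * sqrt (1 - 1) * M"
   by (intro tendsto_intros L r1 s.tendsto_integral_poisson_integral[OF p(1) r01(3,2) r1])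
  ultimately have "(\<integral>x. p x \<partial>\<beta>E) \<le> 0 + (\<integral>x. p x \<partial>q) + 32 * sqrt (1 - 1) * M"
   by (intro LIMSEQ_le) auto
  then show ?thesis by simp
 qed
 have KS: "K \<subseteq> sphere 0 1" using K E by auto
 have Ks: "K \<in> sets circle_borel" by (rule closed_sets_circle[OF K(1) KS])
 have "emeasure \<beta> K = emeasure \<beta>E K"
  unfolding \<beta>E_def using circle_measure_restrict(2)[OF \<beta> Es Ks] K by (simp add: Int_absorb2)
 also have "... \<le> emeasure q K"
  by (rule closed_le_if_test_functions[OF q \<beta>E K(1) KS test])
 also have "... = emeasure \<alpha> K + emeasure \<gamma> K"
  using sps Ks by (simp add: splits_def)
 also have "emeasure \<gamma> K = 0"
  using emeasure_mono[OF K(2), of \<gamma>] Es null by (simp add: g.sets_circle)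
 finally show ?thesis by simp
qed

lemma closed_arc: "closed {x\<in>sphere (0::complex) 1. norm (x - x0) \<le> d}"
proof -
 have "{x\<in>sphere 0 1. norm (x - x0) \<le> d} = sphere 0 1 \<inter> cball x0 d"
  by (auto simp: dist_norm norm_minus_commute)
 then show ?thesis by (simp only:) (intro closed_Int closed_sphere closed_cball)
qed

lemma arc_in_sets: "{x\<in>sphere 0 1. norm (x - x0) \<le> d} \<in> sets circle_borel"
 by (rule closed_sets_circle[OF closed_arc]) auto

lemma measure_arc_ge:
 assumes x0: "norm x0 = 1" and d: "0 < d" "d \<le> 1"
 shows "d / (2 * pi) \<le> measure leb {x\<in>sphere 0 1. norm (x - x0) \<le> d}"
proof -
 define e where "e = d / (2 * pi)"
 define s where "s = circle_param x0"
 have e: "0 < e" "e \<le> 1 / 2"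
 proof -
  show "0 < e" using d by (simp add: e_def)
  have "d / (2 * pi) \<le> 1 / 2" using d pi_ge_two by (intro frac_le) auto
  then show "e \<le> 1 / 2" by (simp add: e_def)
 qed
 have s: "0 \<le> s" "s < 1" using circle_param_bounds by (auto simp: s_def)
 \<comment> \<open>A one-sided interval, turned away from the nearer end of the parameter interval
   so as not to leave it.\<close>
 define A where "A = (if s < 1 / 2 then {s..<s + e} else {s - e<..s})"
 have A: "A \<in> sets borel" "A \<inter> {0..<1} = A" "emeasure lborel A = ennreal e"
  using s e by (auto simp: A_def)
 have sub: "{x\<in>sphere 0 1. circle_param x \<in> A} \<subseteq> {x\<in>sphere 0 1. norm (x - x0) \<le> d}"
 proof safe
  fix x :: complex assume x: "x \<in> sphere 0 1" "circle_param x \<in> A"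
  then have "\<bar>circle_param x - s\<bar> \<le> e" using e by (auto simp: A_def split: if_splits)
  then have "2 * pi * \<bar>circle_param x - s\<bar> \<le> 2 * pi * e" by (intro mult_left_mono) auto
  then show "norm (x - x0) \<le> d"
   using norm_diff_le_param[of x x0] x x0 by (simp add: s_def e_def)
 qed
 have ms: "{x\<in>sphere 0 1. norm (x - x0) \<le> d} \<in> sets leb"
  using arc_in_sets unfolding sets_circle_lebesgue .
 have "ennreal e = emeasure leb {x\<in>sphere 0 1. circle_param x \<in> A}"
  using emeasure_circle_param[OF A(1)] A by simp
 also have "... \<le> emeasure leb {x\<in>sphere 0 1. norm (x - x0) \<le> d}"
  by (rule emeasure_mono[OF sub ms])
 also have "... = ennreal (measure leb {x\<in>sphere 0 1. norm (x - x0) \<le> d})"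
  by (rule leb.emeasure_eq_measure)
 finally show ?thesis by (simp add: e_def)
qed

context weight
begin

text \<open>The factor c^2 pays for two squarings, from the fourth root of 1 - |z| back to 1 - |z|.
  The factor 8 pi is 4 times 2 pi: with d = 1 - |z| the kernel is at least 1/(4d) on an arc of
  measure at least d/(2 pi). The maximum with 0 keeps the density non-negative at all
  arguments.\<close>

definition entropy_measure :: "complex set => complex measure" where
 "entropy_measure E = density leb (%\<zeta>. ennreal (8 * pi * c\<^sup>2 * max 0 (lam (arc_setdist \<zeta> E))))"

lemma entropy_measure:
 assumes "finite_entropy w E"
 shows "circle_measure (entropy_measure E)" "emeasure (entropy_measure E) E = 0"
proof -
 note E = finite_entropyD[OF assms]
 have "integrable leb (%x. 8 * pi * c\<^sup>2 * max 0 (lam (arc_setdist x E)))"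
  using E(5) by (intro integrable_mult_right integrable_max) auto
 then show "circle_measure (entropy_measure E)"
  unfolding entropy_measure_def by (rule leb.circle_measure_density)
 have [measurable]: "(%x. lam (arc_setdist x E)) \<in> borel_measurable leb"
  by (rule lam_arc_setdist_measurable[OF E(1-3)])
 have "E \<in> null_sets leb"
  using E closed_sets_circle[OF E(1,2)] by (simp add: null_sets_def)
 then have "E \<in> null_sets (entropy_measure E)"
  unfolding entropy_measure_def by (rule absolutely_continuousI_density[unfolded absolutely_continuous_def, THEN subsetD, rotated]) measurable
 then show "emeasure (entropy_measure E) E = 0" by auto
qed

text \<open>The arc of radius d = 1 - |z| about the projection of z stays within s = d^(1/4) of E,
  so \<open>lam\<close> of the distance to E is at least \<open>lam s\<close> almost everywhere on
  it, while the kernel there is at least 1/(4d). Finally \<open>lam (s ^ 4)\<close> <= c^2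
  \<open>lam s\<close>.\<close>

lemma lam_le_entropy_integral:
 assumes fe: "finite_entropy w E" and z: "z \<in> tangential_region E"
 shows "lam (1 - norm z) \<le> poisson_integral (entropy_measure E) z"
proof -
 note E = finite_entropyD[OF fe]
 define d where "d = 1 - norm z"
 define s where "s = sqrt (sqrt d)"
 have z1: "norm z < 1" and inf: "infdist z E \<le> s / 4"
  using z by (auto simp: tangential_region_def s_def d_def)
 have d: "0 < d" "d \<le> 1" using z1 by (auto simp: d_def)
 have s: "0 < s" "s ^ 4 = d"
 proof -
  show "0 < s" using d by (simp add: s_def)
  have "(s\<^sup>2)\<^sup>2 = d" using d by (simp add: s_def)
  then show "s ^ 4 = d" by simp
 qed
 \<comment> \<open>E lies on the circle. The inequality forces s < 1 and leaves room for the arc: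
   s/4 + 2d <= s.\<close>
 have ds: "d \<le> s / 4" using one_minus_norm_le_infdist[OF E(2,3), of z] inf by (simp add: d_def)
 have s1: "s < 1"
 proof (rule ccontr)
  assume "\<not> s < 1"
  then have "s \<le> s ^ 4" using s by (intro self_le_power) auto
  then show False using s ds by simp
 qed
 have lam_s: "0 \<le> lam s" using s s1 by (intro lam_nonneg) auto
 define h where "h x = max 0 (lam (arc_setdist x E))" for x
 have hm[measurable]: "h \<in> borel_measurable leb"
  unfolding h_def using lam_arc_setdist_measurable[OF E(1-3)] by measurable
 have hi: "integrable leb h"
  unfolding h_def using E(5) by (intro integrable_max) auto
 \<comment> \<open>The radial projection of z; at z = 0 any point of the circle would do.\<close>
 define x0 where "x0 = (if z = 0 then 1 else z / of_real (norm z))"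
 have x0: "norm x0 = 1" "norm (x0 - z) = d"
 proof -
  show "norm x0 = 1" by (auto simp: x0_def norm_divide)
  have "z = of_real (norm z) * x0" by (simp add: x0_def)
  then have "x0 - z = of_real d * x0" by (simp add: d_def algebra_simps)
  then have "norm (x0 - z) = \<bar>d\<bar> * norm x0" by (simp only: norm_mult norm_of_real)
  then show "norm (x0 - z) = d" using \<open>norm x0 = 1\<close> d by simp
 qed
 define A where "A = {x\<in>sphere 0 1. norm (x - x0) \<le> d}"
 have As: "A \<in> sets leb"
  using arc_in_sets unfolding A_def sets_circle_lebesgue .
 have AE_E: "AE x in leb. x \<notin> E"
  using E closed_sets_circle[OF E(1,2)] by (intro AE_not_in) (simp add: null_sets_def)
 have int: "integrable leb (%x. h x * poisson z x)"
 proof (rule LINT_integrable_bound[OF integrable_mult_right[OF hi, of "2 / d"]])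
  show "(%x. h x * poisson z x) \<in> borel_measurable leb"
   using z1 by (intro borel_measurable_times hm leb.borel_measurable_continuous continuous_intros)
  show "AE x in leb. norm (h x * poisson z x) \<le> norm (2 / d * h x)"
  proof (rule AE_I2)
   fix x assume "x \<in> space leb"
   then have n: "norm x = 1" by simp
   have "poisson z x \<le> 2 / d"
    using norm_herglotz_le[OF z1 n] abs_Re_le_cmod[of "herglotz z x"] by (simp add: Re_herglotz[OF n] d_def)
   then have "h x * poisson z x \<le> h x * (2 / d)" by (intro mult_left_mono) (auto simp: h_def)
   then show "norm (h x * poisson z x) \<le> norm (2 / d * h x)"
    using z1 d by (simp add: h_def abs_mult mult.commute)
  qed
 qed
 have "lam s / (8 * pi) = lam s / (4 * d) * (d / (2 * pi))"
  using d by (simp add: field_simps)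
 also have "... \<le> lam s / (4 * d) * measure leb A"
  unfolding A_def using lam_s d by (intro mult_left_mono measure_arc_ge x0) auto
 also have "... = (\<oint>x. lam s / (4 * d) * indicator A x)"
 proof -
  have "A \<inter> space leb = A" by (auto simp: A_def)
  then show ?thesis using As by simp
 qed
 also have "... \<le> (\<oint>x. h x * poisson z x)"
 proof (rule integral_mono_AE)
  show "integrable leb (%x. lam s / (4 * d) * indicator A x)"
   using As by (intro integrable_mult_right integrable_real_indicator) (auto simp: less_top[symmetric])
  show "integrable leb (%x. h x * poisson z x)" by (rule int)
  show "AE x in leb. lam s / (4 * d) * indicator A x \<le> h x * poisson z x"
   using AE_E AE_space
  proof eventually_elim
   case (elim x)
   then have n: "norm x = 1" and nE: "x \<notin> E" by auto
   show ?case
   proof (cases "x \<in> A")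
    case True
    have zd: "norm (x - z) \<le> 2 * d"
     using True x0(2) norm_triangle_ineq[of "x - x0" "x0 - z"] by (simp add: A_def)
    have "infdist x E \<le> infdist z E + dist x z" by (rule infdist_triangle)
    also have "... \<le> s" using inf zd ds s by (simp add: dist_norm)
    finally have "arc_setdist x E \<le> s" using arc_setdist_bounds(4)[OF n E(1-3)] by simp
    moreover have "0 < arc_setdist x E"
     using arc_setdist_bounds(1,3)[OF n E(1-3)] nE by (simp add: less_le)
    ultimately have hs: "lam s \<le> h x"
     unfolding h_def using s1 by (intro max.coboundedI2 lam_antimono) auto
    have "1 / (4 * d) \<le> poisson z x"
    proof -
     have "(norm (x - z))\<^sup>2 \<le> (2 * d)\<^sup>2" using zd by (intro power_mono) auto
     moreover have "d \<le> 1 - (norm z)\<^sup>2"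
      using z1 by (simp add: d_def power2_eq_square mult_left_le)
     moreover have "0 < (norm (x - z))\<^sup>2" using n z1 by auto
     ultimately have "d / (2 * d)\<^sup>2 \<le> poisson z x"
      unfolding poisson_def using d by (intro frac_le) auto
     then show ?thesis using d by (simp add: power2_eq_square)
    qed
    then have "lam s * (1 / (4 * d)) \<le> h x * poisson z x"
     using hs lam_s d by (intro mult_mono) (auto simp: h_def)
    then show ?thesis using True by simp
   next
    case False
    then show ?thesis using z1 by (simp add: h_def)
   qed
  qed
 qed
 finally have 1: "lam s \<le> 8 * pi * (\<oint>x. h x * poisson z x)"
  by (simp add: field_simps)
 have "lam (1 - norm z) = lam (s ^ 4)" by (simp add: s(2) d_def)
 also have "... \<le> c\<^sup>2 * lam s" by (rule lam_power4[OF s(1) s1])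
 also have "... \<le> c\<^sup>2 * (8 * pi * (\<oint>x. h x * poisson z x))"
  using 1 by (intro mult_left_mono) auto
 also have "... = (\<oint>x. 8 * pi * c\<^sup>2 * (h x * poisson z x))"
  by (subst integral_mult_right_zero) (simp add: mult_ac)
 also have "... = poisson_integral (entropy_measure E) z"
  unfolding entropy_measure_def h_def[symmetric]
  by (subst leb.poisson_integral_density) (auto simp: h_def[symmetric] z1 mult_ac, auto simp: h_def)
 finally show ?thesis .
qed

end

section \<open>Permanence of singular inner factors\<close>

context weight
begin

text \<open>The bound must not depend on sup |g|. Let F be the function S of the entropy measure, so
  that |F| <= w in the region. On the lateral edge of the region the singular function is at least
  exp(-32 M) in modulus, so gF is at most N exp(32 M) there; towards the circle gF tends to 0
  because g is bounded and w tends to 0. The maximum principle does the rest.\<close>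

lemma permanence_estimate:
 assumes fe: "finite_entropy w E" and \<mu>: "circle_measure \<mu>" and g: "bounded_on_disc g"
  and N: "\<And>z. norm z < 1 ==> w (1 - norm z) * norm (g z * singular_inner (density \<mu> (indicator E)) z) \<le> N"
  and z0: "z0 \<in> tangential_region E"
 shows "norm (g z0) \<le> N * exp (32 * measure \<mu> (sphere 0 1)) * exp (poisson_integral (entropy_measure E) z0)"
proof -
 note E = finite_entropyD[OF fe]
 have Es: "E \<in> sets circle_borel" by (rule closed_sets_circle[OF E(1,2)])
 define S where "S = singular_inner (density \<mu> (indicator E))"
 define F where "F = singular_inner (entropy_measure E)"
 define u where "u z = g z * F z" for z
 define M where "M = measure \<mu> (sphere 0 1)"
 interpret m: circle_measure "density \<mu> (indicator E)" by (rule circle_measure_restrict[OF \<mu> Es])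
 interpret e: circle_measure "entropy_measure E" by (rule entropy_measure[OF fe])
 have M0: "0 \<le> M" by (simp add: M_def)
 define A where "A = N * exp (32 * M)"
 have "0 \<le> w (1 - norm (0::complex)) * norm (g 0 * S 0)"
  using w_disc(1)[of 0] by simp
 also have "... \<le> N" unfolding S_def by (rule N) simp
 finally have N0: "0 \<le> N" .
 have A0: "0 \<le> A" using N0 by (simp add: A_def)
 have Fle: "norm (F z) \<le> w (1 - norm z)" if "z \<in> tangential_region E" for z
 proof -
  have z: "norm z < 1" using that by (simp add: tangential_region_def)
  have "norm (F z) = exp (- poisson_integral (entropy_measure E) z)"
   unfolding F_def by (rule e.norm_singular_inner[OF z])
  also have "... \<le> exp (- lam (1 - norm z))" using lam_le_entropy_integral[OF fe that] by simp
  also have "... = w (1 - norm z)" using z by (intro w_eq_exp[symmetric]) auto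
  finally show ?thesis .
 qed
 have z01: "norm z0 < 1" using z0 by (simp add: tangential_region_def)
 obtain Q where Q: "0 < Q" "\<And>z. norm z < 1 ==> norm (g z) \<le> Q"
  using bounded_on_discD(2)[OF g] by blast
 have edge: "norm (u z) \<le> A" if z: "norm z < 1" "infdist z E = sqrt (sqrt (1 - norm z)) / 4" for z
 proof -
  have zr: "z \<in> tangential_region E" using z by (simp add: tangential_region_def)
  have "poisson_integral (density \<mu> (indicator E)) z \<le> 32 * sqrt (1 - norm z) * M"
   unfolding M_def using z by (intro poisson_integral_off_region_le[OF \<mu> Es]) auto
  also have "... \<le> 32 * 1 * M" using M0 z by (intro mult_right_mono mult_left_mono) auto
  finally have "1 / norm (S z) \<le> exp (32 * M)"
   unfolding S_def m.norm_singular_inner[OF z(1)] by (simp add: exp_minus inverse_eq_divide)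
  moreover have "norm (g z * S z) * norm (F z) \<le> N"
  proof -
   have "norm (g z * S z) * norm (F z) \<le> norm (g z * S z) * w (1 - norm z)"
    by (intro mult_left_mono Fle zr) auto
   also have "... \<le> N" using N[OF z(1)] by (simp add: S_def mult.commute)
   finally show ?thesis .
  qed
  ultimately have "(norm (g z * S z) * norm (F z)) * (1 / norm (S z)) \<le> N * exp (32 * M)"
   using N0 by (intro mult_mono) auto
  moreover have "norm (S z) \<noteq> 0" by (simp add: S_def)
  ultimately show ?thesis by (simp add: u_def norm_mult A_def)
 qed
 have "norm (u z0) \<le> A"
 proof (rule ccontr)
  assume "\<not> norm (u z0) \<le> A"
  then have gt: "A < norm (u z0)" by simp
  \<comment> \<open>Truncation at |z| = r adds a boundary part where |gF| is at most Q w(1 - r); r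
    is chosen so close to 1 that this is at most half of the value to be refuted.\<close>
  define A' where "A' = max A (norm (u z0) / 2)"
  have A': "A \<le> A'" "A' < norm (u z0)" using gt A0 by (auto simp: A'_def)
  have "0 < norm (u z0)" using gt A0 by linarith
  then have "0 < norm (u z0) / 2 / Q" using Q(1) by (intro divide_pos_pos) auto
  then obtain d where d: "0 < d" "d < 1" "\<And>t. 0 \<le> t ==> t \<le> d ==> w t < norm (u z0) / 2 / Q"
   by (rule w_small) blast
  define r where "r = max (1 - d) ((1 + norm z0) / 2)"
  have r: "norm z0 < r" "r < 1" "1 - r \<le> d" "0 < r"
  proof -
   have "norm z0 < (1 + norm z0) / 2" "(1 + norm z0) / 2 < 1" using z01 by simp_all
   then show "norm z0 < r" "r < 1" "1 - r \<le> d" "0 < r" using d(1,2) by (auto simp: r_def less_max_iff_disj)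
  qed
  define G where "G = {z. norm z < r \<and> infdist z E < sqrt (sqrt (1 - norm z)) / 4}"
  define G' where "G' = {z. norm z \<le> r \<and> infdist z E \<le> sqrt (sqrt (1 - norm z)) / 4}"
  have opG: "open G"
   unfolding G_def by (intro open_Collect_conj open_Collect_less continuous_intros) auto
  have clG': "closed G'"
   unfolding G'_def by (intro closed_Collect_conj closed_Collect_le continuous_intros) auto
  have GG': "closure G \<subseteq> G'"
   by (rule closure_minimal[OF _ clG']) (auto simp: G_def G'_def)
  have "G' \<subseteq> ball 0 1" using r by (auto simp: G'_def)
  have uh: "u holomorphic_on ball 0 1"
   unfolding u_def F_def by (intro holomorphic_intros bounded_on_discD(1)[OF g] e.singular_inner_holomorphic)
  have fr: "norm (u z) \<le> A'" if "z \<in> frontier G" for z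
  proof -
   have zG: "z \<in> G'" "z \<notin> G"
    using that GG' opG by (auto simp: frontier_def interior_open)
   have z1: "norm z < 1" using zG r by (simp add: G'_def)
   show ?thesis
   proof (cases "norm z = r")
    case True
    have zr: "z \<in> tangential_region E" using zG z1 by (simp add: G'_def tangential_region_def)
    have "norm (u z) \<le> Q * w (1 - norm z)"
     unfolding u_def norm_mult using Q z1 by (intro mult_mono Fle zr) auto
    also have "w (1 - norm z) \<le> norm (u z0) / 2 / Q"
     using d(3)[of "1 - norm z"] True r by simp
    then have "Q * w (1 - norm z) \<le> Q * (norm (u z0) / 2 / Q)" using Q by (intro mult_left_mono) auto
    also have "... = norm (u z0) / 2" using Q by simp
    also have "... \<le> A'" by (simp add: A'_def)
    finally show ?thesis .
   next
    case False
    then have "infdist z E = sqrt (sqrt (1 - norm z)) / 4"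
     using zG by (auto simp: G_def G'_def)
    then show ?thesis using edge[OF z1] A' by simp
   qed
  qed
  have nG: "z0 \<in> G"
  proof (rule ccontr)
   assume "z0 \<notin> G"
   then have "infdist z0 E = sqrt (sqrt (1 - norm z0)) / 4"
    using z0 r by (auto simp: G_def tangential_region_def)
   then show False using edge[OF z01] gt by simp
  qed
  have "norm (u z0) \<le> A'"
  proof (rule maximum_modulus_frontier[OF _ _ _ _ nG])
   show "u holomorphic_on interior G"
    by (rule holomorphic_on_subset[OF uh]) (unfold interior_open[OF opG], use r in "auto simp: G_def")
   show "continuous_on (closure G) u"
    by (rule continuous_on_subset[OF holomorphic_on_imp_continuous_on[OF uh]])
     (use GG' \<open>G' \<subseteq> ball 0 1\<close> in blast)
   show "bounded G" by (rule bounded_subset[of "ball 0 1"]) (use r in "auto simp: G_def")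
   show "\<And>z. z \<in> frontier G ==> norm (u z) \<le> A'" by (rule fr)
  qed
  then show False using A' by simp
 qed
 moreover have "norm (F z0) = exp (- poisson_integral (entropy_measure E) z0)"
  unfolding F_def by (rule e.norm_singular_inner[OF z01])
 ultimately show ?thesis
  by (simp add: u_def norm_mult A_def M_def exp_minus field_simps)
qed

text \<open>Each approximant q b = (q g) S obeys the preceding estimate with N = H + 1, whatever q
  is. The estimate therefore survives the passage to the limit, at each point separately.\<close>

lemma permanence_bound:
 assumes fe: "finite_entropy w E" and \<mu>: "circle_measure \<mu>" and g: "bounded_on_disc g"
  and b: "\<And>z. norm z < 1 ==> b z = g z * singular_inner (density \<mu> (indicator E)) z"
  and bG: "b \<in> G_space w" and h: "h \<in> G_generated w b"
 obtains C where "0 < C" "\<And>z. z \<in> tangential_region E ==>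
  norm (h z / singular_inner (density \<mu> (indicator E)) z) \<le> C * exp (poisson_integral (entropy_measure E) z)"
proof -
 define S where "S = singular_inner (density \<mu> (indicator E))"
 have hG: "h \<in> G_space w" using G_generated_sub[OF bG] h by blast
 obtain H where H: "0 < H" "\<And>z. norm z < 1 ==> w (1 - norm z) * norm (h z) \<le> H"
  by (rule G_space_bounded[OF hG]) blast
 define C where "C = (H + 1) * exp (32 * measure \<mu> (sphere 0 1))"
 have C: "0 < C" using H by (simp add: C_def)
 have "norm (h z / S z) \<le> C * exp (poisson_integral (entropy_measure E) z)"
  if z: "z \<in> tangential_region E" for z
 proof (rule field_le_epsilon)
  fix e :: real assume e: "0 < e"
  have z1: "norm z < 1" using z by (simp add: tangential_region_def)
  have S0: "0 < norm (S z)" by (simp add: S_def)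
  have wz: "0 < w (1 - norm z)" using w_disc[OF z1] by simp
  \<comment> \<open>The tolerance depends on z, as division by the weight and by S(z) must leave an
    error of at most e.\<close>
  define e' where "e' = min 1 (e * (w (1 - norm z) * norm (S z)))"
  have e': "0 < e'" "e' \<le> 1" "e' \<le> e * (w (1 - norm z) * norm (S z))"
   using e wz S0 by (auto simp: e'_def)
  obtain q where q: "bounded_on_disc q" "\<And>z. norm z < 1 ==> w (1 - norm z) * norm (q z * b z - h z) \<le> e'"
   using G_generated_approx[OF bG h e'(1)] by blast
  have "norm (q z * g z) \<le> (H + 1) * exp (32 * measure \<mu> (sphere 0 1)) * exp (poisson_integral (entropy_measure E) z)"
  proof (rule permanence_estimate[OF fe \<mu> bounded_on_disc_mult[OF q(1) g] _ z])
   fix y :: complex assume y: "norm y < 1"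
   have "norm (q y * g y * singular_inner (density \<mu> (indicator E)) y) \<le> norm (h y) + norm (q y * b y - h y)"
    using norm_triangle_ineq[of "h y" "q y * b y - h y"] by (simp add: b[OF y] mult.assoc)
   then have "w (1 - norm y) * norm (q y * g y * singular_inner (density \<mu> (indicator E)) y) \<le>
     w (1 - norm y) * (norm (h y) + norm (q y * b y - h y))"
    using w_disc[OF y] by (intro mult_left_mono) auto
   also have "... \<le> H + 1"
    unfolding distrib_left using H(2)[OF y] q(2)[OF y] e'(2) by (intro add_mono) auto
   finally show "w (1 - norm y) * norm (q y * g y * singular_inner (density \<mu> (indicator E)) y) \<le> H + 1" .
  qed
  moreover have "norm (h z / S z) \<le> norm (q z * g z) + e"
  proof -
   have "h z / S z = q z * g z - (q z * b z - h z) / S z"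
    using S0 by (simp add: b[OF z1] S_def[symmetric] field_simps)
   then have "norm (h z / S z) \<le> norm (q z * g z) + norm ((q z * b z - h z) / S z)"
    by (simp only: norm_triangle_ineq4)
   also have "norm ((q z * b z - h z) / S z) \<le> e"
   proof -
    have "w (1 - norm z) * norm (q z * b z - h z) \<le> w (1 - norm z) * (e * norm (S z))"
     using q(2)[OF z1] e'(3) by (simp add: mult_ac)
    then have "norm (q z * b z - h z) \<le> e * norm (S z)" using wz by simp
    then show ?thesis using S0 by (simp add: norm_divide pos_divide_le_eq)
   qed
   finally show ?thesis by simp
  qed
  ultimately show "norm (h z / S z) \<le> C * exp (poisson_integral (entropy_measure E) z) + e"
   unfolding C_def by linarith
 qed
 with C show thesis using that unfolding S_def by blast
qed

end

section \<open>Blaschke products\<close>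

lemma one_minus_cnj_mult_nz:
 assumes "norm a < 1" "norm z \<le> (1::real)"
 shows "1 - cnj a * z \<noteq> 0"
proof -
 have "norm (cnj a * z) \<le> norm a * 1" using assms by (simp add: norm_mult mult_left_le)
 then have "norm (cnj a * z) < 1" using assms by simp
 then show ?thesis by auto
qed

lemma norm_blaschke_factor_le:
 assumes a: "norm a < 1" and z: "norm z < 1"
 shows "norm (blaschke_factor a z) \<le> 1"
proof (cases "a = 0")
 case False
 have "(norm (1 - cnj a * z))\<^sup>2 - (norm (a - z))\<^sup>2 = (1 - (norm a)\<^sup>2) * (1 - (norm z)\<^sup>2)"
  unfolding cmod_power2 by (simp add: algebra_simps power2_eq_square)
 also have "... \<ge> 0" using a z by (intro mult_nonneg_nonneg) (auto simp: power_le_one_iff)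
 finally have "(norm (a - z))\<^sup>2 \<le> (norm (1 - cnj a * z))\<^sup>2" by (simp only: diff_ge_0_iff_ge)
 then have "norm (a - z) \<le> norm (1 - cnj a * z)" by (rule power2_le_imp_le) (rule norm_ge_zero)
 moreover have "norm (blaschke_factor a z) = norm a / norm a * (norm (a - z) / norm (1 - cnj a * z))"
  unfolding blaschke_factor_def if_not_P[OF False] norm_mult[of "of_real (norm a) / a"] norm_divide norm_of_real abs_norm_cancel ..
 moreover have "0 < norm (1 - cnj a * z)"
  using one_minus_cnj_mult_nz[OF a less_imp_le[OF z]] by (rule zero_less_norm_iff[THEN iffD2])
 ultimately show ?thesis using False by (metis divide_le_eq_1_pos divide_self mult_1 norm_eq_zero)
qed (use z in "simp add: blaschke_factor_def")

text \<open>Over the common denominator the difference has numerator -(a + |a| z)(1 - |a|), and the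
  Blaschke condition sums the factors 1 - |a|.\<close>

lemma norm_blaschke_factor_minus_1_le:
 assumes a: "norm a < 1" and z: "norm z < 1"
 shows "norm (blaschke_factor a z - 1) \<le> 2 / (1 - norm z) * (1 - norm a)"
proof (cases "a = 0")
 case True
 have "norm (z - 1) \<le> 2" using norm_triangle_ineq4[of z 1] z by simp
 also have "2 \<le> 2 / (1 - norm z)" using z by (simp add: field_simps)
 finally show ?thesis using True by (simp add: blaschke_factor_def)
next
 case False
 have nz: "1 - cnj a * z \<noteq> 0" by (rule one_minus_cnj_mult_nz) (use a z in auto)
 define N where "N = complex_of_real (norm a)"
 define D where "D = 1 - cnj a * z"
 have "of_real ((norm a)\<^sup>2) = a * cnj a" by (rule complex_norm_square)
 then have aca: "a * cnj a = N * N" by (simp add: N_def power2_eq_square)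
 have "a * D = a - (a * cnj a) * z" by (simp add: D_def algebra_simps)
 then have num: "N * (a - z) - a * D = - ((a + N * z) * (1 - N))"
  unfolding aca by (simp add: algebra_simps)
 have "D \<noteq> 0" using nz by (simp add: D_def)
 have "blaschke_factor a z - 1 = N / a * ((a - z) / D) - 1"
  using False by (simp add: blaschke_factor_def N_def D_def)
 also have "... = N * (a - z) / (a * D) - a * D / (a * D)"
  using False \<open>D \<noteq> 0\<close> by (simp only: times_divide_times_eq) simp
 also have "... = (N * (a - z) - a * D) / (a * D)" by (rule diff_divide_distrib[symmetric])
 finally have "blaschke_factor a z - 1 = - ((a + of_real (norm a) * z) * (1 - of_real (norm a)) / (a * (1 - cnj a * z)))"
  unfolding num by (simp add: N_def D_def)
 then have "norm (blaschke_factor a z - 1) = norm (a + of_real (norm a) * z) * norm (1 - complex_of_real (norm a)) / (norm a * norm (1 - cnj a * z))"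
  by (simp only: norm_minus_cancel norm_mult norm_divide)
 also have "norm (1 - complex_of_real (norm a)) = 1 - norm a"
  using a by (metis abs_of_nonneg diff_ge_0_iff_ge less_imp_le norm_of_real of_real_1 of_real_diff)
 also have "norm (a + of_real (norm a) * z) * (1 - norm a) / (norm a * norm (1 - cnj a * z)) \<le>
   (norm a * 2) * (1 - norm a) / (norm a * (1 - norm z))"
 proof (intro frac_le mult_right_mono mult_left_mono)
  have "norm (a + of_real (norm a) * z) \<le> norm a + norm a * norm z"
   using norm_triangle_ineq[of a "of_real (norm a) * z"] by (simp add: norm_mult)
  also have "... \<le> norm a + norm a * 1" using z by (intro add_left_mono mult_left_mono) auto
  finally show "norm (a + of_real (norm a) * z) \<le> norm a * 2" by simp
  have "norm (cnj a * z) \<le> 1 * norm z" unfolding norm_mult using a by (intro mult_right_mono) auto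
  then show "1 - norm z \<le> norm (1 - cnj a * z)"
   using norm_triangle_ineq2[of 1 "cnj a * z"] by simp
 qed (use a z False in auto)
 also have "... = 2 / (1 - norm z) * (1 - norm a)" using False by simp
 finally show ?thesis .
qed

lemma blaschke_factor_eq_0_iff:
 assumes "norm a < 1" "norm z < 1"
 shows "blaschke_factor a z = 0 \<longleftrightarrow> z = a"
proof -
 have "1 - cnj a * z \<noteq> 0" by (rule one_minus_cnj_mult_nz) (use assms in auto)
 then show ?thesis unfolding blaschke_factor_def by (simp only: mult_eq_0_iff divide_eq_0_iff of_real_eq_0_iff norm_eq_zero split: if_split) auto
qed

lemma blaschke_factor_holomorphic:
 assumes "norm a < 1"
 shows "blaschke_factor a holomorphic_on ball 0 1"
proof (cases "a = 0")
 case True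
 then show ?thesis by (simp add: blaschke_factor_def[abs_def])
next
 case False
 then have "(%z. of_real (norm a) / a * ((a - z) / (1 - cnj a * z))) holomorphic_on ball 0 1"
  using one_minus_cnj_mult_nz[OF assms] by (intro holomorphic_intros) auto
 then show ?thesis using False by (simp add: blaschke_factor_def[abs_def])
qed

text \<open>On the closed disc 1 - c x has positive real part, so its principal logarithm is
  holomorphic inside, with value 0 at the centre.\<close>

lemma integral_ln_one_minus:
 assumes "norm c < 1"
 shows "(\<oint>x. ln (norm (1 - c * x))) = 0"
  "continuous_on (sphere 0 1) (%x. ln (norm (1 - c * x)))"
proof -
 have nc: "norm (c * x) < 1" if "norm x \<le> 1" for x
  using that assms mult_left_le[of "norm x" "norm c"] by (simp add: norm_mult)
 have nz: "1 - c * x \<noteq> 0" if "norm x \<le> 1" for x using nc[OF that] by auto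
 have np: "1 - c * x \<notin> \<real>\<^sub>\<le>\<^sub>0" if "norm x \<le> 1" for x
 proof
  assume "1 - c * x \<in> \<real>\<^sub>\<le>\<^sub>0"
  then have "Re (1 - c * x) \<le> 0" by (simp add: complex_nonpos_Reals_iff)
  then show False using nc[OF that] complex_Re_le_cmod[of "c * x"] by simp
 qed
 have cL: "continuous_on (cball 0 1) (%x. Ln (1 - c * x))"
  using np by (intro continuous_intros) auto
 have hL: "(%x. Ln (1 - c * x)) holomorphic_on ball 0 1"
  using np by (intro holomorphic_intros) auto
 have cs: "continuous_on (sphere 0 1) (%x. Ln (1 - c * x))"
  by (rule continuous_on_subset[OF cL]) auto
 show "continuous_on (sphere 0 1) (%x. ln (norm (1 - c * x)))"
  using nz by (intro continuous_intros) auto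
 have "(\<oint>x. ln (norm (1 - c * x))) = (\<oint>x. Re (Ln (1 - c * x)))"
  using nz by (intro LINT_cong) auto
 also have "... = Re (\<oint>x. Ln (1 - c * x))"
  by (intro integral_Re leb.integrable_continuous cs)
 also have "... = 0"
  using mean_value_circle_lebesgue[OF cL hL] by simp
 finally show "(\<oint>x. ln (norm (1 - c * x))) = 0" .
qed

text \<open>Jensen's formula for one factor: the larger of r and |a| is pulled out of |a - r x|,
  which leaves |1 - c x| with |c| < 1, of logarithmic mean 0. For |a| = r there would be a zero on
  the circle of integration.\<close>

lemma integral_ln_blaschke_factor:
 assumes a: "norm a < 1" and r: "0 < r" "r < 1" "norm a \<noteq> r"
 shows "(\<oint>x. ln (norm (blaschke_factor a (of_real r * x)))) = ln (max r (norm a))"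
proof (cases "a = 0")
 case True
 have "(\<oint>x. ln (norm (blaschke_factor a (of_real r * x)))) = (\<oint>x. ln r)"
  using True r by (intro LINT_cong) (auto simp: blaschke_factor_def norm_mult)
 then show ?thesis using True r by simp
next
 case False
 define m where "m = max r (norm a)"
 have m: "0 < m" using r by (simp add: m_def)
 obtain c where c: "norm c < 1" "\<And>x. norm x = 1 ==> norm (a - of_real r * x) = m * norm (1 - c * x)"
 proof (cases "norm a < r")
  case True
  show thesis
  proof (rule that[of "cnj a / of_real r"])
   show "norm (cnj a / of_real r) < 1" using True r by (simp add: norm_divide)
   fix x :: complex assume n: "norm x = 1"
   have 1: "x * cnj x = 1" using n by (simp add: complex_norm_square[symmetric])
   have "norm (a - of_real r * x) = norm (cnj x * (a - of_real r * x))" using n by (simp add: norm_mult)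
   also have "cnj x * (a - of_real r * x) = cnj (cnj a * x - of_real r)"
    using 1 by (simp add: algebra_simps)
   also have "norm ... = norm (cnj a * x - of_real r)" by (rule complex_mod_cnj)
   also have "... = norm (- of_real r * (1 - cnj a / of_real r * x))" using r by (simp add: algebra_simps)
   also have "... = m * norm (1 - cnj a / of_real r * x)"
    unfolding norm_mult using r True by (simp add: m_def)
   finally show "norm (a - of_real r * x) = m * norm (1 - cnj a / of_real r * x)" .
  qed
 next
  case ge: False
  show thesis
  proof (rule that[of "of_real r / a"])
   show "norm (of_real r / a) < 1" using ge r False by (simp add: norm_divide)
   fix x :: complex assume n: "norm x = 1"
   have "a - of_real r * x = a * (1 - of_real r / a * x)" using False by (simp add: algebra_simps)
   then have "norm (a - of_real r * x) = norm a * norm (1 - of_real r / a * x)" by (simp only: norm_mult)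
   then show "norm (a - of_real r * x) = m * norm (1 - of_real r / a * x)" using ge by (simp add: m_def)
  qed
 qed
 have d: "norm (cnj a * of_real r) < 1"
  using a r mult_left_le[of r "norm a"] by (simp add: norm_mult)
 have "(\<oint>x. ln (norm (blaschke_factor a (of_real r * x)))) =
   (\<oint>x. ln m + ln (norm (1 - c * x)) - ln (norm (1 - cnj a * of_real r * x)))"
 proof (intro LINT_cong refl)
  fix x assume "x \<in> space leb"
  then have n: "norm x = 1" by simp
  have one: "norm (1 - e * x) \<noteq> 0" if "norm e < 1" for e
   using one_minus_cnj_mult_nz[of "cnj e" x] that n by simp
  note 1 = one[OF c(1)] and 2 = one[OF d]
  have "norm (blaschke_factor a (of_real r * x)) = m * norm (1 - c * x) / norm (1 - cnj a * of_real r * x)"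
   using False c(2)[OF n] by (simp add: blaschke_factor_def norm_mult norm_divide mult.assoc)
  then show "ln (norm (blaschke_factor a (of_real r * x))) = ln m + ln (norm (1 - c * x)) - ln (norm (1 - cnj a * of_real r * x))"
   using m 1 2 by (simp add: ln_div ln_mult)
 qed
 also have "... = ln m"
 proof -
  note i1 = leb.integrable_continuous[OF integral_ln_one_minus(2)[OF c(1)]]
  note i2 = leb.integrable_continuous[OF integral_ln_one_minus(2)[OF d]]
  have "(\<oint>x. ln m + ln (norm (1 - c * x)) - ln (norm (1 - cnj a * of_real r * x))) =
    (\<oint>x. ln m) + (\<oint>x. ln (norm (1 - c * x))) -
    (\<oint>x. ln (norm (1 - cnj a * of_real r * x)))"
   using i1 i2 leb.integrable_const[of "ln m"]
   by (simp only: LINT_diff LINT_add Bochner_Integration.integrable_add)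
  then show ?thesis
   unfolding integral_ln_one_minus(1)[OF c(1)] integral_ln_one_minus(1)[OF d] by simp
 qed
 finally show ?thesis by (simp add: m_def)
qed

locale blaschke =
 fixes J :: "nat set" and \<Lambda> :: "nat => complex"
 assumes in_disc: "\<And>n. n \<in> J ==> norm (\<Lambda> n) < 1" and condition: "blaschke_condition J \<Lambda>"
begin

definition factor :: "nat => complex => complex" where
 "factor n z = (if n \<in> J then blaschke_factor (\<Lambda> n) z else 1)"

definition B :: "complex => complex" where "B z = prodinf (%n. factor n z)"

definition gap :: "nat => real" where "gap n = (if n \<in> J then 1 - norm (\<Lambda> n) else 0)"

lemma blaschke_product_eq: "blaschke_product \<gamma> J \<Lambda> z = cis \<gamma> * B z"
 by (simp add: blaschke_product_def B_def factor_def)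

lemma summable_gap: "summable gap" and gap_nonneg: "0 \<le> gap n"
 using condition in_disc by (auto simp: blaschke_condition_def gap_def[abs_def] gap_def less_imp_le)

lemma norm_factor_le: "norm z < 1 ==> norm (factor n z) \<le> 1"
 by (simp add: factor_def norm_blaschke_factor_le in_disc)

lemma norm_factor_minus_1_le: "norm z < 1 ==> norm (factor n z - 1) \<le> 2 / (1 - norm z) * gap n"
 by (simp add: factor_def gap_def norm_blaschke_factor_minus_1_le in_disc del: times_divide_eq_left)

lemma factor_eq_0_iff: "norm z < 1 ==> factor n z = 0 \<longleftrightarrow> n \<in> J \<and> z = \<Lambda> n"
 by (simp add: factor_def blaschke_factor_eq_0_iff in_disc)

lemma factor_holomorphic: "factor n holomorphic_on ball 0 1"
 by (cases "n \<in> J") (simp_all add: factor_def[abs_def] blaschke_factor_holomorphic in_disc)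

lemma convergent_factors: "norm z < 1 ==> convergent_prod (%n. factor n z)"
proof (rule abs_convergent_prod_imp_convergent_prod, rule summable_imp_abs_convergent_prod)
 assume z: "norm z < 1"
 show "summable (%n. norm (factor n z - 1))"
  by (rule summable_comparison_test'[OF summable_mult[OF summable_gap, of "2 / (1 - norm z)"], of 0])
   (use norm_factor_minus_1_le[OF z] in auto)
qed

lemma partial_tendsto: "norm z < 1 ==> (%N. \<Prod>n<N. factor n z) \<longlonglongrightarrow> B z"
 using convergent_prod_LIMSEQ[OF convergent_factors] unfolding B_def by (simp add: LIMSEQ_lessThan_iff_atMost)

lemma B_eq_0_iff: "norm z < 1 ==> B z = 0 \<longleftrightarrow> (\<exists>n\<in>J. z = \<Lambda> n)"
 using has_prod_eq_0_iff[OF convergent_prod_has_prod[OF convergent_factors]]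
 by (auto simp: B_def factor_eq_0_iff)

lemma norm_partial_le: "norm z < 1 ==> norm (\<Prod>n<N. factor n z) \<le> 1"
 unfolding prod_norm[symmetric] by (intro prod_le_1) (auto simp: norm_factor_le)

lemma norm_B_le_prod:
 assumes z: "norm z < 1" and F: "finite F"
 shows "norm (B z) \<le> (\<Prod>n\<in>F. norm (factor n z))"
proof (rule LIMSEQ_le_const2[OF tendsto_norm[OF partial_tendsto[OF z]]])
 obtain M where M: "F \<subseteq> {..<M}" using F by (meson finite_nat_iff_bounded)
 show "\<exists>N. \<forall>n\<ge>N. norm (\<Prod>i<n. factor i z) \<le> (\<Prod>n\<in>F. norm (factor n z))"
 proof (intro exI[of _ M] allI impI)
  fix n assume "M \<le> n"
  then have s: "F \<subseteq> {..<n}" using M by auto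
  have "norm (\<Prod>i<n. factor i z) = (\<Prod>i\<in>F. norm (factor i z)) * (\<Prod>i\<in>{..<n} - F. norm (factor i z))"
   by (subst prod.subset_diff[OF s]) (simp_all add: prod_norm[symmetric] norm_mult mult.commute)
  also have "... \<le> (\<Prod>i\<in>F. norm (factor i z)) * 1"
   using norm_factor_le[OF z] by (intro mult_left_mono prod_le_1 prod_nonneg) auto
  finally show "norm (\<Prod>i<n. factor i z) \<le> (\<Prod>n\<in>F. norm (factor n z))" by simp
 qed
qed

lemma norm_B_le: "norm z < 1 ==> norm (B z) \<le> 1"
 using norm_B_le_prod[of z "{}"] by simp

lemma uniform_limit_partial:
 assumes R: "R < 1"
 shows "uniform_limit (cball 0 R) (%N z. \<Prod>n<N. factor n z) B sequentially"
proof -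
 have sub: "cball 0 R \<subseteq> ball (0::complex) 1" using R by auto
 have "uniformly_convergent_on (cball 0 R) (%N z. \<Prod>n<N. factor n z)"
 proof (rule uniformly_convergent_on_prod')
  show "continuous_on (cball 0 R) (factor n)" for n
   using factor_holomorphic[of n] sub by (blast intro: holomorphic_on_imp_continuous_on continuous_on_subset)
  show "uniformly_convergent_on (cball 0 R) (%N z. \<Sum>n<N. norm (factor n z - 1))"
  proof (rule Weierstrass_m_test'[OF _ summable_mult[OF summable_gap]])
   fix n and z :: complex assume z: "z \<in> cball 0 R"
   then have z1: "norm z < 1" using R by simp
   have "norm (factor n z - 1) \<le> 2 / (1 - norm z) * gap n" by (rule norm_factor_minus_1_le[OF z1])
   also have "... \<le> 2 / (1 - R) * gap n"
    using z z1 R gap_nonneg by (intro mult_right_mono divide_left_mono) auto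
   finally show "norm (norm (factor n z - 1)) \<le> 2 / (1 - R) * gap n" by simp
  qed
 qed simp
 then obtain l where l: "uniform_limit (cball 0 R) (%N z. \<Prod>n<N. factor n z) l sequentially"
  by (auto simp: uniformly_convergent_on_def)
 have "l z = B z" if "z \<in> cball 0 R" for z
 proof (rule LIMSEQ_unique)
  show "(%N. \<Prod>n<N. factor n z) \<longlonglongrightarrow> l z" by (rule tendsto_uniform_limitI[OF l that])
  show "(%N. \<Prod>n<N. factor n z) \<longlonglongrightarrow> B z" using that R by (intro partial_tendsto) simp
 qed
 then have "uniform_limit (cball 0 R) (%N z. \<Prod>n<N. factor n z) l sequentially =
   uniform_limit (cball 0 R) (%N z. \<Prod>n<N. factor n z) B sequentially"
  by (intro uniform_limit_cong') auto
 then show ?thesis using l by simp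
qed

lemma B_holomorphic: "B holomorphic_on ball 0 1"
proof (rule holomorphic_uniform_sequence[OF open_ball])
 show "(%z. \<Prod>n<N. factor n z) holomorphic_on ball 0 1" for N
  by (intro holomorphic_on_prod factor_holomorphic)
 fix x :: complex assume x: "x \<in> ball 0 1"
 define d where "d = (1 - norm x) / 2"
 have d: "0 < d" "norm x + d < 1" using x by (auto simp: d_def field_simps)
 have sub: "cball x d \<subseteq> cball 0 (norm x + d)"
 proof
  fix y assume "y \<in> cball x d"
  then show "y \<in> cball 0 (norm x + d)"
   using norm_triangle_ineq[of x "y - x"] by (simp add: dist_norm norm_minus_commute)
 qed
 show "\<exists>d>0. cball x d \<subseteq> ball 0 1 \<and> uniform_limit (cball x d) (%N z. \<Prod>n<N. factor n z) B sequentially"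
  using d sub by (intro exI[of _ d] conjI uniform_limit_on_subset[OF uniform_limit_partial[OF d(2)] sub]) auto
qed

lemma bounded_B: "bounded_on_disc B"
 using B_holomorphic norm_B_le by (auto simp: bounded_on_disc_def)

text \<open>Only countably many radii meet a zero. By Jensen's formula the factor of index m
  contributes -ln max(r, |\<Lambda> m|), for r >= 1/2 at most twice the minimum of 1 - r and
  \<open>gap m\<close>. These minima are dominated by the summable gaps and tend to 0 as r tends to
  1.\<close>

lemma good_radii_exist: "\<exists>r. good_radii B r"
proof -
 have "\<exists>r. 1 - inverse (real (Suc (Suc n))) < r \<and> r < 1 \<and> r \<notin> (norm \<circ> \<Lambda>) ` UNIV" for n
 proof -
  have "uncountable {1 - inverse (real (Suc (Suc n)))<..<1::real}"
   by (intro uncountable_open_interval[THEN iffD2]) simp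
  moreover have "countable ((norm \<circ> \<Lambda>) ` UNIV)" by simp
  ultimately have "\<not> {1 - inverse (real (Suc (Suc n)))<..<1} \<subseteq> (norm \<circ> \<Lambda>) ` UNIV"
   using countable_subset by blast
  then show ?thesis by auto
 qed
 then obtain r where r: "\<And>n. 1 - inverse (real (Suc (Suc n))) < r n" "\<And>n. r n < 1" "\<And>n m. r n \<noteq> norm (\<Lambda> m)"
  by (metis comp_apply rangeI)
 have half: "1 / 2 \<le> r n" for n
 proof -
  have "inverse (real (Suc (Suc n))) \<le> 1 / 2" by (simp add: field_simps)
  then show ?thesis using r(1)[of n] by linarith
 qed
 have r0: "0 < r n" for n using half[of n] by linarith
 have r1: "r \<longlonglongrightarrow> 1"
 proof (rule tendsto_sandwich[of "%n. 1 - inverse (real (Suc (Suc n)))" _ _ "%_. 1"])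
  have "(%n. 1 - inverse (real (Suc (Suc n)))) \<longlonglongrightarrow> 1 - 0"
   by (intro tendsto_intros LIMSEQ_Suc[OF LIMSEQ_inverse_real_of_nat])
  then show "(%n. 1 - inverse (real (Suc (Suc n)))) \<longlonglongrightarrow> 1" by simp
 qed (intro always_eventually allI less_imp_le r | simp)+
 have nr: "norm (of_real (r n) * y) = r n" if "norm y = 1" for n and y :: complex
  using r0[of n] that by (simp add: norm_mult)
 have nz: "B (of_real (r n) * y) \<noteq> 0" if "norm y = 1" for n y
 proof -
  have "norm (of_real (r n) * y) < 1" using nr[OF that, of n] r(2)[of n] by simp
  moreover have "of_real (r n) * y \<noteq> \<Lambda> m" for m using nr[OF that, of n] r(3)[of n m] by metis
  ultimately show ?thesis by (simp only: B_eq_0_iff) blast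
 qed
 have fnz: "factor m (of_real (r n) * y) \<noteq> 0" if "norm y = 1" for m n y
 proof -
  have "norm (of_real (r n) * y) < 1" using nr[OF that, of n] r(2)[of n] by simp
  moreover have "of_real (r n) * y \<noteq> \<Lambda> m" using nr[OF that, of n] r(3)[of n m] by metis
  ultimately show ?thesis by (simp only: factor_eq_0_iff) blast
 qed
 have cB: "continuous_on (sphere 0 1) (%y. - ln (norm (B (of_real (r n) * y))))" for n
  using nz nr r
  by (intro continuous_intros continuous_on_compose2[OF holomorphic_on_imp_continuous_on[OF B_holomorphic]]) auto
 have cf: "continuous_on (sphere 0 1) (%y. ln (norm (factor m (of_real (r n) * y))))" for m n
  using fnz nr r
  by (intro continuous_intros continuous_on_compose2[OF holomorphic_on_imp_continuous_on[OF factor_holomorphic]]) auto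
 define s where "s n = (\<Sum>m. min (1 - r n) (gap m))" for n
 have smin: "summable (%m. min (1 - r n) (gap m))" for n
  by (rule summable_comparison_test'[OF summable_gap, of 0]) (use r(2)[of n] gap_nonneg in "auto simp: abs_if min_def")
 have one: "(\<oint>y. - ln (norm (factor m (of_real (r n) * y)))) \<le> 2 * min (1 - r n) (gap m)" for m n
 proof (cases "m \<in> J")
  case True
  have "(\<oint>y. - ln (norm (factor m (of_real (r n) * y)))) = - ln (max (r n) (norm (\<Lambda> m)))"
   using True integral_ln_blaschke_factor[OF in_disc[OF True] r0 r(2), of n] r(3)[of n m]
   by (simp add: factor_def)
  also have "... \<le> 2 * (1 - max (r n) (norm (\<Lambda> m)))"
  proof -
   define x where "x = max (r n) (norm (\<Lambda> m))"
   have x: "1 / 2 \<le> x" "x \<le> 1" using half[of n] r(2)[of n] in_disc[OF True] by (auto simp: x_def)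
   have "- ln x = ln (1 / x)" using x by (simp add: ln_div)
   also have "... \<le> 1 / x - 1" using x by (intro ln_le_minus_one) simp
   also have "... = (1 - x) * (1 / x)" using x by (simp add: field_simps)
   also have "... \<le> (1 - x) * 2" using x by (intro mult_left_mono) (auto simp: field_simps)
   finally show ?thesis by (simp add: x_def mult.commute)
  qed
  also have "1 - max (r n) (norm (\<Lambda> m)) = min (1 - r n) (gap m)"
   using True by (auto simp: gap_def max_def min_def)
  finally show ?thesis .
 qed (use r(2)[of n] gap_nonneg in "simp add: factor_def")
 have bound: "(\<oint>y. - ln (norm (B (of_real (r n) * y)))) \<le> 2 * s n" for n
 proof (rule LIMSEQ_le_const2)
  let ?P = "%N y. \<Prod>m<N. factor m (of_real (r n) * y)"
  show "(%N. \<integral>y. - ln (norm (?P N y)) \<partial>leb) \<longlonglongrightarrow> (\<oint>y. - ln (norm (B (of_real (r n) * y))))"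
  proof (rule integral_dominated_convergence[where w="%y. - ln (norm (B (of_real (r n) * y)))"])
   show "(%y. - ln (norm (B (of_real (r n) * y)))) \<in> borel_measurable leb"
    by (rule leb.borel_measurable_continuous[OF cB])
   show "integrable leb (%y. - ln (norm (B (of_real (r n) * y))))"
    by (rule leb.integrable_continuous[OF cB])
   have "continuous_on (sphere 0 1) (%y. - (\<Sum>m<N. ln (norm (factor m (of_real (r n) * y)))))" for N
    by (intro continuous_intros cf)
   then have "continuous_on (sphere 0 1) (%y. - ln (norm (?P N y)))" for N
    by (rule continuous_on_eq) (use fnz in "auto simp: ln_prod prod_norm[symmetric]")
   then show "(%y. - ln (norm (?P N y))) \<in> borel_measurable leb" for N
    by (rule leb.borel_measurable_continuous)
   show "AE y in leb. (%N. - ln (norm (?P N y))) \<longlonglongrightarrow> - ln (norm (B (of_real (r n) * y)))"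
   proof (rule AE_I2)
    fix y assume "y \<in> space leb"
    then have n1: "norm y = 1" by simp
    show "(%N. - ln (norm (?P N y))) \<longlonglongrightarrow> - ln (norm (B (of_real (r n) * y)))"
     using nz[OF n1, of n] nr[OF n1, of n] r(2)[of n]
     by (intro tendsto_intros partial_tendsto) auto
   qed
   \<comment> \<open>Further factors have modulus at most 1, so -log of the full product dominates
     -log of every partial product.\<close>
   show "AE y in leb. norm (- ln (norm (?P N y))) \<le> - ln (norm (B (of_real (r n) * y)))" for N
   proof (rule AE_I2)
    fix y assume "y \<in> space leb"
    then have n1: "norm y = 1" by simp
    have z: "norm (of_real (r n) * y) < 1" using nr[OF n1, of n] r(2)[of n] by simp
    have p0: "0 < norm (?P N y)" using fnz[OF n1] by simp
    have p1: "norm (?P N y) \<le> 1" by (rule norm_partial_le[OF z])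
    have "norm (B (of_real (r n) * y)) \<le> norm (?P N y)"
     using norm_B_le_prod[OF z, of "{..<N}"] by (simp add: prod_norm)
    then have "ln (norm (B (of_real (r n) * y))) \<le> ln (norm (?P N y))"
     using nz[OF n1, of n] p0 by (subst ln_le_cancel_iff) auto
    moreover have "ln (norm (?P N y)) \<le> 0" using p0 p1 by simp
    ultimately show "norm (- ln (norm (?P N y))) \<le> - ln (norm (B (of_real (r n) * y)))" by simp
   qed
  qed
  show "\<exists>N. \<forall>M\<ge>N. (\<oint>y. - ln (norm (?P M y))) \<le> 2 * s n"
  proof (intro exI allI impI)
   fix M
   have "(\<oint>y. - ln (norm (?P M y))) = (\<oint>y. (\<Sum>m<M. - ln (norm (factor m (of_real (r n) * y)))))"
    using fnz by (intro LINT_cong refl) (auto simp: ln_prod prod_norm[symmetric] sum_negf)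
   also have "... = (\<Sum>m<M. \<integral>y. - ln (norm (factor m (of_real (r n) * y))) \<partial>leb)"
    by (intro LINT_sum leb.integrable_continuous continuous_on_minus cf)
   also have "... \<le> (\<Sum>m<M. 2 * min (1 - r n) (gap m))" by (intro sum_mono one)
   also have "... = 2 * (\<Sum>m<M. min (1 - r n) (gap m))" by (simp add: sum_distrib_left)
   also have "... \<le> 2 * s n"
    unfolding s_def using smin r(2)[of n] gap_nonneg
    by (intro mult_left_mono sum_le_suminf) (auto simp: less_imp_le)
   finally show "(\<oint>y. - ln (norm (?P M y))) \<le> 2 * s n" .
  qed
 qed
 have "s \<longlonglongrightarrow> 0"
 proof -
  have lim: "(%n. min (1 - r n) (gap m)) \<longlonglongrightarrow> 0" for m
  proof -
   have "(%n. min (1 - r n) (gap m)) \<longlonglongrightarrow> min (1 - 1) (gap m)" by (intro tendsto_intros r1)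
   then show ?thesis using gap_nonneg[of m] by (simp add: min_def)
  qed
  have dom: "norm (min (1 - r n) (gap k)) \<le> gap k" for k n
   using r(2)[of n] gap_nonneg[of k] by simp
  have "(%n. \<Sum>m. min (1 - r n) (gap m)) \<longlonglongrightarrow> (\<Sum>m. 0)"
   by (rule tannerys_theorem[where a="%m n. min (1 - r n) (gap m)" and M=gap and F=sequentially, THEN conjunct2, THEN conjunct2])
    (use lim dom summable_gap in "auto intro!: always_eventually")
  then have "s \<longlonglongrightarrow> (\<Sum>m. 0)" unfolding s_def .
  then show ?thesis by simp
 qed
 then have "(%n. 2 * s n) \<longlonglongrightarrow> 0" by (rule tendsto_mult_right_zero)
 then have "(%n. \<integral>y. - ln (norm (B (of_real (r n) * y))) \<partial>leb) \<longlonglongrightarrow> 0"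
 proof (rule tendsto_sandwich[of "%_. 0", rotated 3])
  show "\<forall>\<^sub>F n in sequentially. 0 \<le> (\<oint>y. - ln (norm (B (of_real (r n) * y))))"
  proof (rule always_eventually, rule allI, rule integral_nonneg_AE, rule AE_I2)
   fix n y assume "y \<in> space leb"
   then have n1: "norm y = 1" by simp
   show "0 \<le> - ln (norm (B (of_real (r n) * y)))"
    using nz[OF n1, of n] norm_B_le[of "of_real (r n) * y"] nr[OF n1, of n] r(2)[of n] by simp
  qed
 qed (use bound in auto)
 then show ?thesis
  unfolding good_radii_def using r0 r(2) r1 nz by blast
qed

end

text \<open>Near a point where g is not 0 the quotient has constant modulus, hence is constant by
  the maximum principle; analytic continuation extends the identity to the disc.\<close>

lemma equal_norm_imp_unimodular:
 assumes f: "f holomorphic_on ball 0 1" and g: "g holomorphic_on ball 0 1"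
  and eq: "\<And>z. norm z < 1 ==> norm (f z) = norm (g z)"
 shows "\<exists>t. \<forall>z. norm z < 1 --> f z = cis t * g z"
proof (cases "\<exists>a. norm a < 1 \<and> g a \<noteq> 0")
 case False
 then have "f z = 0 \<and> g z = 0" if "norm z < 1" for z using that eq[OF that] by auto
 then show ?thesis by auto
next
 case True
 then obtain a where a: "norm a < 1" "g a \<noteq> 0" by blast
 have "open (ball 0 1 \<inter> g -` (- {0}))"
  by (rule continuous_open_preimage[OF holomorphic_on_imp_continuous_on[OF g] open_ball]) auto
 moreover have "a \<in> ball 0 1 \<inter> g -` (- {0})" using a by simp
 ultimately obtain e where e: "0 < e" "ball a e \<subseteq> ball 0 1 \<inter> g -` (- {0})"
  unfolding open_contains_ball by blast
 have sub: "ball a e \<subseteq> ball 0 1" and nz: "\<And>z. z \<in> ball a e ==> g z \<noteq> 0" using e by auto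
 have q: "(%z. f z / g z) holomorphic_on ball a e"
  using nz by (intro holomorphic_intros holomorphic_on_subset[OF f sub] holomorphic_on_subset[OF g sub]) auto
 have q1: "norm (f z / g z) = 1" if "z \<in> ball a e" for z
  using that sub eq[of z] nz[OF that] by (auto simp: norm_divide)
 have "(%z. f z / g z) constant_on ball a e"
  using e(1) q1 by (intro maximum_modulus_principle[OF q open_ball connected_ball open_ball subset_refl, of a]) auto
 then obtain c where c: "\<And>z. z \<in> ball a e ==> f z / g z = c" by (auto simp: constant_on_def)
 have nc: "norm c = 1" using c[of a] q1[of a] e(1) by auto
 have fc: "f z = c * g z" if "z \<in> ball a e" for z using c[OF that] nz[OF that] by auto
 have "f z = c * g z" if "norm z < 1" for z
 proof (rule analytic_continuation_open[of "ball a e" "ball 0 1" f "%z. c * g z"])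
  show "(%z. c * g z) holomorphic_on ball 0 1" by (intro holomorphic_intros g)
 qed (use f e(1) sub fc that in auto)
 moreover have "c = cis (Arg c)" using rcis_cmod_Arg[of c] nc by (simp add: rcis_def)
 ultimately show ?thesis by metis
qed

text \<open>The injection reorders the factors, so initial segments of the products do not
  correspond. Moduli of finite products decrease as factors are added, and finite subproducts give
  both inequalities; the argument is lost later by an appeal to
  \<open>equal_norm_imp_unimodular\<close>.\<close>

lemma blaschke_split:
 assumes "blaschke J \<Lambda>" "blaschke J0 \<Lambda>0" and \<iota>: "inj_on \<iota> J0" "\<iota> ` J0 \<subseteq> J"
  and eq: "\<And>n. n \<in> J0 ==> \<Lambda> (\<iota> n) = \<Lambda>0 n"
 defines "J2 \<equiv> J - \<iota> ` J0"
 shows "blaschke J2 \<Lambda>"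
  "norm z < 1 ==> norm (blaschke.B J \<Lambda> z) = norm (blaschke.B J0 \<Lambda>0 z) * norm (blaschke.B J2 \<Lambda> z)"
proof -
 interpret b: blaschke J \<Lambda> by fact
 interpret b0: blaschke J0 \<Lambda>0 by fact
 show b2: "blaschke J2 \<Lambda>"
 proof
  show "norm (\<Lambda> n) < 1" if "n \<in> J2" for n using that b.in_disc by (simp add: J2_def)
  show "blaschke_condition J2 \<Lambda>"
   unfolding blaschke_condition_def
   by (rule summable_comparison_test'[OF b.summable_gap, of 0])
    (use b.in_disc in "auto simp: J2_def b.gap_def less_imp_le")
 qed
 then interpret b2: blaschke J2 \<Lambda> .
 assume z: "norm z < 1"
 have fac0: "b.factor (\<iota> n) z = b0.factor n z" if "n \<in> J0" for n
  using that \<iota>(2) eq[OF that] by (auto simp: b.factor_def b0.factor_def)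
 have fac2: "b.factor n z = b2.factor n z" if "n \<in> J2" for n
  using that unfolding b.factor_def b2.factor_def by (simp add: J2_def)
 have union: "(\<Prod>n\<in>\<iota> ` F \<union> G. norm (b.factor n z)) = (\<Prod>n\<in>F. norm (b0.factor n z)) * (\<Prod>n\<in>G. norm (b2.factor n z))"
  if F: "finite F" "F \<subseteq> J0" and G: "finite G" "G \<subseteq> J2" for F G
 proof -
  have "(\<Prod>n\<in>\<iota> ` F \<union> G. norm (b.factor n z)) = (\<Prod>n\<in>\<iota> ` F. norm (b.factor n z)) * (\<Prod>n\<in>G. norm (b.factor n z))"
   by (rule prod.union_disjoint) (use F G in "auto simp: J2_def")
  also have "(\<Prod>n\<in>\<iota> ` F. norm (b.factor n z)) = (\<Prod>n\<in>F. norm (b.factor (\<iota> n) z))"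
   using prod.reindex[OF inj_on_subset[OF \<iota>(1) F(2)], of "%n. norm (b.factor n z)"] by simp
  also have "... = (\<Prod>n\<in>F. norm (b0.factor n z))" using F(2) by (intro prod.cong) (auto simp: fac0)
  also have "(\<Prod>n\<in>G. norm (b.factor n z)) = (\<Prod>n\<in>G. norm (b2.factor n z))"
   using G(2) by (intro prod.cong) (auto simp: fac2)
  finally show ?thesis .
 qed
 have restrict: "(\<Prod>n\<in>{..<N} \<inter> K. norm (blaschke.factor K L n z)) = norm (\<Prod>n<N. blaschke.factor K L n z)"
  if "blaschke K L" for K L and N :: nat
  unfolding prod_norm[symmetric]
  by (rule prod.mono_neutral_left) (auto simp: blaschke.factor_def[OF that])
 show "norm (b.B z) = norm (b0.B z) * norm (b2.B z)"
 proof (rule antisym)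
  show "norm (b.B z) \<le> norm (b0.B z) * norm (b2.B z)"
  proof (rule LIMSEQ_le_const)
   show "(%N. norm (\<Prod>n<N. b0.factor n z) * norm (\<Prod>n<N. b2.factor n z)) \<longlonglongrightarrow> norm (b0.B z) * norm (b2.B z)"
    by (intro tendsto_intros b0.partial_tendsto b2.partial_tendsto z)
   show "\<exists>N. \<forall>n\<ge>N. norm (b.B z) \<le> norm (\<Prod>i<n. b0.factor i z) * norm (\<Prod>i<n. b2.factor i z)"
   proof (intro exI allI impI)
    fix N
    have "norm (b.B z) \<le> (\<Prod>n\<in>\<iota> ` ({..<N} \<inter> J0) \<union> ({..<N} \<inter> J2). norm (b.factor n z))"
     by (rule b.norm_B_le_prod[OF z]) auto
    also have "... = norm (\<Prod>n<N. b0.factor n z) * norm (\<Prod>n<N. b2.factor n z)"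
     by (subst union) (auto simp: restrict[OF assms(2)] restrict[OF b2])
    finally show "norm (b.B z) \<le> norm (\<Prod>i<N. b0.factor i z) * norm (\<Prod>i<N. b2.factor i z)" .
   qed
  qed
  show "norm (b0.B z) * norm (b2.B z) \<le> norm (b.B z)"
  proof (rule LIMSEQ_le_const[OF tendsto_norm[OF b.partial_tendsto[OF z]]])
   show "\<exists>N. \<forall>n\<ge>N. norm (b0.B z) * norm (b2.B z) \<le> norm (\<Prod>i<n. b.factor i z)"
   proof (intro exI allI impI)
    fix N
    let ?F = "{n\<in>J0. \<iota> n < N}" and ?G = "{..<N} \<inter> J2"
    have fin: "finite ?F"
    proof (rule finite_imageD)
     show "finite (\<iota> ` ?F)" by (rule finite_subset[of _ "{..<N}"]) auto
     show "inj_on \<iota> ?F" by (rule inj_on_subset[OF \<iota>(1)]) auto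
    qed
    have "norm (b0.B z) * norm (b2.B z) \<le> (\<Prod>n\<in>?F. norm (b0.factor n z)) * (\<Prod>n\<in>?G. norm (b2.factor n z))"
     by (intro mult_mono b0.norm_B_le_prod[OF z fin] b2.norm_B_le_prod[OF z] prod_nonneg) auto
    also have "... = (\<Prod>n\<in>\<iota> ` ?F \<union> ?G. norm (b.factor n z))"
     by (rule union[symmetric]) (use fin in auto)
    also have "\<iota> ` ?F \<union> ?G = {..<N} \<inter> J" using \<iota>(2) by (auto simp: J2_def)
    finally show "norm (b0.B z) * norm (b2.B z) \<le> norm (\<Prod>i<N. b.factor i z)"
     by (simp only: restrict[OF assms(1)])
   qed
  qed
 qed
qed

section \<open>Radial limits\<close>

abbreviation radial_limit :: "(complex => complex) => complex => complex => bool" where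
 "radial_limit g \<zeta> l \<equiv> ((%r::real. g (of_real r * \<zeta>)) \<longlongrightarrow> l) (at_left 1)"

lemma circle_borel_sets_Int: "A \<in> sets borel ==> A \<inter> sphere 0 1 \<in> sets circle_borel"
 by (auto simp: sets_restrict_space)

text \<open>For s < 1 the Poisson kernel at the point (1 - s) x has integral 1 and is at least
  1/(4s) on the disc of radius s about x.\<close>

lemma emeasure_disc_le:
 assumes x: "norm x = 1" and s: "0 < s"
 shows "emeasure leb (cball x s \<inter> sphere 0 1) \<le> ennreal (4 * s)"
proof (cases "s < 1")
 case False
 have "emeasure leb (cball x s \<inter> sphere 0 1) \<le> emeasure leb (sphere 0 1)"
  by (intro emeasure_mono) (auto simp: sets.top[of circle_borel, simplified])
 also have "... \<le> ennreal (4 * s)" using False by (simp add: emeasure_circle_lebesgue_space)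
 finally show ?thesis .
next
 case True
 define z where "z = of_real (1 - s) * x"
 have nz: "norm z = 1 - s" unfolding z_def norm_mult norm_of_real using True x by simp
 have z: "norm z < 1" using nz s by simp
 let ?D = "cball x s \<inter> sphere 0 1"
 have D: "?D \<in> sets leb" by (simp add: circle_borel_sets_Int)
 have lower: "1 / (4 * s) \<le> poisson z y" if "y \<in> ?D" for y
 proof -
  have "y - z = (y - x) + of_real s * x" by (simp add: z_def algebra_simps)
  then have "norm (y - z) \<le> norm (y - x) + norm (of_real s * x)" by (metis norm_triangle_ineq)
  also have "... \<le> s + s"
   using that s x by (intro add_mono) (auto simp: norm_mult dist_norm norm_minus_commute)
  finally have "(norm (y - z))\<^sup>2 \<le> (2 * s)\<^sup>2" by (intro power_mono) auto
  moreover have "0 < norm (y - z)" using that circle_minus_disc_nz[OF _ z] by simp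
  moreover have "s \<le> 1 - (norm z)\<^sup>2"
  proof -
   have "s * s \<le> s * 1" using s True by (intro mult_left_mono) auto
   then show ?thesis unfolding nz by (simp add: power2_eq_square algebra_simps)
  qed
  ultimately have "s / (2 * s)\<^sup>2 \<le> poisson z y"
   unfolding poisson_def using s by (intro frac_le) auto
  moreover have "s / (2 * s)\<^sup>2 = 1 / (4 * s)" using s by (simp add: power2_eq_square)
  ultimately show ?thesis by simp
 qed
 have "(\<oint>y. 1 / (4 * s) * indicator ?D y) \<le> (\<oint>y. poisson z y)"
 proof (rule integral_mono)
  show "integrable leb (%y. 1 / (4 * s) * indicator ?D y)"
   by (intro integrable_mult_right integrable_real_indicator D) (simp add: leb.emeasure_eq_measure)
  show "integrable leb (poisson z)"
   by (intro leb.integrable_continuous continuous_on_poisson z)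
  show "1 / (4 * s) * indicator ?D y \<le> poisson z y" for y
   using lower[of y] poisson_nonneg[of z y] z by (auto simp: indicator_def)
 qed
 then have "measure leb ?D / (4 * s) \<le> 1"
  using D integral_poisson_lebesgue[OF z] by simp
 then have "measure leb ?D \<le> 4 * s" using s by (simp add: divide_le_eq)
 then show ?thesis
  by (simp only: leb.emeasure_eq_measure ennreal_leI)
qed

text \<open>With d = 1 - r the kernel is at most the sum of the indicators of the discs of radius
  2^j d about y with coefficients 32/(4^j d). By hypothesis the disc of index j contributes at most
  (t/2) 2^(-j).\<close>

lemma poisson_average_le:
 fixes f :: "complex => real"
 assumes c: "continuous_on (sphere 0 1) f" and f0: "\<And>x. 0 \<le> f x" and y: "norm y = 1"
  and r: "0 \<le> r" "r < 1" and t: "0 < t"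
  and small: "\<And>s. 0 < s ==> s \<le> 2 ==> (\<oint>u. f u * indicator (cball y s) u) \<le> t * s / 64"
 shows "(\<oint>u. poisson (of_real r * y) u * f u) \<le> t"
proof -
 define z where "z = of_real r * y"
 have nz: "norm z = r" unfolding z_def norm_mult norm_of_real using r y by simp
 have z: "norm z < 1" using nz r by simp
 define d where "d = 1 - r"
 have d: "0 < d" "d \<le> 1" using r by (auto simp: d_def)
 have fi: "integrable leb f" by (rule leb.integrable_continuous[OF c])
 have fI: "integrable leb (%u. f u * indicator (cball y s) u)" for s
 proof (rule LINT_integrable_bound[OF fi])
  have "f \<in> borel_measurable leb" using fi by simp
  moreover have "indicator (cball y s) \<in> borel_measurable leb"
   unfolding leb.measurable_circle_iff by (intro measurable_restrict_space1 borel_measurable_indicator) simp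
  ultimately show "(%u. f u * indicator (cball y s) u) \<in> borel_measurable leb"
   by (rule borel_measurable_times)
 qed (auto simp: indicator_def f0)
 have far: "sphere 0 1 \<subseteq> cball y 2"
 proof
  fix u :: complex assume "u \<in> sphere 0 1"
  then show "u \<in> cball y 2" using norm_triangle_ineq4[of y u] y by (simp add: dist_norm)
 qed
 have small': "(\<oint>u. f u * indicator (cball y s) u) \<le> t * s / 64" if s: "0 < s" for s
 proof (cases "s \<le> 2")
  case False
  have "cball y 2 \<subseteq> cball y s" using False by (intro subset_cball) simp
  then have "(\<oint>u. f u * indicator (cball y s) u) = (\<oint>u. f u * indicator (cball y 2) u)"
   using far by (intro LINT_cong refl) (auto simp: indicator_def)
  also have "... \<le> t * 2 / 64" by (rule small) auto
  also have "... \<le> t * s / 64" using False t by simp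
  finally show ?thesis .
 qed (use small s in auto)
 obtain N where N: "2 / d < 2 ^ N" using real_arch_pow[of 2 "2 / d"] by auto
 define a where "a j = 32 / (4 ^ j * d)" for j :: nat
 have a0: "0 \<le> a j" for j using d by (simp add: a_def)
 have kernel: "poisson z u \<le> (\<Sum>j\<le>N. a j * indicator (cball y (2 ^ j * d)) u)" if u: "norm u = 1" for u
 proof -
  have "u \<in> cball y 2" using far u by auto
  moreover have "2 \<le> 2 ^ N * d" using N d by (simp add: divide_less_eq less_imp_le)
  ultimately have ex: "norm (u - y) \<le> 2 ^ N * d" by (simp add: dist_norm norm_minus_commute)
  define j where "j = (LEAST j. norm (u - y) \<le> 2 ^ j * d)"
  have j: "norm (u - y) \<le> 2 ^ j * d" unfolding j_def by (rule LeastI[of _ N]) (rule ex)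
  have jN: "j \<le> N" unfolding j_def by (rule Least_le) (rule ex)
  have "poisson z u \<le> a j"
  proof (cases j)
   case 0
   have "poisson z u \<le> 2 * (1 - norm z) / d\<^sup>2"
    using z d circle_minus_disc_ge[OF u, of z] nz by (intro poisson_le) (auto simp: d_def)
   also have "... = 2 / d" using d nz by (simp add: d_def[symmetric] power2_eq_square)
   also have "... \<le> a j" using d 0 by (simp add: a_def divide_right_mono)
   finally show ?thesis .
  next
   case (Suc i)
   have "\<not> norm (u - y) \<le> 2 ^ i * d" using Suc not_less_Least[of i "%j. norm (u - y) \<le> 2 ^ j * d"] by (simp add: j_def)
   moreover have "norm (u - y) \<le> 2 * norm (u - z)"
   proof -
    have "z - y = of_real (- d) * y" by (simp add: z_def d_def algebra_simps)
    then have "norm (z - y) = d" using d y by (simp only: norm_mult norm_of_real)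
    moreover have "norm (u - y) \<le> norm (u - z) + norm (z - y)"
     using norm_triangle_ineq[of "u - z" "z - y"] by simp
    moreover have "d \<le> norm (u - z)" using circle_minus_disc_ge[OF u, of z] nz by (simp add: d_def)
    ultimately show ?thesis by simp
   qed
   ultimately have "2 ^ i * d / 2 \<le> norm (u - z)" by simp
   then have "poisson z u \<le> 2 * (1 - norm z) / (2 ^ i * d / 2)\<^sup>2"
    using d z by (intro poisson_le) auto
   also have "... = a j"
   proof -
    have "(2::real) ^ i * 2 ^ i = 4 ^ i" by (simp flip: power_mult_distrib)
    then have e1: "(2 ^ i * d / 2)\<^sup>2 = 4 ^ i * d * d / 4" by (simp add: power2_eq_square mult.assoc mult.left_commute)
    have e2: "1 - norm z = d" using nz by (simp add: d_def)
    show ?thesis unfolding e1 e2 a_def Suc using d by simp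
   qed
   finally show ?thesis .
  qed
  also have "a j = a j * indicator (cball y (2 ^ j * d)) u" using j by (simp add: dist_norm norm_minus_commute)
  also have "... \<le> (\<Sum>j\<le>N. a j * indicator (cball y (2 ^ j * d)) u)"
   using jN a0 by (intro member_le_sum) auto
  finally show ?thesis .
 qed
 have "(\<oint>u. poisson z u * f u) \<le>
   (\<oint>u. (\<Sum>j\<le>N. a j * (f u * indicator (cball y (2 ^ j * d)) u)))"
 proof (rule integral_mono)
  show "integrable leb (%u. poisson z u * f u)"
   by (intro leb.integrable_continuous continuous_intros c z)
  show "integrable leb (%u. \<Sum>j\<le>N. a j * (f u * indicator (cball y (2 ^ j * d)) u))"
   by (intro LINT_integrable_sum integrable_mult_right fI)
  fix u assume "u \<in> space leb"
  then have "poisson z u * f u \<le> (\<Sum>j\<le>N. a j * indicator (cball y (2 ^ j * d)) u) * f u"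
   by (intro mult_right_mono kernel f0) simp
  then show "poisson z u * f u \<le> (\<Sum>j\<le>N. a j * (f u * indicator (cball y (2 ^ j * d)) u))"
   by (simp only: sum_distrib_right mult.assoc mult.commute[of "f u"])
 qed
 also have "... = (\<Sum>j\<le>N. a j * (\<oint>u. f u * indicator (cball y (2 ^ j * d)) u))"
  by (subst LINT_sum) (auto intro!: integrable_mult_right fI)
 also have "... \<le> (\<Sum>j\<le>N. a j * (t * (2 ^ j * d) / 64))"
  using d by (intro sum_mono mult_left_mono small' a0) simp
 also have "... = (\<Sum>j\<le>N. t / 2 * (1 / 2) ^ j)"
 proof (rule sum.cong[OF refl])
  fix j :: nat
  have "(4::real) ^ j = 2 ^ j * 2 ^ j" by (simp flip: power_mult_distrib)
  then show "a j * (t * (2 ^ j * d) / 64) = t / 2 * (1 / 2) ^ j"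
   using d by (simp add: a_def power_one_over)
 qed
 also have "... = t / 2 * (\<Sum>j\<le>N. (1 / 2) ^ j)" by (simp add: sum_distrib_left)
 also have "... \<le> t / 2 * 2"
 proof -
  have "(\<Sum>j\<le>N. (1 / 2 :: real) ^ j) = 2 - (1 / 2) ^ N" by (induction N) auto
  then have "(\<Sum>j\<le>N. (1 / 2 :: real) ^ j) \<le> 2" by simp
  then show ?thesis using t by (intro mult_left_mono) auto
 qed
 finally show ?thesis by (simp add: z_def)
qed

text \<open>
 The constant is $64 \cdot 5 \cdot 4$, from the averages, from Vitali's covering lemma and from the
 measure of a disc.
\<close>

lemma maximal_inequality:
 fixes f :: "complex => real"
 assumes c: "continuous_on (sphere 0 1) f" and f0: "\<And>x. 0 \<le> f x" and t: "0 < t"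
  and A: "A \<in> sets circle_borel"
  and large: "\<And>y. y \<in> A ==> \<exists>r. 0 \<le> r \<and> r < 1 \<and> t < (\<oint>u. poisson (of_real r * y) u * f u)"
 shows "measure leb A \<le> 1280 / t * (\<oint>u. f u)"
proof -
 have AS: "A \<subseteq> sphere 0 1" using sets.sets_into_space[OF A] by simp
 have "\<exists>s. 0 < s \<and> s \<le> 2 \<and> t * s / 64 \<le> (\<oint>u. f u * indicator (cball y s) u)" if "y \<in> A" for y
 proof (rule ccontr)
  assume n: "\<not> ?thesis"
  obtain r where r: "0 \<le> r" "r < 1" "t < (\<oint>u. poisson (of_real r * y) u * f u)"
   using large[OF \<open>y \<in> A\<close>] by blast
  have "norm y = 1" using AS that by auto
  then have "(\<oint>u. poisson (of_real r * y) u * f u) \<le> t"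
   by (rule poisson_average_le[OF c f0 _ r(1,2) t]) (use n in "meson linear")
  then show False using r(3) by simp
 qed
 then obtain s where s: "\<And>y. y \<in> A ==> 0 < s y" "\<And>y. y \<in> A ==> s y \<le> 2"
  "\<And>y. y \<in> A ==> t * s y / 64 \<le> (\<oint>u. f u * indicator (cball y (s y)) u)"
  by metis
 have cover: "A \<subseteq> (\<Union>y\<in>A. cball y (s y))"
 proof
  fix y assume "y \<in> A"
  then show "y \<in> (\<Union>y\<in>A. cball y (s y))" using s(1)[of y] by (intro UN_I[of y]) auto
 qed
 obtain C where C: "countable C" "C \<subseteq> A" "pairwise (%i j. disjnt (cball i (s i)) (cball j (s j))) C"
  "A \<subseteq> (\<Union>i\<in>C. cball i (5 * s i))"
  by (rule Vitali_covering_lemma_cballs[OF cover, of 2]) (use s in auto)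
 define X where "X i = cball i (s i) \<inter> sphere 0 1" for i :: complex
 define Y where "Y i = cball i (5 * s i) \<inter> sphere 0 1" for i :: complex
 have X: "X i \<in> sets leb" and Y: "Y i \<in> sets leb" for i
  by (simp_all add: X_def Y_def circle_borel_sets_Int)
 have fi: "integrable leb f" by (rule leb.integrable_continuous[OF c])
 have fm: "f \<in> borel_measurable leb" using fi by simp
 \<comment> \<open>As a measure, f times \<open>leb\<close> makes the disjointness of the selected
   discs usable through countable additivity.\<close>
 define q where "q = density leb (%x. ennreal (f x))"
 have Xs: "emeasure q (X i) = ennreal (\<oint>u. f u * indicator (cball i (s i)) u)" for i
 proof -
  have "emeasure q (X i) = (\<integral>\<^sup>+u. ennreal (f u) * indicator (X i) u \<partial>leb)"
   unfolding q_def by (rule emeasure_density) (use fm X in auto)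
  also have "... = (\<integral>\<^sup>+u. ennreal (f u * indicator (cball i (s i)) u) \<partial>leb)"
   by (intro nn_integral_cong) (auto simp: X_def indicator_def)
  also have "... = ennreal (\<oint>u. f u * indicator (cball i (s i)) u)"
  proof (rule nn_integral_eq_integral)
   show "integrable leb (%u. f u * indicator (cball i (s i)) u)"
   proof (rule LINT_integrable_bound[OF fi])
    have "indicator (cball i (s i)) \<in> borel_measurable leb"
     unfolding leb.measurable_circle_iff by (intro measurable_restrict_space1 borel_measurable_indicator) simp
    with fm show "(%u. f u * indicator (cball i (s i)) u) \<in> borel_measurable leb"
     by (rule borel_measurable_times)
   qed (auto simp: indicator_def f0)
  qed (auto simp: f0)
  finally show ?thesis .
 qed
 have "emeasure leb A = (\<integral>\<^sup>+x. indicator A x \<partial>leb)" using A by simp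
 also have "... \<le> (\<integral>\<^sup>+x. (\<integral>\<^sup>+i. indicator (Y i) x \<partial>count_space C) \<partial>leb)"
 proof (rule nn_integral_mono)
  fix x
  show "indicator A x \<le> (\<integral>\<^sup>+i. indicator (Y i) x \<partial>count_space C)"
  proof (cases "x \<in> A")
   case True
   then obtain i where i: "i \<in> C" "x \<in> cball i (5 * s i)" using C(4) by blast
   then have "x \<in> Y i" using True AS by (auto simp: Y_def)
   then have "indicator A x = (indicator (Y i) x :: ennreal)" using True by simp
   also have "... \<le> (\<integral>\<^sup>+i. indicator (Y i) x \<partial>count_space C)" by (rule nn_integral_ge_point[OF i(1)])
   finally show ?thesis .
  qed simp
 qed
 also have "... = (\<integral>\<^sup>+i. (\<integral>\<^sup>+x. indicator (Y i) x \<partial>leb) \<partial>count_space C)"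
  by (rule nn_integral_count_space_nn_integral[OF C(1)]) (use Y in simp)
 also have "... \<le> (\<integral>\<^sup>+i. ennreal (1280 / t) * emeasure q (X i) \<partial>count_space C)"
 proof (rule nn_integral_mono)
  fix i assume "i \<in> space (count_space C)"
  then have i: "i \<in> A" using C(2) by auto
  have "(\<integral>\<^sup>+x. indicator (Y i) x \<partial>leb) = emeasure leb (Y i)" using Y by simp
  also have "... \<le> ennreal (4 * (5 * s i))"
   unfolding Y_def using i AS s(1)[OF i] by (intro emeasure_disc_le) auto
  also have "... = ennreal (1280 / t * (t * s i / 64))" using t by simp
  also have "... \<le> ennreal (1280 / t * (\<oint>u. f u * indicator (cball i (s i)) u))"
   using t by (intro ennreal_leI mult_left_mono s(3)[OF i]) simp
  also have "... = ennreal (1280 / t) * emeasure q (X i)"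
   unfolding Xs using t by (intro ennreal_mult') simp
  finally show "(\<integral>\<^sup>+x. indicator (Y i) x \<partial>leb) \<le> ennreal (1280 / t) * emeasure q (X i)" .
 qed
 also have "... = ennreal (1280 / t) * (\<integral>\<^sup>+i. emeasure q (X i) \<partial>count_space C)"
  by (intro nn_integral_cmult) simp
 also have "(\<integral>\<^sup>+i. emeasure q (X i) \<partial>count_space C) = emeasure q (\<Union>i\<in>C. X i)"
 proof (rule emeasure_UN_countable[symmetric])
  show "disjoint_family_on X C"
   using C(3) by (auto simp: disjoint_family_on_def pairwise_def disjnt_def X_def)
 qed (use X C(1) in "auto simp: q_def")
 also have "ennreal (1280 / t) * ... \<le> ennreal (1280 / t) * emeasure q (space q)"
  by (intro mult_left_mono emeasure_space) simp
 also have "emeasure q (space q) = ennreal (\<oint>u. f u)"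
 proof -
  have "emeasure q (space q) = (\<integral>\<^sup>+u. ennreal (f u) * indicator (space leb) u \<partial>leb)"
   unfolding q_def space_density by (rule emeasure_density[OF _ sets.top]) (use fm in simp)
  also have "... = (\<integral>\<^sup>+u. ennreal (f u) \<partial>leb)"
   by (intro nn_integral_cong) simp
  also have "... = ennreal (\<oint>u. f u)"
   by (rule nn_integral_eq_integral[OF fi]) (simp add: f0)
  finally show ?thesis .
 qed
 also have "ennreal (1280 / t) * ennreal (\<oint>u. f u) = ennreal (1280 / t * (\<oint>u. f u))"
  using t by (intro ennreal_mult'[symmetric]) simp
 finally have "ennreal (measure leb A) \<le> ennreal (1280 / t * (\<oint>u. f u))"
  by (simp only: leb.emeasure_eq_measure)
 moreover have "0 \<le> 1280 / t * (\<oint>u. f u)"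
  using t f0 by (intro mult_nonneg_nonneg) auto
 ultimately show ?thesis by (simp only: ennreal_le_iff)
qed

section \<open>Parseval's identity and Fatou's theorem\<close>

lemma integral_monomials:
 "(\<oint>x. x ^ i * cnj x ^ j) = (if i = j then 1 else 0)"
proof -
 have *: "(\<oint>x. x ^ i * cnj x ^ j) = (if i = j then 1 else 0)" if "j \<le> i" for i j
 proof -
  have "(\<oint>x. x ^ i * cnj x ^ j) = (\<oint>x. x ^ (i - j))"
  proof (intro LINT_cong refl)
   fix x assume "x \<in> space leb"
   then have "x * cnj x = 1" by (simp add: complex_norm_square[symmetric])
   then have "x ^ j * cnj x ^ j = 1" by (simp flip: power_mult_distrib)
   moreover have "x ^ i = x ^ (i - j) * x ^ j" using that by (simp flip: power_add)
   ultimately show "x ^ i * cnj x ^ j = x ^ (i - j)" by (simp add: mult.assoc)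
  qed
  also have "... = 0 ^ (i - j)"
   by (rule mean_value_circle_lebesgue) (intro continuous_intros holomorphic_intros)+
  finally show ?thesis using that by (auto simp: power_0_left)
 qed
 show ?thesis
 proof (cases "j \<le> i")
  case False
  have "(\<oint>x. x ^ i * cnj x ^ j) = (\<oint>x. cnj (x ^ j * cnj x ^ i))"
   by (simp add: mult.commute)
  also have "... = cnj (\<oint>x. x ^ j * cnj x ^ i)"
   by (rule Bochner_Integration.integral_cnj)
  finally show ?thesis using *[of i j] False by simp
 qed (use * in simp)
qed

lemma integral_polynomials:
 "(\<oint>x. (\<Sum>i<n. c i * (of_real a * x) ^ i) * cnj (\<Sum>j<n. c j * (of_real b * x) ^ j)) =
  of_real (\<Sum>i<n. (norm (c i))\<^sup>2 * (a * b) ^ i)"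
proof -
 let ?t = "%i j. c i * of_real a ^ i * cnj (c j) * of_real b ^ j"
 have int: "integrable leb (%x. k * (x ^ i * cnj x ^ j))" for k i j
  by (intro leb.integrable_continuous continuous_intros)
 have "(\<oint>x. (\<Sum>i<n. c i * (of_real a * x) ^ i) * cnj (\<Sum>j<n. c j * (of_real b * x) ^ j)) =
   (\<oint>x. (\<Sum>i<n. \<Sum>j<n. ?t i j * (x ^ i * cnj x ^ j)))"
  by (intro LINT_cong refl)
   (simp add: sum_product power_mult_distrib mult.assoc mult.left_commute)
 also have "... = (\<Sum>i<n. \<Sum>j<n. \<integral>x. ?t i j * (x ^ i * cnj x ^ j) \<partial>leb)"
  by (simp only: LINT_sum int LINT_integrable_sum)
 also have "... = (\<Sum>i<n. \<Sum>j<n. if i = j then ?t i j else 0)"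
 proof (intro sum.cong refl)
  fix i j
  have "(\<oint>x. ?t i j * (x ^ i * cnj x ^ j)) = ?t i j * (\<oint>x. x ^ i * cnj x ^ j)"
   by (rule integral_mult_right_zero)
  also have "... = (if i = j then ?t i j else 0)" unfolding integral_monomials by simp
  finally show "(\<oint>x. ?t i j * (x ^ i * cnj x ^ j)) = (if i = j then ?t i j else 0)" .
 qed
 also have "... = (\<Sum>i<n. ?t i i)" by (intro sum.cong refl) simp
 also have "... = of_real (\<Sum>i<n. (norm (c i))\<^sup>2 * (a * b) ^ i)"
  unfolding of_real_sum
 proof (intro sum.cong refl)
  fix i
  have "of_real ((norm (c i))\<^sup>2) = c i * cnj (c i)" by (rule complex_norm_square)
  then show "?t i i = of_real ((norm (c i))\<^sup>2 * (a * b) ^ i)"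
   by (simp only: of_real_mult of_real_power power_mult_distrib) (simp add: mult.commute mult.left_commute)
 qed
 finally show ?thesis .
qed

text \<open>I q is the sum of |c n|^2 q^n over the Taylor coefficients. The series is hidden because
  the sequel uses only that the scalar product of two dilations depends on the product of the radii,
  through a monotone function bounded by 1.\<close>

lemma parseval:
 assumes g: "g holomorphic_on ball 0 1" and b: "\<forall>z\<in>ball 0 1. norm (g z) \<le> 1"
 shows "\<exists>I :: real => real.
  (\<forall>a\<in>{0..<1}. \<forall>b\<in>{0..<1}.
   (\<oint>x. g (of_real a * x) * cnj (g (of_real b * x))) = of_real (I (a * b))) \<and>
  mono_on {0..<1} I \<and> (\<forall>q\<in>{0..<1}. I q \<le> 1)"
proof -
 define c where "c n = (deriv ^^ n) g 0 / fact n" for n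
 define P where "P n z = (\<Sum>i<n. c i * z ^ i)" for n z
 have sums: "(%n. c n * z ^ n) sums g z" if "norm z < 1" for z
  using holomorphic_power_series[OF g, of z] that by (simp add: c_def)
 have P: "(%n. P n z) \<longlonglongrightarrow> g z" if "norm z < 1" for z
  using sums[OF that] by (simp add: sums_def P_def)
 have abs: "summable (%n. norm (c n) * r ^ n)" if r: "0 \<le> r" "r < 1" for r
 proof -
  obtain s where s: "r < s" "s < 1" using dense r(2) by blast
  have "summable (%n. c n * (of_real s) ^ n)" using sums[of "of_real s"] r s by (auto simp: sums_iff)
  then have "summable (%n. norm (c n * (of_real r) ^ n))"
   by (rule powser_insidea) (use r s in simp)
  then show ?thesis using r by (simp add: norm_mult norm_power)
 qed
 have gc: "continuous_on (sphere 0 1) (%x. g (of_real a * x))" if "0 \<le> a" "a < 1" for a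
  by (rule dilation_disc(2)[OF g that])
 have lim: "(%n. complex_of_real (\<Sum>i<n. (norm (c i))\<^sup>2 * (a * b) ^ i)) \<longlonglongrightarrow>
   (\<oint>x. g (of_real a * x) * cnj (g (of_real b * x)))"
  if a: "0 \<le> a" "a < 1" and b: "0 \<le> b" "b < 1" for a b
 proof -
  define A where "A = (\<Sum>n. norm (c n) * a ^ n)"
  define B where "B = (\<Sum>n. norm (c n) * b ^ n)"
  have bound: "norm (P n (of_real r * x)) \<le> (\<Sum>n. norm (c n) * r ^ n)" if "norm x = 1" "0 \<le> r" "r < 1" for n r x
  proof -
   have "norm (P n (of_real r * x)) \<le> (\<Sum>i<n. norm (c i) * r ^ i)"
    unfolding P_def by (rule sum_norm_le) (use that in "simp add: norm_mult norm_power")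
   also have "... \<le> (\<Sum>n. norm (c n) * r ^ n)"
    by (rule sum_le_suminf) (use abs that in auto)
   finally show ?thesis .
  qed
  have "(%n. \<integral>x. P n (of_real a * x) * cnj (P n (of_real b * x)) \<partial>leb) \<longlonglongrightarrow>
    (\<oint>x. g (of_real a * x) * cnj (g (of_real b * x)))"
  proof (rule integral_dominated_convergence[where w="%_. A * B"])
   show "(%x. g (of_real a * x) * cnj (g (of_real b * x))) \<in> borel_measurable leb"
    by (intro leb.borel_measurable_continuous continuous_intros gc a b)
   show "(%x. P n (of_real a * x) * cnj (P n (of_real b * x))) \<in> borel_measurable leb" for n
    unfolding P_def by (intro leb.borel_measurable_continuous continuous_intros)
   show "AE x in leb. (%n. P n (of_real a * x) * cnj (P n (of_real b * x))) \<longlonglongrightarrow>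
     g (of_real a * x) * cnj (g (of_real b * x))"
    by (rule AE_I2, intro tendsto_intros P) (use a b in "auto simp: norm_mult")
   show "AE x in leb. norm (P n (of_real a * x) * cnj (P n (of_real b * x))) \<le> A * B" for n
   proof (rule AE_I2)
    fix x assume "x \<in> space leb"
    then have n1: "norm x = 1" by simp
    have "0 \<le> A" unfolding A_def using abs[OF a] a by (intro suminf_nonneg) auto
    then show "norm (P n (of_real a * x) * cnj (P n (of_real b * x))) \<le> A * B"
     unfolding norm_mult complex_mod_cnj A_def B_def
     by (intro mult_mono bound n1 a b) (auto simp: A_def)
   qed
  qed simp
  then show ?thesis unfolding P_def integral_polynomials .
 qed
 define I where "I q = Re (\<oint>x. g (of_real (sqrt q) * x) * cnj (g (of_real (sqrt q) * x)))" for q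
 have ss: "sqrt q * sqrt q = q" "0 \<le> sqrt q" "sqrt q < 1" if "0 \<le> q" "q < 1" for q using that by auto
 have I: "(%n. \<Sum>i<n. (norm (c i))\<^sup>2 * q ^ i) \<longlonglongrightarrow> I q" if "0 \<le> q" "q < 1" for q
  using tendsto_Re[OF lim[OF ss(2,3)[OF that] ss(2,3)[OF that]]]
  unfolding ss(1)[OF that] I_def Re_complex_of_real .
 show ?thesis
 proof (intro exI[of _ I] conjI ballI mono_onI)
  fix a b :: real assume "a \<in> {0..<1}" "b \<in> {0..<1}"
  then have a: "0 \<le> a" "a < 1" and b: "0 \<le> b" "b < 1" by auto
  have "a * b \<le> a * 1" using a b by (intro mult_left_mono) auto
  then have ab: "0 \<le> a * b" "a * b < 1" using a b by auto
  show "(\<oint>x. g (of_real a * x) * cnj (g (of_real b * x))) = of_real (I (a * b))"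
   by (rule LIMSEQ_unique[OF lim[OF a b] tendsto_of_real[OF I[OF ab]]])
 next
  fix p q :: real assume "p \<in> {0..<1}" "q \<in> {0..<1}" "p \<le> q"
  then have pq: "0 \<le> p" "p \<le> q" "q < 1" by auto
  show "I p \<le> I q"
  proof (rule LIMSEQ_le[OF I I])
   show "\<exists>N. \<forall>n\<ge>N. (\<Sum>i<n. (norm (c i))\<^sup>2 * p ^ i) \<le> (\<Sum>i<n. (norm (c i))\<^sup>2 * q ^ i)"
    using pq by (intro exI allI impI sum_mono mult_left_mono power_mono) auto
  qed (use pq in auto)
 next
  fix q :: real assume "q \<in> {0..<1}"
  then have q: "0 \<le> q" "q < 1" by auto
  have "I q \<le> norm (\<oint>x. g (of_real (sqrt q) * x) * cnj (g (of_real (sqrt q) * x)))"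
   unfolding I_def by (rule complex_Re_le_cmod)
  also have "... \<le> (\<oint>x. norm (g (of_real (sqrt q) * x) * cnj (g (of_real (sqrt q) * x))))"
   by (rule integral_norm_bound)
  also have "... \<le> (\<oint>x. 1)"
  proof (rule integral_mono)
   fix x assume "x \<in> space leb"
   then have "norm (of_real (sqrt q) * x) < 1" using q by (simp add: norm_mult)
   then have n: "norm (g (of_real (sqrt q) * x)) \<le> 1" using b by simp
   show "norm (g (of_real (sqrt q) * x) * cnj (g (of_real (sqrt q) * x))) \<le> 1"
    unfolding norm_mult complex_mod_cnj using mult_mono[OF n n] by simp
  qed (intro leb.integrable_continuous continuous_intros gc ss q | simp)+
  also have "... = 1" by simp
  finally show "I q \<le> 1" .
 qed
qed

text \<open>Cauchy-Schwarz for a probability measure, from f <= f^2/(2e) + e/2.\<close>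

lemma integral_le_sqrt:
 fixes f :: "complex => real"
 assumes c: "continuous_on (sphere 0 1) f" and e: "0 < e" and sq: "(\<oint>x. (f x)\<^sup>2) \<le> e\<^sup>2"
 shows "(\<oint>x. f x) \<le> e"
proof -
 have "(\<oint>x. f x) \<le> (\<oint>x. (f x)\<^sup>2 / (2 * e) + e / 2)"
 proof (rule integral_mono)
  fix x
  have "0 \<le> (f x - e)\<^sup>2" by simp
  then have "2 * e * f x \<le> (f x)\<^sup>2 + e * e" by (simp add: power2_eq_square algebra_simps)
  then have "2 * e * f x / (2 * e) \<le> ((f x)\<^sup>2 + e * e) / (2 * e)" using e by (intro divide_right_mono) auto
  then show "f x \<le> (f x)\<^sup>2 / (2 * e) + e / 2" using e by (simp add: add_divide_distrib)
 qed (intro leb.integrable_continuous continuous_intros c | use e in simp)+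
 also have "... = (\<oint>x. (f x)\<^sup>2) / (2 * e) + e / 2"
 proof -
  have "integrable leb (%x. (f x)\<^sup>2 / (2 * e))"
   by (intro leb.integrable_continuous continuous_intros c) (use e in simp)
  then show ?thesis by (subst LINT_add) auto
 qed
 also have "... \<le> e\<^sup>2 / (2 * e) + e / 2" using e sq by (intro add_right_mono divide_right_mono) auto
 also have "... = e" using e by (simp add: power2_eq_square)
 finally show ?thesis .
qed

lemma openin_sphere_sets: "openin (top_of_set (sphere 0 1)) A ==> A \<in> sets circle_borel"
 unfolding openin_open by (auto simp: Int_commute[of "sphere 0 1"] intro!: circle_borel_sets_Int)

definition oscillation_set :: "(complex => complex) => real => real => complex set" where
 "oscillation_set g s t = {\<zeta>\<in>sphere 0 1. \<exists>r. 0 < r \<and> r < 1 \<and> t < norm (g (of_real r * \<zeta>) - g (of_real (s * r) * \<zeta>))}"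

text \<open>The squared L^2 distance of the dilations by \<rho> and s \<rho> is a combination of
  values of I, at most L - I q for L the supremum of I. The maximal inequality converts this into a
  small measure of the set where the difference exceeds t at some radius.\<close>

lemma oscillation_small:
 assumes g: "g holomorphic_on ball 0 1" and b: "\<And>z. norm z < 1 ==> norm (g z) \<le> 1" and t: "0 < t" and e: "0 < e"
 shows "\<exists>s. 0 < s \<and> s < 1 \<and> oscillation_set g s t \<in> sets circle_borel \<and>
  measure leb (oscillation_set g s t) \<le> e"
proof -
 obtain I :: "real => real" where
  I0: "\<forall>a\<in>{0..<1}. \<forall>b\<in>{0..<1}.
   (\<oint>x. g (of_real a * x) * cnj (g (of_real b * x))) = of_real (I (a * b))"
  and mono0: "mono_on {0..<1} I" and le10: "\<forall>q\<in>{0..<1}. I q \<le> 1"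
 proof -
  have "\<forall>z\<in>ball 0 1. norm (g z) \<le> 1" using b by simp
  then show ?thesis using that parseval[OF g] by blast
 qed
 have I: "(\<oint>x. g (of_real a * x) * cnj (g (of_real b * x))) = of_real (I (a * b))"
  if "0 \<le> a" "a < 1" "0 \<le> b" "b < 1" for a b
  using I0 that by simp
 have mono: "I p \<le> I q" if "0 \<le> p" "p \<le> q" "q < 1" for p q
  using that by (intro mono_onD[OF mono0]) auto
 have le1: "I q \<le> 1" if "0 \<le> q" "q < 1" for q using le10 that by simp
 define e' where "e' = e * t / 1280"
 have e': "0 < e'" using e t by (simp add: e'_def)
 define L where "L = Sup (I ` {0..<1})"
 have bdd: "bdd_above (I ` {0..<1})" using le1 by (intro bdd_aboveI2[of _ _ 1]) auto
 have L: "I q \<le> L" if "0 \<le> q" "q < 1" for q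
  unfolding L_def using that by (intro cSUP_upper bdd) auto
 have "\<exists>y\<in>I ` {0..<1}. L - e'\<^sup>2 < y"
  using e' bdd unfolding L_def by (subst less_cSup_iff[symmetric]) auto
 then obtain q where q: "0 \<le> q" "q < 1" "L - e'\<^sup>2 < I q" by auto
 obtain s where s: "q < s" "s < 1" using dense q(2) by blast
 have s0: "0 < s" using s q by linarith
 note gc = dilation_disc(1)[OF g] and gs = dilation_disc(2)[OF g] and gh = dilation_disc(3)[OF g]
 \<comment> \<open>The restriction r < \<rho> allows the Poisson formula for dilations that are
   continuous on the closed disc; \<rho> increases to 1 at the end.\<close>
 define D where "D \<rho> = {x\<in>sphere 0 1. \<exists>r. 0 < r \<and> r < \<rho> \<and> t < norm (g (of_real r * x) - g (of_real (s * r) * x))}" for \<rho> :: real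
 have sr: "0 \<le> s * r" "s * r < 1" if "0 \<le> r" "r < 1" for r
 proof -
  have "s * r \<le> 1 * r" using s that by (intro mult_right_mono) auto
  then show "0 \<le> s * r" "s * r < 1" using that s0 by auto
 qed
 have Dm: "D \<rho> \<in> sets circle_borel" if "\<rho> \<le> 1" for \<rho>
 proof -
  have "openin (top_of_set (sphere 0 1))
    (\<Union>r\<in>{0<..<\<rho>}. sphere 0 1 \<inter> (%x. norm (g (of_real r * x) - g (of_real (s * r) * x))) -` {t<..})"
  proof (rule openin_Union, clarify)
   fix r assume r: "r \<in> {0<..<\<rho>}"
   have "continuous_on (sphere 0 1) (%x. norm (g (of_real r * x) - g (of_real (s * r) * x)))"
    by (intro continuous_intros gs sr) (use r that in auto)
   then show "openin (top_of_set (sphere 0 1)) (sphere 0 1 \<inter> (%x. norm (g (of_real r * x) - g (of_real (s * r) * x))) -` {t<..})"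
    by (rule continuous_openin_preimage_gen) simp
  qed
  also have "... = D \<rho>" by (auto simp: D_def)
  finally show ?thesis by (rule openin_sphere_sets)
 qed
 \<comment> \<open>From this radius on s \<rho>^2 >= q, so that I takes a value above L - e'^2
   there.\<close>
 define \<rho>0 where "\<rho>0 = sqrt (q / s)"
 have \<rho>0: "0 \<le> \<rho>0" "\<rho>0 < 1" using q s s0 by (auto simp: \<rho>0_def)
 have Dle: "measure leb (D \<rho>) \<le> e" if \<rho>: "\<rho>0 \<le> \<rho>" "0 < \<rho>" "\<rho> < 1" for \<rho>
 proof -
  define G where "G z = g (of_real \<rho> * z) - g (of_real (s * \<rho>) * z)" for z
  have r1: "0 \<le> \<rho>" "\<rho> < 1" "0 \<le> s * \<rho>" "s * \<rho> < 1" using \<rho> sr[of \<rho>] by auto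
  have Gc: "continuous_on (cball 0 1) G" unfolding G_def by (intro continuous_intros gc r1)
  have Gs: "continuous_on (sphere 0 1) G" by (rule continuous_on_subset[OF Gc]) auto
  have Gh: "G holomorphic_on ball 0 1" unfolding G_def by (intro holomorphic_intros gh r1)
  have max: "measure leb (D \<rho>) \<le> 1280 / t * (\<oint>x. norm (G x))"
  proof (rule maximal_inequality[OF continuous_on_norm[OF Gs] norm_ge_zero t])
   show "D \<rho> \<in> sets circle_borel" using \<rho> by (intro Dm) simp
   fix x assume "x \<in> D \<rho>"
   then obtain r where n1: "norm x = 1" and r: "0 < r" "r < \<rho>" "t < norm (g (of_real r * x) - g (of_real (s * r) * x))"
    by (auto simp: D_def)
   define z where "z = of_real (r / \<rho>) * x"
   have z: "norm z < 1" unfolding z_def norm_mult norm_of_real using r \<rho> n1 by simp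
   have "of_real \<rho> * z = of_real r * x" "of_real (s * \<rho>) * z = of_real (s * r) * x"
    using \<rho> by (simp_all add: z_def)
   then have "t < norm (G z)" using r(3) by (simp only: G_def)
   also have "G z = (\<oint>u. poisson z u * G u)"
    by (rule Poisson_formula[OF Gc Gh z, symmetric])
   also have "norm ... \<le> (\<oint>u. norm (poisson z u * G u))" by (rule integral_norm_bound)
   also have "... = (\<oint>u. poisson z u * norm (G u))"
    using z by (simp add: norm_mult)
   finally show "\<exists>r. 0 \<le> r \<and> r < 1 \<and> t < (\<oint>u. poisson (of_real r * x) u * norm (G u))"
    unfolding z_def using r \<rho> by (intro exI[of _ "r / \<rho>"]) simp
  qed
  have "(\<oint>x. norm (G x)) \<le> e'"
  proof (rule integral_le_sqrt[OF continuous_on_norm[OF Gs] e'])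
   have int: "integrable leb (%x. g (of_real a * x) * cnj (g (of_real b * x)))" if "0 \<le> a" "a < 1" "0 \<le> b" "b < 1" for a b
    by (intro leb.integrable_continuous continuous_intros gs that)
   have "complex_of_real (\<oint>x. (norm (G x))\<^sup>2) = (\<oint>x. of_real ((norm (G x))\<^sup>2))"
    by (rule integral_complex_of_real[symmetric])
   also have "... = (\<oint>x. g (of_real \<rho> * x) * cnj (g (of_real \<rho> * x)) - g (of_real \<rho> * x) * cnj (g (of_real (s * \<rho>) * x))
     - g (of_real (s * \<rho>) * x) * cnj (g (of_real \<rho> * x)) + g (of_real (s * \<rho>) * x) * cnj (g (of_real (s * \<rho>) * x)))"
    unfolding complex_norm_square by (intro LINT_cong refl) (simp add: G_def algebra_simps)
   also have "... = of_real (I (\<rho> * \<rho>)) - of_real (I (\<rho> * (s * \<rho>))) - of_real (I (s * \<rho> * \<rho>)) + of_real (I (s * \<rho> * (s * \<rho>)))"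
    by (simp only: LINT_add LINT_diff Bochner_Integration.integrable_add Bochner_Integration.integrable_diff int I r1)
   also have "... = complex_of_real (I (\<rho> * \<rho>) - I (\<rho> * (s * \<rho>)) - I (s * \<rho> * \<rho>) + I (s * \<rho> * (s * \<rho>)))"
    by (simp only: of_real_diff of_real_add)
   finally have eq: "(\<oint>x. (norm (G x))\<^sup>2) = I (\<rho> * \<rho>) - I (\<rho> * (s * \<rho>)) - I (s * \<rho> * \<rho>) + I (s * \<rho> * (s * \<rho>))"
    by (simp only: of_real_eq_iff)
   have "\<rho> * \<rho> \<le> \<rho> * 1" using \<rho> by (intro mult_left_mono) auto
   then have a: "0 \<le> \<rho> * \<rho>" "\<rho> * \<rho> < 1" using \<rho> by (simp, linarith)
   have "s * \<rho> * (s * \<rho>) \<le> s * \<rho> * \<rho>" using s s0 \<rho> by (intro mult_left_mono) auto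
   moreover have "s * \<rho> * \<rho> < 1" using sr[OF a] by (simp add: mult.assoc)
   ultimately have "I (s * \<rho> * (s * \<rho>)) \<le> I (s * \<rho> * \<rho>)" using r1 by (intro mono) auto
   moreover have "I (\<rho> * \<rho>) \<le> L" by (rule L[OF a])
   moreover have "I q \<le> I (\<rho> * (s * \<rho>))"
   proof (rule mono)
    have "q / s \<le> \<rho>\<^sup>2" using \<rho>(1) power_mono[OF \<rho>(1) \<rho>0(1), of 2] q s0 by (simp add: \<rho>0_def)
    then show "q \<le> \<rho> * (s * \<rho>)" using s0 by (simp add: divide_le_eq power2_eq_square mult.assoc mult.left_commute mult.commute)
    show "\<rho> * (s * \<rho>) < 1" using sr[OF a] by (simp add: mult.assoc mult.left_commute)
   qed (rule q(1))
   ultimately show "(\<oint>x. (norm (G x))\<^sup>2) \<le> e'\<^sup>2" unfolding eq using q(3) by linarith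
  qed
  then have "1280 / t * (\<oint>x. norm (G x)) \<le> 1280 / t * e'" using t by (intro mult_left_mono) auto
  also have "1280 / t * e' = e" using t by (simp add: e'_def)
  finally show ?thesis using max by (rule order_trans[rotated])
 qed
 define \<rho> where "\<rho> n = 1 - (1 - \<rho>0) / real (n + 2)" for n
 have \<rho>: "\<rho>0 \<le> \<rho> n" "0 < \<rho> n" "\<rho> n < 1" for n
 proof -
  define d where "d = (1 - \<rho>0) / real (n + 2)"
  have "d \<le> (1 - \<rho>0) / 1" unfolding d_def using \<rho>0 by (intro divide_left_mono) auto
  moreover have "d < 1"
  proof -
   have "d \<le> 1 / real (n + 2)" unfolding d_def using \<rho>0 by (intro divide_right_mono) auto
   also have "... < 1" by simp
   finally show ?thesis .
  qed
  moreover have "0 < d" unfolding d_def using \<rho>0 by (intro divide_pos_pos) auto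
  ultimately show "\<rho>0 \<le> \<rho> n" "0 < \<rho> n" "\<rho> n < 1" unfolding \<rho>_def d_def[symmetric] by auto
 qed
 have \<rho>lim: "\<rho> \<longlonglongrightarrow> 1"
 proof -
  have "(%n. (1 - \<rho>0) / real (n + 2)) \<longlonglongrightarrow> 0" by (rule LIMSEQ_ignore_initial_segment[OF lim_const_over_n])
  then have "(%n. 1 - (1 - \<rho>0) / real (n + 2)) \<longlonglongrightarrow> 1 - 0" by (intro tendsto_intros)
  then show ?thesis unfolding \<rho>_def by (simp only: diff_zero)
 qed
 have inc: "\<rho> n \<le> \<rho> m" if "n \<le> m" for n m
  unfolding \<rho>_def using that \<rho>0 by (intro diff_left_mono divide_left_mono) auto
 have D_mono: "D \<rho>1 \<subseteq> D \<rho>2" if "\<rho>1 \<le> \<rho>2" for \<rho>1 \<rho>2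
  unfolding D_def using less_le_trans[OF _ that] by blast
 have incD: "incseq (%n. D (\<rho> n))"
  by (intro incseq_SucI D_mono inc) simp
 have U: "(\<Union>n. D (\<rho> n)) = D 1"
 proof (intro equalityI subsetI)
  fix x assume "x \<in> D 1"
  then obtain r where r: "x \<in> sphere 0 1" "0 < r" "r < 1" "t < norm (g (of_real r * x) - g (of_real (s * r) * x))"
   unfolding D_def by blast
  have "\<forall>\<^sub>F n in sequentially. r < \<rho> n" by (rule order_tendstoD(1)[OF \<rho>lim r(3)])
  then obtain n where n: "r < \<rho> n" by (auto simp: eventually_sequentially)
  have "x \<in> D (\<rho> n)" unfolding D_def using r n by blast
  then show "x \<in> (\<Union>n. D (\<rho> n))" by blast
 next
  fix x assume "x \<in> (\<Union>n. D (\<rho> n))"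
  then show "x \<in> D 1" using D_mono \<rho>(3) less_imp_le by blast
 qed
 have "(%n. measure leb (D (\<rho> n))) \<longlonglongrightarrow> measure leb (\<Union>n. D (\<rho> n))"
  by (rule leb.finite_Lim_measure_incseq[OF _ incD]) (use Dm less_imp_le[OF \<rho>(3)] in auto)
 then have "measure leb (\<Union>n. D (\<rho> n)) \<le> e"
  by (rule LIMSEQ_le_const2) (use Dle \<rho> in blast)
 then have "measure leb (D 1) \<le> e" unfolding U .
 then show ?thesis using s(2) s0 Dm[of 1] unfolding D_def oscillation_set_def by (intro exI[of _ s]) simp
qed

text \<open>Cauchy's criterion in the form in which the oscillation is estimated, the centre l being
  allowed to vary with e.\<close>

lemma tendsto_exists_if_close:
 fixes u :: "real => complex"
 assumes close: "\<And>e. 0 < e ==> \<exists>l. \<forall>\<^sub>F r in at_left 1. dist (u r) l < e"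
 shows "\<exists>l. (u \<longlongrightarrow> l) (at_left 1)"
proof -
 have "cauchy_filter (filtermap u (at_left 1))"
  unfolding cauchy_filter_metric_filtermap
 proof (intro allI impI)
  fix e :: real assume e: "0 < e"
  obtain l where l: "\<forall>\<^sub>F r in at_left 1. dist (u r) l < e / 2" using close[of "e / 2"] e by auto
  show "\<exists>P. eventually P (at_left 1) \<and> (\<forall>x y. P x \<and> P y --> dist (u x) (u y) < e)"
   using l by (intro exI[of _ "%r. dist (u r) l < e / 2"]) (auto intro: dist_triangle_half_l[of _ l] simp: dist_commute)
 qed
 then obtain l where "filtermap u (at_left 1) \<le> nhds l"
  using complete_UNIV[where 'a=complex] unfolding complete_uniform
  by (metis UNIV_I filtermap_bot_iff principal_UNIV top_greatest trivial_limit_at_left_real)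
 then show ?thesis by (auto simp: filterlim_def)
qed

text \<open>Fatou's theorem. For fixed s < 1 the values g(s r x) converge as r tends to 1, by
  continuity inside the disc, so outside \<open>oscillation_set g s t\<close> the values g(r x)
  eventually stay within about t of g(s x). For each t = 1/(n + 1) the bad points lie in sets of
  arbitrarily small measure, hence in a null set.\<close>

theorem radial_limit_exists:
 assumes b: "bounded_on_disc b"
 shows "AE x in leb. \<exists>l. radial_limit b x l"
proof -
 obtain K where K: "\<And>z. norm z < 1 ==> norm (b z) \<le> K" and bh: "b holomorphic_on ball 0 1"
  using b by (auto simp: bounded_on_disc_def)
 define M where "M = max K 1"
 have M: "0 < M" by (simp add: M_def)
 define g where "g z = b z / of_real M" for z
 have bg: "b z = of_real M * g z" for z using M by (simp add: g_def)
 have g: "g holomorphic_on ball 0 1" unfolding g_def using M by (intro holomorphic_intros bh) simp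
 have g1: "norm (g z) \<le> 1" if "norm z < 1" for z
  using K[OF that] M by (simp add: g_def norm_divide M_def)
 let ?A = "oscillation_set g"
 have null: "\<exists>N\<in>null_sets leb. \<forall>x\<in>sphere 0 1 - N. \<exists>s. 0 < s \<and> s < 1 \<and> x \<notin> ?A s t" if t: "0 < t" for t
 proof -
  have "\<exists>s. 0 < s \<and> s < 1 \<and> ?A s t \<in> sets circle_borel \<and> measure leb (?A s t) \<le> inverse (real (Suc n))" for n
   by (rule oscillation_small[OF g g1 t]) auto
  then obtain s where s: "\<And>n. 0 < s n" "\<And>n. s n < 1" "\<And>n. ?A (s n) t \<in> sets circle_borel"
   "\<And>n. measure leb (?A (s n) t) \<le> inverse (real (Suc n))" by metis
  define N where "N = (\<Inter>n. ?A (s n) t)"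
  have N: "N \<in> sets leb" unfolding N_def using s(3) by auto
  have "measure leb N \<le> inverse (real (Suc n))" for n
  proof -
   have "measure leb N \<le> measure leb (?A (s n) t)"
    by (rule leb.finite_measure_mono) (use s(3) in "auto simp: N_def")
   then show ?thesis using s(4)[of n] by simp
  qed
  then have "measure leb N \<le> 0"
   by (intro LIMSEQ_le_const[OF LIMSEQ_inverse_real_of_nat]) auto
  then have "N \<in> null_sets leb"
   using N by (auto simp: null_sets_def leb.emeasure_eq_measure measure_le_0_iff)
  then show ?thesis using s(1,2) by (intro bexI[of _ N]) (auto simp: N_def)
 qed
 have "\<forall>n. \<exists>N. N \<in> null_sets leb \<and> (\<forall>x\<in>sphere 0 1 - N. \<exists>s. 0 < s \<and> s < 1 \<and> x \<notin> ?A s (inverse (real (Suc n))))"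
  using null by (metis inverse_positive_iff_positive of_nat_0_less_iff zero_less_Suc)
 then obtain N where N: "\<And>n. N n \<in> null_sets leb"
  "\<And>n x. x \<in> sphere 0 1 - N n ==> \<exists>s. 0 < s \<and> s < 1 \<and> x \<notin> ?A s (inverse (real (Suc n)))" by metis
 have "(\<Union>n. N n) \<in> null_sets leb" using N(1) by (intro null_sets_UN)
 then show ?thesis
 proof (rule AE_I'[OF _ subsetI])
  fix x assume "x \<in> {x \<in> space leb. \<not> (\<exists>l. radial_limit b x l)}"
  then have x: "x \<in> sphere 0 1" and no: "\<not> (\<exists>l. radial_limit b x l)" by auto
  show "x \<in> (\<Union>n. N n)"
  proof (rule ccontr)
   assume out: "x \<notin> (\<Union>n. N n)"
   have "\<exists>l. radial_limit g x l"
   proof (rule tendsto_exists_if_close)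
    fix e :: real assume "0 < e"
    then obtain n where n: "inverse (real (Suc n)) < e / 2" using reals_Archimedean[of "e / 2"] by auto
    obtain s where s: "0 < s" "s < 1" "x \<notin> ?A s (inverse (real (Suc n)))"
     using N(2)[of x n] x out by blast
    have close: "norm (g (of_real r * x) - g (of_real (s * r) * x)) \<le> inverse (real (Suc n))" if "0 < r" "r < 1" for r
    proof (rule ccontr)
     assume "\<not> ?thesis"
     then have "x \<in> ?A s (inverse (real (Suc n)))"
      unfolding oscillation_set_def using x that by (intro CollectI conjI exI[of _ r]) (auto simp only: not_le)
     then show False using s(3) by contradiction
    qed
    have "isCont g (of_real s * x)"
     using g s x by (intro continuous_on_interior[of "ball 0 1"] holomorphic_on_imp_continuous_on) (auto simp: norm_mult)
    then have "isCont (%r::real. g (of_real (s * r) * x)) 1"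
     by (intro continuous_at_compose[where f="%r::real. of_real (s * r) * x" and g=g, unfolded o_def] continuous_intros) simp
    then have "((%r::real. g (of_real (s * r) * x)) \<longlongrightarrow> g (of_real s * x)) (at_left 1)"
     by (simp add: isCont_def filterlim_at_split)
    then have "\<forall>\<^sub>F r in at_left 1. dist (g (of_real (s * r) * x)) (g (of_real s * x)) < e / 2"
     by (rule tendstoD) (use \<open>0 < e\<close> in simp)
    moreover have "\<forall>\<^sub>F r :: real in at_left 1. 0 < r \<and> r < 1"
     using eventually_at_left_real[of 0 1] by (simp add: greaterThanLessThan_iff)
    ultimately have "\<forall>\<^sub>F r in at_left 1. dist (g (of_real r * x)) (g (of_real s * x)) < e"
    proof eventually_elim
     case (elim r)
     have "dist (g (of_real r * x)) (g (of_real (s * r) * x)) < e / 2"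
      using close[of r] elim n by (simp add: dist_norm)
     moreover have "dist (g (of_real s * x)) (g (of_real (s * r) * x)) < e / 2"
      using elim(1) by (simp only: dist_commute)
     ultimately show ?case by (rule dist_triangle_half_l)
    qed
    then show "\<exists>l. \<forall>\<^sub>F r in at_left 1. dist (g (of_real r * x)) l < e" by blast
   qed
   then obtain l where "radial_limit g x l" ..
   then have "radial_limit b x (of_real M * l)"
    unfolding bg by (intro tendsto_intros)
   then show False using no by blast
  qed
 qed
qed

text \<open>d is 1 minus the modulus of the radial limit. It is defined along the sequence r to be
  measurable, and clamped to [0, 1] for points without a limit. Boundedness of b gives the weak
  convergence by dominated convergence.\<close>

lemma radial_deficit:
 assumes h: "b holomorphic_on ball 0 1" and b1: "\<And>z. norm z < 1 ==> norm (b z) \<le> 1"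
  and r: "\<And>n. 0 \<le> r n" "\<And>n. r n < 1" "r \<longlonglongrightarrow> (1::real)"
 shows "\<exists>d. integrable leb d \<and> (\<forall>x. 0 \<le> d x) \<and>
  (AE x in leb. \<exists>l. norm l = 1 - d x \<and> radial_limit b x l) \<and>
  (\<forall>p. continuous_on (sphere 0 1) p -->
   (%n. \<integral>x. p x * (1 - norm (b (of_real (r n) * x))) \<partial>leb) \<longlonglongrightarrow> (\<oint>x. p x * d x))"
proof -
 define d where "d x = max 0 (min 1 (1 - norm (lim (%n. b (of_real (r n) * x)))))" for x
 have d01: "0 \<le> d x" "d x \<le> 1" for x by (auto simp: d_def)
 have rz: "norm (of_real (r n) * x) < 1" if "norm x = 1" for n and x :: complex
  by (rule norm_dilation_less) (use that r in auto)
 have bc: "continuous_on (sphere 0 1) (%x. b (of_real (r n) * x))" for n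
  by (rule dilation_disc(2)[OF h r(1,2)])
 have bm: "(%x. b (of_real (r n) * x)) \<in> borel_measurable leb" for n
  by (rule leb.borel_measurable_continuous[OF bc])
 have dm: "d \<in> borel_measurable leb"
  unfolding d_def using borel_measurable_lim_metric[OF bm] by measurable
 have di: "integrable leb d"
  by (rule leb.integrable_const_bound[of _ 1]) (use d01 dm in auto)
 have at1: "filterlim r (at_left 1) sequentially"
  unfolding filterlim_at using r by (auto intro!: always_eventually simp: less_imp_neq)
 have "bounded_on_disc b" using h b1 by (auto simp: bounded_on_disc_def)
 then have lim: "AE x in leb. \<exists>l. norm l = 1 - d x \<and> radial_limit b x l"
 proof (rule AE_mp[OF radial_limit_exists], intro AE_I2 impI)
  fix x assume "x \<in> space leb"
  then have n1: "norm x = 1" by simp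
  assume "\<exists>l. radial_limit b x l"
  then obtain l where l: "radial_limit b x l" ..
  have s: "(%n. b (of_real (r n) * x)) \<longlonglongrightarrow> l" by (rule filterlim_compose[OF l at1])
  have "norm l \<le> 1"
   by (rule LIMSEQ_le_const2[OF tendsto_norm[OF s]]) (use b1 rz[OF n1] in auto)
  then have "norm l = 1 - d x" unfolding d_def limI[OF s] by (simp add: max_def min_def)
  then show "\<exists>l. norm l = 1 - d x \<and> radial_limit b x l" using l by blast
 qed
 have conv: "(%n. \<integral>x. p x * (1 - norm (b (of_real (r n) * x))) \<partial>leb) \<longlonglongrightarrow> (\<oint>x. p x * d x)"
  if p: "continuous_on (sphere 0 1) p" for p
 proof (rule integral_dominated_convergence[where w="%x. norm (p x)"])
  show "(%x. p x * d x) \<in> borel_measurable leb"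
   using leb.borel_measurable_continuous[OF p] dm by (rule borel_measurable_times)
  show "(%x. p x * (1 - norm (b (of_real (r n) * x)))) \<in> borel_measurable leb" for n
   by (intro leb.borel_measurable_continuous continuous_intros p bc)
  show "integrable leb (%x. norm (p x))"
   by (intro leb.integrable_continuous continuous_intros p)
  show "AE x in leb. (%n. p x * (1 - norm (b (of_real (r n) * x)))) \<longlonglongrightarrow> p x * d x"
   using lim
  proof eventually_elim
   case (elim x)
   then obtain l where l: "norm l = 1 - d x" "radial_limit b x l" by blast
   have "(%n. p x * (1 - norm (b (of_real (r n) * x)))) \<longlonglongrightarrow> p x * (1 - norm l)"
    by (intro tendsto_intros filterlim_compose[OF l(2) at1])
   then show ?case using l(1) by simp
  qed
  show "AE x in leb. norm (p x * (1 - norm (b (of_real (r n) * x)))) \<le> norm (p x)" for n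
  proof (rule AE_I2)
   fix x assume "x \<in> space leb"
   then have "\<bar>1 - norm (b (of_real (r n) * x))\<bar> \<le> 1" using b1[OF rz[of x n]] by simp
   then show "norm (p x * (1 - norm (b (of_real (r n) * x)))) \<le> norm (p x)"
    unfolding norm_mult by (simp add: mult_left_le)
  qed
 qed
 show ?thesis using di d01(1) lim conv by blast
qed

section \<open>Functions with unimodular radial limits\<close>

definition radially_unimodular :: "(complex => complex) => bool" where
 "radially_unimodular b \<longleftrightarrow>
  (AE \<zeta> in leb. \<exists>l. norm l = 1 \<and> radial_limit b \<zeta> l)"

lemma radially_unimodular_mult:
 assumes "radially_unimodular a" "radially_unimodular b"
 shows "radially_unimodular (%z. a z * b z)"
 using assms unfolding radially_unimodular_def
proof eventually_elim
 case (elim x)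
 then obtain k l where "norm k = 1" "radial_limit a x k"
  "norm l = 1" "radial_limit b x l" by blast
 then show ?case by (intro exI[of _ "k * l"]) (auto simp: norm_mult intro: tendsto_intros)
qed

lemma radially_unimodular_if_deficit_0:
 assumes "AE x in leb. \<exists>l. norm l = 1 - d x \<and> radial_limit b x l"
  and "integrable leb d" "\<forall>x. 0 \<le> d x" "(\<oint>x. d x) = 0"
 shows "radially_unimodular b"
proof -
 have "AE x in leb. d x = 0"
  using integral_nonneg_eq_0_iff_AE[OF assms(2)] assms(3,4) by simp
 with assms(1) show ?thesis unfolding radially_unimodular_def
  by eventually_elim auto
qed

text \<open>1 - |B| <= -log|B|, and along good radii the means of the latter tend to 0, so the
  deficit has integral 0.\<close>

lemma (in blaschke) radially_unimodular_B: "radially_unimodular B"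
proof -
 obtain r where r: "good_radii B r" using good_radii_exist ..
 have r01: "0 \<le> r n" "r n < 1" "r \<longlonglongrightarrow> 1" for n using r by (auto simp: good_radii_def less_imp_le)
 obtain d where d: "integrable leb d" "\<forall>x. 0 \<le> d x"
  "AE x in leb. \<exists>l. norm l = 1 - d x \<and> radial_limit B x l"
  and lim: "\<forall>p. continuous_on (sphere 0 1) p -->
   (%n. \<integral>x. p x * (1 - norm (B (of_real (r n) * x))) \<partial>leb) \<longlonglongrightarrow> (\<oint>x. p x * d x)"
  using radial_deficit[OF B_holomorphic norm_B_le r01] by blast
 have nz: "B (of_real (r n) * x) \<noteq> 0" if "norm x = 1" for n x using r that by (auto simp: good_radii_def)
 have Bc: "continuous_on (sphere 0 1) (%x. B (of_real (r n) * x))" for n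
  by (rule dilation_disc(2)[OF B_holomorphic r01(1,2)])
 have "(\<oint>x. d x) \<le> 0"
 proof (rule LIMSEQ_le)
  show "(%n. \<integral>x. 1 - norm (B (of_real (r n) * x)) \<partial>leb) \<longlonglongrightarrow> (\<oint>x. d x)"
   using lim[rule_format, of "%_. 1"] by simp
  show "(%n. \<integral>x. - ln (norm (B (of_real (r n) * x))) \<partial>leb) \<longlonglongrightarrow> 0"
   using r by (simp only: good_radii_def)
  show "\<exists>N. \<forall>n\<ge>N. (\<oint>x. 1 - norm (B (of_real (r n) * x))) \<le> (\<oint>x. - ln (norm (B (of_real (r n) * x))))"
  proof (intro exI allI impI integral_mono)
   fix n
   show "integrable leb (%x. 1 - norm (B (of_real (r n) * x)))"
    by (intro leb.integrable_continuous continuous_intros Bc)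
   show "integrable leb (%x. - ln (norm (B (of_real (r n) * x))))"
    by (intro leb.integrable_continuous continuous_intros Bc) (use nz in auto)
   fix x assume "x \<in> space leb"
   then have "0 < norm (B (of_real (r n) * x))" using nz by simp
   from ln_le_minus_one[OF this]
   show "1 - norm (B (of_real (r n) * x)) \<le> - ln (norm (B (of_real (r n) * x)))" by linarith
  qed
 qed
 moreover have "0 \<le> (\<oint>x. d x)" using d(2) by simp
 ultimately show ?thesis by (intro radially_unimodular_if_deficit_0[OF d(3,1,2)]) simp
qed

lemma finite_singular_measure_imp_circle_measure: "finite_singular_measure \<mu> ==> circle_measure \<mu>"
 by (auto simp: finite_singular_measure_def intro: circle_measure_if)

text \<open>If P is the Poisson integral of \<mu>, then 1 - |S| = 1 - exp(-P) <= P. In the limit the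
  measure with density d is at most \<mu>, and it vanishes because \<mu> is singular.\<close>

lemma radially_unimodular_singular_inner:
 assumes \<mu>: "finite_singular_measure \<mu>"
 shows "radially_unimodular (singular_inner \<mu>)"
proof -
 have cm: "circle_measure \<mu>" by (rule finite_singular_measure_imp_circle_measure[OF \<mu>])
 interpret u: circle_measure \<mu> by fact
 obtain A where A: "A \<in> sets circle_borel" "emeasure \<mu> A = 0" "emeasure leb (sphere 0 1 - A) = 0"
  using \<mu> by (auto simp: finite_singular_measure_def mutually_singular_def)
 obtain r where r: "\<And>n. 0 < r n" "\<And>n. r n < 1" and r1: "r \<longlonglongrightarrow> (1::real)" by (rule radii_to_1) blast
 have r01: "0 \<le> r n" "r n < 1" for n using r[of n] by auto
 let ?S = "singular_inner \<mu>"
 obtain d where d: "integrable leb d" "\<forall>y. 0 \<le> d y"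
  "AE y in leb. \<exists>l. norm l = 1 - d y \<and> radial_limit ?S y l"
  and lim: "\<forall>p. continuous_on (sphere 0 1) p -->
   (%n. \<integral>y. p y * (1 - norm (?S (of_real (r n) * y))) \<partial>leb) \<longlonglongrightarrow> (\<oint>y. p y * d y)"
  using radial_deficit[OF u.singular_inner_holomorphic u.norm_singular_inner_le r01 r1] by blast
 have rz: "norm (of_real (r n) * y) < 1" if "norm y = 1" for n and y :: complex
  by (rule norm_dilation_less) (use that r01 in auto)
 have Sc: "continuous_on (sphere 0 1) (%y. ?S (of_real (r n) * y))" for n
  by (rule dilation_disc(2)[OF u.singular_inner_holomorphic r01])
 note Pc = u.continuous_on_poisson_integral_dilation[OF r01]
 define e where "e = density leb (%y. ennreal (d y))"
 have e: "circle_measure e" unfolding e_def by (rule leb.circle_measure_density[OF d(1)])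
 have dm: "d \<in> borel_measurable leb" using d(1) by simp
 have "emeasure e K \<le> emeasure \<mu> K" if K: "closed K" "K \<subseteq> sphere 0 1" for K
 proof (rule closed_le_if_test_functions[OF cm e K])
  fix p :: "complex => real"
  assume p: "continuous_on (sphere 0 1) p" and p0: "\<And>x. 0 \<le> p x"
  have "(\<integral>x. p x \<partial>e) = (\<oint>x. d x * p x)"
   unfolding e_def using dm d(2) leb.borel_measurable_continuous[OF p]
   by (subst integral_density) auto
  also have "... = (\<oint>x. p x * d x)" by (simp only: mult.commute)
  also have "... \<le> (\<integral>x. p x \<partial>\<mu>)"
  proof (rule LIMSEQ_le[OF lim[rule_format, OF p] u.tendsto_integral_poisson_integral[OF p r01 r1]])
   show "\<exists>N. \<forall>n\<ge>N. (\<oint>y. p y * (1 - norm (?S (of_real (r n) * y)))) \<le>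
     (\<oint>y. p y * poisson_integral \<mu> (of_real (r n) * y))"
   proof (intro exI allI impI integral_mono)
    fix n
    show "integrable leb (%y. p y * (1 - norm (?S (of_real (r n) * y))))"
     by (intro leb.integrable_continuous continuous_intros Sc p)
    show "integrable leb (%y. p y * poisson_integral \<mu> (of_real (r n) * y))"
     by (intro leb.integrable_continuous continuous_intros Pc p)
    fix y assume "y \<in> space leb"
    then have z: "norm (of_real (r n) * y) < 1" by (intro rz) simp
    show "p y * (1 - norm (?S (of_real (r n) * y))) \<le> p y * poisson_integral \<mu> (of_real (r n) * y)"
     unfolding u.norm_singular_inner[OF z]
     using exp_ge_add_one_self[of "- poisson_integral \<mu> (of_real (r n) * y)"]
     by (intro mult_left_mono p0) linarith
   qed
  qed
  finally show "(\<integral>x. p x \<partial>e) \<le> (\<integral>x. p x \<partial>\<mu>)" .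
 qed
 then have "emeasure e A \<le> emeasure \<mu> A"
  using sets.sets_into_space[OF A(1)] by (intro inner_regular_circle_le[OF cm e A(1)]) auto
 then have eA: "emeasure e A = 0" using A(2) by simp
 have top: "sphere 0 1 \<in> sets leb" using sets.top[of leb] by simp
 have "emeasure e (sphere 0 1 - A) = 0"
 proof -
  have m: "sphere 0 1 - A \<in> sets leb" using top A(1) by auto
  then have n: "sphere 0 1 - A \<in> null_sets leb" using A(3) by auto
  have "AE x in leb. x \<notin> sphere 0 1 - A" by (rule AE_not_in[OF n])
  then have "(\<integral>\<^sup>+x. ennreal (d x) * indicator (sphere 0 1 - A) x \<partial>leb) = (\<integral>\<^sup>+x. 0 \<partial>leb)"
   by (intro nn_integral_cong_AE) (auto simp: indicator_def)
  then show ?thesis unfolding e_def using dm m by (simp add: emeasure_density)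
 qed
 then have "emeasure e (sphere 0 1) = 0"
  using emeasure_Un_null_set[of A e "sphere 0 1 - A"] sets.sets_into_space[OF A(1)] eA top A(1)
  by (auto simp: null_sets_def e_def Un_absorb1)
 then have "(\<integral>\<^sup>+x. ennreal (d x) \<partial>leb) = 0"
  unfolding e_def using dm top
  by (simp add: emeasure_density) (metis (no_types, lifting) nn_integral_cong mult.right_neutral indicator_simps(1) space_circle_lebesgue)
 then have "(\<oint>x. d x) = 0"
  using nn_integral_eq_integral[OF d(1)] d(2) by (simp add: ennreal_eq_0_iff)
   (metis integral_nonneg_AE AE_I2 antisym)
 then show ?thesis by (rule radially_unimodular_if_deficit_0[OF d(3,1,2)])
qed

text \<open>
 Where there is no radial limit, the boundary values of both functions are the same junk value.
\<close>

lemma norm_boundary_value_mult: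
 assumes b: "radially_unimodular b" and eq: "\<And>z. norm z < 1 ==> h z = b z * u z"
 shows "AE x in leb. norm (boundary_value h x) = norm (boundary_value u x)"
 using b unfolding radially_unimodular_def
proof (rule AE_mp, intro AE_I2 impI)
 fix x assume "x \<in> space leb"
 then have n1: "norm x = 1" by simp
 assume "\<exists>l. norm l = 1 \<and> radial_limit b x l"
 then obtain l where l: "norm l = 1" "radial_limit b x l" by blast
 have "\<forall>\<^sub>F r :: real in at_left 1. 0 < r \<and> r < 1"
  using eventually_at_left_real[of 0 1] by simp
 then have ev: "\<forall>\<^sub>F r in at_left 1. h (of_real r * x) = b (of_real r * x) * u (of_real r * x)"
  by eventually_elim (rule eq, simp add: norm_mult n1)
 have nb: "\<forall>\<^sub>F r in at_left 1. b (of_real r * x) \<noteq> 0"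
  using l(1) by (intro tendsto_imp_eventually_ne[OF l(2)]) auto
 have uh: "radial_limit h x (l * k)" if "radial_limit u x k" for k
  using tendsto_mult[OF l(2) that] ev by (subst filterlim_cong[OF refl refl ev])
 have hu: "radial_limit u x (k / l)" if k: "radial_limit h x k" for k
 proof -
  have "((%r::real. h (of_real r * x) / b (of_real r * x)) \<longlongrightarrow> k / l) (at_left 1)"
   using l(1) by (intro tendsto_divide k l(2)) auto
  moreover have "\<forall>\<^sub>F r in at_left 1. h (of_real r * x) / b (of_real r * x) = u (of_real r * x)"
   using ev nb by eventually_elim simp
  ultimately show ?thesis by (simp only: filterlim_cong[OF refl refl])
 qed
 have nt: "at_left (1::real) \<noteq> bot" by simp
 show "norm (boundary_value h x) = norm (boundary_value u x)"
 proof (cases "\<exists>k. radial_limit u x k")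
  case True
  then obtain k where k: "radial_limit u x k" ..
  show ?thesis unfolding boundary_value_def tendsto_Lim[OF nt k] tendsto_Lim[OF nt uh[OF k]]
   using l(1) by (simp add: norm_mult)
 next
  case False
  then have "\<not> (\<exists>k. radial_limit h x k)" using hu by blast
  then have "(%k. radial_limit h x k) = (%k. radial_limit u x k)"
   using False by (intro ext) blast
  then show ?thesis unfolding boundary_value_def t2_space_class.Lim_def by simp
 qed
qed

section \<open>The factorization in terms of singular inner functions\<close>

definition lebesgue_null :: "complex measure => bool" where
 "lebesgue_null \<kappa> \<longleftrightarrow> (\<forall>A\<in>sets circle_borel. emeasure leb A = 0 --> emeasure \<kappa> A = 0)"

lemma circle_measure_null: "circle_measure (null_measure circle_borel)"
 by (rule circle_measure_if) (auto intro!: finite_measureI)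

lemma lebesgue_null_density:
 assumes "integrable leb p"
 shows "lebesgue_null (density leb (%x. ennreal (p x)))"
 unfolding lebesgue_null_def
proof (intro ballI impI)
 fix A assume A: "A \<in> sets circle_borel" "emeasure leb A = 0"
 then have "A \<in> null_sets leb" by auto
 moreover have "(%x. ennreal (p x)) \<in> borel_measurable leb" using assms by simp
 ultimately have "A \<in> null_sets (density leb (%x. ennreal (p x)))"
  using absolutely_continuousI_density unfolding absolutely_continuous_def by blast
 then show "emeasure (density leb (%x. ennreal (p x))) A = 0" by auto
qed

lemma circle_lebesgue_density:
 assumes "integrable leb p"
 shows "circle_measure (density leb (%x. ennreal (p x)))"
 by (rule leb.circle_measure_density[OF assms])

text \<open>
 If $\log |f|$ is not integrable, neither is its product with the Herglotz kernel, so that the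
 outer factor is 1 and null measures represent it.
\<close>

lemma outer_factor_form:
 obtains Km Kp where "circle_measure Km" "circle_measure Kp" "lebesgue_null Km" "lebesgue_null Kp"
  "\<And>z. norm z < 1 ==> outer_factor f z = singular_inner Km z / singular_inner Kp z"
proof -
 define q where "q y = ln (norm (boundary_value f y))" for y
 have of: "outer_factor f z = exp (\<oint>y. herglotz z y * of_real (q y))" for z
  by (simp add: outer_factor_def herglotz_def q_def)
 show thesis
 proof (cases "integrable leb q")
  case True
  define p where "p y = max 0 (q y)" for y
  define m where "m y = max 0 (- q y)" for y
  have p: "integrable leb p" unfolding p_def using True by (intro integrable_max) auto
  have m: "integrable leb m" unfolding m_def using True by (intro integrable_max) auto
  have 0: "0 \<le> p y" "0 \<le> m y" for y by (auto simp: p_def m_def)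
  show thesis
  proof (rule that)
   show "circle_measure (density leb (%x. ennreal (m x)))"
    "circle_measure (density leb (%x. ennreal (p x)))"
    by (intro circle_lebesgue_density p m)+
   show "lebesgue_null (density leb (%x. ennreal (m x)))"
    "lebesgue_null (density leb (%x. ennreal (p x)))"
    by (intro lebesgue_null_density p m)+
   fix z :: complex assume z: "norm z < 1"
   have int: "integrable leb (%y. herglotz z y * of_real (k y))" if k: "integrable leb k" for k
   proof (rule LINT_integrable_bound)
    show "integrable leb (%y. 2 / (1 - norm z) * norm (k y))"
     using k by (intro integrable_mult_right integrable_norm)
    have "(%y. complex_of_real (k y)) \<in> borel_measurable leb"
     using k by (intro borel_measurable_integrable integrable_of_real)
    then show "(%y. herglotz z y * of_real (k y)) \<in> borel_measurable leb"
     by (rule borel_measurable_times[OF leb.borel_measurable_continuous[OF continuous_on_herglotz[OF z]]])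
    show "AE y in leb. norm (herglotz z y * of_real (k y)) \<le> norm (2 / (1 - norm z) * norm (k y))"
    proof (rule AE_I2)
     fix y assume "y \<in> space leb"
     then have "norm (herglotz z y) * \<bar>k y\<bar> \<le> 2 / (1 - norm z) * \<bar>k y\<bar>"
      by (intro mult_right_mono norm_herglotz_le z) auto
     then show "norm (herglotz z y * of_real (k y)) \<le> norm (2 / (1 - norm z) * norm (k y))"
      using z by (simp add: norm_mult abs_mult)
    qed
   qed
   have dens: "herglotz_integral (density leb (%x. ennreal (k x))) z = (\<oint>y. herglotz z y * of_real (k y))"
    if k: "integrable leb k" "\<And>x. 0 \<le> k x" for k
    using leb.herglotz_integral_density[of k z] that z by (simp add: mult.commute scaleR_conv_of_real)
   have "(\<oint>y. herglotz z y * of_real (q y)) =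
     (\<oint>y. herglotz z y * of_real (p y) - herglotz z y * of_real (m y))"
    by (intro LINT_cong refl) (auto simp: p_def m_def max_def simp flip: right_diff_distrib of_real_diff)
   also have "... = herglotz_integral (density leb (%x. ennreal (p x))) z - herglotz_integral (density leb (%x. ennreal (m x))) z"
    using dens[OF p 0(1)] dens[OF m 0(2)] int[OF p] int[OF m] by simp
   finally show "outer_factor f z = singular_inner (density leb (%x. ennreal (m x))) z / singular_inner (density leb (%x. ennreal (p x))) z"
    by (simp add: of singular_inner_eq exp_diff exp_minus divide_inverse mult.commute)
  qed
 next
  case False
  show thesis
  proof (rule that[OF circle_measure_null circle_measure_null])
   show "lebesgue_null (null_measure circle_borel)" by (simp add: lebesgue_null_def)
   then show "lebesgue_null (null_measure circle_borel)" .
   fix z :: complex assume z: "norm z < 1"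
   have "\<not> integrable leb (%y. herglotz z y * of_real (q y))"
   proof
    assume i: "integrable leb (%y. herglotz z y * of_real (q y))"
    have nz: "y + z \<noteq> 0" if "norm y = 1" for y
     using circle_minus_disc_nz[of y "- z"] that z by simp
    have c: "continuous_on (sphere 0 1) (%y. (y - z) / (y + z))"
     by (intro continuous_intros) (use nz in auto)
    have "bounded ((%y. (y - z) / (y + z)) ` sphere 0 1)"
     by (intro compact_imp_bounded compact_continuous_image c) simp
    then obtain M where M: "\<forall>x\<in>sphere 0 1. norm ((x - z) / (x + z)) \<le> M" by (auto simp: bounded_iff)
    have "integrable leb (%y. (y - z) / (y + z) * (herglotz z y * of_real (q y)))"
    proof (rule LINT_integrable_bound)
     show "integrable leb (%y. M * norm (herglotz z y * of_real (q y)))"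
      by (intro integrable_mult_right integrable_norm i)
     show "(%y. (y - z) / (y + z) * (herglotz z y * of_real (q y))) \<in> borel_measurable leb"
      by (rule borel_measurable_times[OF leb.borel_measurable_continuous[OF c] borel_measurable_integrable[OF i]])
     show "AE y in leb. norm ((y - z) / (y + z) * (herglotz z y * of_real (q y))) \<le> norm (M * norm (herglotz z y * of_real (q y)))"
     proof (rule AE_I2)
      fix y assume "y \<in> space leb"
      then have "norm ((y - z) / (y + z)) \<le> M" using M by simp
      then have "norm ((y - z) / (y + z)) * norm (herglotz z y * of_real (q y)) \<le> M * norm (herglotz z y * of_real (q y))"
       by (intro mult_right_mono) auto
      also have "... \<le> norm (M * norm (herglotz z y * of_real (q y)))" by simp
      finally show "norm ((y - z) / (y + z) * (herglotz z y * of_real (q y))) \<le> norm (M * norm (herglotz z y * of_real (q y)))"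
       by (simp only: norm_mult)
     qed
    qed
    also have "integrable leb (%y. (y - z) / (y + z) * (herglotz z y * of_real (q y))) \<longleftrightarrow>
      integrable leb (%y. complex_of_real (q y))"
    proof (intro Bochner_Integration.integrable_cong refl)
     fix y assume "y \<in> space leb"
     then have "y + z \<noteq> 0" "y - z \<noteq> 0" using nz circle_minus_disc_nz[OF _ z] by simp_all
     then show "(y - z) / (y + z) * (herglotz z y * of_real (q y)) = of_real (q y)"
      by (simp add: herglotz_def)
    qed
    finally have "integrable leb (%y. complex_of_real (q y))" .
    then have "integrable leb (%y. Re (complex_of_real (q y)))" by (rule integrable_Re)
    then show False using False by simp
   qed
   then show "outer_factor f z = singular_inner (null_measure circle_borel) z / singular_inner (null_measure circle_borel) z"
    by (simp add: of not_integrable_integral_eq singular_inner_nz)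
  qed
 qed
qed

lemma factorization_form:
 assumes "nevanlinna_factorization f \<mu> n \<gamma> J \<Lambda>"
 shows "blaschke J \<Lambda>" "circle_measure \<mu>" "circle_measure n"
  and "\<exists>Km Kp. circle_measure Km \<and> circle_measure Kp \<and> lebesgue_null Km \<and> lebesgue_null Kp \<and>
   (\<forall>z. norm z < 1 --> outer_factor f z = singular_inner Km z / singular_inner Kp z) \<and>
   (\<forall>z. norm z < 1 --> f z = cis \<gamma> * blaschke.B J \<Lambda> z * (singular_inner Km z * singular_inner \<mu> z) /
    (singular_inner Kp z * singular_inner n z))" (is "\<exists>Km Kp. ?P Km Kp")
proof -
 note fac = assms[unfolded nevanlinna_factorization_def]
 show b: "blaschke J \<Lambda>"
  using fac by (auto simp: blaschke_def zero_sequence_def)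
 then interpret blaschke J \<Lambda> .
 show "circle_measure \<mu>" "circle_measure n"
  using fac by (auto intro: finite_singular_measure_imp_circle_measure)
 obtain Km Kp where k: "circle_measure Km" "circle_measure Kp" "lebesgue_null Km" "lebesgue_null Kp"
  "\<And>z. norm z < 1 ==> outer_factor f z = singular_inner Km z / singular_inner Kp z"
  by (rule outer_factor_form[of f]) blast
 have "f z = cis \<gamma> * B z * (singular_inner Km z * singular_inner \<mu> z) / (singular_inner Kp z * singular_inner n z)"
  if z: "norm z < 1" for z
 proof -
  have "f z = outer_factor f z * (singular_inner \<mu> z / singular_inner n z) * (cis \<gamma> * B z)"
   using fac z by (simp add: blaschke_product_eq)
  then show ?thesis unfolding k(5)[OF z] by simp
 qed
 then show "\<exists>Km Kp. ?P Km Kp"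
  using k by blast
qed

lemma singular_inner_null: "emeasure k (space k) = 0 ==> singular_inner k z = 1"
proof -
 assume "emeasure k (space k) = 0"
 then have "AE x in k. (x + z) / (x - z) = 0" by (intro AE_I[of _ _ "space k"]) auto
 then have "(\<integral>x. (x + z) / (x - z) \<partial>k) = 0" by (rule integral_eq_zero_AE)
 then show ?thesis by (simp add: singular_inner_def)
qed

text \<open>The positive part of log|u| is at most the Poisson integral of k, whose mean over every
  circle is the mass of k by Fubini.\<close>

lemma nevanlinna_if_norm_le:
 assumes u: "u holomorphic_on ball 0 1" and k: "circle_measure k"
  and le: "\<And>z. norm z < 1 ==> norm (u z) \<le> exp (poisson_integral k z)"
 shows "u \<in> nevanlinna"
proof -
 interpret circle_measure k by fact
 have "(\<oint>x. ln (max 1 (norm (u (of_real r * x))))) \<le> measure k (sphere 0 1)" if r: "0 < r" "r < 1" for r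
 proof -
  have rz: "norm (of_real r * x) < 1" if "norm x = 1" for x :: complex
   unfolding norm_mult norm_of_real that using r by simp
  have uc: "continuous_on (sphere 0 1) (%x. u (of_real r * x))"
   by (rule dilation_disc(2)[OF u]) (use r in auto)
  have Pc: "continuous_on (sphere 0 1) (%x. poisson_integral k (of_real r * x))"
   by (rule continuous_on_poisson_integral_dilation) (use r in auto)
  have "(\<oint>x. ln (max 1 (norm (u (of_real r * x))))) \<le> (\<oint>x. poisson_integral k (of_real r * x))"
  proof (rule integral_mono)
   have pos: "max 1 (norm (u z)) \<noteq> 0" for z by (metis max.cobounded1 not_one_le_zero)
   have "continuous_on (sphere 0 1) (%x. ln (max 1 (norm (u (of_real r * x)))))"
    using pos by (intro continuous_on_ln continuous_intros uc) simp
   then show "integrable leb (%x. ln (max 1 (norm (u (of_real r * x)))))"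
    by (rule leb.integrable_continuous)
   show "integrable leb (%x. poisson_integral k (of_real r * x))"
    by (rule leb.integrable_continuous[OF Pc])
   fix x assume "x \<in> space leb"
   then have z: "norm (of_real r * x) < 1" by (intro rz) simp
   have "max 1 (norm (u (of_real r * x))) \<le> exp (poisson_integral k (of_real r * x))"
    using le[OF z] poisson_integral_nonneg[OF z] by simp
   then have "ln (max 1 (norm (u (of_real r * x)))) \<le> ln (exp (poisson_integral k (of_real r * x)))"
    by (intro ln_mono) (auto simp: less_max_iff_disj)
   then show "ln (max 1 (norm (u (of_real r * x)))) \<le> poisson_integral k (of_real r * x)" by simp
  qed
  also have "... = measure k (sphere 0 1)"
  proof -
   have "(\<oint>x. 1 * poisson_integral k (of_real r * x)) = (\<integral>y. poisson_integral leb (of_real r * y) \<partial>k)"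
    using Fubini_poisson(2)[of "%_. 1" r] r by (simp add: poisson_integral_def)
   also have "... = (\<integral>y. 1 \<partial>k)"
    by (intro LINT_cong refl) (use rz in "simp add: poisson_integral_def integral_poisson_lebesgue")
   finally show ?thesis by simp
  qed
  finally show ?thesis .
 qed
 then show ?thesis unfolding nevanlinna_def using u by (auto intro!: bdd_aboveI2)
qed

section \<open>Zeros\<close>

lemma higher_deriv_eq_0_if_less_zorder:
 assumes f: "f holomorphic_on ball 0 1" and z: "norm z < 1" and i: "int i < zorder f z"
 shows "(deriv ^^ i) f z = 0"
proof -
 have "f analytic_on {z}" by (rule holomorphic_on_imp_analytic_at[OF f]) (use z in auto)
 then have F: "(%w. f (z + w)) has_fps_expansion fps_expansion f z"
  by (rule analytic_at_imp_has_fps_expansion)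
 have "fps_nth (fps_expansion f z) i = 0"
 proof (cases "fps_expansion f z = 0")
  case False
  from has_fps_expansion_zorder[OF F False] show ?thesis
   using i by (intro nth_less_subdegree_zero) simp
 qed simp
 then show ?thesis by (simp add: fps_expansion_def)
qed

lemma frequently_nonzero:
 assumes f: "f holomorphic_on ball 0 1" and nz: "\<exists>z\<in>ball 0 1. f z \<noteq> 0" and z: "norm z < 1"
 shows "\<forall>\<^sub>F w in at z. f w \<noteq> 0"
proof -
 have "\<forall>\<^sub>F w in at z. f w \<noteq> 0 \<and> w \<in> ball 0 1"
  using nz z by (elim bexE) (rule non_zero_neighbour_alt[OF f]; auto)
 then show ?thesis by eventually_elim simp
qed

text \<open>The functions whose derivatives at a vanish below the order of f form a closed invariant
  subspace: Leibniz' rule gives invariance under multiplication by z, Cauchy's estimate on a small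
  disc gives closedness in the norm.\<close>

lemma (in weight) zorder_generated_ge:
 assumes fG: "f \<in> G_space w" and g: "g \<in> G_generated w f" and nz: "\<exists>z\<in>ball 0 1. g z \<noteq> 0" and a: "norm a < 1"
 shows "zorder f a \<le> zorder g a"
proof -
 define V where "V = {g \<in> G_space w. \<forall>i. int i < zorder f a --> (deriv ^^ i) g a = 0}"
 have ab: "a \<in> ball 0 1" using a by simp
 note hol = G_space_holomorphic
 have fV: "f \<in> V" unfolding V_def using fG higher_deriv_eq_0_if_less_zorder[OF hol[OF fG] a] by simp
 have inv: "shift_invariant V"
  unfolding shift_invariant_def
 proof
  fix g assume "g \<in> V"
  then have gG: "g \<in> G_space w" and g0: "\<And>i. int i < zorder f a ==> (deriv ^^ i) g a = 0" by (auto simp: V_def)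
  have "(deriv ^^ n) (%z. z * g z) a = 0" if n: "int n < zorder f a" for n
  proof -
   have "(deriv ^^ n) (%z. z * g z) a = (\<Sum>i = 0..n. of_nat (n choose i) * (deriv ^^ i) (%z. z) a * (deriv ^^ (n - i)) g a)"
    by (rule higher_deriv_mult[OF _ hol[OF gG] open_ball ab]) (intro holomorphic_intros)
   also have "... = 0"
   proof (intro sum.neutral ballI)
    fix i assume "i \<in> {0..n}"
    then have "(deriv ^^ (n - i)) g a = 0" using n by (intro g0) auto
    then show "of_nat (n choose i) * (deriv ^^ i) (%z. z) a * (deriv ^^ (n - i)) g a = 0" by simp
   qed
   finally show ?thesis .
  qed
  moreover have "(%z. z * g z) \<in> G_space w"
   using G_space_shift gG unfolding shift_invariant_def by (rule bspec)
  ultimately show "(%z. z * g z) \<in> V" by (simp add: V_def)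
 qed
 have closed: "G_closed_subspace w V"
 proof (rule G_closed_subspaceI)
  show "V \<subseteq> G_space w" by (auto simp: V_def)
  show "(%z. 0) \<in> V" using G_closed_subspaceD(2)[OF G_space_closed_subspace] by (simp add: V_def)
  show "(%z. g z + h z) \<in> V" if "g \<in> V" "h \<in> V" for g h
   using that by (simp add: V_def G_space_add higher_deriv_add[OF hol hol open_ball ab])
  show "(%z. k * g z) \<in> V" if "g \<in> V" for k g
   using that by (simp add: V_def G_space_cmult higher_deriv_cmult[OF hol ab open_ball])
  fix g assume gG: "g \<in> G_space w" and approx: "\<And>e. 0 < e ==> \<exists>v\<in>V. w_close v g e"
  have "(deriv ^^ n) g a = 0" if n: "int n < zorder f a" for n
  proof -
   define d where "d = (1 - norm a) / 2"
   have d: "0 < d" "norm a + d < 1" using a by (auto simp: d_def field_simps)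
   define m where "m = w (1 - (norm a + d))"
   have m: "0 < m" unfolding m_def using d norm_ge_zero[of a] by (intro w_pos) linarith+
   have sub: "norm x \<le> norm a + d" if "x \<in> cball a d" for x
    using norm_triangle_ineq[of a "x - a"] that by (simp add: dist_norm norm_minus_commute)
   have "norm ((deriv ^^ n) g a) \<le> fact n * (e / m) / d ^ n" if e: "0 < e" for e
   proof -
    obtain v where v: "v \<in> V" "\<And>z. norm z < 1 ==> w (1 - norm z) * norm (v z - g z) \<le> e"
     using approx[OF e] by blast
    have vG: "v \<in> G_space w" and v0: "(deriv ^^ n) v a = 0" using v(1) n by (auto simp: V_def)
    have h: "(%z. v z - g z) holomorphic_on ball 0 1" by (intro holomorphic_intros hol vG gG)
    have cs: "cball a d \<subseteq> ball 0 1" using sub d by fastforce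
    have "norm ((deriv ^^ n) (%z. v z - g z) a) \<le> fact n * (e / m) / d ^ n"
    proof (rule Cauchy_inequality)
     show "(%z. v z - g z) holomorphic_on ball a d"
      by (rule holomorphic_on_subset[OF h]) (use cs ball_subset_cball in blast)
     show "continuous_on (cball a d) (%z. v z - g z)"
      by (rule continuous_on_subset[OF holomorphic_on_imp_continuous_on[OF h] cs])
     fix x assume "norm (a - x) = d"
     then have x: "norm x \<le> norm a + d" by (intro sub) (simp add: dist_norm)
     have "m * norm (v x - g x) \<le> w (1 - norm x) * norm (v x - g x)"
      unfolding m_def using x d by (intro mult_right_mono w_mono) auto
     also have "... \<le> e" using x d by (intro v(2)) simp
     finally show "norm (v x - g x) \<le> e / m" using m by (simp add: le_divide_eq mult.commute)
    qed (rule d)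
    also have "(deriv ^^ n) (%z. v z - g z) a = (deriv ^^ n) v a - (deriv ^^ n) g a"
     by (rule higher_deriv_diff[OF hol[OF vG] hol[OF gG] open_ball ab])
    finally show ?thesis using v0 by simp
   qed
   note le = this
   show ?thesis
   proof (rule ccontr)
    assume n0: "(deriv ^^ n) g a \<noteq> 0"
    define e where "e = norm ((deriv ^^ n) g a) * d ^ n * m / (2 * fact n)"
    have "0 < e" using n0 d m by (simp add: e_def)
    from le[OF this] have "norm ((deriv ^^ n) g a) \<le> norm ((deriv ^^ n) g a) / 2"
     using d m by (simp add: e_def)
    then show False using n0 by simp
   qed
  qed
  then show "g \<in> V" using gG by (simp add: V_def)
 qed
 have "G_generated w f \<subseteq> V" by (rule G_generated_subset[OF closed inv fV])
 then have gV: "g \<in> V" using g by blast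
 have gG: "g \<in> G_space w" using gV by (simp add: V_def)
 obtain z0 where "z0 \<in> ball 0 1" "g z0 \<noteq> 0" using nz by blast
 show ?thesis
 proof (cases "0 \<le> zorder f a")
  case True
  have "zorder g a \<ge> int (nat (zorder f a))"
  proof (rule zorder_geI)
   show "g analytic_on {a}" by (rule holomorphic_on_imp_analytic_at[OF hol[OF gG]]) (use a in auto)
   show "g holomorphic_on ball 0 1" by (rule hol[OF gG])
   show "z0 \<in> ball 0 1" "g z0 \<noteq> 0" by fact+
   show "(deriv ^^ k) g a = 0" if "k < nat (zorder f a)" for k
    using gV that by (simp add: V_def)
  qed (use a in auto)
  then show ?thesis using True by simp
 next
  \<comment> \<open>For f = 0 the value of \<open>zorder\<close> is unspecified and could be
    negative; the order of the holomorphic function g is non-negative in any case.\<close>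
  case False
  have "g analytic_on {a}" by (rule holomorphic_on_imp_analytic_at[OF hol[OF gG]]) (use a in auto)
  moreover have "\<exists>\<^sub>F z in at a. g z \<noteq> 0"
   by (rule eventually_frequently[OF _ frequently_nonzero[OF hol[OF gG] nz a]]) simp
  ultimately have "0 \<le> zorder g a" by (rule zorder_ge_0)
  then show ?thesis using False by simp
 qed
qed

section \<open>Powers of the weight\<close>

context weight
begin

lemma ln_inverse_powr: "0 < x ==> ln (1 / x powr s) = s * ln (1 / (x::real))"
 by (simp add: ln_div ln_powr)

text \<open>The factor s cancels in the comparison of logarithms, so c is unchanged, and the
  exponent of the modulus of continuity becomes l/s. This makes approximate inversion available for
  w^s.\<close>

lemma weight_powr:
 assumes s: "0 < s"
 shows "weight (%t. w t powr s) c"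
proof
 obtain l where l: "0 < l" "modulus_of_continuity (%t. w t powr l)"
  using majorant by (auto simp: majorant_def)
 have "modulus_of_continuity (%t. (w t powr s) powr (l / s))"
  using l(2) s by (simp add: powr_powr)
 moreover have "continuous_on {0..1} (%t. w t powr s)"
  by (intro continuous_on_powr' w_cont continuous_on_const) (use w_nonneg s in auto)
 moreover have "mono_on {0..1} (%t. w t powr s)"
  using s by (intro mono_onI powr_mono2 w_mono w_nonneg) auto
 moreover have "w 1 powr s \<noteq> 0" using w_pos[of 1] by simp
 ultimately show "majorant (%t. w t powr s)"
  unfolding majorant_def using l(1) s
  by (intro conjI bexI[of _ 1] exI[of _ "l / s"]) auto
 show "0 < c" by (rule c_pos)
 fix t :: real assume t: "0 < t" "t < 1"
 have t2: "0 < t\<^sup>2" "t\<^sup>2 \<le> 1" using t by (auto simp: power_le_one)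
 have e: "ln (1 / w t powr s) = s * ln (1 / w t)" "ln (1 / w (t\<^sup>2) powr s) = s * ln (1 / w (t\<^sup>2))"
  using t t2 w_pos by (intro ln_inverse_powr; simp)+
 have "s * (inverse c * ln (1 / w (t\<^sup>2))) \<le> s * ln (1 / w t)" "s * ln (1 / w t) \<le> s * (c * ln (1 / w (t\<^sup>2)))"
  using log_square[OF t] s by (intro mult_left_mono; simp)+
 then show "inverse c * ln (1 / w (t\<^sup>2) powr s) \<le> ln (1 / w t powr s) \<and> ln (1 / w t powr s) \<le> c * ln (1 / w (t\<^sup>2) powr s)"
  unfolding e by (simp only: mult.left_commute)
qed

text \<open>A power of the weight multiplies the entropy integral by s, so measures that do not
  charge entropy sets of w do not charge those of its powers.\<close>

lemma finite_entropy_powr: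
 assumes s: "0 < s" and E: "finite_entropy (%t. w t powr s) E"
 shows "finite_entropy w E"
proof -
 have "ln (x powr s) = s * ln x" for x :: real
  by (cases "x = 0") (auto simp: powr_def)
 then have "integrable leb (%y. s * ln (w (arc_setdist y E)))"
  using E by (simp add: finite_entropy_def)
 then have "integrable leb (%y. inverse s * (s * ln (w (arc_setdist y E))))"
  by (rule integrable_mult_right)
 then have "integrable leb (%y. ln (w (arc_setdist y E)))"
  using s by (simp add: mult.assoc[symmetric])
 then show ?thesis using E by (simp add: finite_entropy_def)
qed

lemma approx_powr:
 assumes s: "0 < s" and \<kappa>: "circle_measure \<kappa>" and null: "\<And>E. finite_entropy w E ==> emeasure \<kappa> E = 0" and e: "0 < e"
 shows "\<exists>q. bounded_on_disc q \<and> (\<forall>z. norm z < 1 --> w (1 - norm z) powr s * norm (q z * singular_inner \<kappa> z - 1) \<le> e)"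
proof -
 interpret p: weight "%t. w t powr s" c by (rule weight_powr[OF s])
 have "p.approx_cyclic (singular_inner \<kappa>)"
  by (rule p.approx_cyclic_singular_inner[OF \<kappa> null[OF finite_entropy_powr[OF s]]])
 then show ?thesis unfolding p.approx_cyclic_def using e by simp
qed

end

text \<open>The constant is absorbed by the Poisson integral of the constant density max(0, ln C),
  whose measure vanishes on the null set E.\<close>

lemma singular_part_le_const:
 assumes \<alpha>: "circle_measure \<alpha>" and \<beta>: "circle_measure \<beta>" and \<gamma>: "circle_measure \<gamma>"
  and E: "closed E" "E \<subseteq> sphere 0 1" "emeasure leb E = 0" and null: "emeasure \<gamma> E = 0"
  and b: "b holomorphic_on ball 0 1" "\<And>z. norm z < 1 ==> norm (b z) \<le> 1" and r: "good_radii b r" and C: "0 < C"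
  and bound: "\<And>z. z \<in> tangential_region E ==>
   norm (b z * singular_inner \<alpha> z / singular_inner \<beta> z) \<le> C * exp (poisson_integral \<gamma> z)"
  and K: "closed K" "K \<subseteq> E"
 shows "emeasure \<beta> K \<le> emeasure \<alpha> K"
proof -
 define t where "t = (%_::complex. max 0 (ln C))"
 define \<delta> where "\<delta> = density leb (%x. ennreal (t x))"
 have t: "integrable leb t" by (simp add: t_def)
 have \<delta>: "circle_measure \<delta>" unfolding \<delta>_def by (rule circle_lebesgue_density[OF t])
 have Es: "E \<in> sets circle_borel" by (rule closed_sets_circle[OF E(1,2)])
 have "emeasure \<delta> E = 0"
  using lebesgue_null_density[OF t] Es E(3) by (simp add: lebesgue_null_def \<delta>_def)
 have P\<delta>: "poisson_integral \<delta> z = max 0 (ln C)" if "norm z < 1" for z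
  unfolding \<delta>_def using that
  by (subst leb.poisson_integral_density) (auto simp: t_def integral_poisson_lebesgue)
 show ?thesis
 proof (rule singular_part_le[OF \<alpha> \<beta> circle_measure_sum[OF \<gamma> \<delta>] E(1,2) _ b r _ K])
  show "emeasure (sum_circle_measure \<gamma> \<delta>) E = 0"
   using null \<open>emeasure \<delta> E = 0\<close> by (simp add: emeasure_sum_circle_measure[OF \<gamma> \<delta> Es])
  fix z assume z: "z \<in> tangential_region E"
  then have z1: "norm z < 1" by (simp add: tangential_region_def)
  have "C = exp (ln C)" using C by simp
  also have "... \<le> exp (poisson_integral \<delta> z)" unfolding P\<delta>[OF z1] by simp
  finally have "C * exp (poisson_integral \<gamma> z) \<le> exp (poisson_integral \<delta> z) * exp (poisson_integral \<gamma> z)"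
   by (intro mult_right_mono) auto
  also have "... = exp (poisson_integral (sum_circle_measure \<gamma> \<delta>) z)"
   by (simp add: splits_integral(2)[OF splits_sum[OF \<gamma> \<delta>] z1] exp_add mult.commute)
  finally show "norm (b z * singular_inner \<alpha> z / singular_inner \<beta> z) \<le> exp (poisson_integral (sum_circle_measure \<gamma> \<delta>) z)"
   using bound[OF z] by linarith
 qed
qed

section \<open>The factorized function and its invariant subspace\<close>

lemma lebesgue_nullD: "lebesgue_null \<kappa> ==> A \<in> sets circle_borel ==> emeasure leb A = 0 ==> emeasure \<kappa> A = 0"
 by (simp add: lebesgue_null_def)

text \<open>\<kappa>m and \<kappa>p carry the outer factor as absolutely continuous measures. With
  \<alpha>, \<beta> and \<eta> defined below, everything in f except the Blaschke product and its
  constant becomes a quotient of functions S of measures.\<close>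

locale factorized = weight w c + blaschke J \<Lambda>
 for w c J \<Lambda> +
 fixes f :: "complex => complex" and \<mu> \<nu> \<mu>P \<mu>C \<kappa>m \<kappa>p :: "complex measure" and \<gamma> :: real
 assumes f_G: "f \<in> G_space w"
  and \<mu>: "circle_measure \<mu>" and \<nu>: "circle_measure \<nu>" and singular: "mutually_singular \<mu> \<nu>"
  and decomposition: "entropy_decomposition w \<mu> \<mu>P \<mu>C"
  and \<kappa>m: "circle_measure \<kappa>m" "lebesgue_null \<kappa>m" and \<kappa>p: "circle_measure \<kappa>p" "lebesgue_null \<kappa>p"
  and f_eq: "\<And>z. norm z < 1 ==> f z = cis \<gamma> * B z * (singular_inner \<kappa>m z * singular_inner \<mu> z) /
   (singular_inner \<kappa>p z * singular_inner \<nu> z)"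
begin

lemma sets_\<mu>: "sets \<mu> = sets circle_borel" using \<mu> by (simp add: circle_measure_def circle_measure_axioms_def)

lemma add: "A \<in> sets circle_borel ==> emeasure \<mu> A = emeasure \<mu>P A + emeasure \<mu>C A"
 using decomposition by (simp add: entropy_decomposition_def sets_\<mu>)

lemma splits_\<mu>: "splits \<mu> \<mu>P \<mu>C"
proof -
 interpret u: circle_measure \<mu> by (rule \<mu>)
 have s: "sets \<mu>P = sets circle_borel" "sets \<mu>C = sets circle_borel"
  using decomposition sets_\<mu> by (auto simp: entropy_decomposition_def)
 have sp: "space \<mu>P = sphere 0 1" "space \<mu>C = sphere 0 1"
  using s[THEN sets_eq_imp_space_eq] by auto
 have top: "sphere 0 1 \<in> sets circle_borel" using sets.top[of circle_borel] by simp
 have "emeasure \<mu>P (sphere 0 1) + emeasure \<mu>C (sphere 0 1) \<noteq> \<infinity>"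
  using add[OF top] u.emeasure_finite[of "sphere 0 1"] by (metis infinity_ennreal_def)
 then have "finite_measure \<mu>P" "finite_measure \<mu>C" by (auto intro!: finite_measureI simp: sp)
 then have "circle_measure \<mu>P" "circle_measure \<mu>C" using s by (auto intro: circle_measure_if)
 then show ?thesis using add \<mu> by (simp add: splits_def)
qed

lemma \<mu>P: "circle_measure \<mu>P" and \<mu>C: "circle_measure \<mu>C"
 using splits_\<mu> by (simp_all add: splits_def)

abbreviation (input) "S \<equiv> singular_inner"

definition \<alpha> where "\<alpha> = sum_circle_measure \<kappa>m \<mu>"
definition \<beta> where "\<beta> = sum_circle_measure \<kappa>p \<nu>"
definition \<eta> where "\<eta> = sum_circle_measure \<kappa>m \<mu>C"
definition b where "b z = blaschke_product \<gamma> J \<Lambda> z * S \<mu>P z"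

lemma \<alpha>: "circle_measure \<alpha>" and \<beta>: "circle_measure \<beta>" and \<eta>: "circle_measure \<eta>"
 unfolding \<alpha>_def \<beta>_def \<eta>_def by (intro circle_measure_sum \<mu> \<nu> \<mu>C \<kappa>m \<kappa>p)+

lemma S_\<alpha>: "norm z < 1 ==> S \<alpha> z = S \<kappa>m z * S \<mu> z"
 unfolding \<alpha>_def by (rule splits_integral(3)[OF splits_sum[OF \<kappa>m(1) \<mu>]])
lemma S_\<beta>: "norm z < 1 ==> S \<beta> z = S \<kappa>p z * S \<nu> z"
 unfolding \<beta>_def by (rule splits_integral(3)[OF splits_sum[OF \<kappa>p(1) \<nu>]])
lemma S_\<eta>: "norm z < 1 ==> S \<eta> z = S \<kappa>m z * S \<mu>C z"
 unfolding \<eta>_def by (rule splits_integral(3)[OF splits_sum[OF \<kappa>m(1) \<mu>C]])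
lemma S_\<mu>: "norm z < 1 ==> S \<mu> z = S \<mu>P z * S \<mu>C z"
 by (rule splits_integral(3)[OF splits_\<mu>])

lemma f_form: "norm z < 1 ==> f z = cis \<gamma> * (B z * S \<alpha> z / S \<beta> z)"
 by (simp add: f_eq S_\<alpha> S_\<beta>)

lemma b_eq: "b z = cis \<gamma> * B z * S \<mu>P z"
 by (simp add: b_def blaschke_product_eq)

text \<open>The hinge between f and b: each is obtained from the other by multiplication with one
  function S and division by another, and neither \<beta> nor \<eta> charges sets of finite
  entropy.\<close>

lemma f_\<beta>_eq_b_\<eta>: "norm z < 1 ==> S \<beta> z * f z = S \<eta> z * b z"
 by (simp add: f_form S_\<alpha> S_\<eta> S_\<mu> b_eq singular_inner_nz)

lemma bounded_S: "circle_measure \<kappa> ==> bounded_on_disc (S \<kappa>)"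
 using circle_measure.singular_inner_holomorphic circle_measure.norm_singular_inner_le
 unfolding bounded_on_disc_def by blast

lemma bounded_b: "bounded_on_disc b"
 unfolding b_eq[abs_def] by (intro bounded_on_disc_mult bounded_on_disc_const bounded_B bounded_S \<mu>P)

lemma norm_b_le: "norm z < 1 ==> norm (b z) \<le> 1"
 unfolding b_eq norm_mult
 using mult_mono[OF norm_B_le circle_measure.norm_singular_inner_le[OF \<mu>P], of z z] by simp

lemma b_G: "b \<in> G_space w" by (rule G_space_if_bounded_on_disc[OF bounded_b])

text \<open>Membership in the growth space gives |f| <= C exp(\<open>lam (1 - norm z)\<close>), and
  near E the exponent is at most the Poisson integral of the entropy measure, which does not charge
  E.\<close>

lemma singular_le_on_entropy_set:
 assumes fe: "finite_entropy w E" and K: "closed K" "K \<subseteq> E"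
 shows "emeasure \<beta> K \<le> emeasure \<alpha> K"
proof -
 note E = finite_entropyD[OF fe]
 obtain r where r: "good_radii B r" using good_radii_exist ..
 obtain C where C: "0 < C" "\<And>z. norm z < 1 ==> w (1 - norm z) * norm (f z) \<le> C"
  by (rule G_space_bounded[OF f_G]) blast
 show ?thesis
 proof (rule singular_part_le_const[OF \<alpha> \<beta> entropy_measure(1)[OF fe] _ _ _ entropy_measure(2)[OF fe] B_holomorphic norm_B_le r C(1) _ K])
  fix z assume z: "z \<in> tangential_region E"
  then have z1: "norm z < 1" by (simp add: tangential_region_def)
  have pos: "0 < 1 - norm z" "1 - norm z \<le> 1" using z1 by auto
  have "norm (B z * S \<alpha> z / S \<beta> z) = norm (f z)" unfolding f_form[OF z1] norm_mult by simp
  also have "... \<le> C * exp (lam (1 - norm z))"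
  proof -
   have "norm (f z) = (w (1 - norm z) * norm (f z)) * exp (lam (1 - norm z))"
    unfolding w_eq_exp[OF pos] by (simp add: exp_minus)
   also have "... \<le> C * exp (lam (1 - norm z))" by (intro mult_right_mono C(2) z1) simp
   finally show ?thesis .
  qed
  also have "... \<le> C * exp (poisson_integral (entropy_measure E) z)"
   using lam_le_entropy_integral[OF fe z] C(1) by simp
  finally show "norm (B z * S \<alpha> z / S \<beta> z) \<le> C * exp (poisson_integral (entropy_measure E) z)" .
 qed (use fe in "auto simp: finite_entropy_def")
qed

lemma null_on_subset:
 assumes "finite_entropy w E" "lebesgue_null \<kappa>" "closed K" "K \<subseteq> E"
 shows "emeasure \<kappa> K = 0"
proof -
 have E: "E \<subseteq> sphere 0 1" "E \<in> null_sets leb"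
  using assms(1) closed_sets_circle[of E] by (auto simp: finite_entropy_def null_sets_def)
 have K: "K \<in> sets circle_borel" using assms E by (intro closed_sets_circle) auto
 then have "K \<in> null_sets leb" using E(2) assms(4) by (intro null_sets_subset[OF E(2)]) auto
 then show ?thesis using lebesgue_nullD[OF assms(2) K] by auto
qed

text \<open>The absolutely continuous parts of \<alpha> and \<beta> vanish on E, so \<nu> is at most
  \<mu> on E; as the two are mutually singular, nothing is left.\<close>

lemma \<nu>_null:
 assumes fe: "finite_entropy w E"
 shows "emeasure \<nu> E = 0"
proof -
 have Es: "E \<in> sets circle_borel" using fe by (intro closed_sets_circle) (auto simp: finite_entropy_def)
 have le: "emeasure \<nu> A \<le> emeasure \<mu> A" if A: "A \<in> sets circle_borel" "A \<subseteq> E" for A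
 proof (rule inner_regular_circle_le[OF \<mu> \<nu> A(1)])
  fix K assume K: "closed K" "K \<subseteq> A"
  then have KE: "K \<subseteq> E" using A by blast
  have Ks: "K \<in> sets circle_borel" using K KE fe by (intro closed_sets_circle) (auto simp: finite_entropy_def)
  have "emeasure \<nu> K \<le> emeasure \<beta> K"
   unfolding \<beta>_def by (simp add: emeasure_sum_circle_measure[OF \<kappa>p(1) \<nu> Ks])
  also have "... \<le> emeasure \<alpha> K" by (rule singular_le_on_entropy_set[OF fe K(1) KE])
  also have "... = emeasure \<mu> K"
   unfolding \<alpha>_def using null_on_subset[OF fe \<kappa>m(2) K(1) KE] by (simp add: emeasure_sum_circle_measure[OF \<kappa>m(1) \<mu> Ks])
  finally show "emeasure \<nu> K \<le> emeasure \<mu> K" .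
 qed
 interpret n: circle_measure \<nu> by (rule \<nu>)
 interpret m: circle_measure \<mu> by (rule \<mu>)
 obtain A where A: "A \<in> sets circle_borel" "emeasure \<mu> A = 0" "emeasure \<nu> (sphere 0 1 - A) = 0"
  using singular by (auto simp: mutually_singular_def sets_\<mu>)
 have "E \<subseteq> sphere 0 1" using fe by (simp add: finite_entropy_def)
 have "emeasure \<mu> (E \<inter> A) \<le> emeasure \<mu> A"
  by (rule emeasure_mono) (use A m.sets_circle in auto)
 then have 1: "emeasure \<nu> (E \<inter> A) = 0" using le[of "E \<inter> A"] A(1,2) Es by auto
 have top: "sphere 0 1 \<in> sets circle_borel" using sets.top[of circle_borel] by simp
 have "emeasure \<nu> (E - A) \<le> emeasure \<nu> (sphere 0 1 - A)"
  by (rule emeasure_mono) (use A top \<open>E \<subseteq> sphere 0 1\<close> n.sets_circle in auto)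
 then have 2: "emeasure \<nu> (E - A) = 0" using A(3) by simp
 have "emeasure \<nu> ((E \<inter> A) \<union> (E - A)) \<le> emeasure \<nu> (E \<inter> A) + emeasure \<nu> (E - A)"
  by (rule emeasure_subadditive) (use A Es n.sets_circle in auto)
 then show ?thesis using 1 2 by (simp add: Int_Diff_Un)
qed

lemma cyclic_\<nu>: "G_cyclic w (S \<nu>)"
 by (intro approx_cyclic_imp_G_cyclic bounded_S \<nu> approx_cyclic_singular_inner \<nu>_null)

lemma null_on_entropy_set: "finite_entropy w E ==> lebesgue_null \<kappa> ==> emeasure \<kappa> E = 0"
 by (rule null_on_subset) (auto simp: finite_entropy_def)

lemma \<beta>_null: "finite_entropy w E ==> emeasure \<beta> E = 0"
 unfolding \<beta>_def
 by (subst emeasure_sum_circle_measure[OF \<kappa>p(1) \<nu>])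
  (auto simp: \<nu>_null null_on_entropy_set \<kappa>p finite_entropy_def intro: closed_sets_circle)

lemma \<eta>_null: "finite_entropy w E ==> emeasure \<eta> E = 0"
proof -
 assume fe: "finite_entropy w E"
 have "emeasure \<mu>C E = 0" using decomposition fe by (simp add: entropy_decomposition_def)
 moreover have "E \<in> sets circle_borel" using fe by (auto simp: finite_entropy_def intro: closed_sets_circle)
 ultimately show ?thesis unfolding \<eta>_def
  using null_on_entropy_set[OF fe \<kappa>m(2)] by (simp add: emeasure_sum_circle_measure[OF \<kappa>m(1) \<mu>C])
qed

lemma eq_on_disc_mem:
 assumes "G_closed_subspace w V" "g \<in> V" "h holomorphic_on ball 0 1" "\<And>z. norm z < 1 ==> h z = g z"
 shows "h \<in> V"
proof (rule G_closedI[OF assms(1)])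
 have gG: "g \<in> G_space w" using assms(1,2) G_closed_subspaceD(1) by blast
 show "h \<in> G_space w" using gG assms(3,4) by (simp add: G_space_iff)
 show "\<exists>v\<in>V. w_close v h e" if "0 < e" for e
  using assms(2,4) that by (intro bexI[of _ g]) auto
qed

lemma f_holomorphic: "f holomorphic_on ball 0 1" by (rule G_space_holomorphic[OF f_G])

text \<open>The product of S_\<eta> and b lies in the subspace, and b is bounded, so the factor can
  be removed with the full weight, a = 1.\<close>

lemma b_in: "b \<in> G_generated w f"
proof -
 note V = G_generated_closed[OF f_G]
 have "(%z. S \<beta> z * f z) \<in> G_generated w f" by (rule invariant_bounded[OF V bounded_S[OF \<beta>]])
 then have Sb: "(%z. S \<eta> z * b z) \<in> G_generated w f"
 proof (rule eq_on_disc_mem[OF V(1)])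
  show "(%z. S \<eta> z * b z) holomorphic_on ball 0 1"
   by (intro holomorphic_on_mult bounded_on_discD bounded_S \<eta> bounded_b)
 qed (simp add: f_\<beta>_eq_b_\<eta>)
 show ?thesis
 proof (rule remove_factor[OF V(1,2) Sb b_G, of 1 1])
  show "norm (b z) \<le> 1 * w (1 - norm z) powr (1 - 1)" if "norm z < 1" for z
   using norm_b_le[OF that] w_disc(1)[OF that] by simp
  show "\<exists>q. bounded_on_disc q \<and> (\<forall>z. norm z < 1 --> w (1 - norm z) powr 1 * norm (q z * S \<eta> z - 1) \<le> e)" if "0 < e" for e
   by (rule approx_powr[OF _ \<eta> \<eta>_null that]) simp_all
 qed
qed

text \<open>Provides the powers of S as functions S of multiples of the measure, so that all results
  on measures apply to them.\<close>

lemma scaled_measure: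
 assumes s: "0 \<le> s" and \<kappa>: "circle_measure \<kappa>"
 shows "circle_measure (density \<kappa> (%_. ennreal s))"
  "emeasure \<kappa> E = 0 ==> E \<in> sets circle_borel ==> emeasure (density \<kappa> (%_. ennreal s)) E = 0"
  "norm z < 1 ==> S (density \<kappa> (%_. ennreal s)) z = exp (- of_real s * herglotz_integral \<kappa> z)"
proof -
 interpret k: circle_measure \<kappa> by fact
 show cm: "circle_measure (density \<kappa> (%_. ennreal s))"
  by (rule k.circle_measure_density) simp
 show "emeasure (density \<kappa> (%_. ennreal s)) E = 0" if "emeasure \<kappa> E = 0" "E \<in> sets circle_borel"
  using that k.sets_circle by (simp add: emeasure_density nn_integral_cmult_indicator)
 show "S (density \<kappa> (%_. ennreal s)) z = exp (- of_real s * herglotz_integral \<kappa> z)" if z: "norm z < 1"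
 proof -
  have "herglotz_integral (density \<kappa> (%_. ennreal s)) z = (\<integral>x. s *\<^sub>R herglotz z x \<partial>\<kappa>)"
   by (rule k.herglotz_integral_density) (use s z in auto)
  then show ?thesis by (simp add: singular_inner_eq herglotz_integral_def scaleR_conv_of_real)
 qed
qed

text \<open>\<open>T s\<close> is the power S_\<beta>^s. Its product with f has modulus |S_\<beta>
  f|^s |f|^(1-s), where S_\<beta> f = S_\<eta> b is bounded by 1. The growth is therefore at most
  that of w^(s-1), just what \<open>remove_factor\<close> admits with exponent s.\<close>

lemma f_in: "f \<in> G_generated w b"
proof -
 note V = G_generated_closed[OF b_G]
 have cms: "circle_measure (density \<beta> (%_. ennreal s))" if "0 \<le> s" for s by (rule scaled_measure(1)[OF that \<beta>])
 define T where "T s = S (density \<beta> (%_. ennreal s))" for s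
 have T: "T s z = exp (- of_real s * herglotz_integral \<beta> z)" if "0 \<le> s" "norm z < 1" for s z
  unfolding T_def by (rule scaled_measure(3)[OF that(1) \<beta> that(2)])
 have Tb: "bounded_on_disc (T s)" if "0 \<le> s" for s unfolding T_def by (rule bounded_S[OF cms[OF that]])
 have T1: "norm (T s z) \<le> 1" if "0 \<le> s" "norm z < 1" for s z
  unfolding T_def using circle_measure.norm_singular_inner_le[OF cms] that by blast
 have TT: "T (1 - s) z * T s z = S \<beta> z" if "0 \<le> s" "s \<le> 1" "norm z < 1" for s z
  using that by (simp add: T singular_inner_eq algebra_simps flip: exp_add)
 have "(%z. S \<eta> z * b z) \<in> G_generated w b" by (rule invariant_bounded[OF V bounded_S[OF \<eta>]])
 then have Sf: "(%z. S \<beta> z * f z) \<in> G_generated w b"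
 proof (rule eq_on_disc_mem[OF V(1)])
  show "(%z. S \<beta> z * f z) holomorphic_on ball 0 1"
   by (intro holomorphic_on_mult bounded_on_discD[OF bounded_S] \<beta> f_holomorphic)
 qed (simp add: f_\<beta>_eq_b_\<eta>)
 have Sf1: "norm (S \<beta> z * f z) \<le> 1" if "norm z < 1" for z
  unfolding f_\<beta>_eq_b_\<eta>[OF that] norm_mult
  using mult_mono[OF circle_measure.norm_singular_inner_le[OF \<eta> that] norm_b_le[OF that]] by simp
 obtain C where C: "0 < C" "\<And>z. norm z < 1 ==> w (1 - norm z) * norm (f z) \<le> C"
  by (rule G_space_bounded[OF f_G]) blast
 have step: "(%z. T s z * f z) \<in> G_generated w b" if s: "0 < s" "s < 1" for s
 proof (rule remove_factor[OF V(1,2), where S="T (1 - s)" and K="C powr (1 - s)" and a=s])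
  have TG: "(%z. T s z * f z) \<in> G_space w" by (rule G_space_mult[OF Tb f_G]) (use s in simp)
  then show "(%z. T s z * f z) \<in> G_space w" .
  show "(%z. T (1 - s) z * (T s z * f z)) \<in> G_generated w b"
  proof (rule eq_on_disc_mem[OF V(1) Sf])
   show "(%z. T (1 - s) z * (T s z * f z)) holomorphic_on ball 0 1"
    by (intro holomorphic_on_mult[OF _ G_space_holomorphic[OF TG]] bounded_on_discD[OF Tb]) (use s in simp)
   show "T (1 - s) z * (T s z * f z) = S \<beta> z * f z" if "norm z < 1" for z
    using TT[of s z] s that by (simp add: mult.assoc[symmetric])
  qed
  fix z :: complex assume z: "norm z < 1"
  have w0: "0 < w (1 - norm z)" by (rule w_disc(1)[OF z])
  show "norm (T s z * f z) \<le> C powr (1 - s) * w (1 - norm z) powr (s - 1)"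
  proof (cases "f z = 0")
   case False
   have nT: "norm (T s z) = norm (S \<beta> z) powr s"
    using s z by (simp add: T singular_inner_eq powr_def)
   have f_le: "norm (f z) \<le> C / w (1 - norm z)" using C(2)[OF z] w0 by (simp add: le_divide_eq mult.commute)
   have "norm (T s z * f z) = norm (S \<beta> z) powr s * (norm (f z) powr s * norm (f z) powr (1 - s))"
    using False by (simp add: norm_mult nT flip: powr_add)
   also have "... = norm (S \<beta> z * f z) powr s * norm (f z) powr (1 - s)"
    by (simp add: norm_mult powr_mult mult.assoc)
   also have "... \<le> 1 * (C / w (1 - norm z)) powr (1 - s)"
    using s Sf1[OF z] f_le by (intro mult_mono powr_mono2 powr_le1) auto
   also have "... = C powr (1 - s) * w (1 - norm z) powr (s - 1)"
    using w0 C(1) by (simp add: powr_divide powr_minus_divide[of _ "1 - s", simplified minus_diff_eq])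
   finally show ?thesis .
  qed simp
 next
  show "\<exists>q. bounded_on_disc q \<and> (\<forall>z. norm z < 1 --> w (1 - norm z) powr s * norm (q z * T (1 - s) z - 1) \<le> e)" if e: "0 < e" for e
   unfolding T_def
  proof (rule approx_powr[OF s(1) cms _ e])
   show "emeasure (density \<beta> (%_. ennreal (1 - s))) E = 0" if "finite_entropy w E" for E
    using that s by (intro scaled_measure(2) \<beta> \<beta>_null closed_sets_circle) (auto simp: finite_entropy_def)
  qed (use s in simp)
 qed
 show ?thesis
 proof (rule G_closedI[OF V(1) f_G])
  fix e :: real assume e: "0 < e"
  define t where "t n = 1 / real (n + 2)" for n
  have t: "0 < t n" "t n < 1" for n by (auto simp: t_def)
  have tlim: "t \<longlonglongrightarrow> 0" unfolding t_def by (rule LIMSEQ_ignore_initial_segment[OF lim_const_over_n])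
  have "\<forall>\<^sub>F n in sequentially. w_close (%z. T (t n) z * f z) (%z. 1 * f z) e"
  proof (rule G_mult_approx[OF f_G e])
   show "norm (T (t n) z - 1) \<le> 2" if "norm z < 1" for n z
    using norm_triangle_ineq4[of "T (t n) z" 1] T1[OF less_imp_le[OF t(1)] that, of n] by simp
   fix R d :: real assume R: "R < 1" and d: "0 < d"
   interpret be: circle_measure \<beta> by (rule \<beta>)
   define M where "M = measure \<beta> (sphere 0 1) * (2 / (1 - R))"
   have M: "0 \<le> M" using R by (simp add: M_def)
   have "(%n. t n * M * exp (t n * M)) \<longlonglongrightarrow> 0 * M * exp (0 * M)" by (intro tendsto_intros tlim)
   then have "\<forall>\<^sub>F n in sequentially. t n * M * exp (t n * M) < d" using d by (intro order_tendstoD) auto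
   then show "\<forall>\<^sub>F n in sequentially. \<forall>z. norm z \<le> R --> norm (T (t n) z - 1) < d"
   proof eventually_elim
    case (elim n)
    show ?case
    proof (intro allI impI)
     fix z :: complex assume z: "norm z \<le> R"
     then have z1: "norm z < 1" using R by simp
     have "norm (herglotz_integral \<beta> z) \<le> 2 / (1 - norm z) * measure \<beta> (sphere 0 1)"
      by (rule be.norm_herglotz_integral_le[OF z1])
     also have "... \<le> 2 / (1 - R) * measure \<beta> (sphere 0 1)"
      using z R by (intro mult_right_mono divide_left_mono) auto
     finally have "norm (herglotz_integral \<beta> z) \<le> M" unfolding M_def by (simp only: mult.commute)
     then have x: "norm (- of_real (t n) * herglotz_integral \<beta> z) \<le> t n * M"
      using t(1)[of n] by (simp add: norm_mult mult_left_mono)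
     have "norm (T (t n) z - 1) \<le> norm (- of_real (t n) * herglotz_integral \<beta> z) * exp (norm (- of_real (t n) * herglotz_integral \<beta> z))"
      unfolding T[OF less_imp_le[OF t(1)] z1] by (rule norm_exp_minus_1_le)
     also have "... \<le> t n * M * exp (t n * M)" using x by (intro mult_mono) (use t(1)[of n] M in auto)
     finally show "norm (T (t n) z - 1) < d" using elim by linarith
    qed
   qed
  qed
  then obtain n where "w_close (%z. T (t n) z * f z) (%z. 1 * f z) e"
   unfolding eventually_sequentially by blast
  then show "\<exists>v\<in>G_generated w b. w_close v f e"
   by (intro bexI[OF _ step[OF t(1,2)[of n]]]) simp
 qed
qed

lemma generated_eq: "G_generated w f = G_generated w b"
 by (intro equalityI G_generated_subset G_generated_closed f_G b_G b_in f_in)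

end

section \<open>Permanence\<close>

text \<open>The points with a radial limit are described by Cauchy's criterion. For fixed accuracy k
  and radius d n the condition on all pairs of larger radii is an intersection of closed sets,
  uncountable but closed.\<close>

lemma boundary_value_measurable:
 assumes f: "f holomorphic_on ball 0 1"
 shows "boundary_value f \<in> borel_measurable leb"
proof -
 obtain r where r: "\<And>n. 0 < r n" "\<And>n. r n < 1" and r1: "r \<longlonglongrightarrow> (1::real)" by (rule radii_to_1) blast
 have fc: "continuous_on (sphere 0 1) (%x. f (of_real s * x))" if "0 < s" "s < 1" for s
  by (rule dilation_disc(2)[OF f]) (use that in auto)
 define d where "d n = 1 - inverse (real (Suc (Suc n)))" for n
 have d: "0 < d n" "d n < 1" for n by (auto simp: d_def field_simps)
 define A where "A k n = (\<Inter>s\<in>{d n<..<1}. \<Inter>t\<in>{d n<..<1}. {x\<in>sphere 0 1. norm (f (of_real s * x) - f (of_real t * x)) \<le> inverse (real (Suc k))})" for k n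
 define Cv where "Cv = (\<Inter>k. \<Union>n. A k n)"
 have Ak: "A k n \<in> sets circle_borel" for k n
 proof (rule closed_sets_circle)
  have "closed {x\<in>sphere 0 1. norm (f (of_real s * x) - f (of_real t * x)) \<le> inverse (real (Suc k))}"
   if s: "s \<in> {d n<..<1}" and t: "t \<in> {d n<..<1}" for s t
  proof -
   have "closed (sphere 0 1 \<inter> (%x. norm (f (of_real s * x) - f (of_real t * x))) -` {..inverse (real (Suc k))})"
    by (intro continuous_closed_preimage continuous_intros fc) (use s t d[of n] in auto)
   also have "... = {x\<in>sphere 0 1. norm (f (of_real s * x) - f (of_real t * x)) \<le> inverse (real (Suc k))}" by auto
   finally show ?thesis .
  qed
  then show "closed (A k n)" unfolding A_def by (intro closed_INT ballI)
  obtain s where "s \<in> {d n<..<1}" using dense[OF d(2)[of n]] by auto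
  then show "A k n \<subseteq> sphere 0 1" unfolding A_def by blast
 qed
 have Cv: "Cv \<in> sets circle_borel" unfolding Cv_def using Ak by auto
 have conv: "(\<exists>l. radial_limit f x l) \<longleftrightarrow> x \<in> Cv" if x: "x \<in> sphere 0 1" for x
 proof
  assume "\<exists>l. radial_limit f x l"
  then obtain l where l: "radial_limit f x l" ..
  have "\<exists>n. x \<in> A k n" for k
  proof -
   have "0 < inverse (real (Suc k)) / 2" by simp
   from tendstoD[OF l this] obtain b where b: "b < 1" "\<And>s. b < s ==> s < 1 ==> dist (f (of_real s * x)) l < inverse (real (Suc k)) / 2"
    unfolding eventually_at_left_field by blast
   have "(%n. 1 - inverse (real (Suc (Suc n)))) \<longlonglongrightarrow> 1 - 0"
    by (intro tendsto_intros LIMSEQ_Suc[OF LIMSEQ_inverse_real_of_nat])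
   then have "d \<longlonglongrightarrow> 1" unfolding d_def by simp
   from order_tendstoD(1)[OF this b(1)] obtain n where n: "b < d n" by (auto simp: eventually_sequentially)
   have "norm (f (of_real s * x) - f (of_real t * x)) \<le> inverse (real (Suc k))"
    if s: "s \<in> {d n<..<1}" and t: "t \<in> {d n<..<1}" for s t
   proof -
    have "dist (f (of_real s * x)) (f (of_real t * x)) < inverse (real (Suc k))"
     by (rule dist_triangle_half_l[OF b(2) b(2)]) (use s t n in auto)
    then show ?thesis by (simp only: dist_norm less_imp_le)
   qed
   then have "x \<in> A k n" unfolding A_def using x by blast
   then show ?thesis ..
  qed
  then show "x \<in> Cv" unfolding Cv_def by blast
 next
  assume C: "x \<in> Cv"
  show "\<exists>l. radial_limit f x l"
  proof (rule tendsto_exists_if_close)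
   fix e :: real assume "0 < e"
   then obtain k where k: "inverse (real (Suc k)) < e" using reals_Archimedean by blast
   obtain n where n: "x \<in> A k n" using C unfolding Cv_def by blast
   obtain t where t: "t \<in> {d n<..<1}" using dense[OF d(2)[of n]] by auto
   have le: "norm (f (of_real s * x) - f (of_real t * x)) \<le> inverse (real (Suc k))" if "s \<in> {d n<..<1}" for s
    using n that t unfolding A_def by blast
   have "\<forall>\<^sub>F s in at_left 1. s \<in> {d n<..<1}" by (rule eventually_at_left_real[OF d(2)])
   then have "\<forall>\<^sub>F s in at_left 1. dist (f (of_real s * x)) (f (of_real t * x)) < e"
    by eventually_elim (use le k in "force simp: dist_norm")
   then show "\<exists>l. \<forall>\<^sub>F s in at_left 1. dist (f (of_real s * x)) l < e" by blast
  qed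
 qed
 \<comment> \<open>The value of \<open>Lim\<close> in the absence of a limit: its defining predicate
   is then false throughout, so the value is the same at all such points.\<close>
 define c0 where "c0 = (THE l :: complex. False)"
 have at1: "filterlim r (at_left 1) sequentially"
  unfolding filterlim_at using r r1 by (auto intro!: always_eventually simp: less_imp_neq)
 have eq: "boundary_value f x = (if x \<in> Cv then lim (%n. f (of_real (r n) * x)) else c0)" if x: "x \<in> sphere 0 1" for x
 proof (cases "x \<in> Cv")
  case True
  then obtain l where l: "radial_limit f x l" using conv[OF x] by blast
  have "boundary_value f x = l" unfolding boundary_value_def by (rule tendsto_Lim[OF _ l]) simp
  moreover have "lim (%n. f (of_real (r n) * x)) = l" by (rule limI[OF filterlim_compose[OF l at1]])
  ultimately show ?thesis using True by simp
 next
  case False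
  then have "\<And>l. \<not> radial_limit f x l" using conv[OF x] by blast
  then show ?thesis using False by (simp add: boundary_value_def t2_space_class.Lim_def c0_def)
 qed
 have "(%x. if x \<in> Cv then lim (%n. f (of_real (r n) * x)) else c0) \<in> borel_measurable leb"
 proof (rule measurable_If_set)
  show "(%x. lim (%n. f (of_real (r n) * x))) \<in> borel_measurable leb"
   by (intro borel_measurable_lim_metric leb.borel_measurable_continuous fc r)
  show "Cv \<inter> space leb \<in> sets leb" using sets.Int_space_eq2[of Cv leb] Cv by simp
 qed simp
 then show ?thesis
  by (rule measurable_cong[THEN iffD1, rotated]) (use eq in simp)
qed

text \<open>The boundary moduli agree only almost everywhere. Equality of the integrals is then
  drawn from measurable integrands, which is where the measurability of boundary values is
  used.\<close>

lemma outer_factor_mult: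
 assumes b: "radially_unimodular b" and eq: "\<And>z. norm z < 1 ==> h z = b z * u z"
  and h: "h holomorphic_on ball 0 1" and u: "u holomorphic_on ball 0 1" and z: "norm z < 1"
 shows "outer_factor h z = outer_factor u z"
proof -
 have m: "(%x. (x + z) / (x - z) * complex_of_real (ln (norm (boundary_value g x)))) \<in> borel_measurable leb"
  if "g holomorphic_on ball 0 1" for g
 proof (rule borel_measurable_times)
  show "(%x. (x + z) / (x - z)) \<in> borel_measurable leb"
   using leb.borel_measurable_continuous[OF continuous_on_herglotz[OF z]] by (simp add: herglotz_def[abs_def])
  show "(%x. complex_of_real (ln (norm (boundary_value g x)))) \<in> borel_measurable leb"
   using boundary_value_measurable[OF that] by measurable
 qed
 have "(\<oint>x. (x + z) / (x - z) * complex_of_real (ln (norm (boundary_value h x)))) =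
   (\<oint>x. (x + z) / (x - z) * complex_of_real (ln (norm (boundary_value u x))))"
 proof (rule integral_cong_AE[OF m[OF h] m[OF u]])
  show "AE x in leb. (x + z) / (x - z) * complex_of_real (ln (norm (boundary_value h x))) =
    (x + z) / (x - z) * complex_of_real (ln (norm (boundary_value u x)))"
  proof -
   have "AE x in leb. norm (boundary_value h x) = norm (boundary_value u x)"
    by (rule norm_boundary_value_mult[OF b]) (rule eq)
   then show ?thesis by eventually_elim simp
  qed
 qed
 then show ?thesis by (simp add: outer_factor_def)
qed

text \<open>Divide h by the function S of the part of \<mu>P on E. Near E the quotient is bounded by
  \<open>permanence_bound\<close>; its numerator carries m + q, its denominator p and that part of
  \<mu>P. Since m and p vanish on E, comparing singular parts gives \<mu>P <= q there. Only |h|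
  enters, and the factorization is free, so that h = 1 is covered as well.\<close>

lemma (in factorized) \<mu>P_le:
 assumes h: "h \<in> G_generated w f" and b': "blaschke J' \<Lambda>'" and q: "circle_measure q"
  and m: "circle_measure m" "lebesgue_null m" and p: "circle_measure p" "lebesgue_null p"
  and h_eq: "\<And>z. norm z < 1 ==> norm (h z) = norm (blaschke.B J' \<Lambda>' z * (S m z * S q z) / S p z)"
  and A: "A \<in> sets circle_borel"
 shows "emeasure \<mu>P A \<le> emeasure q A"
proof -
 interpret b': blaschke J' \<Lambda>' by fact
 interpret r: circle_measure q by fact
 interpret P: circle_measure \<mu>P by (rule \<mu>P)
 have le: "emeasure \<mu>P A \<le> emeasure q A" if fe: "finite_entropy w E" and A: "A \<in> sets circle_borel" "A \<subseteq> E" for E A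
 proof (rule inner_regular_circle_le[OF q \<mu>P A(1)])
  fix K assume K: "closed K" "K \<subseteq> A"
  then have KE: "K \<subseteq> E" using A by blast
  have E: "E \<subseteq> sphere 0 1" "closed E" "emeasure leb E = 0" using fe by (auto simp: finite_entropy_def)
  have Es: "E \<in> sets circle_borel" by (rule closed_sets_circle[OF E(2,1)])
  have Ks: "K \<in> sets circle_borel" using K KE E(1) by (intro closed_sets_circle) auto
  define \<mu>E where "\<mu>E = density \<mu>P (indicator E)"
  define \<mu>E' where "\<mu>E' = density \<mu>P (indicator (sphere 0 1 - E))"
  have \<mu>E: "circle_measure \<mu>E" and e: "emeasure \<mu>E K = emeasure \<mu>P K" and sp: "splits \<mu>P \<mu>E \<mu>E'"
   unfolding \<mu>E_def \<mu>E'_def using circle_measure_restrict[OF \<mu>P Es] Ks KE by (simp_all add: Int_absorb2)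
  have \<mu>E': "circle_measure \<mu>E'" using sp by (simp add: splits_def)
  define g where "g z = cis \<gamma> * B z * S \<mu>E' z" for z
  have g: "bounded_on_disc g"
   unfolding g_def[abs_def] by (intro bounded_on_disc_mult bounded_on_disc_const bounded_B bounded_S \<mu>E')
  have bg: "b z = g z * S (density \<mu>P (indicator E)) z" if "norm z < 1" for z
   using splits_integral(3)[OF sp that] by (simp add: b_eq g_def \<mu>E_def)
  have hb: "h \<in> G_generated w b" using h generated_eq by simp
  obtain C where C: "0 < C" "\<And>z. z \<in> tangential_region E ==> norm (h z / S \<mu>E z) \<le> C * exp (poisson_integral (entropy_measure E) z)"
   using permanence_bound[OF fe \<mu>P g bg b_G hb] unfolding \<mu>E_def by blast
  obtain r where r: "good_radii b'.B r" using b'.good_radii_exist ..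
  have "emeasure (sum_circle_measure p \<mu>E) K \<le> emeasure (sum_circle_measure m q) K"
  proof (rule singular_part_le_const[OF circle_measure_sum[OF m(1) q] circle_measure_sum[OF p(1) \<mu>E] entropy_measure(1)[OF fe]
    E(2,1,3) entropy_measure(2)[OF fe] b'.B_holomorphic b'.norm_B_le r C(1) _ K(1) KE])
   fix z assume z: "z \<in> tangential_region E"
   then have z1: "norm z < 1" by (simp add: tangential_region_def)
   have "norm (b'.B z * S (sum_circle_measure m q) z / S (sum_circle_measure p \<mu>E) z) = norm (b'.B z * (S m z * S q z) / S p z) / norm (S \<mu>E z)"
    by (simp add: splits_integral(3)[OF splits_sum[OF m(1) q] z1] splits_integral(3)[OF splits_sum[OF p(1) \<mu>E] z1] norm_mult norm_divide)
   also have "... = norm (h z / S \<mu>E z)" by (simp add: h_eq[OF z1] norm_divide)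
   also have "... \<le> C * exp (poisson_integral (entropy_measure E) z)" by (rule C(2)[OF z])
   finally show "norm (b'.B z * S (sum_circle_measure m q) z / S (sum_circle_measure p \<mu>E) z) \<le> C * exp (poisson_integral (entropy_measure E) z)" .
  qed
  then show "emeasure \<mu>P K \<le> emeasure q K"
   using null_on_subset[OF fe m(2) K(1) KE] null_on_subset[OF fe p(2) K(1) KE] e
   by (simp add: emeasure_sum_circle_measure[OF m(1) q Ks] emeasure_sum_circle_measure[OF p(1) \<mu>E Ks])
 qed
 obtain \<E> where \<E>: "countable \<E>" "\<And>E. E \<in> \<E> ==> finite_entropy w E" "emeasure \<mu>P (space \<mu>P - \<Union>\<E>) = 0"
  using decomposition by (auto simp: entropy_decomposition_def)
 have Es: "E \<in> sets circle_borel" if "E \<in> \<E>" for E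
  using \<E>(2)[OF that] by (auto simp: finite_entropy_def intro: closed_sets_circle)
 have US: "\<Union>\<E> \<in> sets circle_borel" using \<E>(1) Es by (intro sets.countable_Union) auto
 have AS: "A \<subseteq> sphere 0 1" using sets.sets_into_space[OF A] by simp
 have top: "sphere 0 1 \<in> sets circle_borel" using sets.top[of circle_borel] by simp
 have "emeasure \<mu>P A \<le> emeasure \<mu>P (A \<inter> \<Union>\<E>) + emeasure \<mu>P (sphere 0 1 - \<Union>\<E>)"
 proof -
  have "emeasure \<mu>P A \<le> emeasure \<mu>P ((A \<inter> \<Union>\<E>) \<union> (sphere 0 1 - \<Union>\<E>))"
   by (rule emeasure_mono) (use A US AS top P.sets_circle in auto)
  also have "... \<le> emeasure \<mu>P (A \<inter> \<Union>\<E>) + emeasure \<mu>P (sphere 0 1 - \<Union>\<E>)"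
   by (rule emeasure_subadditive) (use A US top P.sets_circle in auto)
  finally show ?thesis .
 qed
 also have "emeasure \<mu>P (sphere 0 1 - \<Union>\<E>) = 0" using \<E>(3) by simp
 also have "emeasure \<mu>P (A \<inter> \<Union>\<E>) \<le> emeasure q (A \<inter> \<Union>\<E>)"
 proof (cases "\<E> = {}")
  case False
  define F where "F = from_nat_into \<E>"
  have F: "F n \<in> \<E>" for n unfolding F_def by (rule from_nat_into[OF False])
  have UF: "\<Union>\<E> = (\<Union>n. F n)" unfolding F_def using range_from_nat_into[OF False \<E>(1)] by simp
  \<comment> \<open>The inequality holds for subsets of a single entropy set, and these sets may
    overlap; disjoint pieces allow it to be summed.\<close>
  define G where "G n = A \<inter> disjointed F n" for n
  have "range F \<subseteq> sets circle_borel" using F Es by blast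
  then have "disjointed F n \<in> sets circle_borel" for n using sets.range_disjointed_sets by blast
  then have Gs: "G n \<in> sets circle_borel" for n unfolding G_def using A by blast
  have disj: "disjoint_family G"
   unfolding G_def by (rule disjoint_family_on_bisimulation[OF disjoint_family_disjointed[of F]]) auto
  have UG: "(\<Union>n. G n) = A \<inter> \<Union>\<E>" unfolding G_def UF UN_disjointed_eq[of F, symmetric] by blast
  have "G n \<subseteq> F n" for n unfolding G_def using disjointed_subset[of F n] by blast
  then have "emeasure \<mu>P (G n) \<le> emeasure q (G n)" for n by (intro le[OF \<E>(2)[OF F] Gs])
  then have "(\<Sum>n. emeasure \<mu>P (G n)) \<le> (\<Sum>n. emeasure q (G n))" by (intro suminf_le) auto
  moreover have "(\<Sum>n. emeasure \<mu>P (G n)) = emeasure \<mu>P (\<Union>n. G n)"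
   by (rule suminf_emeasure[OF _ disj]) (use Gs P.sets_circle in auto)
  moreover have "(\<Sum>n. emeasure q (G n)) = emeasure q (\<Union>n. G n)"
   by (rule suminf_emeasure[OF _ disj]) (use Gs r.sets_circle in auto)
  ultimately show ?thesis unfolding UG by simp
 qed simp
 also have "emeasure q (A \<inter> \<Union>\<E>) \<le> emeasure q A"
  by (rule emeasure_mono) (use A r.sets_circle in auto)
 finally show ?thesis by simp
qed

text \<open>Zeros are indexed with multiplicity. The injection is chosen separately on the finite
  fibres over each point, and the pieces stay injective together because the fibres over different
  points have disjoint images.\<close>

lemma fiber_injection:
 assumes fin: "\<forall>z\<in>\<Lambda> ` J. finite {n\<in>J. \<Lambda> n = z} \<and> finite {n\<in>J'. \<Lambda>' n = z} \<and> card {n\<in>J. \<Lambda> n = z} \<le> card {n\<in>J'. \<Lambda>' n = z}"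
 shows "\<exists>\<iota>. inj_on \<iota> J \<and> \<iota> ` J \<subseteq> J' \<and> (\<forall>n\<in>J. \<Lambda>' (\<iota> n) = \<Lambda> n)"
proof -
 have "\<forall>z\<in>\<Lambda> ` J. \<exists>i. i ` {n\<in>J. \<Lambda> n = z} \<subseteq> {n\<in>J'. \<Lambda>' n = z} \<and> inj_on i {n\<in>J. \<Lambda> n = z}"
 proof
  fix z assume "z \<in> \<Lambda> ` J"
  from bspec[OF fin this] show "\<exists>i. i ` {n\<in>J. \<Lambda> n = z} \<subseteq> {n\<in>J'. \<Lambda>' n = z} \<and> inj_on i {n\<in>J. \<Lambda> n = z}"
   by (elim conjE) (rule card_le_inj)
 qed
 from bchoice[OF this] obtain i where
  i: "\<forall>z\<in>\<Lambda> ` J. i z ` {n\<in>J. \<Lambda> n = z} \<subseteq> {n\<in>J'. \<Lambda>' n = z} \<and> inj_on (i z) {n\<in>J. \<Lambda> n = z}" ..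
 have in': "i (\<Lambda> n) n \<in> J'" "\<Lambda>' (i (\<Lambda> n) n) = \<Lambda> n" if "n \<in> J" for n
 proof -
  have "i (\<Lambda> n) n \<in> {m\<in>J'. \<Lambda>' m = \<Lambda> n}"
   by (rule subsetD[OF conjunct1[OF bspec[OF i imageI[OF that]]]], rule imageI) (simp add: that)
  then show "i (\<Lambda> n) n \<in> J'" "\<Lambda>' (i (\<Lambda> n) n) = \<Lambda> n" by auto
 qed
 show ?thesis
 proof (intro exI[of _ "%n. i (\<Lambda> n) n"] conjI)
  show "inj_on (%n. i (\<Lambda> n) n) J"
  proof (rule inj_onI)
   fix m n assume mn: "m \<in> J" "n \<in> J" "i (\<Lambda> m) m = i (\<Lambda> n) n"
   have "\<Lambda> m = \<Lambda> n" using in'(2)[OF mn(1)] in'(2)[OF mn(2)] mn(3) by simp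
   moreover have "inj_on (i (\<Lambda> n)) {k\<in>J. \<Lambda> k = \<Lambda> n}" by (rule conjunct2[OF bspec[OF i imageI[OF mn(2)]]])
   ultimately show "m = n" by (intro inj_onD[of "i (\<Lambda> n)" "{k\<in>J. \<Lambda> k = \<Lambda> n}"]) (use mn in auto)
  qed
 qed (use in' in auto)
qed

lemma zorder_mult_nonvanishing:
 assumes f: "f holomorphic_on ball 0 1" "\<exists>z\<in>ball 0 1. f z \<noteq> 0" and g: "g holomorphic_on ball 0 1" "\<exists>z\<in>ball 0 1. g z \<noteq> 0"
  and a: "norm a < 1"
 shows "zorder (%z. f z * g z) a = zorder f a + zorder g a"
proof (rule zorder_times_analytic)
 show "f analytic_on {a}" "g analytic_on {a}"
  using holomorphic_on_imp_analytic_at[OF f(1)] holomorphic_on_imp_analytic_at[OF g(1)] a by auto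
 show "\<forall>\<^sub>F z in at a. f z * g z \<noteq> 0"
  using frequently_nonzero[OF f a] frequently_nonzero[OF g a] by eventually_elim simp
qed

lemma zorder_eq_on_disc:
 assumes "\<And>z. norm z < 1 ==> f z = g z" "norm a < 1"
 shows "zorder f a = zorder g a"
proof (rule zorder_cong[OF _ refl])
 have "\<forall>\<^sub>F z in at a. z \<in> ball 0 1" using assms(2) by (intro eventually_at_in_open') auto
 then show "\<forall>\<^sub>F z in at a. f z = g z" by eventually_elim (use assms(1) in simp)
qed

context factorized
begin

text \<open>The quotient u is defined by its prospective factorization: the outer factor of h, the
  measure \<rho> - \<mu>P, and the zeros of h that remain after those of f. Then h = b u is a
  multiplication; the work is to show that these are the true data of u.\<close>

lemma permanence:
 assumes sing: "finite_singular_measure \<mu>" and zs: "zero_sequence f J \<Lambda>" and fnz: "\<exists>z\<in>ball 0 1. f z \<noteq> 0"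
  and h: "h \<in> G_generated w f" and hs: "h \<in> smirnov"
 shows "\<exists>u\<in>smirnov. \<forall>z\<in>ball 0 1. h z = b z * u z"
proof (cases "\<exists>z\<in>ball 0 1. h z \<noteq> 0")
 case False
 have "(%_. 0) \<in> nevanlinna" by (auto simp: nevanlinna_def intro: bdd_aboveI2[of _ _ 0])
 then have "(%_. 0) \<in> smirnov" by (simp add: smirnov_def)
 then show ?thesis using False by (intro bexI[of _ "%_. 0"]) auto
next
 case hnz: True
 let ?null = "null_measure circle_borel :: complex measure"
 have hG: "h \<in> G_space w" using G_generated_sub[OF f_G] h by blast
 note hh = G_space_holomorphic[OF hG]
 obtain \<rho> \<gamma>' J' \<Lambda>' where hf: "nevanlinna_factorization h \<rho> ?null \<gamma>' J' \<Lambda>'"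
  using hs hnz by (auto simp: smirnov_def)
 have b': "blaschke J' \<Lambda>'" and \<rho>: "circle_measure \<rho>" by (rule factorization_form[OF hf])+
 interpret b': blaschke J' \<Lambda>' by fact
 interpret r: circle_measure \<rho> by fact
 have Snull: "S ?null z = 1" for z by (rule singular_inner_null) simp
 obtain m p where m: "circle_measure m" "lebesgue_null m" and p: "circle_measure p" "lebesgue_null p"
  and O0: "\<forall>z. norm z < 1 --> outer_factor h z = S m z / S p z"
  and h0: "\<forall>z. norm z < 1 --> h z = cis \<gamma>' * b'.B z * (S m z * S \<rho> z) / (S p z * S ?null z)"
  using factorization_form(4)[OF hf] by (elim exE conjE) (rule that; assumption)
 have Oh: "outer_factor h z = S m z / S p z" if "norm z < 1" for z by (rule O0[rule_format, OF that])
 have h_eq: "h z = cis \<gamma>' * b'.B z * (S m z * S \<rho> z) / S p z" if "norm z < 1" for z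
  using h0[rule_format, OF that] by (simp only: Snull mult_1_right)
 have le: "emeasure \<mu>P A \<le> emeasure \<rho> A" if "A \<in> sets circle_borel" for A
  by (rule \<mu>P_le[OF h b' \<rho> m p _ that]) (simp add: h_eq norm_mult norm_divide)
 define \<rho>2 where "\<rho>2 = diff_measure \<rho> \<mu>P"
 have sp: "splits \<rho> \<mu>P \<rho>2" unfolding \<rho>2_def by (rule splits_diff[OF \<rho> \<mu>P le])
 have \<rho>2: "circle_measure \<rho>2" using sp by (simp add: splits_def)
 have zs': "zero_sequence h J' \<Lambda>'" using hf by (simp add: nevanlinna_factorization_def)
 have fib: "finite {n\<in>J. \<Lambda> n = z}" "int (card {n\<in>J. \<Lambda> n = z}) = zorder f z"
  "finite {n\<in>J'. \<Lambda>' n = z}" "int (card {n\<in>J'. \<Lambda>' n = z}) = zorder h z" if "norm z < 1" for z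
  using zs zs' that by (auto simp: zero_sequence_def)
 have zle: "zorder f z \<le> zorder h z" if "norm z < 1" for z
  by (rule zorder_generated_ge[OF f_G h hnz that])
 have "\<forall>z\<in>\<Lambda> ` J. finite {n\<in>J. \<Lambda> n = z} \<and> finite {n\<in>J'. \<Lambda>' n = z} \<and> card {n\<in>J. \<Lambda> n = z} \<le> card {n\<in>J'. \<Lambda>' n = z}"
 proof
  fix z assume "z \<in> \<Lambda> ` J"
  then have "norm z < 1" using in_disc by auto
  note fib[OF this] zle[OF this]
  then show "finite {n\<in>J. \<Lambda> n = z} \<and> finite {n\<in>J'. \<Lambda>' n = z} \<and> card {n\<in>J. \<Lambda> n = z} \<le> card {n\<in>J'. \<Lambda>' n = z}" by simp
 qed
 from fiber_injection[OF this] obtain i where i: "inj_on i J" "i ` J \<subseteq> J'" "\<And>n. n \<in> J ==> \<Lambda>' (i n) = \<Lambda> n"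
  by blast
 define J2 where "J2 = J' - i ` J"
 have b2: "blaschke J2 \<Lambda>'"
  unfolding J2_def by (rule blaschke_split(1)[OF b' blaschke_axioms i(1,2)]) (rule i(3))
 interpret b2: blaschke J2 \<Lambda>' by fact
 have "\<exists>t. \<forall>z. norm z < 1 --> b'.B z = cis t * (B z * b2.B z)"
 proof (rule equal_norm_imp_unimodular[OF b'.B_holomorphic])
  show "(%z. B z * b2.B z) holomorphic_on ball 0 1"
   by (intro holomorphic_on_mult B_holomorphic b2.B_holomorphic)
  show "norm (b'.B z) = norm (B z * b2.B z)" if "norm z < 1" for z
   unfolding J2_def norm_mult by (rule blaschke_split(2)[OF b' blaschke_axioms i(1,2) _ that]) (rule i(3))
 qed
 then obtain t where t: "\<And>z. norm z < 1 ==> b'.B z = cis t * (B z * b2.B z)" by blast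
 \<comment> \<open>Balances the unimodular constants: that of h and the one from splitting its
   Blaschke product, against the one contained in b.\<close>
 define \<gamma>2 where "\<gamma>2 = \<gamma>' + t - \<gamma>"
 have cis: "cis \<gamma>' * cis t = cis \<gamma> * cis \<gamma>2" by (simp add: cis_mult \<gamma>2_def)
 define u where "u z = outer_factor h z * (S \<rho>2 z / S ?null z) * blaschke_product \<gamma>2 J2 \<Lambda>' z" for z
 have u_eq: "u z = S m z / S p z * S \<rho>2 z * (cis \<gamma>2 * b2.B z)" if "norm z < 1" for z
  by (simp add: u_def Oh[OF that] Snull b2.blaschke_product_eq)
 have uh: "u holomorphic_on ball 0 1"
 proof (rule holomorphic_transform)
  show "(%z. S m z / S p z * S \<rho>2 z * (cis \<gamma>2 * b2.B z)) holomorphic_on ball 0 1"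
   by (intro holomorphic_on_mult holomorphic_on_divide holomorphic_on_const b2.B_holomorphic
    circle_measure.singular_inner_holomorphic m p \<rho>2) (simp add: singular_inner_nz)
 qed (simp add: u_eq)
 have hbu: "h z = b z * u z" if z: "norm z < 1" for z
 proof -
  have "h z = (cis \<gamma>' * cis t) * (B z * b2.B z) * (S m z * (S \<mu>P z * S \<rho>2 z)) / S p z"
   unfolding h_eq[OF z] t[OF z] splits_integral(3)[OF sp z] by simp
  then show ?thesis unfolding cis u_eq[OF z] b_eq by simp
 qed
 have un: "u \<in> nevanlinna"
 proof (rule nevanlinna_if_norm_le[OF uh p(1)])
  fix z :: complex assume z: "norm z < 1"
  have "norm (u z) = norm (S m z) * norm (S \<rho>2 z) * norm (b2.B z) / norm (S p z)"
   by (simp add: u_eq[OF z] norm_mult norm_divide)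
  also have "... \<le> 1 * 1 * 1 / norm (S p z)"
   using circle_measure.norm_singular_inner_le[OF m(1) z] circle_measure.norm_singular_inner_le[OF \<rho>2 z] b2.norm_B_le[OF z]
   by (intro divide_right_mono mult_mono) auto
  also have "... = exp (poisson_integral p z)"
   unfolding circle_measure.norm_singular_inner[OF p(1) z] by (simp add: exp_minus divide_inverse)
  finally show "norm (u z) \<le> exp (poisson_integral p z)" .
 qed
 have singP: "finite_singular_measure \<mu>P"
 proof -
  interpret P: circle_measure \<mu>P by (rule \<mu>P)
  obtain A where A: "A \<in> sets circle_borel" "emeasure \<mu> A = 0" "emeasure leb (sphere 0 1 - A) = 0"
   using sing by (auto simp: finite_singular_measure_def mutually_singular_def)
  have "emeasure \<mu>P A = 0" using add[OF A(1)] A(2) by simp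
  then show ?thesis
   using A P.sets_circle P.finite_measure_axioms by (auto simp: finite_singular_measure_def mutually_singular_def)
 qed
 have bu: "radially_unimodular b"
 proof -
  have "radially_unimodular (%_. cis \<gamma>)" unfolding radially_unimodular_def
   by (intro AE_I2 exI[of _ "cis \<gamma>"]) simp
  then show ?thesis unfolding b_eq[abs_def]
   by (intro radially_unimodular_mult radially_unimodular_B radially_unimodular_singular_inner[OF singP])
 qed
 have Ou: "outer_factor h z = outer_factor u z" if "norm z < 1" for z
  by (rule outer_factor_mult[OF bu hbu hh uh that])
 have sing2: "finite_singular_measure \<rho>2"
 proof -
  interpret r2: circle_measure \<rho>2 by (rule \<rho>2)
  have "finite_singular_measure \<rho>" using hf by (simp add: nevanlinna_factorization_def)
  then obtain A where A: "A \<in> sets circle_borel" "emeasure \<rho> A = 0" "emeasure leb (sphere 0 1 - A) = 0"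
   by (auto simp: finite_singular_measure_def mutually_singular_def)
  have "emeasure \<rho>2 A = 0" using sp A(1,2) by (simp add: splits_def)
  then show ?thesis
   using A r2.sets_circle r2.finite_measure_axioms by (auto simp: finite_singular_measure_def mutually_singular_def)
 qed
 have singn: "finite_singular_measure ?null"
  using hf by (simp add: nevanlinna_factorization_def)
 have top: "sphere 0 1 \<in> sets circle_borel" using sets.top[of circle_borel] by simp
 have unz: "\<exists>z\<in>ball 0 1. u z \<noteq> 0" using hnz hbu by fastforce
 \<comment> \<open>With the zero-free function q = S_\<eta>/S_\<beta> one has h q = f u, so the
   orders of f and u add up to that of h.\<close>
 have zu: "zorder u z + zorder f z = zorder h z" if z: "norm z < 1" for z
 proof -
  define q where "q z = S \<eta> z / S \<beta> z" for z
  have q: "q holomorphic_on ball 0 1" unfolding q_def[abs_def]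
   by (intro holomorphic_on_divide circle_measure.singular_inner_holomorphic \<eta> \<beta>) (simp add: singular_inner_nz)
  have qnz: "q z \<noteq> 0" for z by (simp add: q_def singular_inner_nz)
  have "h z * q z = f z * u z" if "norm z < 1" for z
  proof -
   have "S \<beta> z * (h z * q z) = (S \<eta> z * b z) * u z"
    unfolding hbu[OF that] q_def by (simp add: singular_inner_nz)
   also have "... = S \<beta> z * (f z * u z)" unfolding f_\<beta>_eq_b_\<eta>[OF that, symmetric] by simp
   finally show ?thesis by (simp add: singular_inner_nz)
  qed
  then have "zorder (%z. h z * q z) z = zorder (%z. f z * u z) z" by (rule zorder_eq_on_disc) (use z in auto)
  moreover have "zorder (%z. h z * q z) z = zorder h z + zorder q z"
   by (intro zorder_mult_nonvanishing hh hnz q z bexI[of _ 0] qnz) simp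
  moreover have "zorder q z = 0"
   using qnz holomorphic_on_imp_analytic_at[OF q] z by (intro zorder_eq_0I) auto
  moreover have "zorder (%z. f z * u z) z = zorder f z + zorder u z"
   by (intro zorder_mult_nonvanishing f_holomorphic fnz uh unz z)
  ultimately show ?thesis by simp
 qed
 have zsu: "zero_sequence u J2 \<Lambda>'"
  unfolding zero_sequence_def
 proof (intro conjI ballI)
  fix n assume "n \<in> J2"
  then show "\<Lambda>' n \<in> ball 0 1" using b2.in_disc by simp
 next
  fix z :: complex assume "z \<in> ball 0 1"
  then have z: "norm z < 1" by simp
  have eq: "{n\<in>J2. \<Lambda>' n = z} = {n\<in>J'. \<Lambda>' n = z} - i ` {n\<in>J. \<Lambda> n = z}"
   using i(3) by (auto simp: J2_def)
  have sub: "i ` {n\<in>J. \<Lambda> n = z} \<subseteq> {n\<in>J'. \<Lambda>' n = z}" using i(2,3) by auto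
  have ci: "card (i ` {n\<in>J. \<Lambda> n = z}) = card {n\<in>J. \<Lambda> n = z}"
   by (rule card_image[OF inj_on_subset[OF i(1)]]) auto
  show "finite {n\<in>J2. \<Lambda>' n = z}" unfolding eq using fib(3)[OF z] by simp
  have "card {n\<in>J2. \<Lambda>' n = z} = card {n\<in>J'. \<Lambda>' n = z} - card {n\<in>J. \<Lambda> n = z}"
   unfolding eq using card_Diff_subset[OF finite_imageI[OF fib(1)[OF z]] sub] ci by simp
  then show "int (card {n\<in>J2. \<Lambda>' n = z}) = zorder u z"
   using zu[OF z] fib(2,4)[OF z] zle[OF z] by simp
 qed
 have "mutually_singular \<rho>2 ?null"
  unfolding mutually_singular_def
  using circle_measure.sets_circle[OF \<rho>2] by (auto intro!: bexI[of _ "{}"])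
 then have "nevanlinna_factorization u \<rho>2 ?null \<gamma>2 J2 \<Lambda>'"
  unfolding nevanlinna_factorization_def using sing2 singn zsu b2.condition Ou by (simp add: u_def)
 then have "u \<in> smirnov" using un by (auto simp: smirnov_def)
 then show ?thesis using hbu by auto
qed

text \<open>If f is cyclic, its subspace contains 1; the bounds on \<mu>P and on the orders of
  zeros, applied to h = 1, give \<mu>P = 0 and J empty. Conversely the formula excludes zeros and,
  by comparison of moduli at 0, gives \<mu>P mass 0, so b is a constant in the subspace.\<close>

lemma cyclic_iff:
 assumes zs: "zero_sequence f J \<Lambda>"
  and of: "\<And>z. norm z < 1 ==> outer_factor f z = S \<kappa>m z / S \<kappa>p z"
 shows "G_cyclic w f \<longleftrightarrow>
  (\<exists>c. norm c = 1 \<and> (\<forall>z\<in>ball 0 1. f z = c * (outer_factor f z * S \<mu>C z / S \<nu> z)))"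
proof
 have f_J: "f z = cis \<gamma> * (outer_factor f z * S \<mu> z / S \<nu> z)" if "J = {}" "norm z < 1" for z
 proof -
  have "B z = 1" unfolding B_def factor_def using that(1) by simp
  then show ?thesis by (simp add: f_eq[OF that(2)] of[OF that(2)])
 qed
 {
  assume "G_cyclic w f"
  then have one: "(%_. 1) \<in> G_generated w f" using G_space_1 by (simp add: G_cyclic_def)
  let ?null = "null_measure circle_borel :: complex measure"
  have Snull: "S ?null z = 1" for z by (rule singular_inner_null) simp
  have b0: "blaschke {} \<Lambda>" by (simp add: blaschke_def blaschke_condition_def)
  have B0: "blaschke.B {} \<Lambda> z = 1" for z by (simp add: blaschke.B_def[OF b0] blaschke.factor_def[OF b0])
  have top: "sphere 0 1 \<in> sets circle_borel" using sets.top[of circle_borel] by simp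
  have n: "lebesgue_null ?null" by (simp add: lebesgue_null_def)
  \<comment> \<open>The constant 1 is factored trivially, with an empty Blaschke product and three
    null measures.\<close>
  have "emeasure \<mu>P (sphere 0 1) \<le> emeasure ?null (sphere 0 1)"
   by (rule \<mu>P_le[OF one b0 circle_measure_null circle_measure_null n circle_measure_null n _ top]) (simp add: B0 Snull)
  then have "emeasure \<mu>P (space \<mu>P) = 0"
   unfolding circle_measure.space_circle[OF \<mu>P] by simp
  then have SP: "S \<mu>P z = 1" for z by (rule singular_inner_null)
  have "J = {}"
  proof (rule ccontr)
   assume "J \<noteq> {}"
   then obtain n where n: "n \<in> J" by blast
   have z: "norm (\<Lambda> n) < 1" by (rule in_disc[OF n])
   have "zorder f (\<Lambda> n) \<le> zorder (%_. 1) (\<Lambda> n)"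
    by (rule zorder_generated_ge[OF f_G one _ z]) (rule bexI[of _ 0]; simp)
   moreover have "finite {k\<in>J. \<Lambda> k = \<Lambda> n}" "int (card {k\<in>J. \<Lambda> k = \<Lambda> n}) = zorder f (\<Lambda> n)"
    using zs z by (auto simp: zero_sequence_def)
   ultimately have "card {k\<in>J. \<Lambda> k = \<Lambda> n} = 0" using zorder_const[OF one_neq_zero, of "\<Lambda> n"] by linarith
   then show False using \<open>finite {k\<in>J. \<Lambda> k = \<Lambda> n}\<close> n by auto
  qed
  then have "f z = cis \<gamma> * (outer_factor f z * S \<mu>C z / S \<nu> z)" if "norm z < 1" for z
   using f_J[OF _ that] by (simp add: S_\<mu>[OF that] SP)
  then show "\<exists>c. norm c = 1 \<and> (\<forall>z\<in>ball 0 1. f z = c * (outer_factor f z * S \<mu>C z / S \<nu> z))"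
   by (intro exI[of _ "cis \<gamma>"]) auto
 }
 assume "\<exists>c. norm c = 1 \<and> (\<forall>z\<in>ball 0 1. f z = c * (outer_factor f z * S \<mu>C z / S \<nu> z))"
 then obtain k where k: "norm k = 1" "\<And>z. norm z < 1 ==> f z = k * (outer_factor f z * S \<mu>C z / S \<nu> z)" by auto
 have of0: "outer_factor f z \<noteq> 0" for z by (simp add: outer_factor_def)
 have fz: "f z \<noteq> 0" if "norm z < 1" for z
  using k(1) by (subst k(2)[OF that]) (auto simp: of0 singular_inner_nz)
 have J: "J = {}"
 proof (rule ccontr)
  assume "J \<noteq> {}"
  then obtain n where n: "n \<in> J" by blast
  have z: "norm (\<Lambda> n) < 1" by (rule in_disc[OF n])
  have "B (\<Lambda> n) = 0" unfolding B_eq_0_iff[OF z] using n by blast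
  then show False using fz[OF z] f_eq[OF z] by simp
 qed
 interpret u: circle_measure \<mu> by (rule \<mu>)
 interpret P: circle_measure \<mu>P by (rule \<mu>P)
 interpret C: circle_measure \<mu>C by (rule \<mu>C)
 \<comment> \<open>At 0 the modulus of S is the exponential of minus the total mass, so a single
   point is enough to compare masses.\<close>
 have "k * (outer_factor f 0 * S \<mu>C 0 / S \<nu> 0) = cis \<gamma> * (outer_factor f 0 * S \<mu> 0 / S \<nu> 0)"
  using trans[OF k(2)[of 0, symmetric] f_J[OF J, of 0]] by simp
 then have "norm (k * (outer_factor f 0 * S \<mu>C 0 / S \<nu> 0)) = norm (cis \<gamma> * (outer_factor f 0 * S \<mu> 0 / S \<nu> 0))" by (rule arg_cong)
 then have "norm (S \<mu>C 0) = norm (S \<mu> 0)"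
  using k(1) of0 by (simp add: norm_mult norm_divide singular_inner_nz)
 then have "measure \<mu>C (sphere 0 1) = measure \<mu> (sphere 0 1)"
  by (simp add: C.norm_singular_inner_0 u.norm_singular_inner_0)
 moreover have "measure \<mu> (sphere 0 1) = measure \<mu>P (sphere 0 1) + measure \<mu>C (sphere 0 1)"
 proof -
  have "sphere 0 1 \<in> sets circle_borel" using sets.top[of circle_borel] by simp
  from add[OF this] show ?thesis
   by (simp add: u.emeasure_eq_measure P.emeasure_eq_measure C.emeasure_eq_measure flip: ennreal_plus)
 qed
 ultimately have "emeasure \<mu>P (space \<mu>P) = 0" by (simp add: P.emeasure_eq_measure)
 then have SP: "S \<mu>P z = 1" for z by (rule singular_inner_null)
 have "b = (%_. cis \<gamma>)" unfolding b_def[abs_def] blaschke_product_def SP by (simp add: J)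
 then have b1: "(%z. cis \<gamma>) \<in> G_generated w f" using b_in by simp
 note V = G_generated_closed[OF f_G]
 have "(%z. cis (- \<gamma>) * cis \<gamma>) \<in> G_generated w f" by (rule G_closed_subspaceD(4)[OF V(1) b1])
 then have "(%z. 1) \<in> G_generated w f" by (simp add: cis_mult)
 then show "G_cyclic w f" unfolding G_cyclic_def by (rule G_space_if_1_in[OF V(1,2)])
qed

end

theorem theorem1p1:
  fixes w :: "real \<Rightarrow> real" and f :: "complex \<Rightarrow> complex"
    and \<mu> \<nu> \<mu>P \<mu>C :: "complex measure"
    and \<gamma> :: real and J :: "nat set" and \<Lambda> :: "nat \<Rightarrow> complex"
  assumes "majorant w"
    and "\<exists>c>0. \<forall>t\<in>{0<..<1}. inverse c * ln (1 / w (t\<^sup>2)) \<le> ln (1 / w t) \<and>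
                              ln (1 / w t) \<le> c * ln (1 / w (t\<^sup>2))"
    and "f \<in> G_space w \<inter> nevanlinna"
    and "\<exists>z\<in>ball 0 1. f z \<noteq> 0"
    and "nevanlinna_factorization f \<mu> \<nu> \<gamma> J \<Lambda>"
    and "entropy_decomposition w \<mu> \<mu>P \<mu>C"
  shows "G_generated w f = G_generated w (\<lambda>z. blaschke_product \<gamma> J \<Lambda> z * singular_inner \<mu>P z) \<and>
    G_generated w f \<inter> smirnov \<subseteq>
      {h. \<exists>u\<in>smirnov. \<forall>z\<in>ball 0 1. h z = blaschke_product \<gamma> J \<Lambda> z * singular_inner \<mu>P z * u z} \<and>
    G_cyclic w (singular_inner \<nu>) \<and>
    (G_cyclic w f \<longleftrightarrow>
      (\<exists>c. norm c = 1 \<and>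
        (\<forall>z\<in>ball 0 1. f z = c * (outer_factor f z * singular_inner \<mu>C z / singular_inner \<nu> z))))"
proof -
 obtain c where c0: "0 < c" and c1: "\<forall>t\<in>{0<..<1}. inverse c * ln (1 / w (t\<^sup>2)) \<le> ln (1 / w t) \<and>
   ln (1 / w t) \<le> c * ln (1 / w (t\<^sup>2))"
  using assms(2) by (elim exE conjE) (rule that; assumption)
 have weight: "weight w c"
  by (rule weight.intro[OF assms(1) c0]) (rule bspec[OF c1], simp)
 have fac: "finite_singular_measure \<mu>" "mutually_singular \<mu> \<nu>" "zero_sequence f J \<Lambda>"
  using assms(5) by (simp_all add: nevanlinna_factorization_def)
 obtain \<kappa>m \<kappa>p where k: "circle_measure \<kappa>m" "circle_measure \<kappa>p" "lebesgue_null \<kappa>m" "lebesgue_null \<kappa>p"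
  and of: "\<forall>z. norm z < 1 --> outer_factor f z = singular_inner \<kappa>m z / singular_inner \<kappa>p z"
  and f_eq: "\<forall>z. norm z < 1 --> f z = cis \<gamma> * blaschke.B J \<Lambda> z * (singular_inner \<kappa>m z * singular_inner \<mu> z) /
    (singular_inner \<kappa>p z * singular_inner \<nu> z)"
  using factorization_form(4)[OF assms(5)] by (elim exE conjE) (rule that; assumption)
 have fG: "f \<in> G_space w" using assms(3) by blast
 interpret factorized w c J \<Lambda> f \<mu> \<nu> \<mu>P \<mu>C \<kappa>m \<kappa>p \<gamma>
  by (intro factorized.intro factorized_axioms.intro weight factorization_form(1-3)[OF assms(5)] fG fac(2) assms(6) k
   f_eq[rule_format])
 have b: "b = (%z. blaschke_product \<gamma> J \<Lambda> z * singular_inner \<mu>P z)" by (simp add: b_def fun_eq_iff)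
 have "h \<in> {h. \<exists>u\<in>smirnov. \<forall>z\<in>ball 0 1. h z = blaschke_product \<gamma> J \<Lambda> z * singular_inner \<mu>P z * u z}"
  if "h \<in> G_generated w f \<inter> smirnov" for h
  using permanence[OF fac(1,3) assms(4), of h] that by (auto simp: b)
 then show ?thesis
  using generated_eq cyclic_\<nu> cyclic_iff[OF fac(3) of[rule_format]] unfolding b by (intro conjI subsetI)
qed

end
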